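(* Assume $\lambda\in L^\infty(Q)$, $g_1,g_2\in L^2(Q)$, $h_1,h_2\in L^2(\Sigma)$, $y_0^1,y_0^2\in L^2(\Omega)$ with $\widehat\beta(y_0^1),\widehat\beta(y_0^2)\in L^1(\Omega)$, and $$(y_0^1)_\Omega=(y_0^2)_\Omega,\qquad \int_\Gamma h_1(t)=\int_\Gamma h_2(t)\ \text{ for a.e. } t\in(0,T).$$ Let $(y_i,w_i,\xi_i)$, $i=1,2$, be any solutions of the limit problem corresponding to the data $(y_0^i,g_i,h_i)$. Then there is a constant $C>0$ depending only on $\tau$, $\Omega$, $T$, $\|\lambda\|_{L^\infty(Q)}$ and a Lipschitz constant of $\pi$ such that $$\|y_1-y_2\|_{L^\infty(0,T;H)}\le C\Big[\|y_0^1-y_0^2\|_H+\|g_1-g_2\|_{L^2(Q)}+\|h_1-h_2\|_{L^2(\Sigma)}\Big].$$ In particular, the component $y$ of a solution of the limit problem is unique.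
   Context: Standing setting: $\Omega\subset\mathbb R^3$ is a smooth bounded domain with boundary $\Gamma$, $T>0$, $Q=\Omega\times(0,T)$, $\Sigma=\Gamma\times(0,T)$, $H=L^2(\Omega)$, $V=H^1(\Omega)$. For $v\in L^1(\Omega)$, $v_\Omega$ denotes its mean value over $\Omega$. $\widehat\beta:\mathbb R\to[0,+\infty)$ is convex and lower semicontinuous (hence finite everywhere) with $\widehat\beta(0)=0$, and $\beta=\partial\widehat\beta$. $\pi:\mathbb R\to\mathbb R$ is Lipschitz continuous with $\pi(0)=0$. $\tau>0$ is fixed. Growth assumption: $|\beta^0(r)|\le C(1+\widehat\beta(r))$ for all $r$, with $\beta^0(r)$ the minimal-modulus element of $\beta(r)$. A solution of the limit problem with data $(y_0,g,h)$ is a triple $y\in H^1(0,T;H)$, $w\in L^2(0,T;V)$, $\xi\in L^2(0,T;H)$ such that for a.e. $t\in(0,T)$: $\int_\Omega\partial_ty(t)v+\int_\Omega\nabla w(t)\cdot\nabla v=\int_\Gamma h(t)v$ for all $v\in H^1(\Omega)$; $\int_\Omega w(t)v=\tau\int_\Omega\partial_ty(t)v+\int_\Omega\xi(t)v+\int_\Omega\lambda(t)\pi(y(t))v-\int_\Omega g(t)v$ for all $v\in L^2(\Omega)$; $\xi\in\beta(y)$ a.e. in $Q$; and $y(0)=y_0$. *)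

theory Defs
  imports "HOL-Analysis.Analysis"
begin

type_synonym pt = "real^3"

definition pd :: "'a::euclidean_space \<Rightarrow> ('a \<Rightarrow> real) \<Rightarrow> 'a \<Rightarrow> real" where
  "pd e f x = (SOME d. ((\<lambda>s. f (x + s *\<^sub>R e)) has_real_derivative d) (at 0))"

fun iter_pd :: "'a::euclidean_space list \<Rightarrow> ('a \<Rightarrow> real) \<Rightarrow> 'a \<Rightarrow> real" where
  "iter_pd [] f = f"
| "iter_pd (e # es) f = pd e (iter_pd es f)"

definition Cinf_on :: "'a::euclidean_space set \<Rightarrow> ('a \<Rightarrow> real) \<Rightarrow> bool" where
  "Cinf_on S f \<longleftrightarrow> (\<forall>es. set es \<subseteq> Basis \<longrightarrow>
     continuous_on S (iter_pd es f) \<and>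
     (\<forall>e\<in>Basis. \<forall>x\<in>S.
        ((\<lambda>s. iter_pd es f (x + s *\<^sub>R e)) has_real_derivative pd e (iter_pd es f) x) (at 0)))"

definition test_fun :: "'a::euclidean_space set \<Rightarrow> ('a \<Rightarrow> real) \<Rightarrow> bool" where
  "test_fun S \<phi> \<longleftrightarrow> Cinf_on UNIV \<phi> \<and> compact (closure {x. \<phi> x \<noteq> 0})
      \<and> closure {x. \<phi> x \<noteq> 0} \<subseteq> S"

definition smooth_bounded_domain :: "pt set \<Rightarrow> bool" where
  "smooth_bounded_domain \<Omega> \<longleftrightarrow> open \<Omega> \<and> connected \<Omega> \<and> bounded \<Omega> \<and> \<Omega> \<noteq> {} \<and>
     (\<forall>p\<in>frontier \<Omega>. \<exists>r>0. \<exists>\<psi>. Cinf_on (ball p r) \<psi> \<and>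
        (\<forall>x\<in>ball p r. \<exists>e\<in>Basis. pd e \<psi> x \<noteq> 0) \<and>
        \<Omega> \<inter> ball p r = {x\<in>ball p r. \<psi> x < 0})"

definition hausdorff2 :: "pt set \<Rightarrow> ennreal" where
  "hausdorff2 A = (SUP \<delta>\<in>{0::real<..}.
      INF C\<in>{C :: nat \<Rightarrow> pt set. A \<subseteq> (\<Union>n. C n) \<and> (\<forall>n. bounded (C n) \<and> diameter (C n) < \<delta>)}.
        (\<Sum>n. ennreal (pi * (diameter (C n) / 2)^2)))"

definition surf :: "pt set \<Rightarrow> pt measure" where
  "surf \<Omega> = measure_of (frontier \<Omega>) (sets (restrict_space borel (frontier \<Omega>))) hausdorff2"

definition L2 :: "'a measure \<Rightarrow> ('a \<Rightarrow> real) \<Rightarrow> bool" where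
  "L2 M f \<longleftrightarrow> f \<in> borel_measurable M \<and> integrable M (\<lambda>x. (f x)^2)"

definition nL2 :: "'a measure \<Rightarrow> ('a \<Rightarrow> real) \<Rightarrow> real" where
  "nL2 M f = sqrt (\<integral>x. (f x)^2 \<partial>M)"

definition Linf :: "'a measure \<Rightarrow> ('a \<Rightarrow> real) \<Rightarrow> bool" where
  "Linf M f \<longleftrightarrow> f \<in> borel_measurable M \<and> (\<exists>c. AE x in M. \<bar>f x\<bar> \<le> c)"

definition Linf_norm :: "'a measure \<Rightarrow> ('a \<Rightarrow> real) \<Rightarrow> real" where
  "Linf_norm M f = Inf {c. 0 \<le> c \<and> (AE x in M. \<bar>f x\<bar> \<le> c)}"

definition mean :: "pt set \<Rightarrow> (pt \<Rightarrow> real) \<Rightarrow> real" where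
  "mean \<Omega> v = (\<integral>x. v x \<partial>lebesgue_on \<Omega>) / measure lebesgue \<Omega>"

definition Tm :: "real \<Rightarrow> real measure" where
  "Tm T = lebesgue_on {0<..<T}"

definition Qm :: "pt set \<Rightarrow> real \<Rightarrow> (real \<times> pt) measure" where
  "Qm \<Omega> T = Tm T \<Otimes>\<^sub>M lebesgue_on \<Omega>"

definition Sm :: "pt set \<Rightarrow> real \<Rightarrow> (real \<times> pt) measure" where
  "Sm \<Omega> T = Tm T \<Otimes>\<^sub>M surf \<Omega>"

definition weak_grad :: "pt set \<Rightarrow> (pt \<Rightarrow> real) \<Rightarrow> (pt \<Rightarrow> pt) \<Rightarrow> bool" where
  "weak_grad \<Omega> v G \<longleftrightarrow> L2 (lebesgue_on \<Omega>) v \<and>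
     (\<forall>e\<in>Basis. L2 (lebesgue_on \<Omega>) (\<lambda>x. G x \<bullet> e)) \<and>
     (\<forall>\<phi>. test_fun \<Omega> \<phi> \<longrightarrow> (\<forall>e\<in>Basis.
        (\<integral>x. v x * pd e \<phi> x \<partial>lebesgue_on \<Omega>) = - (\<integral>x. (G x \<bullet> e) * \<phi> x \<partial>lebesgue_on \<Omega>)))"

definition H1 :: "pt set \<Rightarrow> (pt \<Rightarrow> real) \<Rightarrow> bool" where
  "H1 \<Omega> v \<longleftrightarrow> (\<exists>G. weak_grad \<Omega> v G)"

text \<open>tv is the trace of v: the limit in L2(Gamma) of boundary values of smooth functions
  converging to v in H1(Omega) (continuous extension of the restriction map).\<close>
definition trace_of :: "pt set \<Rightarrow> (pt \<Rightarrow> real) \<Rightarrow> (pt \<Rightarrow> real) \<Rightarrow> bool" where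
  "trace_of \<Omega> v tv \<longleftrightarrow> L2 (surf \<Omega>) tv \<and>
     (\<exists>G \<phi>. weak_grad \<Omega> v G \<and> (\<forall>n. Cinf_on UNIV (\<phi> n)) \<and>
        (\<lambda>n. nL2 (lebesgue_on \<Omega>) (\<lambda>x. \<phi> n x - v x)) \<longlonglongrightarrow> 0 \<and>
        (\<forall>e\<in>Basis. (\<lambda>n. nL2 (lebesgue_on \<Omega>) (\<lambda>x. pd e (\<phi> n) x - G x \<bullet> e)) \<longlonglongrightarrow> 0) \<and>
        (\<lambda>n. nL2 (surf \<Omega>) (\<lambda>x. \<phi> n x - tv x)) \<longlonglongrightarrow> 0)"

definition subdiff :: "(real \<Rightarrow> real) \<Rightarrow> real \<Rightarrow> real set" where
  "subdiff bh r = {\<xi>. \<forall>s. bh r + \<xi> * (s - r) \<le> bh s}"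

definition beta0 :: "(real \<Rightarrow> real) \<Rightarrow> real \<Rightarrow> real" where
  "beta0 bh r = (THE \<xi>. \<xi> \<in> subdiff bh r \<and> (\<forall>\<eta>\<in>subdiff bh r. \<bar>\<xi>\<bar> \<le> \<bar>\<eta>\<bar>))"

definition admissible_bhat :: "(real \<Rightarrow> real) \<Rightarrow> bool" where
  "admissible_bhat bh \<longleftrightarrow> convex_on UNIV bh \<and> (\<forall>c. closed {r. bh r \<le> c}) \<and>
     (\<forall>r. 0 \<le> bh r) \<and> bh 0 = 0 \<and> (\<exists>K. \<forall>r. \<bar>beta0 bh r\<bar> \<le> K * (1 + bh r))"

text \<open>Functions on Q / Sigma are written time-first: y t x.  dy is the weak time derivative
  (H-valued) of y, Gw the spatial gradient of w.\<close>
definition limit_solution ::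
  "pt set \<Rightarrow> real \<Rightarrow> real \<Rightarrow> (real \<Rightarrow> real) \<Rightarrow> (real \<Rightarrow> real) \<Rightarrow> (real \<Rightarrow> pt \<Rightarrow> real) \<Rightarrow>
   (pt \<Rightarrow> real) \<Rightarrow> (real \<Rightarrow> pt \<Rightarrow> real) \<Rightarrow> (real \<Rightarrow> pt \<Rightarrow> real) \<Rightarrow>
   (real \<Rightarrow> pt \<Rightarrow> real) \<Rightarrow> (real \<Rightarrow> pt \<Rightarrow> real) \<Rightarrow> (real \<Rightarrow> pt \<Rightarrow> real) \<Rightarrow> bool" where
  "limit_solution \<Omega> T \<tau> bh \<pi> lam y0 g h y w \<xi> \<longleftrightarrow>
   (\<exists>dy Gw.
     \<comment> \<open>y in H^1(0,T;H)\<close>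
     L2 (Qm \<Omega> T) (\<lambda>(t,x). y t x) \<and> L2 (Qm \<Omega> T) (\<lambda>(t,x). dy t x) \<and>
     (\<forall>\<phi> v. test_fun {0<..<T} \<phi> \<and> L2 (lebesgue_on \<Omega>) v \<longrightarrow>
        (\<integral>p. y (fst p) (snd p) * pd 1 \<phi> (fst p) * v (snd p) \<partial>Qm \<Omega> T)
          = - (\<integral>p. dy (fst p) (snd p) * \<phi> (fst p) * v (snd p) \<partial>Qm \<Omega> T)) \<and>
     \<comment> \<open>w in L^2(0,T;V)\<close>
     L2 (Qm \<Omega> T) (\<lambda>(t,x). w t x) \<and>
     (\<forall>e\<in>Basis. L2 (Qm \<Omega> T) (\<lambda>(t,x). Gw t x \<bullet> e)) \<and>
     (AE t in Tm T. weak_grad \<Omega> (w t) (Gw t)) \<and>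
     \<comment> \<open>xi in L^2(0,T;H)\<close>
     L2 (Qm \<Omega> T) (\<lambda>(t,x). \<xi> t x) \<and>
     \<comment> \<open>first variational equation\<close>
     (AE t in Tm T. \<forall>v Gv tv. weak_grad \<Omega> v Gv \<and> trace_of \<Omega> v tv \<longrightarrow>
        (\<integral>x. dy t x * v x \<partial>lebesgue_on \<Omega>) + (\<integral>x. Gw t x \<bullet> Gv x \<partial>lebesgue_on \<Omega>)
          = (\<integral>x. h t x * tv x \<partial>surf \<Omega>)) \<and>
     \<comment> \<open>second variational equation\<close>
     (AE t in Tm T. \<forall>v. L2 (lebesgue_on \<Omega>) v \<longrightarrow>
        (\<integral>x. w t x * v x \<partial>lebesgue_on \<Omega>)
          = \<tau> * (\<integral>x. dy t x * v x \<partial>lebesgue_on \<Omega>) + (\<integral>x. \<xi> t x * v x \<partial>lebesgue_on \<Omega>)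
            + (\<integral>x. lam t x * \<pi> (y t x) * v x \<partial>lebesgue_on \<Omega>)
            - (\<integral>x. g t x * v x \<partial>lebesgue_on \<Omega>)) \<and>
     \<comment> \<open>xi in beta(y) a.e. in Q\<close>
     (AE p in Qm \<Omega> T. \<xi> (fst p) (snd p) \<in> subdiff bh (y (fst p) (snd p))) \<and>
     \<comment> \<open>y(0) = y0, via the continuous representative of y in C([0,T];H)\<close>
     (\<exists>yc. (\<forall>s\<in>{0..T}. L2 (lebesgue_on \<Omega>) (yc s)) \<and>
        (AE t in Tm T. nL2 (lebesgue_on \<Omega>) (\<lambda>x. yc t x - y t x) = 0) \<and>
        (\<forall>t\<in>{0..T}. ((\<lambda>s. nL2 (lebesgue_on \<Omega>) (\<lambda>x. yc s x - yc t x)) \<longlongrightarrow> 0) (at t within {0..T})) \<and>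
        nL2 (lebesgue_on \<Omega>) (\<lambda>x. yc 0 x - y0 x) = 0))"

definition admissible_data ::
  "pt set \<Rightarrow> real \<Rightarrow> (real \<Rightarrow> real) \<Rightarrow> (pt \<Rightarrow> real) \<Rightarrow> (real \<Rightarrow> pt \<Rightarrow> real) \<Rightarrow> (real \<Rightarrow> pt \<Rightarrow> real) \<Rightarrow> bool" where
  "admissible_data \<Omega> T bh y0 g h \<longleftrightarrow>
     L2 (lebesgue_on \<Omega>) y0 \<and> integrable (lebesgue_on \<Omega>) (\<lambda>x. bh (y0 x)) \<and>
     L2 (Qm \<Omega> T) (\<lambda>(t,x). g t x) \<and> L2 (Sm \<Omega> T) (\<lambda>(t,x). h t x)"

end

theory Submission
  imports Defs
begin

text \<open>Subtract the two systems and write \<open>y, w, g, h\<close> for the differences. All time slices of \<open>y\<close> have mean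
  zero, so the first equation may be tested with \<open>N y\<close>, where \<open>N\<close> inverts the Neumann Laplacian, and the second
  with \<open>y\<close>. Adding them eliminates \<open>w\<close>, the \<open>\<xi>\<close>-term has a sign because \<open>\<beta>\<close> is monotone, and the trace and Poincare
  inequalities bound the boundary term, so that \<open>\<tau> |y|\<^sup>2 + (y, N y)\<close> satisfies a Gronwall inequality.

  The operator \<open>N\<close> is never constructed: its place is taken by smooth almost minimisers of the Dirichlet energy,
  which are their own traces and hence admissible test functions. That they approximate \<open>N\<close> against every \<open>w\<close> in
  \<open>H\<^sup>1\<close> requires the density of smooth functions up to the boundary. This density, the Poincare inequality and the
  trace inequality for the Hausdorff measure all follow from the interior cones at the boundary points.\<close>

subsection \<open>Square-integrable and smooth functions\<close>

text \<open>The time derivative of \<open>y\<close> is accessible only through its pairings with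
  fixed functions, so the energy cannot be differentiated directly. By symmetry, its increment from
  \<open>s\<close> to \<open>t\<close> is the increment of the bilinear form against the fixed
  function \<open>y(t) + y(s)\<close>. Replacing that function by twice the value at an intermediate
  time costs an error controlled by the modulus of continuity of \<open>y\<close> in
  \<open>H\<close>, and a Bolzano argument turns the estimate on short intervals into one on all
  intervals. Mean zero of the slices comes from testing the first equation with the constant 1,
  which leaves only the boundary integrals. The boundary is described by local defining functions
  and measured by coverings, so there are no charts to integrate over: every boundary estimate rests
  on the fact that a step along a fixed direction, with a margin in the angle, stays in the domain.
  In the final constant \<open>C\<close> is a Poincare constant, \<open>D\<close> a trace constant,
  and \<open>K0 * C\<close> bounds the boundary pairing with \<open>N y\<close> relative to the
  norms of the boundary datum and of \<open>y\<close>.\<close>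

lemma L2_mult_integrable:
  assumes f: "L2 M f" and g: "L2 M g"
  shows "integrable M (\<lambda>x. f x * g x)"
proof (rule Bochner_Integration.integrable_bound)
  show "integrable M (\<lambda>x. (f x)\<^sup>2 + (g x)\<^sup>2)"
    using f g by (simp add: L2_def)
  show "(\<lambda>x. f x * g x) \<in> borel_measurable M"
    using f g by (auto simp: L2_def)
  show "AE x in M. norm (f x * g x) \<le> norm ((f x)\<^sup>2 + (g x)\<^sup>2)"
  proof (rule AE_I2)
    fix x
    have "2 * (\<bar>f x\<bar> * \<bar>g x\<bar>) \<le> (f x)\<^sup>2 + (g x)\<^sup>2"
      using sum_squares_bound[of "\<bar>f x\<bar>" "\<bar>g x\<bar>"] by simp
    moreover have "0 \<le> \<bar>f x\<bar> * \<bar>g x\<bar>" by simp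
    ultimately have "\<bar>f x\<bar> * \<bar>g x\<bar> \<le> (f x)\<^sup>2 + (g x)\<^sup>2" by linarith
    then show "norm (f x * g x) \<le> norm ((f x)\<^sup>2 + (g x)\<^sup>2)"
      by (simp add: abs_mult)
  qed
qed

lemma L2_scale: "L2 M f \<Longrightarrow> L2 M (\<lambda>x. c * f x)"
  by (auto simp: L2_def power_mult_distrib)

lemma L2_add:
  assumes f: "L2 M f" and g: "L2 M g"
  shows "L2 M (\<lambda>x. f x + g x)"
proof -
  have "(\<lambda>x. (f x + g x)\<^sup>2) = (\<lambda>x. ((f x)\<^sup>2 + (g x)\<^sup>2) + 2 * (f x * g x))"
    by (auto simp: power2_eq_square algebra_simps)
  moreover have "integrable M (\<lambda>x. ((f x)\<^sup>2 + (g x)\<^sup>2) + 2 * (f x * g x))"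
    using f g L2_mult_integrable[OF f g]
    by (intro Bochner_Integration.integrable_add integrable_mult_right) (auto simp: L2_def)
  ultimately show ?thesis using f g by (auto simp: L2_def)
qed

lemma L2_diff: "L2 M f \<Longrightarrow> L2 M g \<Longrightarrow> L2 M (\<lambda>x. f x - g x)"
  using L2_add[of M f "\<lambda>x. (-1) * g x"] L2_scale[of M g "-1"] by simp

lemma nL2_nonneg [simp]: "0 \<le> nL2 M f"
  by (simp add: nL2_def)

lemma nL2_sq: "(nL2 M f)\<^sup>2 = (\<integral>x. (f x)\<^sup>2 \<partial>M)"
  by (simp add: nL2_def)

lemma nL2_zero [simp]: "nL2 M (\<lambda>x. 0) = 0"
  by (simp add: nL2_def)

lemma nL2_scale: "nL2 M (\<lambda>x. c * f x) = \<bar>c\<bar> * nL2 M f"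
  by (simp add: nL2_def power_mult_distrib real_sqrt_mult)

lemma nL2_minus_commute: "nL2 M (\<lambda>x. f x - g x) = nL2 M (\<lambda>x. g x - f x)"
  by (simp add: nL2_def power2_commute)

text \<open>The integral of the square of \<open>s * f + t * g\<close> is nonnegative for all real
  \<open>s\<close> and \<open>t\<close>; the homogeneous form \<open>q\<close> avoids normalising
  either function.\<close>

lemma L2_cauchy_schwarz:
  assumes f: "L2 M f" and g: "L2 M g"
  shows "\<bar>\<integral>x. f x * g x \<partial>M\<bar> \<le> nL2 M f * nL2 M g"
proof -
  let ?a = "\<integral>x. (f x)\<^sup>2 \<partial>M" and ?b = "\<integral>x. f x * g x \<partial>M" and ?c = "\<integral>x. (g x)\<^sup>2 \<partial>M"
  have fi: "integrable M (\<lambda>x. (f x)\<^sup>2)" and gi: "integrable M (\<lambda>x. (g x)\<^sup>2)"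
    using f g by (auto simp: L2_def)
  have fg: "integrable M (\<lambda>x. f x * g x)" by (rule L2_mult_integrable[OF f g])
  have q: "0 \<le> s\<^sup>2 * ?a + 2 * s * t * ?b + t\<^sup>2 * ?c" for s t
  proof -
    have "0 \<le> (\<integral>x. (s * f x + t * g x)\<^sup>2 \<partial>M)" by simp
    also have "(\<integral>x. (s * f x + t * g x)\<^sup>2 \<partial>M)
      = (\<integral>x. s\<^sup>2 * (f x)\<^sup>2 + (2 * s * t) * (f x * g x) + t\<^sup>2 * (g x)\<^sup>2 \<partial>M)"
      by (rule Bochner_Integration.integral_cong) (auto simp: power2_eq_square algebra_simps)
    also have "\<dots> = s\<^sup>2 * ?a + 2 * s * t * ?b + t\<^sup>2 * ?c"
      using fi gi fg by simp
    finally show ?thesis .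
  qed
  have "?b\<^sup>2 \<le> ?a * ?c"
  proof (cases "?c = 0")
    case True
    have "?b = 0"
    proof (rule ccontr)
      assume b: "?b \<noteq> 0"
      \<comment> \<open>For this \<open>t\<close> the affine expression equals -1.\<close>
      have "0 \<le> ?a + 2 * (- (?a + 1) / (2 * ?b)) * ?b"
        using q[of 1 "- (?a + 1) / (2 * ?b)"] True by simp
      then show False using b by (simp add: field_simps)
    qed
    then show ?thesis by simp
  next
    case False
    then have c: "?c > 0" by (simp add: order_less_le)
    have "0 \<le> ?c\<^sup>2 * ?a + 2 * ?c * (- ?b) * ?b + (- ?b)\<^sup>2 * ?c"
      using q[of ?c "- ?b"] .
    also have "\<dots> = ?c * (?a * ?c - ?b\<^sup>2)"
      by (simp add: power2_eq_square algebra_simps)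
    finally have "0 \<le> ?a * ?c - ?b\<^sup>2" using c by (simp add: zero_le_mult_iff)
    then show ?thesis by simp
  qed
  then have "sqrt (?b\<^sup>2) \<le> sqrt (?a * ?c)" by (rule real_sqrt_le_mono)
  then show ?thesis by (simp add: nL2_def real_sqrt_mult)
qed

lemma nL2_add_sq:
  assumes f: "L2 M f" and g: "L2 M g"
  shows "(nL2 M (\<lambda>x. f x + g x))\<^sup>2 = (nL2 M f)\<^sup>2 + 2 * (\<integral>x. f x * g x \<partial>M) + (nL2 M g)\<^sup>2"
proof -
  have "(\<integral>x. (f x + g x)\<^sup>2 \<partial>M) = (\<integral>x. (f x)\<^sup>2 + 2 * (f x * g x) + (g x)\<^sup>2 \<partial>M)"
    by (rule Bochner_Integration.integral_cong) (auto simp: power2_eq_square algebra_simps)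
  also have "\<dots> = (\<integral>x. (f x)\<^sup>2 \<partial>M) + 2 * (\<integral>x. f x * g x \<partial>M) + (\<integral>x. (g x)\<^sup>2 \<partial>M)"
    using f g L2_mult_integrable[OF f g] by (simp add: L2_def)
  finally show ?thesis by (simp add: nL2_sq)
qed

lemma nL2_triangle:
  assumes f: "L2 M f" and g: "L2 M g"
  shows "nL2 M (\<lambda>x. f x + g x) \<le> nL2 M f + nL2 M g"
proof (rule power2_le_imp_le)
  show "(nL2 M (\<lambda>x. f x + g x))\<^sup>2 \<le> (nL2 M f + nL2 M g)\<^sup>2"
    using nL2_add_sq[OF f g] L2_cauchy_schwarz[OF f g] by (simp add: power2_sum)
qed simp

lemma nL2_triangle_diff:
  assumes f: "L2 M f" and g: "L2 M g"
  shows "nL2 M (\<lambda>x. f x - g x) \<le> nL2 M f + nL2 M g"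
  using nL2_triangle[OF f L2_scale[OF g, of "-1"]] nL2_scale[of M "-1" g] by simp

lemma nL2_eq_0_iff:
  assumes f: "L2 M f"
  shows "nL2 M f = 0 \<longleftrightarrow> (AE x in M. f x = 0)"
proof -
  have "nL2 M f = 0 \<longleftrightarrow> (\<integral>x. (f x)\<^sup>2 \<partial>M) = 0" by (simp add: nL2_def)
  also have "\<dots> \<longleftrightarrow> (AE x in M. (f x)\<^sup>2 = 0)"
    using f by (subst integral_nonneg_eq_0_iff_AE) (auto simp: L2_def)
  finally show ?thesis by simp
qed

lemma L2_cong_AE:
  assumes "L2 M f" "g \<in> borel_measurable M" "AE x in M. f x = g x"
  shows "L2 M g"
proof -
  have "integrable M (\<lambda>x. (g x)\<^sup>2)"
    using assms by (subst integrable_cong_AE[of _ _ "\<lambda>x. (f x)\<^sup>2"]) (auto simp: L2_def)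
  then show ?thesis using assms by (simp add: L2_def)
qed

section \<open>Calculus of iterated partial derivatives\<close>

lemma iter_pd_append: "iter_pd (es @ fs) f = iter_pd es (iter_pd fs f)"
  by (induction es) auto

lemma pd_eqI: "((\<lambda>s. f (x + s *\<^sub>R e)) has_real_derivative d) (at 0) \<Longrightarrow> pd e f x = d"
  unfolding pd_def by (rule some_equality) (auto intro: DERIV_unique)

lemma Cinf_on_continuous: "Cinf_on S f \<Longrightarrow> continuous_on S f"
  unfolding Cinf_on_def by (drule spec[of _ "[]"]) simp

lemma Cinf_on_pd: "Cinf_on S f \<Longrightarrow> e \<in> Basis \<Longrightarrow> Cinf_on S (pd e f)"
  unfolding Cinf_on_def
proof (intro allI impI)
  fix es :: "'a list"
  assume A: "\<forall>es. set es \<subseteq> Basis \<longrightarrow> continuous_on S (iter_pd es f) \<and>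
     (\<forall>e\<in>Basis. \<forall>x\<in>S. ((\<lambda>s. iter_pd es f (x + s *\<^sub>R e)) has_real_derivative pd e (iter_pd es f) x) (at 0))"
    and e: "e \<in> Basis" and "set es \<subseteq> Basis"
  then have "set (es @ [e]) \<subseteq> Basis" by simp
  with A have "continuous_on S (iter_pd (es @ [e]) f) \<and>
     (\<forall>e'\<in>Basis. \<forall>x\<in>S. ((\<lambda>s. iter_pd (es @ [e]) f (x + s *\<^sub>R e')) has_real_derivative pd e' (iter_pd (es @ [e]) f) x) (at 0))"
    by blast
  then show "continuous_on S (iter_pd es (pd e f)) \<and>
     (\<forall>e'\<in>Basis. \<forall>x\<in>S. ((\<lambda>s. iter_pd es (pd e f) (x + s *\<^sub>R e')) has_real_derivative pd e' (iter_pd es (pd e f)) x) (at 0))"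
    by (simp add: iter_pd_append)
qed

lemma Cinf_on_has_pd:
  "Cinf_on S f \<Longrightarrow> e \<in> Basis \<Longrightarrow> x \<in> S \<Longrightarrow> ((\<lambda>s. f (x + s *\<^sub>R e)) has_real_derivative pd e f x) (at 0)"
  unfolding Cinf_on_def by (drule spec[of _ "[]"]) simp

text \<open>\<open>Cinf_on\<close> quantifies over all words of coordinate directions, so smoothness
  is coinductive: a class of continuous functions closed under partial derivatives consists of
  smooth functions. Concrete smoothness proofs then only have to exhibit such a class.\<close>

lemma Cinf_coinduct:
  fixes f :: "'a::euclidean_space \<Rightarrow> real"
  assumes f: "P f"
    and cont: "\<And>f. P f \<Longrightarrow> continuous_on UNIV f"
    and step: "\<And>f e. P f \<Longrightarrow> e \<in> Basis \<Longrightarrow>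
      \<exists>f'. P f' \<and> (\<forall>x. ((\<lambda>s. f (x + s *\<^sub>R e)) has_real_derivative f' x) (at 0))"
  shows "Cinf_on UNIV f"
proof -
  have pdP: "P (pd e F) \<and> (\<forall>x. ((\<lambda>s. F (x + s *\<^sub>R e)) has_real_derivative pd e F x) (at 0))"
    if F: "P F" and e: "e \<in> Basis" for F e
  proof -
    obtain f' where f': "P f'" "\<And>x. ((\<lambda>s. F (x + s *\<^sub>R e)) has_real_derivative f' x) (at 0)"
      using step[OF F e] by blast
    have "pd e F = f'" by (rule ext) (rule pd_eqI[OF f'(2)])
    then show ?thesis using f' by simp
  qed
  have it: "set es \<subseteq> Basis \<Longrightarrow> P (iter_pd es f)" for es
    by (induction es) (auto simp: f pdP)
  show ?thesis unfolding Cinf_on_def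
    using it cont pdP by blast
qed

text \<open>The invariant for sums and products. Products by themselves are not closed under
  differentiation, because the Leibniz rule produces sums of products.\<close>

inductive smooth_closure :: "('a::euclidean_space \<Rightarrow> real) \<Rightarrow> bool" where
  base: "Cinf_on UNIV f \<Longrightarrow> smooth_closure f"
| const: "smooth_closure (\<lambda>x. c)"
| add: "smooth_closure f \<Longrightarrow> smooth_closure g \<Longrightarrow> smooth_closure (\<lambda>x. f x + g x)"
| mult: "smooth_closure f \<Longrightarrow> smooth_closure g \<Longrightarrow> smooth_closure (\<lambda>x. f x * g x)"

lemma smooth_closure_Cinf:
  fixes f :: "'a::euclidean_space \<Rightarrow> real"
  assumes "smooth_closure f"
  shows "Cinf_on UNIV f"
proof (rule Cinf_coinduct[of smooth_closure])
  show "smooth_closure f" by fact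
next
  fix f :: "'a \<Rightarrow> real"
  assume "smooth_closure f"
  then show "continuous_on UNIV f"
    by induction (auto intro: Cinf_on_continuous continuous_intros)
next
  fix f :: "'a \<Rightarrow> real" and e :: 'a
  assume "smooth_closure f" and e: "e \<in> Basis"
  then show "\<exists>f'. smooth_closure f' \<and> (\<forall>x. ((\<lambda>s. f (x + s *\<^sub>R e)) has_real_derivative f' x) (at 0))"
  proof induction
    case (base f)
    then show ?case
      using e Cinf_on_pd Cinf_on_has_pd smooth_closure.base by blast
  next
    case (const c)
    then show ?case by (intro exI[of _ "\<lambda>x. 0"]) (auto intro: smooth_closure.const)
  next
    case (add f g)
    then obtain f' g' where *: "smooth_closure f'" "smooth_closure g'"
      "\<And>x. ((\<lambda>s. f (x + s *\<^sub>R e)) has_real_derivative f' x) (at 0)"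
      "\<And>x. ((\<lambda>s. g (x + s *\<^sub>R e)) has_real_derivative g' x) (at 0)"
      by blast
    then show ?case
      by (intro exI[of _ "\<lambda>x. f' x + g' x"]) (auto intro!: smooth_closure.add DERIV_add)
  next
    case (mult f g)
    then obtain f' g' where *: "smooth_closure f'" "smooth_closure g'"
      "\<And>x. ((\<lambda>s. f (x + s *\<^sub>R e)) has_real_derivative f' x) (at 0)"
      "\<And>x. ((\<lambda>s. g (x + s *\<^sub>R e)) has_real_derivative g' x) (at 0)"
      using e by blast
    show ?case
    proof (intro exI[of _ "\<lambda>x. f' x * g x + g' x * f x"] conjI allI)
      show "smooth_closure (\<lambda>x. f' x * g x + g' x * f x)"
        using * mult.hyps by (intro smooth_closure.add smooth_closure.mult)
      show "((\<lambda>s. f (x + s *\<^sub>R e) * g (x + s *\<^sub>R e)) has_real_derivative f' x * g x + g' x * f x) (at 0)" for x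
        using DERIV_mult[OF *(3) *(4), of x x] by simp
    qed
  qed
qed

lemma Cinf_const: "Cinf_on UNIV (\<lambda>x. c)"
  by (rule smooth_closure_Cinf[OF smooth_closure.const])

lemma Cinf_add: "Cinf_on UNIV f \<Longrightarrow> Cinf_on UNIV g \<Longrightarrow> Cinf_on UNIV (\<lambda>x. f x + g x)"
  by (rule smooth_closure_Cinf[OF smooth_closure.add[OF smooth_closure.base smooth_closure.base]])

lemma Cinf_mult: "Cinf_on UNIV f \<Longrightarrow> Cinf_on UNIV g \<Longrightarrow> Cinf_on UNIV (\<lambda>x. f x * g x)"
  by (rule smooth_closure_Cinf[OF smooth_closure.mult[OF smooth_closure.base smooth_closure.base]])

lemma Cinf_scale: "Cinf_on UNIV f \<Longrightarrow> Cinf_on UNIV (\<lambda>x. c * f x)"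
  by (rule Cinf_mult[OF Cinf_const])

lemma Cinf_diff: "Cinf_on UNIV f \<Longrightarrow> Cinf_on UNIV g \<Longrightarrow> Cinf_on UNIV (\<lambda>x. f x - g x)"
  using Cinf_add[of f "\<lambda>x. (-1) * g x"] Cinf_scale[of g "-1"] by simp

lemma Cinf_sum: "(\<And>i. i \<in> I \<Longrightarrow> Cinf_on UNIV (f i)) \<Longrightarrow> Cinf_on UNIV (\<lambda>x. \<Sum>i\<in>I. f i x)"
  by (induction I rule: infinite_finite_induct) (simp_all add: Cinf_add Cinf_const)

lemma Cinf_prod: "(\<And>i. i \<in> I \<Longrightarrow> Cinf_on UNIV (f i)) \<Longrightarrow> Cinf_on UNIV (\<lambda>x. \<Prod>i\<in>I. f i x)"
  by (induction I rule: infinite_finite_induct) (simp_all add: Cinf_mult Cinf_const)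

lemma pd_const: "pd e (\<lambda>x. c) x = 0"
  by (rule pd_eqI) simp

lemma pd_add:
  assumes "Cinf_on UNIV f" "Cinf_on UNIV g" "e \<in> Basis"
  shows "pd e (\<lambda>x. f x + g x) x = pd e f x + pd e g x"
  using assms by (intro pd_eqI DERIV_add Cinf_on_has_pd) auto

lemma pd_mult:
  assumes "Cinf_on UNIV f" "Cinf_on UNIV g" "e \<in> Basis"
  shows "pd e (\<lambda>x. f x * g x) x = pd e f x * g x + f x * pd e g x"
proof (rule pd_eqI)
  show "((\<lambda>s. f (x + s *\<^sub>R e) * g (x + s *\<^sub>R e)) has_real_derivative pd e f x * g x + f x * pd e g x) (at 0)"
    using DERIV_mult[OF Cinf_on_has_pd[OF assms(1,3)] Cinf_on_has_pd[OF assms(2,3)], of x x]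
    by (simp add: mult.commute)
qed

lemma pd_scale:
  assumes "Cinf_on UNIV f" "e \<in> Basis"
  shows "pd e (\<lambda>x. c * f x) x = c * pd e f x"
  using assms by (intro pd_eqI DERIV_cmult Cinf_on_has_pd) auto

lemma pd_diff:
  assumes "Cinf_on UNIV f" "Cinf_on UNIV g" "e \<in> Basis"
  shows "pd e (\<lambda>x. f x - g x) x = pd e f x - pd e g x"
  using assms by (intro pd_eqI DERIV_diff Cinf_on_has_pd) auto

lemma pd_sum:
  assumes "\<And>i. i \<in> I \<Longrightarrow> Cinf_on UNIV (f i)" "e \<in> Basis"
  shows "pd e (\<lambda>x. \<Sum>i\<in>I. f i x) x = (\<Sum>i\<in>I. pd e (f i) x)"
  using assms by (intro pd_eqI DERIV_sum Cinf_on_has_pd) auto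

lemma has_pd_affine:
  assumes "Cinf_on UNIV f" "e \<in> Basis"
  shows "((\<lambda>s. f (a + c *\<^sub>R (x + s *\<^sub>R e))) has_real_derivative c * pd e f (a + c *\<^sub>R x)) (at 0)"
proof -
  have "((\<lambda>s. f ((a + c *\<^sub>R x) + s *\<^sub>R e)) has_real_derivative pd e f (a + c *\<^sub>R x)) (at (c * 0))"
    using Cinf_on_has_pd[OF assms, of "a + c *\<^sub>R x"] by simp
  then have "((\<lambda>s. f ((a + c *\<^sub>R x) + (c * s) *\<^sub>R e)) has_real_derivative pd e f (a + c *\<^sub>R x) * c) (at 0)"
    by (rule DERIV_chain2[where g="\<lambda>s. c * s"]) (auto intro!: derivative_eq_intros)
  then show ?thesis by (simp add: algebra_simps)
qed

lemma pd_affine: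
  assumes "Cinf_on UNIV f" "e \<in> Basis"
  shows "pd e (\<lambda>x. f (a + c *\<^sub>R x)) x = c * pd e f (a + c *\<^sub>R x)"
  by (rule pd_eqI) (rule has_pd_affine[OF assms])

text \<open>The invariant carries a scalar \<open>k\<close> because every derivative contributes
  another factor \<open>c\<close>.\<close>

lemma Cinf_affine:
  assumes "Cinf_on UNIV f"
  shows "Cinf_on UNIV (\<lambda>x. f (a + c *\<^sub>R x))"
proof (rule Cinf_coinduct[of "\<lambda>F. \<exists>k g. Cinf_on UNIV g \<and> F = (\<lambda>x. k * g (a + c *\<^sub>R x))"])
  show "\<exists>k g. Cinf_on UNIV g \<and> (\<lambda>x. f (a + c *\<^sub>R x)) = (\<lambda>x. k * g (a + c *\<^sub>R x))"
    using assms by (intro exI[of _ 1] exI[of _ f]) auto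
next
  fix F assume "\<exists>k g. Cinf_on UNIV g \<and> F = (\<lambda>x. k * g (a + c *\<^sub>R x))"
  then obtain k g where g: "Cinf_on UNIV g" "F = (\<lambda>x. k * g (a + c *\<^sub>R x))" by blast
  have "continuous_on UNIV (\<lambda>x. g (a + c *\<^sub>R x))"
    by (rule continuous_on_compose2[OF Cinf_on_continuous[OF g(1)]]) (auto intro!: continuous_intros)
  then show "continuous_on UNIV F" unfolding g(2) by (intro continuous_intros)
next
  fix F and e :: 'a
  assume "\<exists>k g. Cinf_on UNIV g \<and> F = (\<lambda>x. k * g (a + c *\<^sub>R x))" and e: "e \<in> Basis"
  then obtain k g where g: "Cinf_on UNIV g" "F = (\<lambda>x. k * g (a + c *\<^sub>R x))" by blast
  show "\<exists>f'. (\<exists>k g. Cinf_on UNIV g \<and> f' = (\<lambda>x. k * g (a + c *\<^sub>R x))) \<and>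
          (\<forall>x. ((\<lambda>s. F (x + s *\<^sub>R e)) has_real_derivative f' x) (at 0))"
  proof (intro exI[of _ "\<lambda>x. (k * c) * pd e g (a + c *\<^sub>R x)"] conjI allI)
    show "\<exists>k' g'. Cinf_on UNIV g' \<and> (\<lambda>x. k * c * pd e g (a + c *\<^sub>R x)) = (\<lambda>x. k' * g' (a + c *\<^sub>R x))"
      using Cinf_on_pd[OF g(1) e] by blast
    show "((\<lambda>s. F (x + s *\<^sub>R e)) has_real_derivative k * c * pd e g (a + c *\<^sub>R x)) (at 0)" for x
      unfolding g(2) using DERIV_cmult[OF has_pd_affine[OF g(1) e, of a c x], of k] by (simp add: mult.assoc)
  qed
qed

text \<open>On the real line \<open>Basis\<close> is \<open>{1}\<close>, so the outer derivative is
  \<open>pd 1 g\<close>, and each differentiation adds a factor \<open>e \<bullet> b\<close> to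
  \<open>k\<close>. This supplies the coordinate factors of \<open>plateau\<close> and
  \<open>mollifier_raw\<close>.\<close>

lemma Cinf_coordinate:
  fixes f :: "real \<Rightarrow> real" and b :: "'a::euclidean_space"
  assumes "Cinf_on UNIV f"
  shows "Cinf_on UNIV (\<lambda>x. f (x \<bullet> b))"
proof (rule Cinf_coinduct[of "\<lambda>F. \<exists>k g. Cinf_on UNIV g \<and> F = (\<lambda>x. k * g (x \<bullet> b))"])
  show "\<exists>k g. Cinf_on UNIV g \<and> (\<lambda>x. f (x \<bullet> b)) = (\<lambda>x. k * g (x \<bullet> b))"
    using assms by (intro exI[of _ 1] exI[of _ f]) auto
next
  fix F :: "'a \<Rightarrow> real" assume "\<exists>k g. Cinf_on UNIV g \<and> F = (\<lambda>x. k * g (x \<bullet> b))"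
  then obtain k and g :: "real \<Rightarrow> real" where g: "Cinf_on UNIV g" "F = (\<lambda>x. k * g (x \<bullet> b))" by blast
  have "continuous_on UNIV (\<lambda>x. g (x \<bullet> b))"
    by (rule continuous_on_compose2[OF Cinf_on_continuous[OF g(1)]]) (auto intro!: continuous_intros)
  then show "continuous_on UNIV F" unfolding g(2) by (intro continuous_intros)
next
  fix F and e :: 'a
  assume "\<exists>k g. Cinf_on UNIV g \<and> F = (\<lambda>x. k * g (x \<bullet> b))" and e: "e \<in> Basis"
  then obtain k and g :: "real \<Rightarrow> real" where g: "Cinf_on UNIV g" "F = (\<lambda>x. k * g (x \<bullet> b))" by blast
  show "\<exists>f'. (\<exists>k g. Cinf_on UNIV g \<and> f' = (\<lambda>x. k * g (x \<bullet> b))) \<and>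
          (\<forall>x. ((\<lambda>s. F (x + s *\<^sub>R e)) has_real_derivative f' x) (at 0))"
  proof (intro exI[of _ "\<lambda>x. (k * (e \<bullet> b)) * pd 1 g (x \<bullet> b)"] conjI allI)
    show "\<exists>k' g'. Cinf_on UNIV g' \<and> (\<lambda>x. k * (e \<bullet> b) * pd 1 g (x \<bullet> b)) = (\<lambda>x. k' * g' (x \<bullet> b))"
      using Cinf_on_pd[OF g(1), of 1] by (auto intro!: exI)
    show "((\<lambda>s. F (x + s *\<^sub>R e)) has_real_derivative k * (e \<bullet> b) * pd 1 g (x \<bullet> b)) (at 0)" for x
    proof -
      have "((\<lambda>s. g (x \<bullet> b + s)) has_real_derivative pd 1 g (x \<bullet> b)) (at (0 * (e \<bullet> b)))"
        using Cinf_on_has_pd[OF g(1), of 1 "x \<bullet> b"] by simp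
      then have "((\<lambda>s. g (x \<bullet> b + s * (e \<bullet> b))) has_real_derivative pd 1 g (x \<bullet> b) * (e \<bullet> b)) (at 0)"
        by (rule DERIV_chain2[where g="\<lambda>s. s * (e \<bullet> b)"]) (auto intro!: derivative_eq_intros)
      then have "((\<lambda>s. k * g (x \<bullet> b + s * (e \<bullet> b))) has_real_derivative k * (pd 1 g (x \<bullet> b) * (e \<bullet> b))) (at 0)"
        by (rule DERIV_cmult)
      then show ?thesis unfolding g(2) by (simp add: inner_add_left mult_ac)
    qed
  qed
qed

section \<open>Gradient and differentiability of smooth functions\<close>

definition grad :: "('a::euclidean_space \<Rightarrow> real) \<Rightarrow> 'a \<Rightarrow> 'a" where
  "grad f x = (\<Sum>b\<in>Basis. pd b f x *\<^sub>R b)"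

lemma grad_inner: "b \<in> Basis \<Longrightarrow> grad f x \<bullet> b = pd b f x"
  unfolding grad_def by simp

lemma Cinf_on_shift_derivative:
  assumes "Cinf_on S f" "e \<in> Basis" "x + r *\<^sub>R e \<in> S"
  shows "((\<lambda>s. f (x + s *\<^sub>R e)) has_real_derivative pd e f (x + r *\<^sub>R e)) (at r)"
proof -
  have "((\<lambda>s. f ((x + r *\<^sub>R e) + s *\<^sub>R e)) has_real_derivative pd e f (x + r *\<^sub>R e)) (at (r - r))"
    using Cinf_on_has_pd[OF assms] by simp
  then have "((\<lambda>s. f ((x + r *\<^sub>R e) + (s - r) *\<^sub>R e)) has_real_derivative pd e f (x + r *\<^sub>R e) * 1) (at r)"
    by (rule DERIV_chain2[where g="\<lambda>s. s - r"]) (auto intro!: derivative_eq_intros)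
  then show ?thesis by (simp add: algebra_simps)
qed

text \<open>Continuous partial derivatives give differentiability: change one coordinate at a time.\<close>
lemma Cinf_on_has_derivative:
  fixes f :: "'a::euclidean_space \<Rightarrow> real"
  assumes f: "Cinf_on S f" and S: "open S" and x: "x \<in> S"
  shows "(f has_derivative (\<lambda>v. v \<bullet> grad f x)) (at x)"
proof (unfold has_derivative_at_alt, intro conjI allI impI)
  show "bounded_linear (\<lambda>v. v \<bullet> grad f x)" by (rule bounded_linear_inner_left)
next
  fix e :: real assume "0 < e"
  define \<epsilon> where "\<epsilon> = e / (real DIM('a) + 1)"
  have eps: "\<epsilon> > 0" "real DIM('a) * \<epsilon> < e" using \<open>0 < e\<close>
    by (auto simp: \<epsilon>_def field_simps)
  have "\<exists>\<delta>>0. ball x \<delta> \<subseteq> S \<and> (\<forall>y\<in>ball x \<delta>. \<bar>pd b f y - pd b f x\<bar> < \<epsilon>)" if b: "b \<in> Basis" for b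
  proof -
    have "continuous_on S (pd b f)" using Cinf_on_continuous[OF Cinf_on_pd[OF f b]] .
    then have "isCont (pd b f) x" using S x by (simp add: continuous_on_eq_continuous_at)
    then obtain d1 where d1: "d1 > 0" "\<And>y. dist y x < d1 \<Longrightarrow> dist (pd b f y) (pd b f x) < \<epsilon>"
      using eps by (metis continuous_at_eps_delta)
    obtain d2 where "d2 > 0" "ball x d2 \<subseteq> S" using S x openE by blast
    then show ?thesis using d1
      by (intro exI[of _ "min d1 d2"]) (auto simp: dist_commute dist_real_def subset_iff)
  qed
  then obtain D where D: "\<And>b. b \<in> Basis \<Longrightarrow> D b > 0 \<and> ball x (D b) \<subseteq> S \<and> (\<forall>y\<in>ball x (D b). \<bar>pd b f y - pd b f x\<bar> < \<epsilon>)"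
    by metis
  define \<delta> where "\<delta> = Min (D ` Basis)"
  have \<delta>: "\<delta> > 0" using D by (simp add: \<delta>_def)
  have \<delta>': "y \<in> S" "\<bar>pd b f y - pd b f x\<bar> < \<epsilon>" if "b \<in> Basis" "y \<in> ball x \<delta>" for b y
  proof -
    have "\<delta> \<le> D b" using that by (simp add: \<delta>_def)
    then have "y \<in> ball x (D b)" using that by auto
    then show "y \<in> S" "\<bar>pd b f y - pd b f x\<bar> < \<epsilon>" using D[OF that(1)] by auto
  qed
  have main: "\<bar>f (x + v) - f x - v \<bullet> grad f x\<bar> \<le> real DIM('a) * \<epsilon> * norm v" if v: "norm v < \<delta>" for v
  proof -
    \<comment> \<open>\<open>w B\<close> keeps the coordinates of \<open>v\<close> in
      \<open>B\<close>; enlarging \<open>B\<close> by one vector moves along one edge of the box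
      spanned by \<open>v\<close>, and each edge costs at most
      \<open>\<epsilon> * norm v\<close>.\<close>
    define w where "w B = (\<Sum>b\<in>B. (v \<bullet> b) *\<^sub>R b)" for B :: "'a set"
    have wi: "w B \<bullet> b = (if b \<in> B then v \<bullet> b else 0)" if "finite B" "B \<subseteq> Basis" "b \<in> Basis" for B b
    proof -
      have "w B \<bullet> b = (\<Sum>c\<in>B. (v \<bullet> c) * (if c = b then 1 else 0))"
        unfolding w_def inner_sum_left using that by (intro sum.cong) (auto simp: inner_Basis subset_iff)
      then show ?thesis using that by (simp add: if_distrib sum.delta cong: if_cong)
    qed
    have "B \<subseteq> Basis \<Longrightarrow> \<bar>f (x + w B) - f x - (\<Sum>b\<in>B. (v \<bullet> b) * pd b f x)\<bar> \<le> real (card B) * \<epsilon> * norm v"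
      if "finite B" for B
      using that
    proof (induction B rule: finite_induct)
      case empty
      then show ?case by (simp add: w_def)
    next
      case (insert c B)
      have c: "c \<in> Basis" and B: "B \<subseteq> Basis" using insert.prems by auto
      define u where "u s = f ((x + w B) + s *\<^sub>R c)" for s
      have inb: "(x + w B) + s *\<^sub>R c \<in> ball x \<delta>" if s: "\<bar>s\<bar> \<le> \<bar>v \<bullet> c\<bar>" for s
      proof -
        have "norm (w B + s *\<^sub>R c) \<le> norm v"
        proof (rule norm_le_componentwise)
          fix b :: 'a assume b: "b \<in> Basis"
          show "\<bar>(w B + s *\<^sub>R c) \<bullet> b\<bar> \<le> \<bar>v \<bullet> b\<bar>"
            using s insert.hyps b c wi[OF insert.hyps(1) B b] by (auto simp: inner_add_left inner_Basis)
        qed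
        moreover have "dist x ((x + w B) + s *\<^sub>R c) = norm (w B + s *\<^sub>R c)"
          by (subst dist_commute) (simp add: dist_norm add.assoc)
        ultimately show ?thesis using v by simp
      qed
      have der: "(u has_real_derivative pd c f ((x + w B) + s *\<^sub>R c)) (at s)" if s: "\<bar>s\<bar> \<le> \<bar>v \<bullet> c\<bar>" for s
        unfolding u_def using Cinf_on_shift_derivative[OF f c] \<delta>'(1)[OF c inb[OF s]] by blast
      have "\<exists>s. \<bar>s\<bar> \<le> \<bar>v \<bullet> c\<bar> \<and> u (v \<bullet> c) - u 0 = (v \<bullet> c) * pd c f ((x + w B) + s *\<^sub>R c)"
      proof (cases "v \<bullet> c" "0::real" rule: linorder_cases)
        case less
        have "\<exists>z. z > v \<bullet> c \<and> z < 0 \<and> u 0 - u (v \<bullet> c) = (0 - v \<bullet> c) * pd c f ((x + w B) + z *\<^sub>R c)"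
          using less by (intro MVT2 der) auto
        then obtain z where z: "z > v \<bullet> c" "z < 0" "u 0 - u (v \<bullet> c) = (0 - v \<bullet> c) * pd c f ((x + w B) + z *\<^sub>R c)"
          by blast
        show ?thesis using less z by (intro exI[of _ z]) auto
      next
        case equal
        then show ?thesis by (intro exI[of _ 0]) auto
      next
        case greater
        have "\<exists>z. z > 0 \<and> z < v \<bullet> c \<and> u (v \<bullet> c) - u 0 = (v \<bullet> c - 0) * pd c f ((x + w B) + z *\<^sub>R c)"
          using greater by (intro MVT2 der) auto
        then obtain z where z: "z > 0" "z < v \<bullet> c" "u (v \<bullet> c) - u 0 = (v \<bullet> c - 0) * pd c f ((x + w B) + z *\<^sub>R c)"
          by blast
        show ?thesis using greater z by (intro exI[of _ z]) auto
      qed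
      then obtain s where s: "\<bar>s\<bar> \<le> \<bar>v \<bullet> c\<bar>" "u (v \<bullet> c) - u 0 = (v \<bullet> c) * pd c f ((x + w B) + s *\<^sub>R c)" by blast
      have "\<bar>u (v \<bullet> c) - u 0 - (v \<bullet> c) * pd c f x\<bar> = \<bar>v \<bullet> c\<bar> * \<bar>pd c f ((x + w B) + s *\<^sub>R c) - pd c f x\<bar>"
        unfolding s(2) by (simp add: abs_mult[symmetric] algebra_simps)
      also have "\<dots> \<le> norm v * \<epsilon>"
        using \<delta>'(2)[OF c inb[OF s(1)]] Basis_le_norm[OF c, of v] by (intro mult_mono) auto
      finally have 1: "\<bar>u (v \<bullet> c) - u 0 - (v \<bullet> c) * pd c f x\<bar> \<le> norm v * \<epsilon>" .
      have "w (insert c B) = w B + (v \<bullet> c) *\<^sub>R c" using insert.hyps by (simp add: w_def)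
      then have 2: "u (v \<bullet> c) = f (x + w (insert c B))" "u 0 = f (x + w B)" by (auto simp: u_def add.assoc)
      show ?case
        using 1 insert.IH[OF B] insert.hyps unfolding 2
        by (simp add: ring_distribs mult.commute[of \<epsilon>])
    qed
    from this[of Basis] have "\<bar>f (x + w Basis) - f x - (\<Sum>b\<in>Basis. (v \<bullet> b) * pd b f x)\<bar> \<le> real DIM('a) * \<epsilon> * norm v"
      by simp
    moreover have "w Basis = v" by (simp add: w_def euclidean_representation)
    moreover have "v \<bullet> grad f x = (\<Sum>b\<in>Basis. (v \<bullet> b) * pd b f x)"
      by (simp add: grad_def inner_sum_right mult.commute)
    ultimately show ?thesis by simp
  qed
  show "\<exists>d>0. \<forall>y. norm (y - x) < d \<longrightarrow> norm (f y - f x - (y - x) \<bullet> grad f x) \<le> e * norm (y - x)"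
  proof (intro exI[of _ \<delta>] conjI allI impI)
    fix x' assume x': "norm (x' - x) < \<delta>"
    have "\<bar>f x' - f x - (x' - x) \<bullet> grad f x\<bar> \<le> real DIM('a) * \<epsilon> * norm (x' - x)"
      using main[of "x' - x"] x' by simp
    also have "\<dots> \<le> e * norm (x' - x)" using eps by (intro mult_right_mono) auto
    finally show "norm (f x' - f x - (x' - x) \<bullet> grad f x) \<le> e * norm (x' - x)"
      by simp
  qed (use \<delta> in auto)
qed

lemma Cinf_line_derivative:
  fixes f :: "'a::euclidean_space \<Rightarrow> real"
  assumes f: "Cinf_on S f" and S: "open S" and x: "x + s *\<^sub>R z \<in> S"
  shows "((\<lambda>s. f (x + s *\<^sub>R z)) has_real_derivative (z \<bullet> grad f (x + s *\<^sub>R z))) (at s)"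
proof -
  have "((\<lambda>s. f (x + s *\<^sub>R z)) has_derivative (\<lambda>h. (h *\<^sub>R z) \<bullet> grad f (x + s *\<^sub>R z))) (at s)"
    by (rule has_derivative_compose[where g=f and f="\<lambda>s. x + s *\<^sub>R z", OF _ Cinf_on_has_derivative[OF f S x]])
      (auto intro!: derivative_eq_intros)
  then show ?thesis unfolding has_field_derivative_def
    by (rule has_derivative_eq_rhs) (auto simp: fun_eq_iff)
qed

subsection \<open>Smooth bumps and mollifiers\<close>

text \<open>The flat function \<open>exp (-1/t)\<close> is the case \<open>p = 1\<close>. The
  polynomial factor makes the family closed under differentiation, as \<open>Cinf_coinduct\<close>
  requires.\<close>

definition flat_exp :: "real poly \<Rightarrow> real \<Rightarrow> real" where
  "flat_exp p t = (if t > 0 then poly p (1 / t) * exp (- (1 / t)) else 0)"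

lemma poly_times_exp_minus_tendsto_0: "((\<lambda>u::real. poly p u * exp (- u)) \<longlongrightarrow> 0) at_top"
proof -
  have "((\<lambda>u. \<Sum>i\<le>degree p. coeff p i * (u ^ i / exp u)) \<longlongrightarrow> (\<Sum>i\<le>degree p. coeff p i * 0)) at_top"
    by (intro tendsto_sum tendsto_mult tendsto_const tendsto_power_div_exp_0)
  moreover have "(\<Sum>i\<le>degree p. coeff p i * (u ^ i / exp u)) = poly p u * exp (- u)" for u :: real
    by (simp add: poly_altdef sum_distrib_right exp_minus divide_inverse mult.assoc)
  ultimately show ?thesis by simp
qed

lemma flat_exp_at_right: "((\<lambda>t. poly p (1 / t) * exp (- (1 / t))) \<longlongrightarrow> 0) (at_right (0::real))"
proof -
  have "filterlim (\<lambda>t::real. 1 / t) at_top (at_right 0)"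
    using filterlim_inverse_at_top_right by (simp add: inverse_eq_divide)
  from filterlim_compose[OF poly_times_exp_minus_tendsto_0 this] show ?thesis .
qed

text \<open>In the variable \<open>u = 1/t\<close> differentiation acts as
  \<open>- u^2 d/du\<close>, which sends \<open>p(u) exp(-u)\<close> to
  \<open>u^2 (p - p')(u) exp(-u)\<close>. At the origin the right difference quotient belongs to the
  same family, with polynomial \<open>pCons 0 p\<close>, and tends to zero.\<close>

lemma flat_exp_has_derivative:
  "(flat_exp p has_real_derivative flat_exp ([:0, 0, 1:] * (p - pderiv p)) t) (at t)"
proof (cases t "0::real" rule: linorder_cases)
  case less
  have "((\<lambda>_. 0) has_real_derivative 0) (at t)" by simp
  then have "(flat_exp p has_real_derivative 0) (at t)"
    by (rule has_field_derivative_transform_within_open[where S="{..<0}"]) (use less in \<open>auto simp: flat_exp_def\<close>)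
  then show ?thesis using less by (simp add: flat_exp_def)
next
  case equal
  have "((\<lambda>h. (flat_exp p (0 + h) - flat_exp p 0) / h) \<longlongrightarrow> 0) (at 0)"
  proof (rule filterlim_split_at)
    have "\<forall>\<^sub>F h in at_left (0::real). 0 = (flat_exp p (0 + h) - flat_exp p 0) / h"
      unfolding eventually_at_filter by (auto simp: flat_exp_def)
    then show "((\<lambda>h. (flat_exp p (0 + h) - flat_exp p 0) / h) \<longlongrightarrow> 0) (at_left 0)"
      by (rule Lim_transform_eventually[rotated]) simp
    have "\<forall>\<^sub>F h in at_right (0::real). poly (pCons 0 p) (1 / h) * exp (- (1 / h)) = (flat_exp p (0 + h) - flat_exp p 0) / h"
      unfolding eventually_at_filter by (auto simp: flat_exp_def)
    then show "((\<lambda>h. (flat_exp p (0 + h) - flat_exp p 0) / h) \<longlongrightarrow> 0) (at_right 0)"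
      by (rule Lim_transform_eventually[rotated]) (rule flat_exp_at_right)
  qed
  then have "(flat_exp p has_real_derivative 0) (at 0)" by (simp add: DERIV_def)
  then show ?thesis using equal by (simp add: flat_exp_def)
next
  case greater
  have 1: "((\<lambda>s::real. 1 / s) has_real_derivative (- (1 / t\<^sup>2))) (at t)"
    using greater by (auto intro!: derivative_eq_intros simp: power2_eq_square)
  have "((\<lambda>s. poly p (1 / s) * exp (- (1 / s))) has_real_derivative
        (poly (pderiv p) (1 / t) * (- (1 / t\<^sup>2))) * exp (- (1 / t)) + exp (- (1 / t)) * (- (- (1 / t\<^sup>2))) * poly p (1 / t)) (at t)"
    by (intro DERIV_mult DERIV_chain2[OF poly_DERIV 1] DERIV_chain2[OF DERIV_exp DERIV_minus[OF 1]])
  then have "(flat_exp p has_real_derivative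
        (poly (pderiv p) (1 / t) * (- (1 / t\<^sup>2))) * exp (- (1 / t)) + exp (- (1 / t)) * (- (- (1 / t\<^sup>2))) * poly p (1 / t)) (at t)"
    by (rule has_field_derivative_transform_within_open[where S="{0<..}"]) (use greater in \<open>auto simp: flat_exp_def\<close>)
  moreover have "(poly (pderiv p) (1 / t) * (- (1 / t\<^sup>2))) * exp (- (1 / t)) + exp (- (1 / t)) * (- (- (1 / t\<^sup>2))) * poly p (1 / t)
      = flat_exp ([:0, 0, 1:] * (p - pderiv p)) t"
    using greater by (simp add: flat_exp_def power2_eq_square field_simps)
  ultimately show ?thesis by simp
qed

lemma real_shift_derivative_iff:
  "((\<lambda>s. f (x + s *\<^sub>R (1::real))) has_real_derivative d) (at 0) \<longleftrightarrow> (f has_real_derivative d) (at x)"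
  using DERIV_shift[of f d 0 x] by (simp add: add.commute)

lemma Cinf_flat_exp: "Cinf_on UNIV (flat_exp p)"
proof (rule Cinf_coinduct[of "\<lambda>F. \<exists>p. F = flat_exp p"])
  show "\<exists>q. flat_exp p = flat_exp q" by blast
next
  fix F assume "\<exists>p. F = flat_exp p"
  then show "continuous_on UNIV F"
    using flat_exp_has_derivative by (metis DERIV_continuous continuous_at_imp_continuous_on)
next
  fix F and e :: real
  assume "\<exists>p. F = flat_exp p" and "e \<in> Basis"
  then obtain p where p: "F = flat_exp p" and e: "e = 1" by auto
  show "\<exists>f'. (\<exists>p. f' = flat_exp p) \<and> (\<forall>x. ((\<lambda>s. F (x + s *\<^sub>R e)) has_real_derivative f' x) (at 0))"
    unfolding p e real_shift_derivative_iff using flat_exp_has_derivative by blast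
qed

definition sbump :: "real \<Rightarrow> real" where
  "sbump t = flat_exp 1 (1 + (-1) *\<^sub>R t) * flat_exp 1 (1 + 1 *\<^sub>R t)"

lemma Cinf_sbump: "Cinf_on UNIV sbump"
  unfolding sbump_def by (rule Cinf_mult[OF Cinf_affine[OF Cinf_flat_exp] Cinf_affine[OF Cinf_flat_exp]])

lemma sbump_nonneg: "0 \<le> sbump t"
  by (simp add: sbump_def flat_exp_def)

lemma sbump_pos: "\<bar>t\<bar> < 1 \<Longrightarrow> 0 < sbump t"
  by (auto simp: sbump_def flat_exp_def)

lemma sbump_eq_0: "\<bar>t\<bar> \<ge> 1 \<Longrightarrow> sbump t = 0"
  by (auto simp: sbump_def flat_exp_def)

text \<open>The lower limit lies strictly to the left of the support of \<open>sbump\<close>. For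
  \<open>t < -2\<close> the interval is empty and the value zero, so this is an antiderivative on
  the whole line.\<close>

definition sbump_int :: "real \<Rightarrow> real" where
  "sbump_int t = integral {-2..t} sbump"

lemma sbump_int_has_derivative: "(sbump_int has_real_derivative sbump t) (at t)"
proof (cases "t > -2")
  case True
  have "((\<lambda>x. integral {-2..x} sbump) has_real_derivative sbump t) (at t within {-2..t+1})"
    using True by (intro integral_has_real_derivative continuous_on_subset[OF Cinf_on_continuous[OF Cinf_sbump]]) auto
  moreover have "at t within {-2..t+1} = at t"
    using True by (intro at_within_interior) (auto simp: interior_atLeastAtMost_real)
  ultimately show ?thesis by (simp add: sbump_int_def[abs_def])
next
  case False
  have "((\<lambda>_. 0) has_real_derivative 0) (at t)" by simp
  then have "(sbump_int has_real_derivative 0) (at t)"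
  proof (rule has_field_derivative_transform_within_open[where S="{..<-1}"])
    show "0 = sbump_int x" if "x \<in> {..<-1}" for x
    proof -
      have "integral {-2..x} sbump = integral {-2..x} (\<lambda>_. 0)"
        using that by (intro Henstock_Kurzweil_Integration.integral_cong) (auto intro: sbump_eq_0)
      then show ?thesis by (simp add: sbump_int_def)
    qed
  qed (use False in auto)
  then show ?thesis using False by (simp add: sbump_eq_0)
qed

lemma sbump_int_MVT:
  assumes "a < b"
  shows "\<exists>z. a < z \<and> z < b \<and> sbump_int b - sbump_int a = (b - a) * sbump z"
  using MVT2[OF assms, of sbump_int sbump] sbump_int_has_derivative by blast

lemma sbump_int_left: "t \<le> -1 \<Longrightarrow> sbump_int t = 0"
proof -
  have z: "sbump_int (-2) = 0" by (simp add: sbump_int_def)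
  assume t: "t \<le> -1"
  consider "t < -2" | "t = -2" | "-2 < t" by linarith
  then show ?thesis
  proof cases
    case 1
    then show ?thesis by (simp add: sbump_int_def)
  next
    case 2
    then show ?thesis using z by simp
  next
    case 3
    obtain w where "-2 < w" "w < t" "sbump_int t - sbump_int (-2) = (t - (-2)) * sbump w"
      using sbump_int_MVT[OF 3] by blast
    then show ?thesis using z t sbump_eq_0[of w] by simp
  qed
qed

lemma sbump_int_right: "t \<ge> 1 \<Longrightarrow> sbump_int t = sbump_int 1"
proof (cases "t = 1")
  case False
  assume "t \<ge> 1"
  then have "1 < t" using False by simp
  then obtain w where "1 < w" "sbump_int t - sbump_int 1 = (t - 1) * sbump w"
    using sbump_int_MVT by blast
  then show ?thesis using sbump_eq_0[of w] by simp
qed simp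

lemma sbump_int_1_pos: "sbump_int 1 > 0"
proof -
  obtain w where w: "-1 < w" "w < 1" "sbump_int 1 - sbump_int (-1) = (1 - (-1)) * sbump w"
    using sbump_int_MVT[of "-1" 1] by auto
  then show ?thesis using sbump_pos[of w] sbump_int_left[of "-1"] by simp
qed

text \<open>Dividing by the total mass \<open>sbump_int 1\<close> makes the antiderivative
  \<open>sstep\<close> rise from 0 at -1 to 1 at 1. The pair is used in space for cutoffs and
  mollifiers, and in time for test functions whose derivatives are approximate identities.\<close>

definition skern :: "real \<Rightarrow> real" where "skern t = (1 / sbump_int 1) * sbump t"
definition sstep :: "real \<Rightarrow> real" where "sstep t = (1 / sbump_int 1) * sbump_int t"

lemma Cinf_skern: "Cinf_on UNIV skern"
  unfolding skern_def by (rule Cinf_scale[OF Cinf_sbump])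

lemma skern_nonneg: "0 \<le> skern t"
  using sbump_int_1_pos by (simp add: skern_def sbump_nonneg)

lemma skern_pos: "\<bar>t\<bar> < 1 \<Longrightarrow> 0 < skern t"
  using sbump_int_1_pos by (simp add: skern_def sbump_pos)

lemma skern_eq_0: "\<bar>t\<bar> \<ge> 1 \<Longrightarrow> skern t = 0"
  by (simp add: skern_def sbump_eq_0)

lemma sstep_has_derivative: "(sstep has_real_derivative skern t) (at t)"
  unfolding sstep_def skern_def by (intro DERIV_cmult sbump_int_has_derivative)

lemma sstep_left: "t \<le> -1 \<Longrightarrow> sstep t = 0"
  by (simp add: sstep_def sbump_int_left)

lemma sstep_right: "t \<ge> 1 \<Longrightarrow> sstep t = 1"
  using sbump_int_right[of t] sbump_int_1_pos by (simp add: sstep_def)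

lemma sstep_mono: "s \<le> t \<Longrightarrow> sstep s \<le> sstep t"
  by (rule DERIV_nonneg_imp_nondecreasing) (auto intro: sstep_has_derivative skern_nonneg)

lemma sstep_bounds: "0 \<le> sstep t" "sstep t \<le> 1"
proof -
  show "0 \<le> sstep t"
    using sstep_mono[of "min t (-1)" t] sstep_left[of "min t (-1)"] by simp
  show "sstep t \<le> 1"
    using sstep_mono[of t "max t 1"] sstep_right[of "max t 1"] by simp
qed

text \<open>Adding \<open>f\<close> to the class of all smooth functions keeps it closed under
  differentiation, since the derivative \<open>k\<close> of the new member is smooth.\<close>

lemma Cinf_real_antiderivative:
  fixes f k :: "real \<Rightarrow> real"
  assumes k: "Cinf_on UNIV k" and f: "\<And>t. (f has_real_derivative k t) (at t)"
  shows "Cinf_on UNIV f"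
proof (rule Cinf_coinduct[of "\<lambda>F. F = f \<or> Cinf_on UNIV F"])
  fix F assume "F = f \<or> Cinf_on UNIV F"
  then show "continuous_on UNIV F"
    using f by (metis DERIV_continuous continuous_at_imp_continuous_on Cinf_on_continuous)
next
  fix F and e :: real
  assume F: "F = f \<or> Cinf_on UNIV F" and "e \<in> Basis"
  then have e: "e = 1" by simp
  from F show "\<exists>f'. (f' = f \<or> Cinf_on UNIV f') \<and> (\<forall>x. ((\<lambda>s. F (x + s *\<^sub>R e)) has_real_derivative f' x) (at 0))"
  proof
    assume "F = f"
    then show ?thesis unfolding e real_shift_derivative_iff using f k by blast
  next
    assume F: "Cinf_on UNIV F"
    have "Cinf_on UNIV (pd e F)" by (rule Cinf_on_pd[OF F \<open>e \<in> Basis\<close>])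
    moreover have "((\<lambda>s. F (x + s *\<^sub>R e)) has_real_derivative pd e F x) (at 0)" for x
      by (rule Cinf_on_has_pd[OF F \<open>e \<in> Basis\<close> UNIV_I])
    ultimately show ?thesis by blast
  qed
qed simp

lemma Cinf_sstep: "Cinf_on UNIV sstep"
  by (rule Cinf_real_antiderivative[OF Cinf_skern sstep_has_derivative])

text \<open>In each coordinate both arguments are at least 1 when the modulus is at most 1, and one
  of them is at most -1 when the modulus is at least 2. The product is therefore 1 on a cube and 0
  outside the cube of twice its size.\<close>

definition plateau :: "'a::euclidean_space \<Rightarrow> real" where
  "plateau x = (\<Prod>b\<in>Basis. sstep (3 + 2 *\<^sub>R (x \<bullet> b)) * sstep (3 + (-2) *\<^sub>R (x \<bullet> b)))"

lemma Cinf_plateau: "Cinf_on UNIV plateau"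
proof -
  have "Cinf_on UNIV (\<lambda>t. sstep (3 + 2 *\<^sub>R t) * sstep (3 + (-2) *\<^sub>R t))"
    by (rule Cinf_mult[OF Cinf_affine[OF Cinf_sstep] Cinf_affine[OF Cinf_sstep]])
  then have "Cinf_on UNIV (\<lambda>x::'a. sstep (3 + 2 *\<^sub>R (x \<bullet> b)) * sstep (3 + (-2) *\<^sub>R (x \<bullet> b)))" for b
    by (rule Cinf_coordinate)
  then show ?thesis unfolding plateau_def[abs_def] by (intro Cinf_prod)
qed

lemma plateau_eq_1: "norm x \<le> 1 \<Longrightarrow> plateau x = 1"
proof -
  assume x: "norm x \<le> 1"
  have "sstep (3 + 2 *\<^sub>R (x \<bullet> b)) * sstep (3 + (-2) *\<^sub>R (x \<bullet> b)) = 1" if "b \<in> Basis" for b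
  proof -
    have "\<bar>x \<bullet> b\<bar> \<le> 1" using Basis_le_norm[OF that, of x] x by linarith
    then show ?thesis by (simp add: sstep_right)
  qed
  then show ?thesis unfolding plateau_def by simp
qed

lemma large_norm_large_coordinate:
  fixes x :: "'a::euclidean_space"
  assumes "norm x \<ge> real DIM('a) * c"
  obtains b where "b \<in> Basis" "\<bar>x \<bullet> b\<bar> \<ge> c"
proof -
  have "\<exists>b\<in>Basis. \<bar>x \<bullet> b\<bar> \<ge> c"
  proof (rule ccontr)
    assume "\<not> ?thesis"
    then have "(\<Sum>b\<in>Basis. \<bar>x \<bullet> b\<bar>) < (\<Sum>b\<in>(Basis::'a set). c)"
      by (intro sum_strict_mono) (auto simp: not_le)
    then show False using norm_le_l1[of x] assms by simp
  qed
  then show ?thesis using that by blast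
qed

lemma plateau_eq_0: "norm (x::'a::euclidean_space) \<ge> real DIM('a) * 2 \<Longrightarrow> plateau x = 0"
proof -
  assume "norm x \<ge> real DIM('a) * 2"
  then obtain b where b: "b \<in> Basis" "\<bar>x \<bullet> b\<bar> \<ge> 2" by (rule large_norm_large_coordinate)
  have "sstep (3 + 2 *\<^sub>R (x \<bullet> b)) * sstep (3 + (-2) *\<^sub>R (x \<bullet> b)) = 0"
    using b(2) sstep_left[of "3 + 2 * (x \<bullet> b)"] sstep_left[of "3 - 2 * (x \<bullet> b)"] by (auto simp: abs_real_def split: if_splits)
  then show ?thesis unfolding plateau_def using b(1) by (auto intro!: prod_zero)
qed

lemma integrable_continuous_support:
  fixes f :: "'a::euclidean_space \<Rightarrow> real"
  assumes f: "continuous_on UNIV f" and z: "\<And>x. x \<notin> S \<Longrightarrow> f x = 0" and S: "bounded S"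
  shows "integrable lborel f"
proof -
  obtain R where R: "S \<subseteq> cball 0 R" using bounded_subset_ballD[OF S, of 0] ball_subset_cball by (metis order_trans)
  have "integrable lborel (\<lambda>x. indicator (cball 0 R) x *\<^sub>R f x)"
    by (intro borel_integrable_compact continuous_on_subset[OF f]) auto
  moreover have "(\<lambda>x. indicator (cball 0 R) x *\<^sub>R f x) = f"
    using subsetD[OF R] z by (auto simp: fun_eq_iff indicator_def simp del: mem_cball_0)
  ultimately show ?thesis by simp
qed

section \<open>A normalised mollifier\<close>

definition mollifier_raw :: "'a::euclidean_space \<Rightarrow> real" where
  "mollifier_raw x = (\<Prod>b\<in>Basis. skern (x \<bullet> b))"

text \<open>Scaling the argument by the dimension shrinks the support from the unit cube into the
  unit ball, by comparison of the norm with the sum of the coordinates. The summand 0 brings the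
  argument into the shape of \<open>Cinf_affine\<close>.\<close>

definition mollifier :: "'a::euclidean_space \<Rightarrow> real" where
  "mollifier x = (1 / (\<integral>y. mollifier_raw (0 + real DIM('a) *\<^sub>R (y::'a)) \<partial>lborel)) * mollifier_raw (0 + real DIM('a) *\<^sub>R x)"

lemma mollifier_raw_nonneg: "0 \<le> mollifier_raw x"
  unfolding mollifier_raw_def by (intro prod_nonneg) (auto simp: skern_nonneg)

lemma Cinf_mollifier_raw: "Cinf_on UNIV mollifier_raw"
  unfolding mollifier_raw_def[abs_def] by (rule Cinf_prod) (rule Cinf_coordinate[OF Cinf_skern])

lemma mollifier_raw_eq_0: "norm (x::'a::euclidean_space) \<ge> real DIM('a) \<Longrightarrow> mollifier_raw x = 0"
proof -
  assume "norm x \<ge> real DIM('a)"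
  then have "norm x \<ge> real DIM('a) * 1" by simp
  then obtain b where b: "b \<in> Basis" "\<bar>x \<bullet> b\<bar> \<ge> 1" by (rule large_norm_large_coordinate)
  then show ?thesis unfolding mollifier_raw_def by (auto intro!: prod_zero skern_eq_0)
qed

lemma mollifier_raw_scaled_eq_0:
  assumes "norm (x::'a::euclidean_space) \<ge> 1"
  shows "mollifier_raw (0 + real DIM('a) *\<^sub>R x) = 0"
proof (rule mollifier_raw_eq_0)
  show "real DIM('a) \<le> norm (0 + real DIM('a) *\<^sub>R x)"
    using mult_left_mono[OF assms, of "real DIM('a)"] by simp
qed

lemma integrable_mollifier_raw: "integrable lborel (\<lambda>x::'a::euclidean_space. mollifier_raw (0 + real DIM('a) *\<^sub>R x))"
  by (rule integrable_continuous_support[where S="ball 0 1", OF Cinf_on_continuous[OF Cinf_affine[OF Cinf_mollifier_raw]]])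
     (auto intro: mollifier_raw_scaled_eq_0[simplified])

text \<open>If the integral of this nonnegative continuous function were zero, the open set where it
  is positive would be negligible and hence empty, although it contains the origin.\<close>

lemma mollifier_raw_integral_pos: "0 < (\<integral>y. mollifier_raw (0 + real DIM('a) *\<^sub>R (y::'a::euclidean_space)) \<partial>lborel)"
proof (rule ccontr)
  let ?f = "\<lambda>y::'a. mollifier_raw (0 + real DIM('a) *\<^sub>R y)"
  assume "\<not> ?thesis"
  moreover have "0 \<le> (\<integral>y. ?f y \<partial>lborel)" by (intro integral_nonneg_AE AE_I2 mollifier_raw_nonneg)
  ultimately have "(\<integral>y. ?f y \<partial>lborel) = 0" by linarith
  then have ae: "AE y in lborel. ?f y = 0"
    using integral_nonneg_eq_0_iff_AE[OF integrable_mollifier_raw] mollifier_raw_nonneg by auto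
  have cont: "continuous_on UNIV ?f" by (rule Cinf_on_continuous[OF Cinf_affine[OF Cinf_mollifier_raw]])
  have "?f 0 > 0" by (auto simp: mollifier_raw_def intro!: zero_less_power skern_pos)
  have "open {y. ?f y > 0}" using open_Collect_less[OF continuous_on_const cont] .
  moreover have "AE y in lborel. y \<notin> {y. ?f y > 0}" using ae by auto
  then have "{y. ?f y > 0} \<in> null_sets lborel"
    using \<open>open _\<close> by (subst AE_iff_null_sets) (auto simp: borel_open)
  then have "negligible {y. ?f y > 0}"
    by (simp add: negligible_iff_null_sets null_sets_completionI)
  ultimately have "{y. ?f y > 0} = {}" using open_not_negligible by blast
  then show False using \<open>?f 0 > 0\<close> by blast
qed

lemma Cinf_mollifier: "Cinf_on UNIV mollifier"
  unfolding mollifier_def[abs_def] by (rule Cinf_scale[OF Cinf_affine[OF Cinf_mollifier_raw]])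

lemma mollifier_nonneg: "0 \<le> mollifier x"
  unfolding mollifier_def
  by (intro mult_nonneg_nonneg divide_nonneg_nonneg less_imp_le[OF mollifier_raw_integral_pos] mollifier_raw_nonneg) simp

lemma mollifier_eq_0: "norm x \<ge> 1 \<Longrightarrow> mollifier x = 0"
  unfolding mollifier_def by (simp only: mollifier_raw_scaled_eq_0 mult_zero_right)

lemma integrable_mollifier: "integrable lborel mollifier"
  unfolding mollifier_def[abs_def] by (intro integrable_mult_right integrable_mollifier_raw)

lemma mollifier_integral: "(\<integral>x. mollifier (x::'a::euclidean_space) \<partial>lborel) = 1"
proof -
  let ?c = "\<integral>y. mollifier_raw (0 + real DIM('a) *\<^sub>R (y::'a)) \<partial>lborel"
  have "(\<integral>x. mollifier (x::'a) \<partial>lborel) = (1 / ?c) * ?c"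
    unfolding mollifier_def by (rule integral_mult_right_zero)
  then show ?thesis using mollifier_raw_integral_pos[where 'a='a] by simp
qed

subsection \<open>Translations and the cone condition\<close>

lemma continuous_on_grad: "Cinf_on UNIV \<phi> \<Longrightarrow> continuous_on UNIV (grad \<phi>)"
  unfolding grad_def[abs_def]
  by (intro continuous_on_sum continuous_on_scaleR continuous_on_const Cinf_on_continuous Cinf_on_pd)

lemma borel_measurable_Cinf: "Cinf_on UNIV \<phi> \<Longrightarrow> \<phi> \<in> borel_measurable borel"
  by (intro borel_measurable_continuous_onI Cinf_on_continuous)

lemma borel_measurable_grad: "Cinf_on UNIV \<phi> \<Longrightarrow> grad \<phi> \<in> borel_measurable borel"
  by (intro borel_measurable_continuous_onI continuous_on_grad)

lemma nn_integral_translate: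
  fixes a :: "'a::euclidean_space"
  assumes [measurable]: "f \<in> borel_measurable borel"
  shows "(\<integral>\<^sup>+x. f (x + a) \<partial>lborel) = (\<integral>\<^sup>+x. f x \<partial>lborel)"
proof -
  have "(\<integral>\<^sup>+x. f x \<partial>lborel) = (\<integral>\<^sup>+x. f x \<partial>distr lborel borel ((+) a))"
    by (simp only: lborel_distr_plus)
  also have "\<dots> = (\<integral>\<^sup>+x. f (a + x) \<partial>lborel)"
    by (rule nn_integral_distr) auto
  finally show ?thesis by (simp add: add.commute)
qed

text \<open>Cauchy-Schwarz for the derivative against the indicator of the interval, whose squared
  norm is \<open>\<delta>\<close>. The values are in \<open>ennreal\<close> so that the bound can
  later be integrated over base points without a separate integrability argument.\<close>

lemma FTC_square_bound:
  fixes u d :: "real \<Rightarrow> real"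
  assumes \<delta>: "0 \<le> \<delta>" and u: "\<And>s. 0 \<le> s \<Longrightarrow> s \<le> \<delta> \<Longrightarrow> (u has_real_derivative d s) (at s)"
    and d: "continuous_on {0..\<delta>} d"
  shows "ennreal ((u \<delta> - u 0)\<^sup>2) \<le> ennreal \<delta> * (\<integral>\<^sup>+s\<in>{0..\<delta>}. ennreal ((d s)\<^sup>2) \<partial>lborel)"
proof -
  let ?f = "\<lambda>s. indicator {0..\<delta>} s *\<^sub>R d s" and ?g = "\<lambda>s. indicat_real {0..\<delta>} s"
  have int: "(\<integral>s. ?f s \<partial>lborel) = u \<delta> - u 0"
    using \<delta> u d by (intro integral_FTC_atLeastAtMost)
      (auto simp: has_real_derivative_iff_has_vector_derivative[symmetric] intro: has_field_derivative_at_within)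
  have "integrable lborel ?f" by (intro borel_integrable_compact d) auto
  then have fm: "?f \<in> borel_measurable lborel" by (rule borel_measurable_integrable)
  have fsq: "(?f s)\<^sup>2 = indicator {0..\<delta>} s *\<^sub>R (d s)\<^sup>2" for s by (simp add: indicator_def)
  have fi: "integrable lborel (\<lambda>s. indicator {0..\<delta>} s *\<^sub>R (d s)\<^sup>2)"
    by (intro borel_integrable_compact continuous_intros d) auto
  have f2: "L2 lborel ?f" unfolding L2_def fsq using fm fi by auto
  have gsq: "(?g s)\<^sup>2 = ?g s" for s by (simp add: indicator_def)
  have g2: "L2 lborel ?g" unfolding L2_def gsq using \<delta> by (auto simp: integrable_indicator_iff)
  have gn: "(nL2 lborel ?g)\<^sup>2 = \<delta>" unfolding nL2_sq gsq using \<delta> by simp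
  have fg: "(\<integral>s. ?f s * ?g s \<partial>lborel) = u \<delta> - u 0"
    unfolding int[symmetric] by (rule Bochner_Integration.integral_cong) (auto simp: indicator_def)
  have "\<bar>u \<delta> - u 0\<bar>\<^sup>2 \<le> (nL2 lborel ?f * nL2 lborel ?g)\<^sup>2"
    using L2_cauchy_schwarz[OF f2 g2] unfolding fg by (intro power_mono) auto
  then have "(u \<delta> - u 0)\<^sup>2 \<le> \<delta> * (\<integral>s. indicator {0..\<delta>} s *\<^sub>R (d s)\<^sup>2 \<partial>lborel)"
    unfolding power_mult_distrib gn by (simp only: nL2_sq fsq power2_abs mult.commute)
  then have "ennreal ((u \<delta> - u 0)\<^sup>2) \<le> ennreal \<delta> * ennreal (\<integral>s. indicator {0..\<delta>} s *\<^sub>R (d s)\<^sup>2 \<partial>lborel)"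
    using \<delta> by (simp add: ennreal_mult'[symmetric] ennreal_leI)
  also have "ennreal (\<integral>s. indicator {0..\<delta>} s *\<^sub>R (d s)\<^sup>2 \<partial>lborel) = (\<integral>\<^sup>+s. ennreal (indicator {0..\<delta>} s *\<^sub>R (d s)\<^sup>2) \<partial>lborel)"
    by (rule nn_integral_eq_integral[OF fi, symmetric]) auto
  also have "\<dots> = (\<integral>\<^sup>+s\<in>{0..\<delta>}. ennreal ((d s)\<^sup>2) \<partial>lborel)"
    by (rule nn_integral_cong) (auto simp: indicator_def)
  finally show ?thesis .
qed

lemma translation_square_bound:
  fixes \<phi> :: "'a::euclidean_space \<Rightarrow> real"
  assumes \<phi>: "Cinf_on UNIV \<phi>" and \<delta>: "0 \<le> \<delta>"
  shows "ennreal ((\<phi> (x + \<delta> *\<^sub>R z) - \<phi> x)\<^sup>2)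
    \<le> ennreal (\<delta> * (norm z)\<^sup>2) * (\<integral>\<^sup>+s\<in>{0..\<delta>}. ennreal ((norm (grad \<phi> (x + s *\<^sub>R z)))\<^sup>2) \<partial>lborel)"
proof -
  let ?d = "\<lambda>s. z \<bullet> grad \<phi> (x + s *\<^sub>R z)"
  have cont: "continuous_on UNIV (\<lambda>s. grad \<phi> (x + s *\<^sub>R z))"
    by (rule continuous_on_compose2[OF continuous_on_grad[OF \<phi>]]) (auto intro!: continuous_intros)
  have m: "(\<lambda>s. grad \<phi> (x + s *\<^sub>R z)) \<in> borel_measurable borel"
    by (rule borel_measurable_continuous_onI[OF cont])
  have "ennreal ((\<phi> (x + \<delta> *\<^sub>R z) - \<phi> (x + 0 *\<^sub>R z))\<^sup>2) \<le> ennreal \<delta> * (\<integral>\<^sup>+s\<in>{0..\<delta>}. ennreal ((?d s)\<^sup>2) \<partial>lborel)"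
  proof (rule FTC_square_bound[where u="\<lambda>s. \<phi> (x + s *\<^sub>R z)", OF \<delta>])
    show "((\<lambda>s. \<phi> (x + s *\<^sub>R z)) has_real_derivative z \<bullet> grad \<phi> (x + s *\<^sub>R z)) (at s)" for s
      by (rule Cinf_line_derivative[OF \<phi>]) auto
    show "continuous_on {0..\<delta>} ?d"
      by (intro continuous_intros continuous_on_subset[OF cont]) auto
  qed
  also have "(\<integral>\<^sup>+s\<in>{0..\<delta>}. ennreal ((?d s)\<^sup>2) \<partial>lborel)
      \<le> (\<integral>\<^sup>+s. ennreal ((norm z)\<^sup>2) * (ennreal ((norm (grad \<phi> (x + s *\<^sub>R z)))\<^sup>2) * indicator {0..\<delta>} s) \<partial>lborel)"
  proof (rule nn_integral_mono)
    fix s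
    have "\<bar>?d s\<bar>\<^sup>2 \<le> (norm z * norm (grad \<phi> (x + s *\<^sub>R z)))\<^sup>2"
      by (intro power_mono Cauchy_Schwarz_ineq2) auto
    then have "ennreal ((?d s)\<^sup>2) \<le> ennreal ((norm z)\<^sup>2) * ennreal ((norm (grad \<phi> (x + s *\<^sub>R z)))\<^sup>2)"
      by (simp add: ennreal_mult'[symmetric] power_mult_distrib ennreal_leI)
    then show "ennreal ((?d s)\<^sup>2) * indicator {0..\<delta>} s \<le> ennreal ((norm z)\<^sup>2) * (ennreal ((norm (grad \<phi> (x + s *\<^sub>R z)))\<^sup>2) * indicator {0..\<delta>} s)"
      by (simp add: indicator_def)
  qed
  also have "\<dots> = ennreal ((norm z)\<^sup>2) * (\<integral>\<^sup>+s\<in>{0..\<delta>}. ennreal ((norm (grad \<phi> (x + s *\<^sub>R z)))\<^sup>2) \<partial>lborel)"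
    using m by (intro nn_integral_cmult) auto
  finally show ?thesis using \<delta> by (simp add: ennreal_mult mult.assoc mult_left_mono)
qed

text \<open>Tonelli and the substitution \<open>y = x + s z\<close>: a point \<open>y\<close> is
  charged with the length of the parameter set for which it was reached from \<open>A\<close>. That
  length is at most 1 for unit segments and small for thin layers; the second fact produces the
  factor \<open>\<epsilon>\<close> in the trace estimate.\<close>

lemma nn_integral_translation_average:
  fixes f :: "'a::euclidean_space \<Rightarrow> ennreal"
  assumes [measurable]: "f \<in> borel_measurable borel" "A \<in> sets borel" "I \<in> sets (borel :: real measure)"
  shows "(\<integral>\<^sup>+x\<in>A. (\<integral>\<^sup>+s\<in>I. f (x + s *\<^sub>R z) \<partial>lborel) \<partial>lborel)
    = (\<integral>\<^sup>+y. f y * emeasure lborel {s\<in>I. y - s *\<^sub>R z \<in> A} \<partial>lborel)"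
proof -
  have "(\<integral>\<^sup>+x\<in>A. (\<integral>\<^sup>+s\<in>I. f (x + s *\<^sub>R z) \<partial>lborel) \<partial>lborel)
    = (\<integral>\<^sup>+x. (\<integral>\<^sup>+s. f (x + s *\<^sub>R z) * indicator I s * indicator A x \<partial>lborel) \<partial>lborel)"
    by (intro nn_integral_cong nn_integral_multc[symmetric]) measurable
  also have "\<dots> = (\<integral>\<^sup>+s. (\<integral>\<^sup>+x. f (x + s *\<^sub>R z) * indicator I s * indicator A x \<partial>lborel) \<partial>lborel)"
    by (rule lborel_pair.Fubini') measurable
  also have "\<dots> = (\<integral>\<^sup>+s. (\<integral>\<^sup>+y. f y * indicator I s * indicator A (y - s *\<^sub>R z) \<partial>lborel) \<partial>lborel)"
  proof (rule nn_integral_cong)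
    fix s :: real
    show "(\<integral>\<^sup>+x. f (x + s *\<^sub>R z) * indicator I s * indicator A x \<partial>lborel) = (\<integral>\<^sup>+y. f y * indicator I s * indicator A (y - s *\<^sub>R z) \<partial>lborel)"
      using nn_integral_translate[where f="\<lambda>y. f y * indicator I s * indicator A (y - s *\<^sub>R z)" and a="s *\<^sub>R z"] by simp
  qed
  also have "\<dots> = (\<integral>\<^sup>+y. (\<integral>\<^sup>+s. f y * indicator I s * indicator A (y - s *\<^sub>R z) \<partial>lborel) \<partial>lborel)"
    by (rule lborel_pair.Fubini') measurable
  also have "\<dots> = (\<integral>\<^sup>+y. f y * emeasure lborel {s\<in>I. y - s *\<^sub>R z \<in> A} \<partial>lborel)"
  proof (rule nn_integral_cong)
    fix y
    have "(\<integral>\<^sup>+s. f y * indicator I s * indicator A (y - s *\<^sub>R z) \<partial>lborel) = (\<integral>\<^sup>+s. f y * indicator {s\<in>I. y - s *\<^sub>R z \<in> A} s \<partial>lborel)"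
      by (rule nn_integral_cong) (auto simp: indicator_def)
    also have "\<dots> = f y * emeasure lborel {s\<in>I. y - s *\<^sub>R z \<in> A}"
      by (rule nn_integral_cmult_indicator) measurable
    finally show "(\<integral>\<^sup>+s. f y * indicator I s * indicator A (y - s *\<^sub>R z) \<partial>lborel) = f y * emeasure lborel {s\<in>I. y - s *\<^sub>R z \<in> A}" .
  qed
  finally show ?thesis .
qed

definition dirichlet :: "'a::euclidean_space set \<Rightarrow> ('a \<Rightarrow> real) \<Rightarrow> ennreal" where
  "dirichlet \<Omega> \<phi> = (\<integral>\<^sup>+x\<in>\<Omega>. ennreal ((norm (grad \<phi> x))\<^sup>2) \<partial>lborel)"

text \<open>The bound along one segment is integrated over \<open>A\<close>; after exchanging the
  integrals each point of \<open>\<Omega>\<close> is charged for a parameter length of at most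
  1.\<close>

lemma translation_estimate:
  fixes \<phi> :: "'a::euclidean_space \<Rightarrow> real"
  assumes \<phi>: "Cinf_on UNIV \<phi>" and A[measurable]: "A \<in> sets borel" and \<Omega>: "open \<Omega>"
    and seg: "\<And>x s. x \<in> A \<Longrightarrow> 0 \<le> s \<Longrightarrow> s \<le> 1 \<Longrightarrow> x + s *\<^sub>R z \<in> \<Omega>"
  shows "(\<integral>\<^sup>+x\<in>A. ennreal ((\<phi> (x + z) - \<phi> x)\<^sup>2) \<partial>lborel) \<le> ennreal ((norm z)\<^sup>2) * dirichlet \<Omega> \<phi>"
proof -
  note [measurable] = borel_measurable_grad[OF \<phi>] borel_open[OF \<Omega>]
  let ?f = "\<lambda>x. ennreal ((norm (grad \<phi> x))\<^sup>2) * indicator \<Omega> x"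
  have "(\<integral>\<^sup>+x\<in>A. ennreal ((\<phi> (x + z) - \<phi> x)\<^sup>2) \<partial>lborel)
      \<le> (\<integral>\<^sup>+x. ennreal ((norm z)\<^sup>2) * ((\<integral>\<^sup>+s\<in>{0..1}. ?f (x + s *\<^sub>R z) \<partial>lborel) * indicator A x) \<partial>lborel)"
  proof (rule nn_integral_mono)
    fix x
    show "ennreal ((\<phi> (x + z) - \<phi> x)\<^sup>2) * indicator A x \<le> ennreal ((norm z)\<^sup>2) * ((\<integral>\<^sup>+s\<in>{0..1}. ?f (x + s *\<^sub>R z) \<partial>lborel) * indicator A x)"
    proof (cases "x \<in> A")
      case True
      have "(\<integral>\<^sup>+s\<in>{0..1}. ennreal ((norm (grad \<phi> (x + s *\<^sub>R z)))\<^sup>2) \<partial>lborel) = (\<integral>\<^sup>+s\<in>{0..1}. ?f (x + s *\<^sub>R z) \<partial>lborel)"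
        using seg[OF True] by (intro nn_integral_cong) (auto simp: indicator_def)
      then show ?thesis using translation_square_bound[OF \<phi>, of 1 x z] True by simp
    qed simp
  qed
  also have "\<dots> = ennreal ((norm z)\<^sup>2) * (\<integral>\<^sup>+x\<in>A. (\<integral>\<^sup>+s\<in>{0..1}. ?f (x + s *\<^sub>R z) \<partial>lborel) \<partial>lborel)"
    by (rule nn_integral_cmult) measurable
  also have "(\<integral>\<^sup>+x\<in>A. (\<integral>\<^sup>+s\<in>{0..1}. ?f (x + s *\<^sub>R z) \<partial>lborel) \<partial>lborel) = (\<integral>\<^sup>+y. ?f y * emeasure lborel {s\<in>{0..1}. y - s *\<^sub>R z \<in> A} \<partial>lborel)"
    by (rule nn_integral_translation_average) measurable
  also have "\<dots> \<le> (\<integral>\<^sup>+y. ?f y * 1 \<partial>lborel)"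
  proof (intro nn_integral_mono mult_left_mono)
    fix y
    have "emeasure lborel {s\<in>{0..1}. y - s *\<^sub>R z \<in> A} \<le> emeasure lborel {0..1::real}"
      by (rule emeasure_mono) auto
    then show "emeasure lborel {s\<in>{0..1}. y - s *\<^sub>R z \<in> A} \<le> 1" by simp
  qed auto
  finally show ?thesis by (simp add: dirichlet_def mult_left_mono)
qed

text \<open>One truncated cone, with axis \<open>- e\<close> and opening \<open>c\<close>, fits at
  all points of \<open>\<Omega>\<close> near \<open>p\<close> simultaneously. Translations and
  mollifications move whole neighbourhoods and therefore depend on this uniformity in
  \<open>x\<close>.\<close>

definition cone_at :: "pt set \<Rightarrow> pt \<Rightarrow> pt \<Rightarrow> real \<Rightarrow> real \<Rightarrow> bool" where
  "cone_at \<Omega> p e c r \<longleftrightarrow> 0 < c \<and> c \<le> 1 \<and> 0 < r \<and> norm e = 1 \<and>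
     (\<forall>x\<in>\<Omega> \<inter> ball p r. \<forall>s z. 0 < s \<and> s < r \<and> norm z < c \<longrightarrow> x - s *\<^sub>R (e + z) \<in> \<Omega>)"

lemma cone_atD:
  assumes "cone_at \<Omega> p e c r" "x \<in> \<Omega>" "dist p x < r" "0 < s" "s < r" "norm z < c"
  shows "x - s *\<^sub>R (e + z) \<in> \<Omega>"
  using assms unfolding cone_at_def by auto

text \<open>A point of the closure is replaced by a nearby point of \<open>\<Omega>\<close>, and the
  displacement is absorbed into the tilt \<open>z\<close>, for which the strict bound
  \<open>norm z < c\<close> leaves room.\<close>

lemma cone_at_closure:
  assumes "cone_at \<Omega> p e c r" "x \<in> closure \<Omega>" "dist p x < r" "0 < s" "s < r" "norm z < c"
  shows "x - s *\<^sub>R (e + z) \<in> \<Omega>"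
proof -
  define \<epsilon> where "\<epsilon> = min (r - dist p x) (s * (c - norm z))"
  have "\<epsilon> > 0" using assms by (simp add: \<epsilon>_def)
  then obtain x' where x': "x' \<in> \<Omega>" "dist x' x < \<epsilon>"
    using assms(2) closure_approachable by blast
  have 1: "dist p x' < r" using x'(2) dist_triangle[of p x' x] by (simp add: \<epsilon>_def dist_commute)
  have "norm (x' - x) / s < c - norm z"
    using x'(2) assms(4) by (simp add: \<epsilon>_def dist_norm pos_divide_less_eq mult.commute)
  moreover have "norm ((x' - x) /\<^sub>R s) = norm (x' - x) / s"
    using assms(4) by (simp add: divide_inverse mult.commute)
  ultimately have "norm ((x' - x) /\<^sub>R s) < c - norm z" by simp
  then have 2: "norm (z + (x' - x) /\<^sub>R s) < c" using norm_triangle_ineq[of z "(x' - x) /\<^sub>R s"] by linarith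
  have "x' - s *\<^sub>R (e + (z + (x' - x) /\<^sub>R s)) \<in> \<Omega>"
    by (rule cone_atD[OF assms(1) x'(1) 1 assms(4,5) 2])
  moreover have "x' - s *\<^sub>R (e + (z + (x' - x) /\<^sub>R s)) = x - s *\<^sub>R (e + z)"
    using assms(4) by (simp add: algebra_simps)
  ultimately show ?thesis by simp
qed

lemma dist_cone_le:
  fixes e z :: "'a::real_normed_vector"
  assumes "norm e = 1" "norm z \<le> 1" "0 \<le> s"
  shows "dist x (x - s *\<^sub>R (e + z)) \<le> 2 * s"
proof -
  have "norm (e + z) \<le> 2" using norm_triangle_ineq[of e z] assms by linarith
  then have "s * norm (e + z) \<le> s * 2" using assms by (intro mult_left_mono)
  then show ?thesis using assms by (simp add: dist_norm)
qed

lemma cone_at_interior: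
  assumes "open \<Omega>" "p \<in> \<Omega>"
  shows "\<exists>e c r. cone_at \<Omega> p e c r"
proof -
  obtain \<rho> where \<rho>: "\<rho> > 0" "ball p \<rho> \<subseteq> \<Omega>" using assms openE by blast
  obtain e :: pt where e: "e \<in> Basis" using nonempty_Basis by blast
  have "cone_at \<Omega> p e 1 (\<rho> / 4)"
    unfolding cone_at_def
  proof (intro conjI ballI allI impI)
    fix x s and z :: pt
    assume x: "x \<in> \<Omega> \<inter> ball p (\<rho> / 4)" and s: "0 < s \<and> s < \<rho> / 4 \<and> norm z < 1"
    have "dist x (x - s *\<^sub>R (e + z)) \<le> 2 * s" using s e by (intro dist_cone_le) auto
    moreover have "dist p x < \<rho> / 4" using x by simp
    ultimately have "dist p (x - s *\<^sub>R (e + z)) < \<rho>"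
      using s dist_triangle[of p "x - s *\<^sub>R (e + z)" x] by linarith
    then show "x - s *\<^sub>R (e + z) \<in> \<Omega>" using \<rho> by auto
  qed (use \<rho> e in auto)
  then show ?thesis by blast
qed

text \<open>The axis is a coordinate vector, with the sign that makes the defining function
  \<open>\<psi>\<close> increase along it at \<open>p\<close>. By continuity of the gradient
  \<open>\<psi>\<close> increases along every slightly tilted direction near \<open>p\<close>, so
  backward steps keep it negative.\<close>

lemma cone_at_frontier:
  assumes \<Omega>: "smooth_bounded_domain \<Omega>" and p: "p \<in> frontier \<Omega>"
  shows "\<exists>e c r. cone_at \<Omega> p e c r"
proof -
  obtain r0 \<psi> where r0: "r0 > 0" and \<psi>: "Cinf_on (ball p r0) \<psi>"
    and nz: "\<And>x. x \<in> ball p r0 \<Longrightarrow> \<exists>e\<in>Basis. pd e \<psi> x \<noteq> 0"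
    and eq: "\<Omega> \<inter> ball p r0 = {x\<in>ball p r0. \<psi> x < 0}"
    using \<Omega> p unfolding smooth_bounded_domain_def by meson
  obtain e0 where e0: "e0 \<in> Basis" "pd e0 \<psi> p \<noteq> 0" using nz[of p] r0 by auto
  define d where "d = \<bar>pd e0 \<psi> p\<bar>"
  define e where "e = sgn (pd e0 \<psi> p) *\<^sub>R e0"
  have d: "d > 0" and ne: "norm e = 1" and ed: "e \<bullet> grad \<psi> p = d"
    using e0 by (auto simp: d_def e_def grad_inner inner_commute[of e0] sgn_real_def)
  have gc: "isCont (grad \<psi>) p"
  proof -
    have "continuous_on (ball p r0) (grad \<psi>)"
      unfolding grad_def[abs_def]
      by (intro continuous_on_sum continuous_on_scaleR continuous_on_const Cinf_on_continuous Cinf_on_pd[OF \<psi>])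
    then show ?thesis using r0 by (simp add: continuous_on_eq_continuous_at)
  qed
  define M where "M = norm (grad \<psi> p) + 1"
  have M: "M \<ge> 1" by (simp add: M_def)
  obtain \<rho>1 where \<rho>1: "\<rho>1 > 0" "\<And>y. dist y p < \<rho>1 \<Longrightarrow> dist (grad \<psi> y) (grad \<psi> p) < min 1 (d / 2)"
    using gc d by (metis continuous_at_eps_delta min_less_iff_conj zero_less_one half_gt_zero)
  define \<rho> where "\<rho> = min r0 \<rho>1"
  \<comment> \<open>The slope \<open>d\<close> is split into halves: one absorbs the oscillation of
    the gradient, the other the tilt, whose effect is at most \<open>c * M\<close>.\<close>
  define c where "c = min 1 (d / (2 * M))"
  have c: "0 < c" "c \<le> 1" "c * M \<le> d / 2" using d M by (auto simp: c_def min_def field_simps)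
  have neg: "(e + z) \<bullet> grad \<psi> y > 0" if y: "dist y p < \<rho>" and z: "norm z < c" for y z
  proof -
    have g: "norm (grad \<psi> y - grad \<psi> p) < 1" "norm (grad \<psi> y - grad \<psi> p) < d / 2"
      using \<rho>1(2)[of y] y by (auto simp: \<rho>_def dist_norm)
    have "norm (grad \<psi> y) \<le> M" using g(1) norm_triangle_ineq[of "grad \<psi> y - grad \<psi> p" "grad \<psi> p"] by (simp add: M_def)
    then have "\<bar>z \<bullet> grad \<psi> y\<bar> \<le> norm z * M"
      using Cauchy_Schwarz_ineq2[of z "grad \<psi> y"] mult_left_mono[of "norm (grad \<psi> y)" M "norm z"] by simp
    also have "\<dots> \<le> c * M" using z M by (intro mult_right_mono) auto
    finally have 1: "\<bar>z \<bullet> grad \<psi> y\<bar> \<le> d / 2" using c(3) by simp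
    have "\<bar>e \<bullet> (grad \<psi> y - grad \<psi> p)\<bar> < d / 2"
      using Cauchy_Schwarz_ineq2[of e "grad \<psi> y - grad \<psi> p"] g(2) ne by simp
    then have "e \<bullet> grad \<psi> y > d / 2" unfolding inner_diff_right ed by linarith
    then show ?thesis using 1 by (simp add: inner_add_left)
  qed
  \<comment> \<open>Starting within \<open>\<rho> / 4\<close> of \<open>p\<close> and moving by at
    most twice a step below \<open>\<rho> / 4\<close> stays inside the ball of radius
    \<open>\<rho>\<close>.\<close>
  have "cone_at \<Omega> p e c (\<rho> / 4)"
    unfolding cone_at_def
  proof (intro conjI ballI allI impI)
    fix x s and z :: pt
    assume x: "x \<in> \<Omega> \<inter> ball p (\<rho> / 4)" and s: "0 < s \<and> s < \<rho> / 4 \<and> norm z < c"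
    have inb: "dist (x + t *\<^sub>R (- (e + z))) p < \<rho>" if "0 \<le> t" "t \<le> s" for t
    proof -
      have "dist x (x - t *\<^sub>R (e + z)) \<le> 2 * t" using that s c ne by (intro dist_cone_le) auto
      moreover have "dist p x < \<rho> / 4" using x by simp
      ultimately have "dist p (x - t *\<^sub>R (e + z)) < \<rho>"
        using s that dist_triangle[of p "x - t *\<^sub>R (e + z)" x] by linarith
      then show ?thesis by (simp only: dist_commute[of _ p] scaleR_minus_right add_uminus_conv_diff)
    qed
    then have inb0: "x + t *\<^sub>R (- (e + z)) \<in> ball p r0" if "0 \<le> t" "t \<le> s" for t
      using that by (auto simp: \<rho>_def dist_commute)
    have "\<psi> (x + s *\<^sub>R (- (e + z))) < \<psi> (x + 0 *\<^sub>R (- (e + z)))"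
    proof (rule DERIV_neg_imp_decreasing[where f="\<lambda>t. \<psi> (x + t *\<^sub>R (- (e + z)))"])
      fix t assume t: "0 \<le> t" "t \<le> s"
      have "((\<lambda>t. \<psi> (x + t *\<^sub>R (- (e + z)))) has_real_derivative ((- (e + z)) \<bullet> grad \<psi> (x + t *\<^sub>R (- (e + z))))) (at t)"
        by (rule Cinf_line_derivative[OF \<psi> open_ball inb0[OF t]])
      moreover have "(- (e + z)) \<bullet> grad \<psi> (x + t *\<^sub>R (- (e + z))) < 0"
        using neg[OF inb[OF t]] s unfolding inner_minus_left by simp
      ultimately show "\<exists>y. ((\<lambda>t. \<psi> (x + t *\<^sub>R (- (e + z)))) has_real_derivative y) (at t) \<and> y < 0" by blast
    qed (use s in auto)
    moreover have iff: "y \<in> \<Omega> \<longleftrightarrow> \<psi> y < 0" if "y \<in> ball p r0" for y using eq that by blast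
    have "x \<in> ball p r0" using inb0[of 0] s by simp
    then have "\<psi> x < 0" using iff x by blast
    ultimately have "\<psi> (x + s *\<^sub>R (- (e + z))) < 0" by simp
    moreover have "x + s *\<^sub>R (- (e + z)) \<in> ball p r0" using s by (intro inb0) auto
    ultimately have "x + s *\<^sub>R (- (e + z)) \<in> \<Omega>" using iff by blast
    then show "x - s *\<^sub>R (e + z) \<in> \<Omega>" by (simp only: scaleR_minus_right add_uminus_conv_diff)
  qed (use r0 \<rho>1 c ne in \<open>auto simp: \<rho>_def\<close>)
  then show ?thesis by blast
qed

lemma cone_at_exists:
  assumes "smooth_bounded_domain \<Omega>" "p \<in> closure \<Omega>"
  shows "\<exists>e c r. cone_at \<Omega> p e c r"
proof (cases "p \<in> \<Omega>")
  case True
  then show ?thesis using cone_at_interior assms by (simp add: smooth_bounded_domain_def)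
next
  case False
  then have "p \<in> frontier \<Omega>" using assms by (simp add: frontier_def smooth_bounded_domain_def interior_open)
  then show ?thesis using cone_at_frontier assms by blast
qed

subsection \<open>The Poincare inequality\<close>

lemma nn_integral_lebesgue_on:
  assumes "\<Omega> \<in> sets borel"
  shows "(\<integral>\<^sup>+x. f x \<partial>lebesgue_on \<Omega>) = (\<integral>\<^sup>+x\<in>\<Omega>. f x \<partial>lborel)"
  using assms by (subst nn_integral_restrict_space) (auto simp: nn_integral_completion)

lemma integral_lebesgue_on:
  fixes f :: "'a::euclidean_space \<Rightarrow> real"
  assumes "\<Omega> \<in> sets borel" "f \<in> borel_measurable borel"
  shows "(\<integral>x. f x \<partial>lebesgue_on \<Omega>) = (\<integral>x. indicator \<Omega> x * f x \<partial>lborel)"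
  using assms by (subst integral_restrict_space) (auto intro!: integral_completion borel_measurable_times borel_measurable_indicator)

lemma lebesgue_on_finite_measure:
  assumes "open \<Omega>" "bounded \<Omega>"
  shows "finite_measure (lebesgue_on \<Omega>)"
  using assms by (intro finite_measure_lebesgue_on lmeasurable_open)

lemma measurable_lebesgue_on_borel:
  "f \<in> borel_measurable borel \<Longrightarrow> f \<in> borel_measurable (lebesgue_on \<Omega>)"
  by (intro measurable_restrict_space1 measurable_completion) simp

lemma bounded_continuous_on_bounded:
  fixes f :: "'a::euclidean_space \<Rightarrow> real"
  assumes "continuous_on UNIV f" "bounded \<Omega>"
  shows "\<exists>B. \<forall>x\<in>\<Omega>. \<bar>f x\<bar> \<le> B"
proof -
  have "compact (f ` closure \<Omega>)"
    using assms by (intro compact_continuous_image continuous_on_subset[OF assms(1)]) (auto simp: compact_closure)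
  then have "bounded (f ` closure \<Omega>)" by (rule compact_imp_bounded)
  then obtain B where "\<forall>y\<in>f ` closure \<Omega>. norm y \<le> B" unfolding bounded_iff by blast
  then show ?thesis using closure_subset[of \<Omega>] by (intro exI[of _ B]) auto
qed

lemma integrable_continuous_lebesgue_on:
  fixes f :: "'a::euclidean_space \<Rightarrow> real"
  assumes "continuous_on UNIV f" "open \<Omega>" "bounded \<Omega>"
  shows "integrable (lebesgue_on \<Omega>) f"
proof -
  interpret finite_measure "lebesgue_on \<Omega>" using assms(2,3) by (rule lebesgue_on_finite_measure)
  obtain B where "\<forall>x\<in>\<Omega>. \<bar>f x\<bar> \<le> B" using bounded_continuous_on_bounded assms by blast
  then show ?thesis
    using measurable_lebesgue_on_borel[OF borel_measurable_continuous_onI[OF assms(1)]]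
    by (intro integrable_const_bound[of f B]) (auto intro!: AE_I2 simp: space_restrict_space)
qed

lemma L2_continuous:
  fixes f :: "'a::euclidean_space \<Rightarrow> real"
  assumes "continuous_on UNIV f" "open \<Omega>" "bounded \<Omega>"
  shows "L2 (lebesgue_on \<Omega>) f"
  unfolding L2_def
  using integrable_continuous_lebesgue_on[of "\<lambda>x. (f x)\<^sup>2" \<Omega>] assms
    measurable_lebesgue_on_borel[OF borel_measurable_continuous_onI[OF assms(1)]]
  by (auto intro!: continuous_intros)

lemma L2_Cinf: "Cinf_on UNIV \<phi> \<Longrightarrow> open \<Omega> \<Longrightarrow> bounded \<Omega> \<Longrightarrow> L2 (lebesgue_on \<Omega>) \<phi>"
  by (intro L2_continuous Cinf_on_continuous)

lemma L2_pd: "Cinf_on UNIV \<phi> \<Longrightarrow> b \<in> Basis \<Longrightarrow> open \<Omega> \<Longrightarrow> bounded \<Omega> \<Longrightarrow> L2 (lebesgue_on \<Omega>) (pd b \<phi>)"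
  by (intro L2_Cinf Cinf_on_pd)

lemma nn_integral_square_eq_nL2:
  fixes f :: "'a::euclidean_space \<Rightarrow> real"
  assumes "continuous_on UNIV f" "open \<Omega>" "bounded \<Omega>"
  shows "(\<integral>\<^sup>+x\<in>\<Omega>. ennreal ((f x)\<^sup>2) \<partial>lborel) = ennreal ((nL2 (lebesgue_on \<Omega>) f)\<^sup>2)"
proof -
  have "(\<integral>\<^sup>+x\<in>\<Omega>. ennreal ((f x)\<^sup>2) \<partial>lborel) = (\<integral>\<^sup>+x. ennreal ((f x)\<^sup>2) \<partial>lebesgue_on \<Omega>)"
    using assms by (subst nn_integral_lebesgue_on) auto
  also have "\<dots> = ennreal (\<integral>x. (f x)\<^sup>2 \<partial>lebesgue_on \<Omega>)"
    using L2_continuous[OF assms] by (intro nn_integral_eq_integral) (auto simp: L2_def)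
  finally show ?thesis by (simp add: nL2_sq)
qed

definition nG :: "'a::euclidean_space set \<Rightarrow> ('a \<Rightarrow> real) \<Rightarrow> real" where
  "nG \<Omega> \<phi> = nL2 (lebesgue_on \<Omega>) (\<lambda>x. norm (grad \<phi> x))"

lemma nG_nonneg [simp]: "0 \<le> nG \<Omega> \<phi>"
  by (simp add: nG_def)

lemma dirichlet_eq_nG:
  assumes "Cinf_on UNIV \<phi>" "open \<Omega>" "bounded \<Omega>"
  shows "dirichlet \<Omega> \<phi> = ennreal ((nG \<Omega> \<phi>)\<^sup>2)"
  unfolding dirichlet_def nG_def
  by (rule nn_integral_square_eq_nL2[OF _ assms(2,3)]) (intro continuous_on_norm continuous_on_grad assms)

lemma grad_minus_const: "Cinf_on UNIV \<phi> \<Longrightarrow> grad (\<lambda>x. \<phi> x - c) x = grad \<phi> x"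
  unfolding grad_def by (intro sum.cong refl) (simp add: pd_diff Cinf_const pd_const)

lemma sq_split_ennreal: "ennreal ((a::real)\<^sup>2) \<le> 2 * ennreal (b\<^sup>2) + 2 * ennreal ((b - a)\<^sup>2)"
proof -
  have "0 \<le> (2 * b - a)\<^sup>2" by simp
  then have "a\<^sup>2 \<le> 2 * b\<^sup>2 + 2 * (b - a)\<^sup>2" by (simp add: power2_eq_square algebra_simps)
  then have "ennreal (a\<^sup>2) \<le> ennreal (2 * b\<^sup>2 + 2 * (b - a)\<^sup>2)" by (rule ennreal_leI)
  also have "\<dots> = 2 * ennreal (b\<^sup>2) + 2 * ennreal ((b - a)\<^sup>2)"
    by (simp add: ennreal_plus ennreal_mult')
  finally show ?thesis .
qed

text \<open>The constants may depend on \<open>p\<close> but not on \<open>\<phi>\<close>. In this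
  form the estimate can be transported from point to point while the reference set \<open>B\<close>
  stays fixed.\<close>

definition local_poincare :: "pt set \<Rightarrow> pt set \<Rightarrow> pt \<Rightarrow> bool" where
  "local_poincare \<Omega> B p \<longleftrightarrow> (\<exists>r>0. \<exists>C\<ge>0. \<forall>\<phi>. Cinf_on UNIV \<phi> \<longrightarrow>
     (\<integral>\<^sup>+x\<in>\<Omega> \<inter> ball p r. ennreal ((\<phi> x)\<^sup>2) \<partial>lborel)
       \<le> ennreal C * (dirichlet \<Omega> \<phi> + (\<integral>\<^sup>+x\<in>B. ennreal ((\<phi> x)\<^sup>2) \<partial>lborel)))"

lemma local_poincareI:
  assumes "r > 0" "C \<ge> 0" "\<And>\<phi>. Cinf_on UNIV \<phi> \<Longrightarrow>
     (\<integral>\<^sup>+x\<in>\<Omega> \<inter> ball p r. ennreal ((\<phi> x)\<^sup>2) \<partial>lborel)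
       \<le> ennreal C * (dirichlet \<Omega> \<phi> + (\<integral>\<^sup>+x\<in>B. ennreal ((\<phi> x)\<^sup>2) \<partial>lborel))"
  shows "local_poincare \<Omega> B p"
  using assms unfolding local_poincare_def by blast

text \<open>Near \<open>p\<close> the function is compared with its translate by
  \<open>q - p\<close>; the translate is controlled by the estimate at \<open>q\<close>, and the
  difference by the energy along the connecting segments.\<close>

lemma local_poincare_shift:
  assumes \<Omega>: "open \<Omega>" and q: "local_poincare \<Omega> B q" and \<rho>: "0 < \<rho>"
    and seg: "\<And>x s. x \<in> \<Omega> \<Longrightarrow> dist p x < \<rho> \<Longrightarrow> 0 \<le> s \<Longrightarrow> s \<le> 1 \<Longrightarrow> x + s *\<^sub>R (q - p) \<in> \<Omega>"
  shows "local_poincare \<Omega> B p"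
proof -
  obtain r C where r: "r > 0" and C: "C \<ge> 0" and
    loc: "\<And>\<phi>. Cinf_on UNIV \<phi> \<Longrightarrow> (\<integral>\<^sup>+x\<in>\<Omega> \<inter> ball q r. ennreal ((\<phi> x)\<^sup>2) \<partial>lborel)
       \<le> ennreal C * (dirichlet \<Omega> \<phi> + (\<integral>\<^sup>+x\<in>B. ennreal ((\<phi> x)\<^sup>2) \<partial>lborel))"
    using q unfolding local_poincare_def by blast
  define A where "A = \<Omega> \<inter> ball p (min r \<rho>)"
  have A[measurable]: "A \<in> sets borel" unfolding A_def using \<Omega> by auto
  define z where "z = q - p"
  show ?thesis
  proof (rule local_poincareI[of "min r \<rho>" "2 * C + 2 * (norm z)\<^sup>2"])
    fix \<phi> :: "pt \<Rightarrow> real" assume \<phi>: "Cinf_on UNIV \<phi>"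
    note [measurable] = borel_measurable_Cinf[OF \<phi>] borel_open[OF \<Omega>] borel_open[OF open_ball, of q r]
    let ?D = "dirichlet \<Omega> \<phi>" and ?I = "\<integral>\<^sup>+x\<in>B. ennreal ((\<phi> x)\<^sup>2) \<partial>lborel"
    have tr: "(\<integral>\<^sup>+x\<in>A. ennreal ((\<phi> (x + z) - \<phi> x)\<^sup>2) \<partial>lborel) \<le> ennreal ((norm z)\<^sup>2) * ?D"
      by (rule translation_estimate[OF \<phi> A \<Omega>]) (auto simp: A_def z_def seg)
    have sh: "(\<integral>\<^sup>+x\<in>A. ennreal ((\<phi> (x + z))\<^sup>2) \<partial>lborel) \<le> ennreal C * (?D + ?I)"
    proof -
      have "(\<integral>\<^sup>+x\<in>A. ennreal ((\<phi> (x + z))\<^sup>2) \<partial>lborel)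
         \<le> (\<integral>\<^sup>+x. ennreal ((\<phi> (x + z))\<^sup>2) * indicator (\<Omega> \<inter> ball q r) (x + z) \<partial>lborel)"
      proof (rule nn_integral_mono)
        fix x
        have "x + z \<in> \<Omega> \<inter> ball q r" if "x \<in> A"
          using seg[of x 1] that by (auto simp: A_def z_def dist_norm algebra_simps)
        then show "ennreal ((\<phi> (x + z))\<^sup>2) * indicator A x \<le> ennreal ((\<phi> (x + z))\<^sup>2) * indicator (\<Omega> \<inter> ball q r) (x + z)"
          by (auto simp: indicator_def)
      qed
      also have "\<dots> = (\<integral>\<^sup>+x\<in>\<Omega> \<inter> ball q r. ennreal ((\<phi> x)\<^sup>2) \<partial>lborel)"
        by (rule nn_integral_translate) measurable
      finally show ?thesis using loc[OF \<phi>] by simp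
    qed
    have "(\<integral>\<^sup>+x\<in>A. ennreal ((\<phi> x)\<^sup>2) \<partial>lborel)
      \<le> (\<integral>\<^sup>+x. 2 * (ennreal ((\<phi> (x + z))\<^sup>2) * indicator A x) + 2 * (ennreal ((\<phi> (x + z) - \<phi> x)\<^sup>2) * indicator A x) \<partial>lborel)"
      using sq_split_ennreal by (intro nn_integral_mono) (auto simp: indicator_def)
    also have "\<dots> = 2 * (\<integral>\<^sup>+x\<in>A. ennreal ((\<phi> (x + z))\<^sup>2) \<partial>lborel) + 2 * (\<integral>\<^sup>+x\<in>A. ennreal ((\<phi> (x + z) - \<phi> x)\<^sup>2) \<partial>lborel)"
      by (subst nn_integral_add) (auto simp: nn_integral_cmult)
    also have "\<dots> \<le> 2 * (ennreal C * (?D + ?I)) + 2 * (ennreal ((norm z)\<^sup>2) * (?D + ?I))"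
      by (intro add_mono mult_left_mono sh order_trans[OF tr]) auto
    also have "\<dots> = ennreal (2 * C + 2 * (norm z)\<^sup>2) * (?D + ?I)"
      using C by (simp add: ennreal_plus ennreal_mult' distrib_right mult.assoc)
    finally show "(\<integral>\<^sup>+x\<in>\<Omega> \<inter> ball p (min r \<rho>). ennreal ((\<phi> x)\<^sup>2) \<partial>lborel) \<le> ennreal (2 * C + 2 * (norm z)\<^sup>2) * (?D + ?I)"
      by (simp add: A_def)
  qed (use r \<rho> C in auto)
qed

lemma local_poincare_center:
  assumes "0 < \<rho>"
  shows "local_poincare \<Omega> (ball q \<rho>) q"
proof (rule local_poincareI[of \<rho> 1])
  fix \<phi> :: "pt \<Rightarrow> real"
  have "(\<integral>\<^sup>+x\<in>\<Omega> \<inter> ball q \<rho>. ennreal ((\<phi> x)\<^sup>2) \<partial>lborel) \<le> (\<integral>\<^sup>+x\<in>ball q \<rho>. ennreal ((\<phi> x)\<^sup>2) \<partial>lborel)"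
    by (intro nn_integral_mono) (auto simp: indicator_def)
  then show "(\<integral>\<^sup>+x\<in>\<Omega> \<inter> ball q \<rho>. ennreal ((\<phi> x)\<^sup>2) \<partial>lborel)
     \<le> ennreal 1 * (dirichlet \<Omega> \<phi> + (\<integral>\<^sup>+x\<in>ball q \<rho>. ennreal ((\<phi> x)\<^sup>2) \<partial>lborel))"
    by (simp add: add_increasing)
qed (use assms in auto)

text \<open>Transport works in both directions between nearby points, so the property is locally
  constant, and connectedness spreads it from the center of the reference ball.\<close>

lemma local_poincare_interior:
  assumes \<Omega>: "open \<Omega>" "connected \<Omega>" and q: "q \<in> \<Omega>" and \<rho>: "0 < \<rho>" and p: "p \<in> \<Omega>"
  shows "local_poincare \<Omega> (ball q \<rho>) p"
proof -
  let ?P = "local_poincare \<Omega> (ball q \<rho>)"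
  have "\<forall>\<^sub>F y in at x within \<Omega>. ?P x = ?P y" if x: "x \<in> \<Omega>" for x
  proof -
    obtain d where d: "d > 0" "ball x d \<subseteq> \<Omega>" using x \<Omega>(1) openE by blast
    \<comment> \<open>The distances add up to less than \<open>d\<close>: one quarter from
      \<open>x\<close> to \<open>a\<close>, one quarter from \<open>a\<close> to the moving point,
      and one half for the shift.\<close>
    have eq: "?P a" if ab: "a \<in> ball x (d/4)" "b \<in> ball x (d/4)" and "?P b" for a b
    proof (rule local_poincare_shift[OF \<Omega>(1) \<open>?P b\<close>, of "d / 4"])
      fix y s :: _ assume "y \<in> \<Omega>" and y: "dist a y < d / 4" and s: "0 \<le> s" "(s::real) \<le> 1"
      have "dist b a < d / 2" using ab dist_triangle_half_r[of x b "d/2" a] by (auto simp: dist_commute)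
      then have "norm (s *\<^sub>R (b - a)) < d / 2"
        using s mult_left_le_one_le[of "norm (b - a)" s] by (simp add: dist_norm)
      moreover have "dist x (y + s *\<^sub>R (b - a)) \<le> dist x a + dist a y + norm (s *\<^sub>R (b - a))"
        using dist_triangle[of x "y + s *\<^sub>R (b - a)" y] dist_triangle[of x y a] by (simp add: dist_norm)
      moreover have "dist x a < d / 4" using ab by simp
      ultimately have "dist x (y + s *\<^sub>R (b - a)) < d" using y by linarith
      then show "y + s *\<^sub>R (b - a) \<in> \<Omega>" using d by auto
    qed (use d in auto)
    have "?P x = ?P y" if "y \<in> ball x (d/4)" for y using eq[of x y] eq[of y x] that d by auto
    then show ?thesis using d unfolding eventually_at by (intro exI[of _ "d/4"]) (auto simp: dist_commute)
  qed
  then have "?P q = ?P p" by (intro connected_local_const[OF \<Omega>(2) q p]) auto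
  then show ?thesis using local_poincare_center[OF \<rho>] by simp
qed

text \<open>One step along the axis of the cone carries a boundary point, and with it the nearby
  part of \<open>\<Omega>\<close>, to an interior point.\<close>

lemma local_poincare_closure:
  assumes \<Omega>: "smooth_bounded_domain \<Omega>" and q: "q \<in> \<Omega>" and \<rho>: "0 < \<rho>" and p: "p \<in> closure \<Omega>"
  shows "local_poincare \<Omega> (ball q \<rho>) p"
proof -
  have op: "open \<Omega>" "connected \<Omega>" using \<Omega> by (auto simp: smooth_bounded_domain_def)
  obtain e c r where cone: "cone_at \<Omega> p e c r" using cone_at_exists[OF \<Omega> p] by blast
  then have cr: "0 < c" "0 < r" by (auto simp: cone_at_def)
  define p' where "p' = p - (r / 2) *\<^sub>R (e + 0)"
  have "p' \<in> \<Omega>" unfolding p'_def by (rule cone_at_closure[OF cone p]) (use cr in auto)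
  then have "local_poincare \<Omega> (ball q \<rho>) p'" by (intro local_poincare_interior op q \<rho>)
  then show ?thesis
  proof (rule local_poincare_shift[OF op(1)])
    show "0 < r" by fact
    fix x s assume x: "x \<in> \<Omega>" "dist p x < r" and s: "0 \<le> s" "(s::real) \<le> 1"
    show "x + s *\<^sub>R (p' - p) \<in> \<Omega>"
    proof (cases "s = 0")
      case False
      have "x - (s * (r / 2)) *\<^sub>R (e + 0) \<in> \<Omega>"
        by (rule cone_atD[OF cone x]) (use s False cr mult_left_le_one_le[of "r/2" s] in auto)
      then show ?thesis by (simp add: p'_def)
    qed (use x in simp)
  qed
qed

text \<open>The constant \<open>c\<close> is the value of \<open>\<phi>\<close> at a well chosen
  point \<open>y\<close>. Writing \<open>x = y + z\<close> and using convexity of the ball, the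
  translation estimate bounds the integral of \<open>F\<close> over all \<open>y\<close>, so some
  \<open>y\<close> is no worse than twice the average.\<close>

lemma ball_poincare:
  fixes q :: "'a::euclidean_space"
  assumes \<rho>: "0 < \<rho>" and sub: "ball q \<rho> \<subseteq> \<Omega>" and \<Omega>: "open \<Omega>" "bounded \<Omega>"
  shows "\<exists>K\<ge>0. \<forall>\<phi>. Cinf_on UNIV \<phi> \<longrightarrow>
    (\<exists>c. (\<integral>\<^sup>+x\<in>ball q \<rho>. ennreal ((\<phi> x - c)\<^sup>2) \<partial>lborel) \<le> ennreal K * dirichlet \<Omega> \<phi>)"
proof -
  let ?B = "ball q \<rho>"
  \<comment> \<open>All differences \<open>z\<close> of two points of the ball lie in the ball of
    radius \<open>2 * \<rho>\<close>; \<open>L\<close> is its volume times the largest value of the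
    squared norm of \<open>z\<close>.\<close>
  define L where "L = measure lborel (ball (0::'a) (2 * \<rho>)) * (2 * \<rho>)\<^sup>2"
  define b where "b = measure lborel ?B"
  have b: "b > 0" unfolding b_def using \<rho> by (simp add: content_ball_pos)
  have eb: "emeasure lborel ?B = ennreal b" unfolding b_def
    using emeasure_bounded_finite[OF bounded_ball, of q \<rho>] by (intro emeasure_eq_ennreal_measure) auto
  have L: "L \<ge> 0" by (simp add: L_def)
  show ?thesis
  proof (rule exI[of _ "2 * L / b"], intro conjI allI impI)
    show "0 \<le> 2 * L / b" using b L by simp
    fix \<phi> :: "'a \<Rightarrow> real" assume \<phi>: "Cinf_on UNIV \<phi>"
    note [measurable] = borel_measurable_Cinf[OF \<phi>] borel_open[OF open_ball, of q \<rho>]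
    define D where "D = (nG \<Omega> \<phi>)\<^sup>2"
    have D: "dirichlet \<Omega> \<phi> = ennreal D" "D \<ge> 0" unfolding D_def using dirichlet_eq_nG[OF \<phi> \<Omega>] by auto
    define F where "F y = (\<integral>\<^sup>+x\<in>?B. ennreal ((\<phi> x - \<phi> y)\<^sup>2) \<partial>lborel)" for y
    have Fm[measurable]: "F \<in> borel_measurable borel" unfolding F_def[abs_def] by measurable
    have "(\<integral>\<^sup>+y\<in>?B. F y \<partial>lborel) = (\<integral>\<^sup>+y. (\<integral>\<^sup>+z. ennreal ((\<phi> (y + z) - \<phi> y)\<^sup>2) * indicator {y\<in>?B. y + z \<in> ?B} y \<partial>lborel) \<partial>lborel)"
    proof (rule nn_integral_cong)
      fix y
      have "F y = (\<integral>\<^sup>+z. ennreal ((\<phi> (z + y) - \<phi> y)\<^sup>2) * indicator ?B (z + y) \<partial>lborel)"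
        unfolding F_def by (rule nn_integral_translate[symmetric]) measurable
      then show "F y * indicator ?B y = (\<integral>\<^sup>+z. ennreal ((\<phi> (y + z) - \<phi> y)\<^sup>2) * indicator {y\<in>?B. y + z \<in> ?B} y \<partial>lborel)"
        by (cases "y \<in> ?B") (auto simp: add.commute indicator_def intro!: nn_integral_cong)
    qed
    also have "\<dots> = (\<integral>\<^sup>+z. (\<integral>\<^sup>+y. ennreal ((\<phi> (y + z) - \<phi> y)\<^sup>2) * indicator {y\<in>?B. y + z \<in> ?B} y \<partial>lborel) \<partial>lborel)"
      by (rule lborel_pair.Fubini') (unfold indicator_def, measurable)
    also have "\<dots> \<le> (\<integral>\<^sup>+z. ennreal ((2 * \<rho>)\<^sup>2 * D) * indicator (ball (0::'a) (2 * \<rho>)) z \<partial>lborel)"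
    proof (rule nn_integral_mono)
      fix z :: 'a
      show "(\<integral>\<^sup>+y. ennreal ((\<phi> (y + z) - \<phi> y)\<^sup>2) * indicator {y\<in>?B. y + z \<in> ?B} y \<partial>lborel)
          \<le> ennreal ((2 * \<rho>)\<^sup>2 * D) * indicator (ball (0::'a) (2 * \<rho>)) z"
      proof (cases "{y\<in>?B. y + z \<in> ?B} = {}")
        case False
        then obtain y where y: "y \<in> ?B" "y + z \<in> ?B" by blast
        have nz: "norm z < 2 * \<rho>"
          using y dist_triangle_half_r[of q y "2 * \<rho>" "y + z"] by (simp add: dist_norm norm_minus_commute)
        have "(\<integral>\<^sup>+y. ennreal ((\<phi> (y + z) - \<phi> y)\<^sup>2) * indicator {y\<in>?B. y + z \<in> ?B} y \<partial>lborel)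
            \<le> ennreal ((norm z)\<^sup>2) * dirichlet \<Omega> \<phi>"
        proof (rule translation_estimate[OF \<phi> _ \<Omega>(1)])
          show "{y\<in>?B. y + z \<in> ?B} \<in> sets borel" by measurable
          fix x s assume x: "x \<in> {y\<in>?B. y + z \<in> ?B}" and s: "0 \<le> s" "(s::real) \<le> 1"
          have "(1 - s) *\<^sub>R x + s *\<^sub>R (x + z) \<in> ?B"
            using x s convex_ball[of q \<rho>] by (intro convexD_alt) auto
          then show "x + s *\<^sub>R z \<in> \<Omega>" using sub by (auto simp: algebra_simps)
        qed
        also have "\<dots> \<le> ennreal ((2 * \<rho>)\<^sup>2 * D)"
        proof -
          have "(norm z)\<^sup>2 \<le> (2 * \<rho>)\<^sup>2" using nz by (intro power_mono) auto
          then have "(norm z)\<^sup>2 * D \<le> (2 * \<rho>)\<^sup>2 * D" using D(2) by (rule mult_right_mono)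
          then show ?thesis unfolding D(1) by (simp only: ennreal_mult'[OF zero_le_power2, symmetric] ennreal_leI)
        qed
        finally show ?thesis using nz by simp
      qed simp
    qed
    also have "\<dots> = ennreal ((2 * \<rho>)\<^sup>2 * D) * emeasure lborel (ball (0::'a) (2 * \<rho>))"
      by (rule nn_integral_cmult_indicator) simp
    also have "\<dots> = ennreal (L * D)"
      using emeasure_bounded_finite[OF bounded_ball, of "0::'a" "2 * \<rho>"]
      by (subst emeasure_eq_ennreal_measure) (auto simp: L_def ennreal_mult''[symmetric] D mult_ac)
    finally have J: "(\<integral>\<^sup>+y\<in>?B. F y \<partial>lborel) \<le> ennreal (L * D)" .
    \<comment> \<open>If every \<open>F y\<close> exceeded the bound, integration over the ball of
      measure \<open>b\<close> would give \<open>2 * L * D \<le> L * D\<close>. When this product is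
      zero the contradiction is instead that \<open>F\<close> has integral zero while being positive
      everywhere.\<close>
    have "\<exists>y. F y \<le> ennreal (2 * L / b * D)"
    proof (rule ccontr)
      assume "\<not> ?thesis"
      then have gt: "F y > ennreal (2 * L / b * D)" for y by (simp add: not_le)
      show False
      proof (cases "L * D = 0")
        case True
        have "(\<integral>\<^sup>+y. F y * indicator ?B y \<partial>lborel) = 0" using J unfolding True by simp
        then have "AE y in lborel. F y * indicator ?B y = 0"
          by (subst (asm) nn_integral_0_iff_AE) measurable
        then have "AE y in lborel. y \<notin> ?B"
        proof (rule AE_mp, intro AE_I2 impI)
          fix y assume "F y * indicator ?B y = 0"
          moreover have "F y \<noteq> 0" using gt[of y] by (metis not_less_zero)
          ultimately show "y \<notin> ?B" by (auto simp: indicator_def split: if_splits)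
        qed
        then have "?B \<in> null_sets lborel" by (subst AE_iff_null_sets) auto
        then have "emeasure lborel ?B = 0" by (rule null_setsD1)
        then show False using eb b by simp
      next
        case False
        have "ennreal (2 * L / b * D) * ennreal b = (\<integral>\<^sup>+y. ennreal (2 * L / b * D) * indicator ?B y \<partial>lborel)"
          unfolding eb[symmetric] by (rule nn_integral_cmult_indicator[symmetric]) simp
        also have "\<dots> \<le> (\<integral>\<^sup>+y\<in>?B. F y \<partial>lborel)"
          using gt by (intro nn_integral_mono) (auto simp: indicator_def less_imp_le)
        also note J
        finally have "ennreal (2 * L / b * D * b) \<le> ennreal (L * D)"
          by (simp only: ennreal_mult''[OF less_imp_le[OF b]])
        then have "2 * L / b * D * b \<le> L * D"
          using L D by (subst (asm) ennreal_le_iff) (auto intro: mult_nonneg_nonneg)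
        then have "2 * (L * D) \<le> L * D" using b by simp
        moreover have "L * D > 0" using False L D by (simp add: less_le)
        ultimately show False by linarith
      qed
    qed
    then obtain y where y: "F y \<le> ennreal (2 * L / b * D)" by blast
    have "ennreal (2 * L / b * D) = ennreal (2 * L / b) * dirichlet \<Omega> \<phi>"
      unfolding D(1) using b L by (intro ennreal_mult') auto
    then show "\<exists>c. (\<integral>\<^sup>+x\<in>?B. ennreal ((\<phi> x - c)\<^sup>2) \<partial>lborel) \<le> ennreal (2 * L / b) * dirichlet \<Omega> \<phi>"
      using y unfolding F_def by metis
  qed
qed

text \<open>Finitely many of the balls with local estimates cover the compact closure, and their
  constants add up.\<close>

lemma global_poincare_mod_ball:
  assumes \<Omega>: "smooth_bounded_domain \<Omega>" and q: "q \<in> \<Omega>" and \<rho>: "0 < \<rho>"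
  shows "\<exists>C\<ge>0. \<forall>\<phi>. Cinf_on UNIV \<phi> \<longrightarrow> (\<integral>\<^sup>+x\<in>\<Omega>. ennreal ((\<phi> x)\<^sup>2) \<partial>lborel)
    \<le> ennreal C * (dirichlet \<Omega> \<phi> + (\<integral>\<^sup>+x\<in>ball q \<rho>. ennreal ((\<phi> x)\<^sup>2) \<partial>lborel))"
proof -
  have op: "open \<Omega>" "bounded \<Omega>" using \<Omega> by (auto simp: smooth_bounded_domain_def)
  define Q where "Q p r C \<longleftrightarrow> r > 0 \<and> C \<ge> 0 \<and> (\<forall>\<phi>. Cinf_on UNIV \<phi> \<longrightarrow>
     (\<integral>\<^sup>+x\<in>\<Omega> \<inter> ball p r. ennreal ((\<phi> x)\<^sup>2) \<partial>lborel)
       \<le> ennreal C * (dirichlet \<Omega> \<phi> + (\<integral>\<^sup>+x\<in>ball q \<rho>. ennreal ((\<phi> x)\<^sup>2) \<partial>lborel)))" for p r C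
  have "\<forall>p\<in>closure \<Omega>. \<exists>rc. Q p (fst rc) (snd rc)"
  proof
    fix p assume "p \<in> closure \<Omega>"
    then obtain r C where "Q p r C"
      using local_poincare_closure[OF \<Omega> q \<rho>] unfolding local_poincare_def Q_def by meson
    then show "\<exists>rc. Q p (fst rc) (snd rc)" by (intro exI[of _ "(r, C)"]) simp
  qed
  then obtain rc where rc: "\<forall>p\<in>closure \<Omega>. Q p (fst (rc p)) (snd (rc p))" by (rule bchoice[THEN exE])
  define r C where "r p = fst (rc p)" and "C p = snd (rc p)" for p
  have rC: "r p > 0" "C p \<ge> 0" "\<And>\<phi>. Cinf_on UNIV \<phi> \<Longrightarrow>
     (\<integral>\<^sup>+x\<in>\<Omega> \<inter> ball p (r p). ennreal ((\<phi> x)\<^sup>2) \<partial>lborel)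
       \<le> ennreal (C p) * (dirichlet \<Omega> \<phi> + (\<integral>\<^sup>+x\<in>ball q \<rho>. ennreal ((\<phi> x)\<^sup>2) \<partial>lborel))"
    if "p \<in> closure \<Omega>" for p
    using rc that unfolding r_def C_def Q_def by auto
  have "compact (closure \<Omega>)" using op by (simp add: compact_closure)
  then obtain P where P: "P \<subseteq> closure \<Omega>" "finite P" "closure \<Omega> \<subseteq> (\<Union>p\<in>P. ball p (r p))"
    by (rule compactE_image[of _ "closure \<Omega>" "\<lambda>p. ball p (r p)"]) (use rC(1) in force)+
  show ?thesis
  proof (intro exI[of _ "\<Sum>p\<in>P. C p"] conjI allI impI)
    show "0 \<le> (\<Sum>p\<in>P. C p)" using rC(2) P by (intro sum_nonneg) auto
    fix \<phi> :: "pt \<Rightarrow> real" assume \<phi>: "Cinf_on UNIV \<phi>"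
    note [measurable] = borel_measurable_Cinf[OF \<phi>] borel_open[OF op(1)] borel_open[OF open_ball]
    let ?R = "dirichlet \<Omega> \<phi> + (\<integral>\<^sup>+x\<in>ball q \<rho>. ennreal ((\<phi> x)\<^sup>2) \<partial>lborel)"
    have "(\<integral>\<^sup>+x\<in>\<Omega>. ennreal ((\<phi> x)\<^sup>2) \<partial>lborel) \<le> (\<integral>\<^sup>+x. (\<Sum>p\<in>P. ennreal ((\<phi> x)\<^sup>2) * indicator (\<Omega> \<inter> ball p (r p)) x) \<partial>lborel)"
    proof (rule nn_integral_mono)
      fix x
      show "ennreal ((\<phi> x)\<^sup>2) * indicator \<Omega> x \<le> (\<Sum>p\<in>P. ennreal ((\<phi> x)\<^sup>2) * indicator (\<Omega> \<inter> ball p (r p)) x)"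
      proof (cases "x \<in> \<Omega>")
        case True
        then obtain p where p: "p \<in> P" "x \<in> ball p (r p)" using P(3) closure_subset by blast
        have "ennreal ((\<phi> x)\<^sup>2) * indicator \<Omega> x = ennreal ((\<phi> x)\<^sup>2) * indicator (\<Omega> \<inter> ball p (r p)) x"
          using True p by (simp add: indicator_def)
        also have "\<dots> \<le> (\<Sum>p\<in>P. ennreal ((\<phi> x)\<^sup>2) * indicator (\<Omega> \<inter> ball p (r p)) x)"
          using p(1) P(2) by (intro member_le_sum[where f="\<lambda>p. ennreal ((\<phi> x)\<^sup>2) * indicator (\<Omega> \<inter> ball p (r p)) x"]) auto
        finally show ?thesis .
      qed simp
    qed
    also have "\<dots> = (\<Sum>p\<in>P. \<integral>\<^sup>+x\<in>\<Omega> \<inter> ball p (r p). ennreal ((\<phi> x)\<^sup>2) \<partial>lborel)"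
      by (rule nn_integral_sum) measurable
    also have "\<dots> \<le> (\<Sum>p\<in>P. ennreal (C p) * ?R)"
      using rC(3) P \<phi> by (intro sum_mono) blast
    also have "\<dots> = ennreal (\<Sum>p\<in>P. C p) * ?R"
      using rC(2) P by (subst sum_ennreal[symmetric]) (auto simp: sum_distrib_right)
    finally show "(\<integral>\<^sup>+x\<in>\<Omega>. ennreal ((\<phi> x)\<^sup>2) \<partial>lborel) \<le> ennreal (\<Sum>p\<in>P. C p) * ?R" .
  qed
qed

text \<open>After subtraction of a constant suited to one small ball, the mass on that ball is
  controlled by the energy, and through it the mass on all of \<open>\<Omega>\<close>.\<close>

theorem poincare:
  assumes \<Omega>: "smooth_bounded_domain \<Omega>"
  shows "\<exists>C>0. \<forall>\<phi>. Cinf_on UNIV \<phi> \<and> (\<integral>x. \<phi> x \<partial>lebesgue_on \<Omega>) = 0 \<longrightarrow> nL2 (lebesgue_on \<Omega>) \<phi> \<le> C * nG \<Omega> \<phi>"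
proof -
  have op: "open \<Omega>" "bounded \<Omega>" "\<Omega> \<noteq> {}" using \<Omega> by (auto simp: smooth_bounded_domain_def)
  interpret finite_measure "lebesgue_on \<Omega>" using op by (intro lebesgue_on_finite_measure)
  obtain q where q: "q \<in> \<Omega>" using op by blast
  obtain \<rho> where \<rho>: "\<rho> > 0" "ball q \<rho> \<subseteq> \<Omega>" using q op openE by blast
  obtain C where C: "C \<ge> 0" "\<And>\<phi>. Cinf_on UNIV \<phi> \<Longrightarrow> (\<integral>\<^sup>+x\<in>\<Omega>. ennreal ((\<phi> x)\<^sup>2) \<partial>lborel)
    \<le> ennreal C * (dirichlet \<Omega> \<phi> + (\<integral>\<^sup>+x\<in>ball q \<rho>. ennreal ((\<phi> x)\<^sup>2) \<partial>lborel))"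
    using global_poincare_mod_ball[OF \<Omega> q \<rho>(1)] by blast
  obtain K where K: "K \<ge> 0" "\<And>\<phi>. Cinf_on UNIV \<phi> \<Longrightarrow>
    (\<exists>c. (\<integral>\<^sup>+x\<in>ball q \<rho>. ennreal ((\<phi> x - c)\<^sup>2) \<partial>lborel) \<le> ennreal K * dirichlet \<Omega> \<phi>)"
    using ball_poincare[OF \<rho> op(1,2)] by blast
  show ?thesis
  \<comment> \<open>The summand 1 only secures strict positivity.\<close>
  proof (intro exI[of _ "sqrt (C * (1 + K)) + 1"] conjI allI impI)
    show "0 < sqrt (C * (1 + K)) + 1" using C K by (simp add: add_nonneg_pos)
    fix \<phi> assume A: "Cinf_on UNIV \<phi> \<and> (\<integral>x. \<phi> x \<partial>lebesgue_on \<Omega>) = 0"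
    then have \<phi>: "Cinf_on UNIV \<phi>" and zero: "(\<integral>x. \<phi> x \<partial>lebesgue_on \<Omega>) = 0" by auto
    obtain c where c: "(\<integral>\<^sup>+x\<in>ball q \<rho>. ennreal ((\<phi> x - c)\<^sup>2) \<partial>lborel) \<le> ennreal K * dirichlet \<Omega> \<phi>"
      using K(2)[OF \<phi>] by blast
    have \<phi>c: "Cinf_on UNIV (\<lambda>x. \<phi> x - c)" by (rule Cinf_diff[OF \<phi> Cinf_const])
    have Deq: "dirichlet \<Omega> (\<lambda>x. \<phi> x - c) = dirichlet \<Omega> \<phi>"
      unfolding dirichlet_def by (simp add: grad_minus_const[OF \<phi>])
    have "ennreal ((nL2 (lebesgue_on \<Omega>) (\<lambda>x. \<phi> x - c))\<^sup>2) \<le> ennreal C * (dirichlet \<Omega> \<phi> + ennreal K * dirichlet \<Omega> \<phi>)"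
      using order_trans[OF C(2)[OF \<phi>c, unfolded Deq] mult_left_mono[OF add_left_mono[OF c]]]
      unfolding nn_integral_square_eq_nL2[OF Cinf_on_continuous[OF \<phi>c] op(1,2)] by simp
    also have "\<dots> = ennreal (C * (1 + K) * (nG \<Omega> \<phi>)\<^sup>2)"
      unfolding dirichlet_eq_nG[OF \<phi> op(1,2)] using C K
      by (simp add: ennreal_mult'[symmetric] ennreal_plus[symmetric] algebra_simps del: ennreal_plus)
    finally have 1: "(nL2 (lebesgue_on \<Omega>) (\<lambda>x. \<phi> x - c))\<^sup>2 \<le> C * (1 + K) * (nG \<Omega> \<phi>)\<^sup>2"
      using C K by (subst (asm) ennreal_le_iff) auto
    have i: "integrable (lebesgue_on \<Omega>) \<phi>" "integrable (lebesgue_on \<Omega>) (\<lambda>x. (\<phi> x)\<^sup>2)"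
      using Cinf_on_continuous[OF \<phi>] op by (auto intro!: integrable_continuous_lebesgue_on continuous_intros)
    have "(\<integral>x. (\<phi> x - c)\<^sup>2 \<partial>lebesgue_on \<Omega>) = (\<integral>x. (\<phi> x)\<^sup>2 - (2 * c) * \<phi> x + c\<^sup>2 \<partial>lebesgue_on \<Omega>)"
      by (rule Bochner_Integration.integral_cong) (auto simp: power2_eq_square algebra_simps)
    also have "\<dots> = (\<integral>x. (\<phi> x)\<^sup>2 \<partial>lebesgue_on \<Omega>) + (\<integral>x. c\<^sup>2 \<partial>lebesgue_on \<Omega>)"
      using i zero by simp
    \<comment> \<open>For a function of mean zero the cross term vanishes, so subtracting a constant
      can only increase the norm; the estimate for \<open>\<phi> - c\<close> thus passes to
      \<open>\<phi>\<close>.\<close>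
    finally have 2: "(nL2 (lebesgue_on \<Omega>) \<phi>)\<^sup>2 \<le> (nL2 (lebesgue_on \<Omega>) (\<lambda>x. \<phi> x - c))\<^sup>2"
      unfolding nL2_sq by simp
    have "(nL2 (lebesgue_on \<Omega>) \<phi>)\<^sup>2 \<le> (sqrt (C * (1 + K)) * nG \<Omega> \<phi>)\<^sup>2"
      using order_trans[OF 2 1] C K by (simp add: power_mult_distrib)
    then have "nL2 (lebesgue_on \<Omega>) \<phi> \<le> sqrt (C * (1 + K)) * nG \<Omega> \<phi>"
      using C K by (elim power2_le_imp_le) simp
    then show "nL2 (lebesgue_on \<Omega>) \<phi> \<le> (sqrt (C * (1 + K)) + 1) * nG \<Omega> \<phi>"
      by (simp add: distrib_right add_increasing2)
  qed
qed

subsection \<open>Boundary layers\<close>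

lemma cone_at_mono:
  assumes "cone_at \<Omega> p e c r" "dist p a \<le> r / 2" "0 < c'" "c' \<le> c" "0 < r'" "r' \<le> r / 2"
  shows "cone_at \<Omega> a e c' r'"
  unfolding cone_at_def
proof (intro conjI ballI allI impI)
  fix x s and z :: pt
  assume x: "x \<in> \<Omega> \<inter> ball a r'" and s: "0 < s \<and> s < r' \<and> norm z < c'"
  have "dist p x < r" using x assms dist_triangle[of p x a] by auto
  then show "x - s *\<^sub>R (e + z) \<in> \<Omega>"
    by (rule cone_atD[OF assms(1), rotated]) (use x s assms in auto)
qed (use assms in \<open>auto simp: cone_at_def\<close>)

text \<open>A cone at \<open>p\<close> serves all points within half of its radius, so by
  compactness opening and height can be chosen uniformly; only the axis still varies.\<close>

lemma uniform_cone:
  assumes \<Omega>: "smooth_bounded_domain \<Omega>"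
  shows "\<exists>c r. 0 < c \<and> 0 < r \<and> (\<forall>a\<in>closure \<Omega>. \<exists>e. cone_at \<Omega> a e c r)"
proof -
  have op: "open \<Omega>" "bounded \<Omega>" using \<Omega> by (auto simp: smooth_bounded_domain_def)
  have "\<forall>p\<in>closure \<Omega>. \<exists>k. cone_at \<Omega> p (fst k) (fst (snd k)) (snd (snd k))"
  proof
    fix p assume "p \<in> closure \<Omega>"
    then obtain e c r where "cone_at \<Omega> p e c r" using cone_at_exists[OF \<Omega>] by blast
    then show "\<exists>k. cone_at \<Omega> p (fst k) (fst (snd k)) (snd (snd k))" by (intro exI[of _ "(e, c, r)"]) simp
  qed
  then obtain k where k: "\<forall>p\<in>closure \<Omega>. cone_at \<Omega> p (fst (k p)) (fst (snd (k p))) (snd (snd (k p)))"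
    by (rule bchoice[THEN exE])
  define e c r where "e p = fst (k p)" and "c p = fst (snd (k p))" and "r p = snd (snd (k p))" for p
  have cone: "cone_at \<Omega> p (e p) (c p) (r p)" if "p \<in> closure \<Omega>" for p
    using k that by (simp add: e_def c_def r_def)
  have pos: "0 < c p" "0 < r p" if "p \<in> closure \<Omega>" for p using cone[OF that] by (auto simp: cone_at_def)
  have "compact (closure \<Omega>)" using op by (simp add: compact_closure)
  then obtain P where P: "P \<subseteq> closure \<Omega>" "finite P" "closure \<Omega> \<subseteq> (\<Union>p\<in>P. ball p (r p / 2))"
    by (rule compactE_image[of _ "closure \<Omega>" "\<lambda>p. ball p (r p / 2)"]) (use pos(2) in force)+
  \<comment> \<open>The element 1 keeps \<open>Min\<close> defined when the finite set is
    empty.\<close>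
  define c0 where "c0 = Min (insert 1 (c ` P))"
  define r0 where "r0 = Min (insert 1 ((\<lambda>p. r p / 2) ` P))"
  have "0 < c0" "0 < r0" using P pos by (auto simp: c0_def r0_def)
  moreover have "\<exists>e. cone_at \<Omega> a e c0 r0" if a: "a \<in> closure \<Omega>" for a
  proof -
    obtain p where p: "p \<in> P" "dist p a < r p / 2" using P(3) a by auto
    have "c0 \<le> c p" unfolding c0_def by (rule Min_le) (use p P(2) in auto)
    moreover have "r0 \<le> r p / 2" unfolding r0_def by (rule Min_le) (use p P(2) in auto)
    ultimately have "cone_at \<Omega> a (e p) c0 r0"
      using cone_at_mono[OF cone] p P(1) \<open>0 < c0\<close> \<open>0 < r0\<close> by (meson less_imp_le subsetD)
    then show ?thesis by blast
  qed
  ultimately show ?thesis by blast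
qed

lemma frontier_properties:
  assumes \<Omega>: "smooth_bounded_domain \<Omega>"
  shows "compact (frontier \<Omega>)" "frontier \<Omega> \<noteq> {}" "\<And>a. a \<in> frontier \<Omega> \<Longrightarrow> a \<notin> \<Omega>" "frontier \<Omega> \<subseteq> closure \<Omega>"
proof -
  have op: "open \<Omega>" "bounded \<Omega>" "\<Omega> \<noteq> {}" using \<Omega> by (auto simp: smooth_bounded_domain_def)
  show "compact (frontier \<Omega>)" using op by (simp add: compact_frontier_bounded)
  show "frontier \<Omega> \<noteq> {}" using op not_bounded_UNIV by (auto simp: frontier_eq_empty)
  show "a \<notin> \<Omega>" if "a \<in> frontier \<Omega>" for a using that op by (simp add: frontier_def interior_open)
  show "frontier \<Omega> \<subseteq> closure \<Omega>" by (simp add: frontier_def)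
qed

text \<open>The cone at a boundary point contains a ball of radius \<open>c * \<epsilon> / 2\<close>
  around its axis point at height \<open>\<epsilon> / 2\<close>. This lower volume bound is what
  later allows covering balls to be counted.\<close>

lemma volume_near_frontier:
  assumes \<Omega>: "smooth_bounded_domain \<Omega>"
  shows "\<exists>c0 \<epsilon>0. 0 < c0 \<and> 0 < \<epsilon>0 \<and> (\<forall>a\<in>frontier \<Omega>. \<forall>\<epsilon>. 0 < \<epsilon> \<and> \<epsilon> < \<epsilon>0 \<longrightarrow>
    ennreal (c0 * \<epsilon> ^ 3) \<le> emeasure lborel (\<Omega> \<inter> cball a \<epsilon>))"
proof -
  have op: "open \<Omega>" using \<Omega> by (auto simp: smooth_bounded_domain_def)
  obtain c r where cr: "0 < c" "0 < r" "\<And>a. a \<in> closure \<Omega> \<Longrightarrow> \<exists>e. cone_at \<Omega> a e c r"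
    using uniform_cone[OF \<Omega>] by blast
  define c0 where "c0 = unit_ball_vol 3 * (c / 2) ^ 3"
  have "0 < c0" using cr by (simp add: c0_def)
  moreover have "ennreal (c0 * \<epsilon> ^ 3) \<le> emeasure lborel (\<Omega> \<inter> cball a \<epsilon>)"
    if a: "a \<in> frontier \<Omega>" and \<epsilon>: "0 < \<epsilon>" "\<epsilon> < r" for a \<epsilon>
  proof -
    have ac: "a \<in> closure \<Omega>" using a frontier_properties(4)[OF \<Omega>] by blast
    obtain e where cone: "cone_at \<Omega> a e c r" using cr(3)[OF ac] by blast
    then have e: "norm e = 1" and c1: "c \<le> 1" by (auto simp: cone_at_def)
    have sub: "ball (a - (\<epsilon> / 2) *\<^sub>R e) (c * \<epsilon> / 2) \<subseteq> \<Omega> \<inter> cball a \<epsilon>"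
    proof
      fix x assume x: "x \<in> ball (a - (\<epsilon> / 2) *\<^sub>R e) (c * \<epsilon> / 2)"
      define z where "z = (2 / \<epsilon>) *\<^sub>R (a - (\<epsilon> / 2) *\<^sub>R e - x)"
      have "norm z = (2 / \<epsilon>) * norm (a - (\<epsilon> / 2) *\<^sub>R e - x)"
        unfolding z_def norm_scaleR using \<epsilon> by simp
      moreover have "norm (a - (\<epsilon> / 2) *\<^sub>R e - x) < c * \<epsilon> / 2" using x by (simp add: dist_norm)
      ultimately have "\<epsilon> * norm z < \<epsilon> * c" using \<epsilon> by (simp add: field_simps)
      then have z: "norm z < c" using \<epsilon> by simp
      have xz: "x = a - (\<epsilon> / 2) *\<^sub>R (e + z)" using \<epsilon> by (simp add: z_def algebra_simps)
      have "x \<in> \<Omega>" unfolding xz by (rule cone_at_closure[OF cone ac]) (use \<epsilon> z cr in auto)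
      moreover have "dist a x \<le> 2 * (\<epsilon> / 2)" unfolding xz by (rule dist_cone_le) (use e z c1 \<epsilon> in auto)
      ultimately show "x \<in> \<Omega> \<inter> cball a \<epsilon>" by simp
    qed
    have "ennreal (c0 * \<epsilon> ^ 3) = emeasure lborel (ball (a - (\<epsilon> / 2) *\<^sub>R e) (c * \<epsilon> / 2))"
      using \<epsilon> cr by (subst emeasure_ball) (auto simp: c0_def power_mult_distrib power_divide)
    also have "\<dots> \<le> emeasure lborel (\<Omega> \<inter> cball a \<epsilon>)"
      by (rule emeasure_mono[OF sub]) (use op in auto)
    finally show ?thesis .
  qed
  ultimately show ?thesis using cr(2) by blast
qed

definition layer :: "pt set \<Rightarrow> real \<Rightarrow> pt set" where
  "layer \<Omega> \<epsilon> = {x\<in>\<Omega>. infdist x (frontier \<Omega>) \<le> \<epsilon>}"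

lemma layer_borel: "open \<Omega> \<Longrightarrow> layer \<Omega> \<epsilon> \<in> sets borel"
proof -
  assume "open \<Omega>"
  moreover have "closed {x. infdist x (frontier \<Omega>) \<le> \<epsilon>}"
    by (intro closed_Collect_le continuous_intros)
  moreover have "layer \<Omega> \<epsilon> = \<Omega> \<inter> {x. infdist x (frontier \<Omega>) \<le> \<epsilon>}" by (auto simp: layer_def)
  ultimately show ?thesis by auto
qed

text \<open>By the cone condition a line in direction \<open>e\<close> leaves \<open>\<Omega>\<close> soon after entering the boundary layer.\<close>
lemma line_in_layer_short:
  assumes \<Omega>: "smooth_bounded_domain \<Omega>" and cone: "cone_at \<Omega> p e c r" and \<epsilon>: "0 < \<epsilon>"
    and I: "I = {s\<in>{0..r / 2}. y + s *\<^sub>R e \<in> layer \<Omega> \<epsilon> \<inter> ball p r}"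
  shows "emeasure lborel I \<le> ennreal (2 * \<epsilon> / c)"
proof (cases "I = {}")
  case False
  have c: "0 < c" and r: "0 < r" using cone by (auto simp: cone_at_def)
  have key: "s2 - s1 \<le> \<epsilon> / c" if s: "s1 \<in> I" "s2 \<in> I" for s1 s2
  proof (rule ccontr)
    assume "\<not> ?thesis"
    then have gt: "s2 - s1 > \<epsilon> / c" by simp
    moreover have "\<epsilon> / c > 0" using \<epsilon> c by simp
    ultimately have pos: "s2 - s1 > 0" by linarith
    have lt: "s2 - s1 < r" using s r unfolding I by auto
    have l1: "infdist (y + s1 *\<^sub>R e) (frontier \<Omega>) \<le> \<epsilon>" using s unfolding I by (auto simp: layer_def)
    obtain a where a: "a \<in> frontier \<Omega>" "infdist (y + s1 *\<^sub>R e) (frontier \<Omega>) = dist (y + s1 *\<^sub>R e) a"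
      using infdist_attains_inf[OF compact_imp_closed[OF frontier_properties(1)[OF \<Omega>]] frontier_properties(2)[OF \<Omega>]] by metis
    \<comment> \<open>The tilt is chosen so that the backward step from the later point hits exactly
      the boundary point \<open>a\<close> nearest to the earlier one. If the two parameters were far
      apart the tilt would be admissible and \<open>a\<close> would lie in
      \<open>\<Omega>\<close>.\<close>
    define \<zeta> where "\<zeta> = (1 / (s2 - s1)) *\<^sub>R (y + s1 *\<^sub>R e - a)"
    have "norm (y + s1 *\<^sub>R e - a) \<le> \<epsilon>" using l1 a by (simp add: dist_norm)
    moreover have "\<epsilon> < c * (s2 - s1)" using gt c by (simp add: pos_divide_less_eq mult.commute)
    ultimately have "norm (y + s1 *\<^sub>R e - a) < c * (s2 - s1)" by linarith
    moreover have "norm \<zeta> = norm (y + s1 *\<^sub>R e - a) / (s2 - s1)" using pos by (simp add: \<zeta>_def)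
    ultimately have \<zeta>: "norm \<zeta> < c" using pos by (simp add: pos_divide_less_eq)
    have x2: "y + s2 *\<^sub>R e \<in> \<Omega>" "dist p (y + s2 *\<^sub>R e) < r" using s unfolding I by (auto simp: layer_def)
    have "y + s2 *\<^sub>R e - (s2 - s1) *\<^sub>R (e + \<zeta>) \<in> \<Omega>"
      by (rule cone_atD[OF cone x2 pos lt \<zeta>])
    moreover have "(s2 - s1) *\<^sub>R \<zeta> = y + s1 *\<^sub>R e - a" using pos by (simp add: \<zeta>_def)
    then have "y + s2 *\<^sub>R e - (s2 - s1) *\<^sub>R (e + \<zeta>) = a"
      by (simp add: scaleR_add_right scaleR_diff_left)
    ultimately show False using frontier_properties(3)[OF \<Omega> a(1)] by simp
  qed
  obtain s where s: "s \<in> I" using False by blast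
  have "I \<subseteq> {s - \<epsilon> / c..s + \<epsilon> / c}"
  proof
    fix t assume "t \<in> I"
    then show "t \<in> {s - \<epsilon> / c..s + \<epsilon> / c}" using key[OF s, of t] key[of t s] s by auto
  qed
  then have "emeasure lborel I \<le> emeasure lborel {s - \<epsilon> / c..s + \<epsilon> / c}" by (rule emeasure_mono) auto
  also have "\<dots> = ennreal (2 * \<epsilon> / c)" using \<epsilon> c by simp
  finally show ?thesis .
qed simp

lemma ennreal_mult3:
  assumes "0 \<le> a" "0 \<le> b" "0 \<le> d"
  shows "ennreal a * (ennreal b * X * ennreal d) = ennreal (a * b * d) * X"
  using assms by (simp add: ennreal_mult mult_ac)

lemma sum_const_ennreal_mult: "(\<Sum>p\<in>P. ennreal k * X) = ennreal (real (card P) * k) * X"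
  by (simp add: ennreal_mult' ennreal_of_nat_eq_real_of_nat mult.assoc)

text \<open>The value at a layer point is compared with the values along a segment of length
  \<open>r / 2\<close> leading into \<open>\<Omega>\<close> and averaged over that segment. After
  exchanging the integrals each point is charged only for the time its line spends in the layer, at
  most \<open>2 * \<epsilon> / c\<close>.\<close>

lemma layer_estimate_local:
  assumes \<Omega>: "smooth_bounded_domain \<Omega>" and cone: "cone_at \<Omega> p e c r" and \<epsilon>: "0 < \<epsilon>" and \<phi>: "Cinf_on UNIV \<phi>"
  shows "(\<integral>\<^sup>+x\<in>layer \<Omega> \<epsilon> \<inter> ball p r. ennreal ((\<phi> x)\<^sup>2) \<partial>lborel)
    \<le> ennreal (4 * \<epsilon> / (c * r) * (2 + r\<^sup>2)) * ((\<integral>\<^sup>+x\<in>\<Omega>. ennreal ((\<phi> x)\<^sup>2) \<partial>lborel) + dirichlet \<Omega> \<phi>)"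
proof -
  have op: "open \<Omega>" using \<Omega> by (auto simp: smooth_bounded_domain_def)
  have c: "0 < c" and r: "0 < r" and e: "norm e = 1" using cone by (auto simp: cone_at_def)
  define \<delta> where "\<delta> = r / 2"
  have \<delta>: "0 < \<delta>" "\<delta> < r" using r by (auto simp: \<delta>_def)
  define A where "A = layer \<Omega> \<epsilon> \<inter> ball p r"
  have A[measurable]: "A \<in> sets borel" using layer_borel[OF op] by (auto simp: A_def)
  note [measurable] = borel_measurable_Cinf[OF \<phi>] borel_measurable_grad[OF \<phi>] borel_open[OF op]
  \<comment> \<open>The density charged along the segments: the value term comes from the splitting
    of the square, and \<open>\<delta>\<close> enters squared, once from Cauchy-Schwarz and once
    from averaging over the segment.\<close>
  define q where "q y = (2 * ennreal ((\<phi> y)\<^sup>2) + ennreal (2 * \<delta>\<^sup>2) * ennreal ((norm (grad \<phi> y))\<^sup>2)) * indicator \<Omega> y" for y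
  have q[measurable]: "q \<in> borel_measurable borel" unfolding q_def[abs_def] by measurable
  have inO: "x + s *\<^sub>R (- e) \<in> \<Omega>" if x: "x \<in> A" and s: "0 \<le> s" "s \<le> \<delta>" for x s
  proof (cases "s = 0")
    case False
    have "x - s *\<^sub>R (e + 0) \<in> \<Omega>"
      by (rule cone_atD[OF cone]) (use x s False \<delta> c in \<open>auto simp: A_def layer_def\<close>)
    then show ?thesis by simp
  qed (use x in \<open>auto simp: A_def layer_def\<close>)
  have pt: "ennreal \<delta> * ennreal ((\<phi> x)\<^sup>2) \<le> (\<integral>\<^sup>+s\<in>{0..\<delta>}. q (x + s *\<^sub>R (- e)) \<partial>lborel)" if x: "x \<in> A" for x
  proof -
    define G where "G = (\<integral>\<^sup>+s\<in>{0..\<delta>}. ennreal ((norm (grad \<phi> (x + s *\<^sub>R (- e))))\<^sup>2) \<partial>lborel)"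
    have *: "ennreal ((\<phi> x)\<^sup>2) \<le> 2 * ennreal ((\<phi> (x + s *\<^sub>R (- e)))\<^sup>2) + 2 * (ennreal \<delta> * G)" if s: "0 \<le> s" "s \<le> \<delta>" for s
    proof -
      have "ennreal ((\<phi> (x + s *\<^sub>R (- e)) - \<phi> x)\<^sup>2)
        \<le> ennreal (s * (norm (- e))\<^sup>2) * (\<integral>\<^sup>+t\<in>{0..s}. ennreal ((norm (grad \<phi> (x + t *\<^sub>R (- e))))\<^sup>2) \<partial>lborel)"
        by (rule translation_square_bound[OF \<phi> s(1)])
      also have "\<dots> \<le> ennreal \<delta> * G"
        unfolding G_def using s e by (intro mult_mono nn_integral_mono) (auto simp: indicator_def ennreal_leI)
      finally show ?thesis using sq_split_ennreal[of "\<phi> x" "\<phi> (x + s *\<^sub>R (- e))"]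
        by (elim order_trans) (intro add_left_mono mult_left_mono, auto)
    qed
    have "ennreal \<delta> * ennreal ((\<phi> x)\<^sup>2) = (\<integral>\<^sup>+s\<in>{0..\<delta>}. ennreal ((\<phi> x)\<^sup>2) \<partial>lborel)"
      using \<delta> by (subst nn_integral_cmult_indicator) (auto simp: mult.commute)
    also have "\<dots> \<le> (\<integral>\<^sup>+s. 2 * ennreal ((\<phi> (x + s *\<^sub>R (- e)))\<^sup>2) * indicator {0..\<delta>} s + 2 * (ennreal \<delta> * G) * indicator {0..\<delta>} s \<partial>lborel)"
      using * by (intro nn_integral_mono) (auto simp: indicator_def)
    also have "\<dots> = (\<integral>\<^sup>+s. 2 * ennreal ((\<phi> (x + s *\<^sub>R (- e)))\<^sup>2) * indicator {0..\<delta>} s \<partial>lborel) + (\<integral>\<^sup>+s. 2 * (ennreal \<delta> * G) * indicator {0..\<delta>} s \<partial>lborel)"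
      by (rule nn_integral_add) measurable
    also have "(\<integral>\<^sup>+s. 2 * (ennreal \<delta> * G) * indicator {0..\<delta>} s \<partial>lborel) = 2 * (ennreal \<delta> * G) * ennreal \<delta>"
      using \<delta> by (subst nn_integral_cmult_indicator) auto
    also have "\<dots> = ennreal (2 * \<delta>\<^sup>2) * G"
      using \<delta> by (simp add: ennreal_mult power2_eq_square mult_ac)
    also have "\<dots> = (\<integral>\<^sup>+s. ennreal (2 * \<delta>\<^sup>2) * (ennreal ((norm (grad \<phi> (x + s *\<^sub>R (- e))))\<^sup>2) * indicator {0..\<delta>} s) \<partial>lborel)"
      unfolding G_def by (rule nn_integral_cmult[symmetric]) measurable
    also have "(\<integral>\<^sup>+s. 2 * ennreal ((\<phi> (x + s *\<^sub>R (- e)))\<^sup>2) * indicator {0..\<delta>} s \<partial>lborel) + \<dots>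
       = (\<integral>\<^sup>+s. 2 * ennreal ((\<phi> (x + s *\<^sub>R (- e)))\<^sup>2) * indicator {0..\<delta>} s + ennreal (2 * \<delta>\<^sup>2) * (ennreal ((norm (grad \<phi> (x + s *\<^sub>R (- e))))\<^sup>2) * indicator {0..\<delta>} s) \<partial>lborel)"
      by (rule nn_integral_add[symmetric]) measurable
    also have "\<dots> = (\<integral>\<^sup>+s\<in>{0..\<delta>}. q (x + s *\<^sub>R (- e)) \<partial>lborel)"
    proof (rule nn_integral_cong)
      fix s
      show "2 * ennreal ((\<phi> (x + s *\<^sub>R (- e)))\<^sup>2) * indicator {0..\<delta>} s + ennreal (2 * \<delta>\<^sup>2) * (ennreal ((norm (grad \<phi> (x + s *\<^sub>R (- e))))\<^sup>2) * indicator {0..\<delta>} s)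
        = q (x + s *\<^sub>R (- e)) * indicator {0..\<delta>} s"
        using inO[OF x, of s] by (cases "s \<in> {0..\<delta>}") (auto simp: q_def)
    qed
    finally show ?thesis .
  qed
  have "ennreal \<delta> * (\<integral>\<^sup>+x\<in>A. ennreal ((\<phi> x)\<^sup>2) \<partial>lborel) = (\<integral>\<^sup>+x. ennreal \<delta> * (ennreal ((\<phi> x)\<^sup>2) * indicator A x) \<partial>lborel)"
    by (rule nn_integral_cmult[symmetric]) measurable
  also have "\<dots> \<le> (\<integral>\<^sup>+x\<in>A. (\<integral>\<^sup>+s\<in>{0..\<delta>}. q (x + s *\<^sub>R (- e)) \<partial>lborel) \<partial>lborel)"
    using pt by (intro nn_integral_mono) (auto simp: indicator_def)
  also have "\<dots> = (\<integral>\<^sup>+y. q y * emeasure lborel {s\<in>{0..\<delta>}. y - s *\<^sub>R (- e) \<in> A} \<partial>lborel)"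
    by (rule nn_integral_translation_average) measurable
  also have "\<dots> \<le> (\<integral>\<^sup>+y. q y * ennreal (2 * \<epsilon> / c) \<partial>lborel)"
  proof (intro nn_integral_mono mult_left_mono)
    fix y
    show "emeasure lborel {s\<in>{0..\<delta>}. y - s *\<^sub>R (- e) \<in> A} \<le> ennreal (2 * \<epsilon> / c)"
      by (rule line_in_layer_short[OF \<Omega> cone \<epsilon>, of _ y]) (simp add: A_def \<delta>_def)
  qed auto
  also have "\<dots> = (\<integral>\<^sup>+y. q y \<partial>lborel) * ennreal (2 * \<epsilon> / c)"
    by (rule nn_integral_multc) measurable
  also have "(\<integral>\<^sup>+y. q y \<partial>lborel) = (\<integral>\<^sup>+y. 2 * (ennreal ((\<phi> y)\<^sup>2) * indicator \<Omega> y) + ennreal (2 * \<delta>\<^sup>2) * (ennreal ((norm (grad \<phi> y))\<^sup>2) * indicator \<Omega> y) \<partial>lborel)"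
    by (rule nn_integral_cong) (simp add: q_def distrib_right mult.assoc)
  also have "\<dots> = 2 * (\<integral>\<^sup>+x\<in>\<Omega>. ennreal ((\<phi> x)\<^sup>2) \<partial>lborel) + ennreal (2 * \<delta>\<^sup>2) * dirichlet \<Omega> \<phi>"
    by (subst nn_integral_add) (auto simp: nn_integral_cmult dirichlet_def)
  also have "\<dots> \<le> ennreal (2 + 2 * \<delta>\<^sup>2) * (\<integral>\<^sup>+x\<in>\<Omega>. ennreal ((\<phi> x)\<^sup>2) \<partial>lborel) + ennreal (2 + 2 * \<delta>\<^sup>2) * dirichlet \<Omega> \<phi>"
  proof (intro add_mono mult_right_mono)
    have "ennreal 2 \<le> ennreal (2 + 2 * \<delta>\<^sup>2)" by (intro ennreal_leI) simp
    then show "2 \<le> ennreal (2 + 2 * \<delta>\<^sup>2)" by simp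
    show "ennreal (2 * \<delta>\<^sup>2) \<le> ennreal (2 + 2 * \<delta>\<^sup>2)" by (intro ennreal_leI) simp
  qed auto
  also have "\<dots> = ennreal (2 + 2 * \<delta>\<^sup>2) * ((\<integral>\<^sup>+x\<in>\<Omega>. ennreal ((\<phi> x)\<^sup>2) \<partial>lborel) + dirichlet \<Omega> \<phi>)"
    by (simp add: distrib_left)
  finally have 1: "ennreal \<delta> * (\<integral>\<^sup>+x\<in>A. ennreal ((\<phi> x)\<^sup>2) \<partial>lborel)
    \<le> ennreal (2 + 2 * \<delta>\<^sup>2) * ((\<integral>\<^sup>+x\<in>\<Omega>. ennreal ((\<phi> x)\<^sup>2) \<partial>lborel) + dirichlet \<Omega> \<phi>) * ennreal (2 * \<epsilon> / c)"
    by (simp add: mult_right_mono)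
  have "(\<integral>\<^sup>+x\<in>A. ennreal ((\<phi> x)\<^sup>2) \<partial>lborel) = ennreal (1 / \<delta>) * (ennreal \<delta> * (\<integral>\<^sup>+x\<in>A. ennreal ((\<phi> x)\<^sup>2) \<partial>lborel))"
    unfolding mult.assoc[symmetric] using \<delta> by (simp add: ennreal_mult'[symmetric])
  also have "\<dots> \<le> ennreal (1 / \<delta>) * (ennreal (2 + 2 * \<delta>\<^sup>2) * ((\<integral>\<^sup>+x\<in>\<Omega>. ennreal ((\<phi> x)\<^sup>2) \<partial>lborel) + dirichlet \<Omega> \<phi>) * ennreal (2 * \<epsilon> / c))"
    by (intro mult_left_mono 1) auto
  also have "\<dots> = ennreal (1 / \<delta> * (2 + 2 * \<delta>\<^sup>2) * (2 * \<epsilon> / c)) * ((\<integral>\<^sup>+x\<in>\<Omega>. ennreal ((\<phi> x)\<^sup>2) \<partial>lborel) + dirichlet \<Omega> \<phi>)"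
    using \<delta> \<epsilon> c by (intro ennreal_mult3) auto
  also have "\<dots> \<le> ennreal (4 * \<epsilon> / (c * r) * (2 + r\<^sup>2)) * ((\<integral>\<^sup>+x\<in>\<Omega>. ennreal ((\<phi> x)\<^sup>2) \<partial>lborel) + dirichlet \<Omega> \<phi>)"
  proof (intro mult_right_mono ennreal_leI)
    have eq: "1 / \<delta> * (2 + 2 * \<delta>\<^sup>2) * (2 * \<epsilon> / c) = 4 * \<epsilon> / (c * r) * (2 + 2 * \<delta>\<^sup>2)"
      using r c by (simp add: \<delta>_def field_simps)
    have "2 * \<delta>\<^sup>2 \<le> r\<^sup>2" by (simp add: \<delta>_def power_divide)
    then show "1 / \<delta> * (2 + 2 * \<delta>\<^sup>2) * (2 * \<epsilon> / c) \<le> 4 * \<epsilon> / (c * r) * (2 + r\<^sup>2)"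
      unfolding eq using \<epsilon> c r by (intro mult_left_mono) auto
  qed auto
  finally show ?thesis by (simp add: A_def)
qed

text \<open>The balls of radius \<open>r / 2\<close> around finitely many boundary points cover the
  boundary; for \<open>\<epsilon> < r / 2\<close> every layer point is then within \<open>r\<close>
  of one of the centers.\<close>

lemma layer_estimate:
  assumes \<Omega>: "smooth_bounded_domain \<Omega>"
  shows "\<exists>C \<epsilon>0. 0 < C \<and> 0 < \<epsilon>0 \<and> (\<forall>\<phi> \<epsilon>. Cinf_on UNIV \<phi> \<and> 0 < \<epsilon> \<and> \<epsilon> < \<epsilon>0 \<longrightarrow>
    (\<integral>\<^sup>+x\<in>layer \<Omega> \<epsilon>. ennreal ((\<phi> x)\<^sup>2) \<partial>lborel)
      \<le> ennreal (C * \<epsilon>) * ((\<integral>\<^sup>+x\<in>\<Omega>. ennreal ((\<phi> x)\<^sup>2) \<partial>lborel) + dirichlet \<Omega> \<phi>))"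
proof -
  have op: "open \<Omega>" using \<Omega> by (auto simp: smooth_bounded_domain_def)
  obtain c r where cr: "0 < c" "0 < r" "\<And>a. a \<in> closure \<Omega> \<Longrightarrow> \<exists>e. cone_at \<Omega> a e c r"
    using uniform_cone[OF \<Omega>] by blast
  note F = frontier_properties[OF \<Omega>]
  obtain P where P: "P \<subseteq> frontier \<Omega>" "finite P" "frontier \<Omega> \<subseteq> (\<Union>p\<in>P. ball p (r / 2))"
    using F(1) by (rule compactE_image[of _ "frontier \<Omega>" "\<lambda>p. ball p (r / 2)"]) (use cr(2) in force)+
  define C where "C = real (card P) * (4 / (c * r) * (2 + r\<^sup>2)) + 1"
  have C: "0 < C" using cr by (auto simp: C_def intro!: add_nonneg_pos mult_nonneg_nonneg)
  have main: "(\<integral>\<^sup>+x\<in>layer \<Omega> \<epsilon>. ennreal ((\<phi> x)\<^sup>2) \<partial>lborel)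
      \<le> ennreal (C * \<epsilon>) * ((\<integral>\<^sup>+x\<in>\<Omega>. ennreal ((\<phi> x)\<^sup>2) \<partial>lborel) + dirichlet \<Omega> \<phi>)"
    if \<phi>: "Cinf_on UNIV \<phi>" and \<epsilon>: "0 < \<epsilon>" "\<epsilon> < r / 2" for \<phi> \<epsilon>
  proof -
    note [measurable] = borel_measurable_Cinf[OF \<phi>] layer_borel[OF op] borel_open[OF open_ball]
    let ?R = "(\<integral>\<^sup>+x\<in>\<Omega>. ennreal ((\<phi> x)\<^sup>2) \<partial>lborel) + dirichlet \<Omega> \<phi>"
    have "(\<integral>\<^sup>+x\<in>layer \<Omega> \<epsilon>. ennreal ((\<phi> x)\<^sup>2) \<partial>lborel)
      \<le> (\<integral>\<^sup>+x. (\<Sum>p\<in>P. ennreal ((\<phi> x)\<^sup>2) * indicator (layer \<Omega> \<epsilon> \<inter> ball p r) x) \<partial>lborel)"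
    proof (rule nn_integral_mono)
      fix x
      show "ennreal ((\<phi> x)\<^sup>2) * indicator (layer \<Omega> \<epsilon>) x \<le> (\<Sum>p\<in>P. ennreal ((\<phi> x)\<^sup>2) * indicator (layer \<Omega> \<epsilon> \<inter> ball p r) x)"
      proof (cases "x \<in> layer \<Omega> \<epsilon>")
        case True
        obtain a where a: "a \<in> frontier \<Omega>" "infdist x (frontier \<Omega>) = dist x a"
          using infdist_attains_inf[OF compact_imp_closed[OF F(1)] F(2)] by metis
        obtain p where p: "p \<in> P" "dist p a < r / 2" using P(3) a(1) by auto
        have "dist x a \<le> \<epsilon>" using True a by (simp add: layer_def)
        then have "dist p x < r" using p(2) \<epsilon> dist_triangle[of p x a] by (simp add: dist_commute)
        then have "ennreal ((\<phi> x)\<^sup>2) * indicator (layer \<Omega> \<epsilon>) x = ennreal ((\<phi> x)\<^sup>2) * indicator (layer \<Omega> \<epsilon> \<inter> ball p r) x"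
          using True by (simp add: indicator_def)
        also have "\<dots> \<le> (\<Sum>p\<in>P. ennreal ((\<phi> x)\<^sup>2) * indicator (layer \<Omega> \<epsilon> \<inter> ball p r) x)"
          using p(1) P(2) by (intro member_le_sum[where f="\<lambda>p. ennreal ((\<phi> x)\<^sup>2) * indicator (layer \<Omega> \<epsilon> \<inter> ball p r) x"]) auto
        finally show ?thesis .
      qed simp
    qed
    also have "\<dots> = (\<Sum>p\<in>P. \<integral>\<^sup>+x\<in>layer \<Omega> \<epsilon> \<inter> ball p r. ennreal ((\<phi> x)\<^sup>2) \<partial>lborel)"
      by (rule nn_integral_sum) measurable
    also have "\<dots> \<le> (\<Sum>p\<in>P. ennreal (4 * \<epsilon> / (c * r) * (2 + r\<^sup>2)) * ?R)"
    proof (rule sum_mono)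
      fix p assume "p \<in> P"
      then have "p \<in> closure \<Omega>" using P(1) F(4) by blast
      then obtain e where "cone_at \<Omega> p e c r" using cr(3) by blast
      then show "(\<integral>\<^sup>+x\<in>layer \<Omega> \<epsilon> \<inter> ball p r. ennreal ((\<phi> x)\<^sup>2) \<partial>lborel) \<le> ennreal (4 * \<epsilon> / (c * r) * (2 + r\<^sup>2)) * ?R"
        by (rule layer_estimate_local[OF \<Omega> _ \<epsilon>(1) \<phi>])
    qed
    also have "\<dots> = ennreal (real (card P) * (4 * \<epsilon> / (c * r) * (2 + r\<^sup>2))) * ?R"
      by (rule sum_const_ennreal_mult)
    also have "\<dots> \<le> ennreal (C * \<epsilon>) * ?R"
    proof (intro mult_right_mono ennreal_leI)
      have "real (card P) * (4 * \<epsilon> / (c * r) * (2 + r\<^sup>2)) = (real (card P) * (4 / (c * r) * (2 + r\<^sup>2))) * \<epsilon>"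
        unfolding divide_inverse by (simp only: mult_ac)
      then show "real (card P) * (4 * \<epsilon> / (c * r) * (2 + r\<^sup>2)) \<le> C * \<epsilon>"
        using \<epsilon> unfolding C_def distrib_right by linarith
    qed auto
    finally show ?thesis .
  qed
  show ?thesis using C main cr(2) by (intro exI[of _ C] exI[of _ "r / 2"]) auto
qed

subsection \<open>Surface measure and the trace inequality\<close>

definition hausdorff2_pre :: "real \<Rightarrow> pt set \<Rightarrow> ennreal" where
  "hausdorff2_pre \<delta> A = (INF C\<in>{C :: nat \<Rightarrow> pt set. A \<subseteq> (\<Union>n. C n) \<and> (\<forall>n. bounded (C n) \<and> diameter (C n) < \<delta>)}.
        (\<Sum>n. ennreal (pi * (diameter (C n) / 2)^2)))"

lemma hausdorff2_pre_antimono: "\<delta> \<le> \<delta>' \<Longrightarrow> hausdorff2_pre \<delta>' A \<le> hausdorff2_pre \<delta> A"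
  unfolding hausdorff2_pre_def by (rule INF_superset_mono) (auto intro: less_le_trans)

text \<open>The covering numbers grow as \<open>\<delta>\<close> decreases, so the supremum is the
  limit of a sequence. In that form bounds for finite weighted sums of covering numbers pass to the
  Hausdorff measure.\<close>

lemma hausdorff2_pre_tendsto: "(\<lambda>n. hausdorff2_pre (1 / real (Suc n)) A) \<longlonglongrightarrow> hausdorff2 A"
proof -
  have "hausdorff2 A = (SUP \<delta>\<in>{0<..}. hausdorff2_pre \<delta> A)"
    by (simp add: hausdorff2_def hausdorff2_pre_def)
  also have "\<dots> = (SUP n. hausdorff2_pre (1 / real (Suc n)) A)"
  proof (rule antisym)
    show "(SUP \<delta>\<in>{0<..}. hausdorff2_pre \<delta> A) \<le> (SUP n. hausdorff2_pre (1 / real (Suc n)) A)"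
    proof (rule SUP_least)
      fix \<delta> :: real assume "\<delta> \<in> {0<..}"
      then obtain n where "1 / real (Suc n) < \<delta>" using nat_approx_posE by auto
      then have "hausdorff2_pre \<delta> A \<le> hausdorff2_pre (1 / real (Suc n)) A"
        by (intro hausdorff2_pre_antimono) simp
      also have "\<dots> \<le> (SUP n. hausdorff2_pre (1 / real (Suc n)) A)" by (rule SUP_upper) simp
      finally show "hausdorff2_pre \<delta> A \<le> (SUP n. hausdorff2_pre (1 / real (Suc n)) A)" .
    qed
    show "(SUP n. hausdorff2_pre (1 / real (Suc n)) A) \<le> (SUP \<delta>\<in>{0<..}. hausdorff2_pre \<delta> A)"
      by (rule SUP_least) (auto intro!: SUP_upper)
  qed
  finally have eq: "hausdorff2 A = (SUP n. hausdorff2_pre (1 / real (Suc n)) A)" .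
  have "incseq (\<lambda>n. hausdorff2_pre (1 / real (Suc n)) A)"
    by (intro incseq_SucI hausdorff2_pre_antimono) (auto simp: divide_simps)
  then show ?thesis unfolding eq by (rule LIMSEQ_SUP)
qed

text \<open>Vitali's covering lemma: the balls of radius \<open>5\<epsilon>\<close> around centers of disjoint \<open>\<epsilon>\<close>-balls cover \<open>A\<close>,
  and the number of the latter is controlled by the volume of the \<open>\<epsilon>\<close>-neighbourhood.\<close>
lemma hausdorff2_pre_le_volume:
  assumes c0: "0 < c0" and \<epsilon>: "0 < \<epsilon>" "10 * \<epsilon> < \<delta>"
    and vol: "\<And>a. a \<in> A \<Longrightarrow> ennreal (c0 * \<epsilon> ^ 3) \<le> emeasure lborel (\<Omega> \<inter> cball a \<epsilon>)"
    and sub: "\<And>a. a \<in> A \<Longrightarrow> \<Omega> \<inter> cball a \<epsilon> \<subseteq> S"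
    and \<Omega>: "open \<Omega>" and S: "S \<in> sets borel"
  shows "hausdorff2_pre \<delta> A \<le> ennreal (25 * pi / (c0 * \<epsilon>)) * emeasure lborel S"
proof -
  obtain C where C: "countable C" "C \<subseteq> A"
     "pairwise (\<lambda>i j. disjnt (cball i \<epsilon>) (cball j \<epsilon>)) C"
     "A \<subseteq> (\<Union>i\<in>C. cball i (5 * \<epsilon>))"
    by (rule Vitali_covering_lemma_cballs[where S=A and K=A and a="\<lambda>a. a" and r="\<lambda>_. \<epsilon>" and B=\<epsilon>]) (use \<epsilon> in auto)
  \<comment> \<open>The countable set of centers is indexed with gaps; indices outside
    \<open>J\<close> contribute empty sets, of diameter zero.\<close>
  define J where "J = to_nat_on C ` C"
  define D where "D n = (if n \<in> J then cball (from_nat_into C n) (5 * \<epsilon>) else {})" for n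
  define E where "E n = (if n \<in> J then \<Omega> \<inter> cball (from_nat_into C n) \<epsilon> else {})" for n
  have fC: "from_nat_into C n \<in> C" if "n \<in> J" for n
    using that C(1) unfolding J_def by (auto simp: from_nat_into_to_nat_on)
  have inj: "n = m" if "n \<in> J" "m \<in> J" "from_nat_into C n = from_nat_into C m" for n m
    using that C(1) unfolding J_def by auto
  have "A \<subseteq> (\<Union>n. D n)"
  proof
    fix a assume "a \<in> A"
    then obtain i where i: "i \<in> C" "a \<in> cball i (5 * \<epsilon>)" using C(4) by blast
    have "to_nat_on C i \<in> J" using i by (simp add: J_def)
    then have "a \<in> D (to_nat_on C i)" unfolding D_def using i C(1) by simp
    then show "a \<in> (\<Union>n. D n)" by blast
  qed
  moreover have "bounded (D n) \<and> diameter (D n) < \<delta>" for n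
    using \<epsilon> by (simp add: D_def diameter_cball)
  ultimately have "hausdorff2_pre \<delta> A \<le> (\<Sum>n. ennreal (pi * (diameter (D n) / 2)^2))"
    unfolding hausdorff2_pre_def by (intro INF_lower) auto
  also have "\<dots> \<le> (\<Sum>n. ennreal (25 * pi / (c0 * \<epsilon>)) * emeasure lborel (E n))"
  proof (rule suminf_le)
    fix n
    show "ennreal (pi * (diameter (D n) / 2)^2) \<le> ennreal (25 * pi / (c0 * \<epsilon>)) * emeasure lborel (E n)"
    proof (cases "n \<in> J")
      case True
      \<comment> \<open>A covering ball of radius \<open>5 * \<epsilon>\<close> contributes
        \<open>25 * pi\<close> times the square of \<open>\<epsilon>\<close>, which is the factor in
        the claim times the guaranteed volume \<open>c0 * \<epsilon> ^ 3\<close>.\<close>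
      have "pi * (diameter (D n) / 2)^2 = 25 * pi / (c0 * \<epsilon>) * (c0 * \<epsilon> ^ 3)"
        using True \<epsilon> c0 by (simp add: D_def diameter_cball power2_eq_square power3_eq_cube)
      then have "ennreal (pi * (diameter (D n) / 2)^2) = ennreal (25 * pi / (c0 * \<epsilon>)) * ennreal (c0 * \<epsilon> ^ 3)"
        using c0 \<epsilon> by (simp only: ennreal_mult''[symmetric] zero_le_mult_iff less_imp_le zero_le_power simp_thms)
      also have "\<dots> \<le> ennreal (25 * pi / (c0 * \<epsilon>)) * emeasure lborel (E n)"
        using True vol fC C(2) by (intro mult_left_mono) (auto simp: E_def)
      finally show ?thesis .
    qed (simp add: D_def)
  qed auto
  also have "\<dots> = ennreal (25 * pi / (c0 * \<epsilon>)) * (\<Sum>n. emeasure lborel (E n))"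
    by (rule ennreal_suminf_cmult)
  also have "(\<Sum>n. emeasure lborel (E n)) = emeasure lborel (\<Union>n. E n)"
  proof (rule suminf_emeasure)
    show "range E \<subseteq> sets lborel" using \<Omega> by (auto simp: E_def)
    show "disjoint_family E"
    proof (unfold disjoint_family_on_def, intro ballI impI)
      fix m n :: nat assume "m \<noteq> n"
      show "E m \<inter> E n = {}"
      proof (cases "m \<in> J \<and> n \<in> J")
        case True
        then have "from_nat_into C m \<noteq> from_nat_into C n" using inj \<open>m \<noteq> n\<close> by blast
        then have "disjnt (cball (from_nat_into C m) \<epsilon>) (cball (from_nat_into C n) \<epsilon>)"
          using C(3) fC True by (auto simp: pairwise_def)
        then show ?thesis by (auto simp: E_def disjnt_def)
      qed (auto simp: E_def)
    qed
  qed
  also have "ennreal (25 * pi / (c0 * \<epsilon>)) * \<dots> \<le> ennreal (25 * pi / (c0 * \<epsilon>)) * emeasure lborel S"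
    using S sub fC C(2) by (intro mult_left_mono emeasure_mono) (auto simp: E_def split: if_splits)
  finally show ?thesis .
qed

section \<open>The surface measure and traces of smooth functions\<close>

lemma space_surf [simp]: "space (surf \<Omega>) = frontier \<Omega>"
  unfolding surf_def by (subst space_measure_of_conv) simp

lemma sets_surf: "sets (surf \<Omega>) = sets (restrict_space borel (frontier \<Omega>))"
proof -
  have "sets (restrict_space borel (frontier \<Omega>)) = sigma_sets (frontier \<Omega>) (sets (restrict_space borel (frontier \<Omega>)))"
    using sets.sigma_sets_eq[of "restrict_space borel (frontier \<Omega>)"] by (simp add: space_restrict_space)
  moreover have "sets (restrict_space borel (frontier \<Omega>)) \<subseteq> Pow (frontier \<Omega>)"
    using sets.space_closed[of "restrict_space borel (frontier \<Omega>)"] by (simp add: space_restrict_space)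
  ultimately show ?thesis unfolding surf_def by (subst sets_measure_of) auto
qed

text \<open>By the convention of \<open>measure_of\<close> the result is either the given set
  function on the measurable sets or zero, and the bound holds in both cases.\<close>

lemma emeasure_surf_le: "emeasure (surf \<Omega>) A \<le> hausdorff2 A"
  unfolding surf_def by (subst emeasure_measure_of_conv) auto

lemma measurable_surf_borel: "f \<in> borel_measurable borel \<Longrightarrow> f \<in> borel_measurable (surf \<Omega>)"
  using measurable_restrict_space1[of f borel borel "frontier \<Omega>"] measurable_cong_sets[OF sets_surf refl, of \<Omega> borel] by blast

text \<open>Bounds how many of the level bands of \<open>trace_inequality_eta\<close>, widened by
  one unit on each side, can contain the same value.\<close>

lemma card_overlap:
  fixes t :: real
  shows "card {k\<in>{..N}. real k - 1 \<le> t \<and> t \<le> real k + 2} \<le> 4"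
proof -
  have sub: "{k\<in>{..N}. real k - 1 \<le> t \<and> t \<le> real k + 2} \<subseteq> {nat \<lceil>t - 2\<rceil>..nat \<lceil>t - 2\<rceil> + 3}"
  proof
    fix k assume k: "k \<in> {k\<in>{..N}. real k - 1 \<le> t \<and> t \<le> real k + 2}"
    then have "t - 2 \<le> real_of_int (int k)" by simp
    then have "\<lceil>t - 2\<rceil> \<le> int k" by (rule ceiling_le)
    moreover have "int k \<le> \<lceil>t - 2\<rceil> + 3"
    proof -
      have "real k - 1 \<le> t" using k by simp
      then have "real k \<le> real_of_int \<lceil>t - 2\<rceil> + 3" using le_of_int_ceiling[of "t - 2"] by linarith
      then show ?thesis by linarith
    qed
    ultimately show "k \<in> {nat \<lceil>t - 2\<rceil>..nat \<lceil>t - 2\<rceil> + 3}" by auto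
  qed
  then have "card {k\<in>{..N}. real k - 1 \<le> t \<and> t \<le> real k + 2} \<le> card {nat \<lceil>t - 2\<rceil>..nat \<lceil>t - 2\<rceil> + 3}"
    by (intro card_mono) auto
  then show ?thesis by simp
qed

text \<open>The boundary is cut into bands \<open>A k\<close> on which \<open>\<phi>\<close> squared
  varies by at most \<open>\<eta>\<close>. The Hausdorff measure of a band is bounded by the volume
  of a nearby part of the layer divided by \<open>\<epsilon>\<close>, and there
  \<open>\<phi>\<close> squared is still close to the level. As the bands overlap at most four
  times, the sum is bounded by a layer integral over \<open>\<epsilon>\<close>, and the layer
  estimate cancels the \<open>\<epsilon>\<close>.\<close>

lemma trace_inequality_eta:
  assumes \<Omega>: "smooth_bounded_domain \<Omega>" and \<phi>: "Cinf_on UNIV \<phi>" and \<eta>: "0 < \<eta>"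
    and c0: "0 < c0" "0 < \<epsilon>0" "\<And>a \<epsilon>. a \<in> frontier \<Omega> \<Longrightarrow> 0 < \<epsilon> \<Longrightarrow> \<epsilon> < \<epsilon>0 \<Longrightarrow>
      ennreal (c0 * \<epsilon> ^ 3) \<le> emeasure lborel (\<Omega> \<inter> cball a \<epsilon>)"
    and C: "0 < C" "\<And>\<phi> \<epsilon>. Cinf_on UNIV \<phi> \<Longrightarrow> 0 < \<epsilon> \<Longrightarrow> \<epsilon> < \<epsilon>0 \<Longrightarrow>
      (\<integral>\<^sup>+x\<in>layer \<Omega> \<epsilon>. ennreal ((\<phi> x)\<^sup>2) \<partial>lborel)
      \<le> ennreal (C * \<epsilon>) * ((\<integral>\<^sup>+x\<in>\<Omega>. ennreal ((\<phi> x)\<^sup>2) \<partial>lborel) + dirichlet \<Omega> \<phi>)"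
  shows "(\<integral>\<^sup>+x. ennreal ((\<phi> x)\<^sup>2) \<partial>surf \<Omega>)
    \<le> ennreal (100 * pi * C / c0) * ((\<integral>\<^sup>+x\<in>\<Omega>. ennreal ((\<phi> x)\<^sup>2) \<partial>lborel) + dirichlet \<Omega> \<phi>
        + ennreal (2 * \<eta>) * emeasure lborel \<Omega>)"
proof -
  have op: "open \<Omega>" "bounded \<Omega>" using \<Omega> by (auto simp: smooth_bounded_domain_def)
  note F = frontier_properties[OF \<Omega>]
  note [measurable] = borel_measurable_Cinf[OF \<phi>] borel_open[OF op(1)]
  have cont: "continuous_on UNIV (\<lambda>x. (\<phi> x)\<^sup>2)" by (intro continuous_intros Cinf_on_continuous[OF \<phi>])
  obtain B where B: "\<And>x. x \<in> frontier \<Omega> \<Longrightarrow> (\<phi> x)\<^sup>2 \<le> B"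
    using bounded_continuous_on_bounded[OF cont compact_imp_bounded[OF F(1)]] by (metis abs_of_nonneg zero_le_power2)
  define N where "N = nat \<lceil>B / \<eta>\<rceil>"
  define A where "A k = {x\<in>frontier \<Omega>. real k * \<eta> \<le> (\<phi> x)\<^sup>2 \<and> (\<phi> x)\<^sup>2 \<le> (real k + 1) * \<eta>}" for k :: nat
  have Am[measurable]: "A k \<in> sets (surf \<Omega>)" for k
  proof -
    have "A k = frontier \<Omega> \<inter> {x. real k * \<eta> \<le> (\<phi> x)\<^sup>2 \<and> (\<phi> x)\<^sup>2 \<le> (real k + 1) * \<eta>}" by (auto simp: A_def)
    moreover have "{x. real k * \<eta> \<le> (\<phi> x)\<^sup>2 \<and> (\<phi> x)\<^sup>2 \<le> (real k + 1) * \<eta>} \<in> sets borel" by measurable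
    ultimately show ?thesis unfolding sets_surf sets_restrict_space by blast
  qed
  let ?c = "\<lambda>k::nat. ennreal ((real k + 1) * \<eta>)"
  have 1: "(\<integral>\<^sup>+x. ennreal ((\<phi> x)\<^sup>2) \<partial>surf \<Omega>) \<le> (\<Sum>k\<le>N. ?c k * emeasure (surf \<Omega>) (A k))"
  proof -
    have "(\<integral>\<^sup>+x. ennreal ((\<phi> x)\<^sup>2) \<partial>surf \<Omega>) \<le> (\<integral>\<^sup>+x. (\<Sum>k\<le>N. ?c k * indicator (A k) x) \<partial>surf \<Omega>)"
    proof (rule nn_integral_mono)
      fix x assume "x \<in> space (surf \<Omega>)"
      then have x: "x \<in> frontier \<Omega>" by simp
      define k where "k = nat \<lfloor>(\<phi> x)\<^sup>2 / \<eta>\<rfloor>"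
      have k1: "real k \<le> (\<phi> x)\<^sup>2 / \<eta>" "(\<phi> x)\<^sup>2 / \<eta> \<le> real k + 1" unfolding k_def using \<eta> by auto
      then have xk: "x \<in> A k" using x \<eta> by (auto simp: A_def field_simps)
      have "real k \<le> B / \<eta>" using k1(1) B[OF x] \<eta> by (meson divide_right_mono less_imp_le order_trans)
      then have "k \<le> N" unfolding N_def by linarith
      have "ennreal ((\<phi> x)\<^sup>2) \<le> ?c k * indicator (A k) x" using xk by (auto simp: A_def intro!: ennreal_leI)
      also have "\<dots> \<le> (\<Sum>k\<le>N. ?c k * indicator (A k) x)"
        using \<open>k \<le> N\<close> by (intro member_le_sum[where f="\<lambda>k. ?c k * indicator (A k) x"]) auto
      finally show "ennreal ((\<phi> x)\<^sup>2) \<le> (\<Sum>k\<le>N. ?c k * indicator (A k) x)" .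
    qed
    also have "\<dots> = (\<Sum>k\<le>N. ?c k * emeasure (surf \<Omega>) (A k))"
      by (subst nn_integral_sum) (auto simp: nn_integral_cmult_indicator)
    finally show ?thesis .
  qed
  also have "\<dots> \<le> (\<Sum>k\<le>N. ?c k * hausdorff2 (A k))"
    by (intro sum_mono mult_left_mono emeasure_surf_le) auto
  also have "\<dots> \<le> ennreal (100 * pi * C / c0) * ((\<integral>\<^sup>+x\<in>\<Omega>. ennreal ((\<phi> x)\<^sup>2) \<partial>lborel) + dirichlet \<Omega> \<phi>
        + ennreal (2 * \<eta>) * emeasure lborel \<Omega>)" (is "_ \<le> ?R")
  proof (rule LIMSEQ_le_const2)
    show "(\<lambda>n. \<Sum>k\<le>N. ?c k * hausdorff2_pre (1 / real (Suc n)) (A k)) \<longlonglongrightarrow> (\<Sum>k\<le>N. ?c k * hausdorff2 (A k))"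
      by (intro tendsto_sum ennreal_tendsto_cmult hausdorff2_pre_tendsto) auto
    have "(\<Sum>k\<le>N. ?c k * hausdorff2_pre \<delta> (A k)) \<le> ?R" if \<delta>: "\<delta> > 0" for \<delta>
    proof -
      obtain R where R: "\<And>x. x \<in> frontier \<Omega> \<Longrightarrow> norm x \<le> R"
        using compact_imp_bounded[OF F(1)] by (auto simp: bounded_iff)
      have "uniformly_continuous_on (cball 0 (R + 1)) (\<lambda>x. (\<phi> x)\<^sup>2)"
        by (rule compact_uniformly_continuous[OF continuous_on_subset[OF cont]]) auto
      then obtain d where d: "d > 0" "\<And>x y. x \<in> cball 0 (R + 1) \<Longrightarrow> y \<in> cball 0 (R + 1) \<Longrightarrow> dist y x < d \<Longrightarrow> dist ((\<phi> y)\<^sup>2) ((\<phi> x)\<^sup>2) < \<eta>"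
        unfolding uniformly_continuous_on_def using \<eta> by meson
      \<comment> \<open>Small enough for the volume and layer bounds, for covers of diameter below
        \<open>\<delta>\<close>, for the oscillation bound at distance \<open>d\<close>, and for
        staying within \<open>cball 0 (R + 1)\<close>.\<close>
      define \<epsilon> where "\<epsilon> = min (min (\<epsilon>0 / 2) (\<delta> / 20)) (min (d / 2) 1)"
      have \<epsilon>: "0 < \<epsilon>" "\<epsilon> < \<epsilon>0" "10 * \<epsilon> < \<delta>" "\<epsilon> < d" "\<epsilon> \<le> 1"
        using c0 \<delta> d by (auto simp: \<epsilon>_def min_def)
      have osc: "\<bar>(\<phi> x)\<^sup>2 - (\<phi> a)\<^sup>2\<bar> \<le> \<eta>" if "a \<in> frontier \<Omega>" "dist a x \<le> \<epsilon>" for a x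
      proof -
        have "norm x \<le> norm a + dist a x" using norm_triangle_sub[of x a] by (simp add: dist_norm norm_minus_commute)
        then have "x \<in> cball 0 (R + 1)" "a \<in> cball 0 (R + 1)" using R[of a] that \<epsilon> by auto
        then show ?thesis using d(2)[of a x] that \<epsilon> by (simp add: dist_real_def dist_commute)
      qed
      \<comment> \<open>The level band is widened by \<open>\<eta>\<close> on both sides, which is
        the oscillation of \<open>\<phi>\<close> squared over distance
        \<open>\<epsilon>\<close>.\<close>
      define S where "S k = {x\<in>layer \<Omega> \<epsilon>. (real k - 1) * \<eta> \<le> (\<phi> x)\<^sup>2 \<and> (\<phi> x)\<^sup>2 \<le> (real k + 2) * \<eta>}" for k :: nat
      have Lm[measurable]: "layer \<Omega> \<epsilon> \<in> sets borel" by (rule layer_borel[OF op(1)])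
      have Sm[measurable]: "S k \<in> sets borel" for k unfolding S_def by measurable
      have "?c k * hausdorff2_pre \<delta> (A k) \<le> ennreal (25 * pi / (c0 * \<epsilon>)) * (\<integral>\<^sup>+x. ennreal ((\<phi> x)\<^sup>2 + 2 * \<eta>) * indicator (S k) x \<partial>lborel)" for k
      proof -
        have "hausdorff2_pre \<delta> (A k) \<le> ennreal (25 * pi / (c0 * \<epsilon>)) * emeasure lborel (S k)"
        proof (rule hausdorff2_pre_le_volume[OF c0(1) \<epsilon>(1,3) _ _ op(1) Sm])
          fix a assume a: "a \<in> A k"
          then have af: "a \<in> frontier \<Omega>" by (simp add: A_def)
          then show "ennreal (c0 * \<epsilon> ^ 3) \<le> emeasure lborel (\<Omega> \<inter> cball a \<epsilon>)" by (intro c0(3) \<epsilon>)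
          show "\<Omega> \<inter> cball a \<epsilon> \<subseteq> S k"
          proof
            fix x assume x: "x \<in> \<Omega> \<inter> cball a \<epsilon>"
            then have "dist a x \<le> \<epsilon>" by simp
            then have "infdist x (frontier \<Omega>) \<le> \<epsilon>" using infdist_le[OF af, of x] by (simp add: dist_commute)
            moreover have "\<bar>(\<phi> x)\<^sup>2 - (\<phi> a)\<^sup>2\<bar> \<le> \<eta>" by (rule osc[OF af \<open>dist a x \<le> \<epsilon>\<close>])
            ultimately show "x \<in> S k" using x a by (auto simp: S_def layer_def A_def algebra_simps)
          qed
        qed
        then have "?c k * hausdorff2_pre \<delta> (A k) \<le> ?c k * (ennreal (25 * pi / (c0 * \<epsilon>)) * emeasure lborel (S k))"
          by (rule mult_left_mono) simp
        also have "\<dots> = ennreal (25 * pi / (c0 * \<epsilon>)) * (\<integral>\<^sup>+x. ?c k * indicator (S k) x \<partial>lborel)"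
          by (subst nn_integral_cmult_indicator) (auto simp: mult_ac)
        also have "\<dots> \<le> ennreal (25 * pi / (c0 * \<epsilon>)) * (\<integral>\<^sup>+x. ennreal ((\<phi> x)\<^sup>2 + 2 * \<eta>) * indicator (S k) x \<partial>lborel)"
        proof (intro mult_left_mono nn_integral_mono)
          fix x
          have "ennreal ((real k + 1) * \<eta>) \<le> ennreal ((\<phi> x)\<^sup>2 + 2 * \<eta>)" if "x \<in> S k"
            using that by (intro ennreal_leI) (simp add: S_def algebra_simps)
          then show "?c k * indicator (S k) x \<le> ennreal ((\<phi> x)\<^sup>2 + 2 * \<eta>) * indicator (S k) x"
            by (cases "x \<in> S k") auto
        qed auto
        finally show ?thesis .
      qed
      then have "(\<Sum>k\<le>N. ?c k * hausdorff2_pre \<delta> (A k))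
        \<le> (\<Sum>k\<le>N. ennreal (25 * pi / (c0 * \<epsilon>)) * (\<integral>\<^sup>+x. ennreal ((\<phi> x)\<^sup>2 + 2 * \<eta>) * indicator (S k) x \<partial>lborel))"
        by (intro sum_mono)
      also have "\<dots> = ennreal (25 * pi / (c0 * \<epsilon>)) * (\<integral>\<^sup>+x. (\<Sum>k\<le>N. ennreal ((\<phi> x)\<^sup>2 + 2 * \<eta>) * indicator (S k) x) \<partial>lborel)"
        by (subst nn_integral_sum) (auto simp: sum_distrib_left)
      \<comment> \<open>The additive constant is written as the square of
        \<open>sqrt (2 * \<eta>)\<close>, so that the layer estimate applies to it as well, as a
        constant smooth function with zero gradient.\<close>
      also have "\<dots> \<le> ennreal (25 * pi / (c0 * \<epsilon>)) * (\<integral>\<^sup>+x. 4 * (ennreal ((\<phi> x)\<^sup>2) * indicator (layer \<Omega> \<epsilon>) x) + 4 * (ennreal ((sqrt (2 * \<eta>))\<^sup>2) * indicator (layer \<Omega> \<epsilon>) x) \<partial>lborel)"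
      proof (intro mult_left_mono nn_integral_mono)
        fix x
        show "(\<Sum>k\<le>N. ennreal ((\<phi> x)\<^sup>2 + 2 * \<eta>) * indicator (S k) x) \<le> 4 * (ennreal ((\<phi> x)\<^sup>2) * indicator (layer \<Omega> \<epsilon>) x) + 4 * (ennreal ((sqrt (2 * \<eta>))\<^sup>2) * indicator (layer \<Omega> \<epsilon>) x)"
        proof (cases "x \<in> layer \<Omega> \<epsilon>")
          case True
          have "(\<Sum>k\<le>N. indicator (S k) x :: ennreal) = of_nat (card {k\<in>{..N}. x \<in> S k})"
            by (simp add: indicator_def sum.If_cases Int_def)
          also have "{k\<in>{..N}. x \<in> S k} = {k\<in>{..N}. real k - 1 \<le> (\<phi> x)\<^sup>2 / \<eta> \<and> (\<phi> x)\<^sup>2 / \<eta> \<le> real k + 2}"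
            using True \<eta> by (auto simp: S_def pos_le_divide_eq pos_divide_le_eq)
          also have "of_nat (card \<dots>) \<le> (of_nat 4 :: ennreal)" using card_overlap by (simp only: of_nat_le_iff)
          finally have "(\<Sum>k\<le>N. indicator (S k) x :: ennreal) \<le> 4" by simp
          then have "(\<Sum>k\<le>N. ennreal ((\<phi> x)\<^sup>2 + 2 * \<eta>) * indicator (S k) x) \<le> ennreal ((\<phi> x)\<^sup>2 + 2 * \<eta>) * 4"
            unfolding sum_distrib_left[symmetric] by (rule mult_left_mono) simp
          also have "\<dots> = 4 * ennreal ((\<phi> x)\<^sup>2) + 4 * ennreal (2 * \<eta>)"
            using \<eta> by (subst ennreal_plus) (auto simp: mult.commute distrib_right)
          finally show ?thesis using True \<eta> by simp
        qed (auto simp: S_def)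
      qed auto
      also have "\<dots> = ennreal (25 * pi / (c0 * \<epsilon>)) * (4 * (\<integral>\<^sup>+x\<in>layer \<Omega> \<epsilon>. ennreal ((\<phi> x)\<^sup>2) \<partial>lborel) + 4 * (\<integral>\<^sup>+x\<in>layer \<Omega> \<epsilon>. ennreal ((sqrt (2 * \<eta>))\<^sup>2) \<partial>lborel))"
        by (subst nn_integral_add) (auto simp: nn_integral_cmult)
      also have "\<dots> \<le> ennreal (25 * pi / (c0 * \<epsilon>)) * (4 * (ennreal (C * \<epsilon>) * ((\<integral>\<^sup>+x\<in>\<Omega>. ennreal ((\<phi> x)\<^sup>2) \<partial>lborel) + dirichlet \<Omega> \<phi>))
          + 4 * (ennreal (C * \<epsilon>) * ((\<integral>\<^sup>+x\<in>\<Omega>. ennreal ((sqrt (2 * \<eta>))\<^sup>2) \<partial>lborel) + dirichlet \<Omega> (\<lambda>_. sqrt (2 * \<eta>)))))"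
        by (intro mult_left_mono add_mono C(2) \<phi> Cinf_const \<epsilon>) auto
      also have "dirichlet \<Omega> (\<lambda>_. sqrt (2 * \<eta>)) = 0"
        by (simp add: dirichlet_def grad_def pd_const)
      also have "(\<integral>\<^sup>+x\<in>\<Omega>. ennreal ((sqrt (2 * \<eta>))\<^sup>2) \<partial>lborel) = ennreal (2 * \<eta>) * emeasure lborel \<Omega>"
        using \<eta> by (subst nn_integral_cmult_indicator) auto
      also have "ennreal (25 * pi / (c0 * \<epsilon>)) * (4 * (ennreal (C * \<epsilon>) * ((\<integral>\<^sup>+x\<in>\<Omega>. ennreal ((\<phi> x)\<^sup>2) \<partial>lborel) + dirichlet \<Omega> \<phi>))
          + 4 * (ennreal (C * \<epsilon>) * (ennreal (2 * \<eta>) * emeasure lborel \<Omega> + 0))) = ?R"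
      proof -
        have gen: "ennreal a * (4 * (ennreal b * X) + 4 * (ennreal b * (Y + 0))) = ennreal (a * 4 * b) * (X + Y)"
          if "0 \<le> a" "0 \<le> b" for a b X Y
          using that by (simp add: ennreal_mult distrib_left mult_ac)
        have "0 \<le> 25 * pi / (c0 * \<epsilon>)" "0 \<le> C * \<epsilon>" using c0(1) C(1) \<epsilon>(1) by auto
        note gen[OF this, of "(\<integral>\<^sup>+x\<in>\<Omega>. ennreal ((\<phi> x)\<^sup>2) \<partial>lborel) + dirichlet \<Omega> \<phi>"
            "ennreal (2 * \<eta>) * emeasure lborel \<Omega>"]
        moreover have "25 * pi / (c0 * \<epsilon>) * 4 * (C * \<epsilon>) = 100 * pi * C / c0"
          using c0(1) \<epsilon>(1) by (simp add: field_simps)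
        ultimately show ?thesis by simp
      qed
      finally show ?thesis .
    qed
    then show "\<exists>M. \<forall>n\<ge>M. (\<Sum>k\<le>N. ?c k * hausdorff2_pre (1 / real (Suc n)) (A k)) \<le> ?R" by auto
  qed
  finally show ?thesis .
qed

text \<open>The band width \<open>\<eta>\<close> enters only through an additive term, which is made
  arbitrarily small while the constant \<open>K\<close> stays fixed.\<close>

theorem trace_inequality:
  assumes \<Omega>: "smooth_bounded_domain \<Omega>"
  shows "\<exists>C>0. \<forall>\<phi>. Cinf_on UNIV \<phi> \<longrightarrow>
    (\<integral>\<^sup>+x. ennreal ((\<phi> x)\<^sup>2) \<partial>surf \<Omega>) \<le> ennreal (C * ((nL2 (lebesgue_on \<Omega>) \<phi>)\<^sup>2 + (nG \<Omega> \<phi>)\<^sup>2))"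
proof -
  have op: "open \<Omega>" "bounded \<Omega>" using \<Omega> by (auto simp: smooth_bounded_domain_def)
  obtain c0 \<epsilon>1 where c0: "0 < c0" "0 < \<epsilon>1" "\<And>a \<epsilon>. a \<in> frontier \<Omega> \<Longrightarrow> 0 < \<epsilon> \<Longrightarrow> \<epsilon> < \<epsilon>1 \<Longrightarrow>
      ennreal (c0 * \<epsilon> ^ 3) \<le> emeasure lborel (\<Omega> \<inter> cball a \<epsilon>)"
    using volume_near_frontier[OF \<Omega>] by blast
  obtain C \<epsilon>2 where C: "0 < C" "0 < \<epsilon>2" "\<And>\<phi> \<epsilon>. Cinf_on UNIV \<phi> \<Longrightarrow> 0 < \<epsilon> \<Longrightarrow> \<epsilon> < \<epsilon>2 \<Longrightarrow>
      (\<integral>\<^sup>+x\<in>layer \<Omega> \<epsilon>. ennreal ((\<phi> x)\<^sup>2) \<partial>lborel)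
      \<le> ennreal (C * \<epsilon>) * ((\<integral>\<^sup>+x\<in>\<Omega>. ennreal ((\<phi> x)\<^sup>2) \<partial>lborel) + dirichlet \<Omega> \<phi>)"
    using layer_estimate[OF \<Omega>] by blast
  define K where "K = 100 * pi * C / c0"
  have K: "0 < K" using c0 C by (simp add: K_def)
  show ?thesis
  proof (intro exI[of _ K] conjI allI impI)
    show "0 < K" by fact
    fix \<phi> :: "pt \<Rightarrow> real" assume \<phi>: "Cinf_on UNIV \<phi>"
    let ?n = "(nL2 (lebesgue_on \<Omega>) \<phi>)\<^sup>2 + (nG \<Omega> \<phi>)\<^sup>2"
    show "(\<integral>\<^sup>+x. ennreal ((\<phi> x)\<^sup>2) \<partial>surf \<Omega>) \<le> ennreal (K * ?n)"
    proof (rule ennreal_le_epsilon)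
      fix e :: real assume e: "0 < e"
      define m where "m = measure lborel \<Omega>"
      have m: "emeasure lborel \<Omega> = ennreal m" "0 \<le> m"
        using emeasure_bounded_finite[OF op(2)] by (auto simp: m_def emeasure_eq_ennreal_measure)
      \<comment> \<open>Makes the surplus \<open>K * (2 * \<eta> * m)\<close> at most
        \<open>e\<close>; the denominator uses \<open>m + 1\<close> so that it is positive for every
        \<open>m \<ge> 0\<close>.\<close>
      define \<eta> where "\<eta> = e / (2 * K * (m + 1))"
      have \<eta>: "0 < \<eta>" using e K m by (simp add: \<eta>_def)
      have "(\<integral>\<^sup>+x. ennreal ((\<phi> x)\<^sup>2) \<partial>surf \<Omega>)
        \<le> ennreal K * ((\<integral>\<^sup>+x\<in>\<Omega>. ennreal ((\<phi> x)\<^sup>2) \<partial>lborel) + dirichlet \<Omega> \<phi> + ennreal (2 * \<eta>) * emeasure lborel \<Omega>)"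
        unfolding K_def
        by (rule trace_inequality_eta[OF \<Omega> \<phi> \<eta> c0(1), of "min \<epsilon>1 \<epsilon>2"]) (use c0 C in auto)
      also have "\<dots> = ennreal (K * (?n + 2 * \<eta> * m))"
        unfolding m(1) nn_integral_square_eq_nL2[OF Cinf_on_continuous[OF \<phi>] op] dirichlet_eq_nG[OF \<phi> op]
        using \<eta> K m by (simp add: ennreal_mult'[symmetric] ennreal_plus[symmetric] del: ennreal_plus)
      also have "\<dots> \<le> ennreal (K * ?n + e)"
      proof (rule ennreal_leI)
        have m1: "m + 1 > 0" using m(2) by simp
        have "K * (2 * \<eta>) = e / (m + 1)" using K m1 by (simp add: \<eta>_def)
        then have "K * (2 * \<eta> * m) = e * (m / (m + 1))" by (simp add: mult.assoc[symmetric])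
        also have "\<dots> \<le> e * 1" using e m by (intro mult_left_mono) (auto simp: divide_le_eq)
        finally show "K * (?n + 2 * \<eta> * m) \<le> K * ?n + e" by (simp add: distrib_left)
      qed
      also have "\<dots> = ennreal (K * ?n) + ennreal e" using K e by (intro ennreal_plus) auto
      finally show "(\<integral>\<^sup>+x. ennreal ((\<phi> x)\<^sup>2) \<partial>surf \<Omega>) \<le> ennreal (K * ?n) + ennreal e" .
    qed
  qed
qed

text \<open>The trace inequality for the constant function 1.\<close>

lemma finite_measure_surf:
  assumes \<Omega>: "smooth_bounded_domain \<Omega>"
  shows "finite_measure (surf \<Omega>)"
proof
  obtain C where "(\<integral>\<^sup>+x. ennreal (((\<lambda>_. 1) x)\<^sup>2) \<partial>surf \<Omega>) \<le> ennreal (C * ((nL2 (lebesgue_on \<Omega>) (\<lambda>_. 1))\<^sup>2 + (nG \<Omega> (\<lambda>_. 1))\<^sup>2))"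
    using trace_inequality[OF \<Omega>] Cinf_const by blast
  then show "emeasure (surf \<Omega>) (space (surf \<Omega>)) \<noteq> \<infinity>" by (auto simp: top_unique)
qed

subsection \<open>Convolution\<close>

lemma clamp_diff_sq_le:
  fixes a :: real
  assumes "0 \<le> k"
  shows "(a - max (-k) (min k a))\<^sup>2 \<le> a\<^sup>2"
proof -
  have "\<bar>a - max (-k) (min k a)\<bar> \<le> \<bar>a\<bar>" using assms by (auto simp: max_def min_def)
  then show ?thesis by (simp add: abs_le_square_iff)
qed

text \<open>Two dominated limits: truncation at level \<open>k\<close> is dominated by
  \<open>u\<close> itself, and for fixed \<open>k\<close> the truncated approximants are dominated
  by a constant on the bounded set \<open>B\<close>. Each error is allowed
  \<open>\<epsilon> / 4\<close> because the square of a sum doubles it.\<close>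

lemma L2_approx_continuous:
  fixes u :: "'a::euclidean_space \<Rightarrow> real"
  assumes u[measurable]: "u \<in> borel_measurable borel" and fin: "(\<integral>\<^sup>+x. ennreal ((u x)\<^sup>2) \<partial>lborel) < \<infinity>"
    and B[measurable]: "B \<in> sets borel" and bB: "bounded B" and \<epsilon>: "0 < \<epsilon>"
  shows "\<exists>g. continuous_on UNIV g \<and> (\<integral>\<^sup>+x\<in>B. ennreal ((u x - g x)\<^sup>2) \<partial>lborel) < ennreal \<epsilon>"
proof -
  define tr where "tr k a = max (- real k) (min (real k) a)" for k :: nat and a :: real
  have trm[measurable]: "(\<lambda>x. tr k (f x)) \<in> borel_measurable M" if [measurable]: "f \<in> borel_measurable M" for k M and f :: "'a \<Rightarrow> real"
    unfolding tr_def by measurable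
  have "(\<lambda>k. \<integral>\<^sup>+x. ennreal ((u x - tr k (u x))\<^sup>2) \<partial>lborel) \<longlonglongrightarrow> (\<integral>\<^sup>+x. 0 \<partial>(lborel :: 'a measure))"
  proof (rule nn_integral_dominated_convergence[where w="\<lambda>x. ennreal ((u x)\<^sup>2)"])
    show "AE x in lborel. ennreal ((u x - tr k (u x))\<^sup>2) \<le> ennreal ((u x)\<^sup>2)" for k
      unfolding tr_def by (intro AE_I2 ennreal_leI clamp_diff_sq_le) simp
    show "AE x in lborel. (\<lambda>k. ennreal ((u x - tr k (u x))\<^sup>2)) \<longlonglongrightarrow> 0"
    proof (intro AE_I2)
      fix x
      obtain N :: nat where N: "\<bar>u x\<bar> \<le> real N" using real_arch_simple by blast
      have "\<forall>\<^sub>F k in sequentially. 0 = ennreal ((u x - tr k (u x))\<^sup>2)"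
        using eventually_ge_at_top[of N]
      proof eventually_elim
        case (elim k)
        then have "\<bar>u x\<bar> \<le> real k" using N by linarith
        then show ?case by (auto simp: tr_def max_def min_def)
      qed
      then show "(\<lambda>k. ennreal ((u x - tr k (u x))\<^sup>2)) \<longlonglongrightarrow> 0"
        by (rule Lim_transform_eventually[rotated]) simp
    qed
  qed (use fin in \<open>auto\<close>)
  then have "\<forall>\<^sub>F k in sequentially. (\<integral>\<^sup>+x. ennreal ((u x - tr k (u x))\<^sup>2) \<partial>lborel) < ennreal (\<epsilon> / 4)"
    using \<epsilon> by (intro order_tendstoD(2)) auto
  then obtain k where k: "(\<integral>\<^sup>+x. ennreal ((u x - tr k (u x))\<^sup>2) \<partial>lborel) < ennreal (\<epsilon> / 4)"
    using eventually_happens'[OF sequentially_bot] by blast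
  \<comment> \<open>Unfolding \<open>measurable_on\<close> yields continuous functions converging to
    \<open>u\<close> off a negligible set, but without any bound; applying \<open>tr k\<close> to
    them supplies the domination.\<close>
  have "u measurable_on UNIV"
    by (rule lebesgue_measurable_imp_measurable_on) (auto simp: lebesgue_on_UNIV_eq measurable_completion)
  then obtain N g where N: "negligible N" and g: "\<And>n. continuous_on UNIV (g n)" and lim: "\<And>x. x \<notin> N \<Longrightarrow> (\<lambda>n. g n x) \<longlonglongrightarrow> u x"
    unfolding measurable_on_def by auto
  have gm[measurable]: "g n \<in> borel_measurable borel" for n by (rule borel_measurable_continuous_onI[OF g])
  have "(\<lambda>n. \<integral>\<^sup>+x. ennreal ((tr k (u x) - tr k (g n x))\<^sup>2) * indicator B x \<partial>lborel) \<longlonglongrightarrow> (\<integral>\<^sup>+x. 0 \<partial>(lborel :: 'a measure))"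
  proof (rule nn_integral_dominated_convergence[where w="\<lambda>x. ennreal ((2 * real k)\<^sup>2) * indicator B x"])
    show "AE x in lborel. ennreal ((tr k (u x) - tr k (g n x))\<^sup>2) * indicator B x \<le> ennreal ((2 * real k)\<^sup>2) * indicator B x" for n
    proof (intro AE_I2 mult_right_mono ennreal_leI)
      fix x
      have "\<bar>tr k (u x) - tr k (g n x)\<bar> \<le> \<bar>2 * real k\<bar>" by (auto simp: tr_def max_def min_def)
      then show "(tr k (u x) - tr k (g n x))\<^sup>2 \<le> (2 * real k)\<^sup>2" by (simp only: abs_le_square_iff)
    qed auto
    show "(\<integral>\<^sup>+x. ennreal ((2 * real k)\<^sup>2) * indicator B x \<partial>lborel) < \<infinity>"
      using emeasure_bounded_finite[OF bB] by (simp add: nn_integral_cmult_indicator ennreal_mult_less_top)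
    have "AE x in lborel. x \<notin> N"
      using N unfolding negligible_iff_null_sets by (metis AE_not_in AE_completion_iff)
    then show "AE x in lborel. (\<lambda>n. ennreal ((tr k (u x) - tr k (g n x))\<^sup>2) * indicator B x) \<longlonglongrightarrow> 0"
    proof eventually_elim
      case (elim x)
      have "(\<lambda>n. (tr k (u x) - tr k (g n x))\<^sup>2) \<longlonglongrightarrow> (tr k (u x) - tr k (u x))\<^sup>2"
        unfolding tr_def by (intro tendsto_intros lim[OF elim])
      then have "(\<lambda>n. ennreal ((tr k (u x) - tr k (g n x))\<^sup>2)) \<longlonglongrightarrow> ennreal 0" by (intro tendsto_ennrealI) simp
      then show ?case by (cases "x \<in> B") auto
    qed
  qed auto
  then have "\<forall>\<^sub>F n in sequentially. (\<integral>\<^sup>+x. ennreal ((tr k (u x) - tr k (g n x))\<^sup>2) * indicator B x \<partial>lborel) < ennreal (\<epsilon> / 4)"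
    using \<epsilon> by (intro order_tendstoD(2)) auto
  then obtain n where n: "(\<integral>\<^sup>+x. ennreal ((tr k (u x) - tr k (g n x))\<^sup>2) * indicator B x \<partial>lborel) < ennreal (\<epsilon> / 4)"
    using eventually_happens'[OF sequentially_bot] by blast
  have "(\<integral>\<^sup>+x\<in>B. ennreal ((u x - tr k (g n x))\<^sup>2) \<partial>lborel)
    \<le> (\<integral>\<^sup>+x. 2 * ennreal ((u x - tr k (u x))\<^sup>2) + 2 * (ennreal ((tr k (u x) - tr k (g n x))\<^sup>2) * indicator B x) \<partial>lborel)"
  proof (rule nn_integral_mono)
    fix x
    have "ennreal ((u x - tr k (g n x))\<^sup>2) \<le> 2 * ennreal ((u x - tr k (u x))\<^sup>2) + 2 * ennreal ((tr k (u x) - tr k (g n x))\<^sup>2)"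
      using sq_split_ennreal[of "u x - tr k (g n x)" "u x - tr k (u x)"] by (simp add: power2_commute)
    then show "ennreal ((u x - tr k (g n x))\<^sup>2) * indicator B x
      \<le> 2 * ennreal ((u x - tr k (u x))\<^sup>2) + 2 * (ennreal ((tr k (u x) - tr k (g n x))\<^sup>2) * indicator B x)"
      by (cases "x \<in> B") auto
  qed
  also have "\<dots> = 2 * (\<integral>\<^sup>+x. ennreal ((u x - tr k (u x))\<^sup>2) \<partial>lborel) + 2 * (\<integral>\<^sup>+x. ennreal ((tr k (u x) - tr k (g n x))\<^sup>2) * indicator B x \<partial>lborel)"
    by (subst nn_integral_add) (auto simp: nn_integral_cmult)
  also have "\<dots> < 2 * ennreal (\<epsilon> / 4) + 2 * ennreal (\<epsilon> / 4)"
    using k n by (intro add_strict_mono ennreal_mult_strict_left_mono) auto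
  also have "\<dots> = ennreal (\<epsilon> / 2) + ennreal (\<epsilon> / 2)"
    using ennreal_mult'[of 2 "\<epsilon> / 4"] by simp
  also have "\<dots> = ennreal \<epsilon>" using ennreal_plus[of "\<epsilon> / 2" "\<epsilon> / 2"] \<epsilon> by simp
  finally have "(\<integral>\<^sup>+x\<in>B. ennreal ((u x - tr k (g n x))\<^sup>2) \<partial>lborel) < ennreal \<epsilon>" .
  moreover have "continuous_on UNIV (\<lambda>x. tr k (g n x))" unfolding tr_def by (intro continuous_intros g)
  ultimately show ?thesis by blast
qed

text \<open>Mean square closeness to a continuous function survives translation, and the continuous
  function is uniformly continuous on a ball containing everything that matters.\<close>

lemma L2_translation_continuous:
  fixes u :: "'a::euclidean_space \<Rightarrow> real"
  assumes u[measurable]: "u \<in> borel_measurable borel" and fin: "(\<integral>\<^sup>+x. ennreal ((u x)\<^sup>2) \<partial>lborel) < \<infinity>"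
    and supp: "\<And>x. norm x > R \<Longrightarrow> u x = 0" and \<epsilon>: "0 < \<epsilon>"
  shows "\<exists>\<delta>>0. \<forall>z. norm z < \<delta> \<longrightarrow> (\<integral>\<^sup>+x. ennreal ((u (x - z) - u x)\<^sup>2) \<partial>lborel) \<le> ennreal \<epsilon>"
proof -
  \<comment> \<open>The margin 2 contains all \<open>x\<close> with norm at most
    \<open>R + 1\<close> together with their translates by less than 1; for larger \<open>x\<close>
    both values of \<open>u\<close> vanish.\<close>
  define B where "B = cball (0::'a) (R + 2)"
  have B[measurable]: "B \<in> sets borel" by (simp add: B_def)
  obtain g where g: "continuous_on UNIV g" and gu: "(\<integral>\<^sup>+x\<in>B. ennreal ((u x - g x)\<^sup>2) \<partial>lborel) < ennreal (\<epsilon> / 16)"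
    using L2_approx_continuous[OF u fin B, of "\<epsilon> / 16"] \<epsilon> by (auto simp: B_def)
  have gm[measurable]: "g \<in> borel_measurable borel" by (rule borel_measurable_continuous_onI[OF g])
  define m where "m = measure lborel B"
  have m: "emeasure lborel B = ennreal m" "0 \<le> m"
    using emeasure_bounded_finite[of B] by (auto simp: m_def B_def emeasure_eq_ennreal_measure)
  \<comment> \<open>Chosen so that the uniform continuity term contributes at most
    \<open>\<epsilon> / 4\<close>; the two approximation terms contribute
    \<open>\<epsilon> / 4\<close> each.\<close>
  define \<eta> where "\<eta> = sqrt (\<epsilon> / (16 * (m + 1)))"
  have \<eta>: "0 < \<eta>" using \<epsilon> m by (simp add: \<eta>_def)
  have "uniformly_continuous_on B g"
    unfolding B_def by (rule compact_uniformly_continuous[OF continuous_on_subset[OF g]]) auto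
  then obtain d where d: "d > 0" "\<And>x y. x \<in> B \<Longrightarrow> y \<in> B \<Longrightarrow> dist y x < d \<Longrightarrow> dist (g y) (g x) < \<eta>"
    unfolding uniformly_continuous_on_def using \<eta> by meson
  have "(\<integral>\<^sup>+x. ennreal ((u (x - z) - u x)\<^sup>2) \<partial>lborel) \<le> ennreal \<epsilon>" if z: "norm z < min d 1" for z
  proof -
    let ?f = "\<lambda>x. ennreal ((u x - g x)\<^sup>2) * indicator B x"
    have pt: "ennreal ((u (x - z) - u x)\<^sup>2) \<le> 4 * ?f (x + (- z)) + (4 * ?f x + ennreal (4 * \<eta>\<^sup>2) * indicator B x)" for x
    proof (cases "norm x \<le> R + 1")
      case True
      have "norm (x - z) \<le> norm x + norm z" by (rule norm_triangle_ineq4)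
      then have xB: "x \<in> B" "x - z \<in> B" using True z by (auto simp: B_def)
      have "\<bar>g (x - z) - g x\<bar> < \<eta>" using d(2)[OF xB] z by (simp add: dist_norm)
      then have "(g (x - z) - g x)\<^sup>2 \<le> \<eta>\<^sup>2" using abs_le_square_iff[of "g (x - z) - g x" \<eta>] \<eta> by simp
      moreover have "(u (x - z) - u x)\<^sup>2 \<le> 4 * (u (x - z) - g (x - z))\<^sup>2 + (4 * (u x - g x)\<^sup>2 + 4 * (g (x - z) - g x)\<^sup>2)"
      proof -
        have sq3: "(a + b + c)\<^sup>2 \<le> 4 * a\<^sup>2 + (4 * b\<^sup>2 + 4 * c\<^sup>2)" for a b c :: real
        proof -
          have "0 \<le> (a - b)\<^sup>2 + (b - c)\<^sup>2 + (a - c)\<^sup>2" by simp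
          also have "\<dots> = 3 * a\<^sup>2 + 3 * b\<^sup>2 + 3 * c\<^sup>2 - (a + b + c)\<^sup>2" by (simp add: power2_eq_square algebra_simps)
          finally show ?thesis using zero_le_power2[of a] zero_le_power2[of b] zero_le_power2[of c] by linarith
        qed
        from sq3[of "u (x - z) - g (x - z)" "- (u x - g x)" "g (x - z) - g x"] show ?thesis
          by (simp add: power2_commute)
      qed
      ultimately have "(u (x - z) - u x)\<^sup>2 \<le> 4 * (u (x - z) - g (x - z))\<^sup>2 + (4 * (u x - g x)\<^sup>2 + 4 * \<eta>\<^sup>2)" by linarith
      then have "ennreal ((u (x - z) - u x)\<^sup>2) \<le> ennreal (4 * (u (x - z) - g (x - z))\<^sup>2 + (4 * (u x - g x)\<^sup>2 + 4 * \<eta>\<^sup>2))"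
        by (rule ennreal_leI)
      also have "\<dots> = 4 * ennreal ((u (x - z) - g (x - z))\<^sup>2) + (4 * ennreal ((u x - g x)\<^sup>2) + ennreal (4 * \<eta>\<^sup>2))"
        by (simp add: ennreal_plus ennreal_mult')
      finally show ?thesis using xB by simp
    next
      case False
      have "norm x \<le> norm (x - z) + norm z" using norm_triangle_sub[of x z] by linarith
      then have "norm (x - z) > R" "norm x > R" using False z by auto
      then show ?thesis using supp by simp
    qed
    have "(\<integral>\<^sup>+x. ennreal ((u (x - z) - u x)\<^sup>2) \<partial>lborel) \<le> (\<integral>\<^sup>+x. 4 * ?f (x + (- z)) + (4 * ?f x + ennreal (4 * \<eta>\<^sup>2) * indicator B x) \<partial>lborel)"
      by (intro nn_integral_mono pt)
    also have "\<dots> = 4 * (\<integral>\<^sup>+x. ?f (x + (- z)) \<partial>lborel) + (4 * (\<integral>\<^sup>+x. ?f x \<partial>lborel) + ennreal (4 * \<eta>\<^sup>2) * emeasure lborel B)"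
      by (subst nn_integral_add, measurable, subst nn_integral_add, measurable)
         (simp add: nn_integral_cmult nn_integral_cmult_indicator del: diff_conv_add_uminus)
    also have "(\<integral>\<^sup>+x. ?f (x + (- z)) \<partial>lborel) = (\<integral>\<^sup>+x. ?f x \<partial>lborel)"
      by (rule nn_integral_translate) measurable
    also have "4 * (\<integral>\<^sup>+x. ?f x \<partial>lborel) + (4 * (\<integral>\<^sup>+x. ?f x \<partial>lborel) + ennreal (4 * \<eta>\<^sup>2) * emeasure lborel B)
        \<le> 4 * ennreal (\<epsilon> / 16) + (4 * ennreal (\<epsilon> / 16) + ennreal (4 * \<eta>\<^sup>2) * ennreal m)"
      unfolding m(1) using gu by (intro add_mono mult_left_mono) auto
    also have "\<dots> = ennreal (4 * (\<epsilon> / 16) + (4 * (\<epsilon> / 16) + 4 * \<eta>\<^sup>2 * m))"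
      using \<epsilon> m(2) by (simp only: ennreal_plus ennreal_mult' ennreal_numeral mult_nonneg_nonneg add_nonneg_nonneg zero_le_power2 zero_le_numeral divide_nonneg_nonneg less_imp_le)
    also have "\<dots> \<le> ennreal \<epsilon>"
    proof (rule ennreal_leI)
      have "\<eta>\<^sup>2 = \<epsilon> / (16 * (m + 1))" unfolding \<eta>_def using \<epsilon> m(2) by (intro real_sqrt_pow2) simp
      moreover have "m + 1 \<noteq> 0" using m(2) by simp
      ultimately have "4 * \<eta>\<^sup>2 * m = (\<epsilon> / 4) * (m / (m + 1))"
        by (simp add: divide_simps) (auto simp: algebra_simps)
      also have "\<dots> \<le> (\<epsilon> / 4) * 1" using \<epsilon> m(2) by (intro mult_left_mono) (auto simp: divide_le_eq)
      finally show "4 * (\<epsilon> / 16) + (4 * (\<epsilon> / 16) + 4 * \<eta>\<^sup>2 * m) \<le> \<epsilon>" using \<epsilon> by simp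
    qed
    finally show ?thesis .
  qed
  then show ?thesis using d(1) by (intro exI[of _ "min d 1"]) auto
qed

section \<open>Convolution with smooth kernels\<close>

definition conv :: "('a::euclidean_space \<Rightarrow> real) \<Rightarrow> ('a \<Rightarrow> real) \<Rightarrow> 'a \<Rightarrow> real" where
  "conv K u x = (\<integral>y. K (x - y) * u y \<partial>lborel)"

definition kernel :: "('a::euclidean_space \<Rightarrow> real) \<Rightarrow> bool" where
  "kernel K \<longleftrightarrow> Cinf_on UNIV K \<and> (\<exists>R. \<forall>x. norm x > R \<longrightarrow> K x = 0)"

lemma pd_eq_0_open:
  assumes "open S" "x \<in> S" "\<And>y. y \<in> S \<Longrightarrow> f y = 0"
  shows "pd e f x = 0"
proof (rule pd_eqI)
  have "open ((\<lambda>s::real. x + s *\<^sub>R e) -` S)"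
    by (intro open_vimage assms continuous_intros)
  moreover have "((\<lambda>s::real. 0::real) has_real_derivative 0) (at 0)" by simp
  ultimately show "((\<lambda>s. f (x + s *\<^sub>R e)) has_real_derivative 0) (at 0)"
    using assms by (elim has_field_derivative_transform_within_open[rotated]) auto
qed

lemma kernel_pd:
  assumes "kernel K" "e \<in> Basis"
  shows "kernel (pd e K)"
proof -
  obtain R where R: "\<And>x. norm x > R \<Longrightarrow> K x = 0" using assms by (auto simp: kernel_def)
  have "pd e K x = 0" if "norm x > R" for x
    by (rule pd_eq_0_open[of "{x. norm x > R}"]) (use that R in \<open>auto intro!: open_Collect_less continuous_intros\<close>)
  then show ?thesis using assms Cinf_on_pd by (auto simp: kernel_def)
qed

lemma kernel_bounded:
  assumes "kernel K"
  obtains M where "0 \<le> M" "\<And>x. \<bar>K x\<bar> \<le> M"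
proof -
  obtain R where R: "\<And>x. norm x > R \<Longrightarrow> K x = 0" using assms by (auto simp: kernel_def)
  have "continuous_on UNIV K" using assms by (auto simp: kernel_def intro: Cinf_on_continuous)
  then obtain M where M: "\<And>x. x \<in> cball 0 R \<Longrightarrow> \<bar>K x\<bar> \<le> M"
    using bounded_continuous_on_bounded[OF _ bounded_cball] by metis
  have "\<bar>K x\<bar> \<le> max 0 M" for x
    using M[of x] R[of x] by (cases "norm x \<le> R") auto
  then show ?thesis using that[of "max 0 M"] by simp
qed

lemma kernel_measurable: "kernel K \<Longrightarrow> K \<in> borel_measurable borel"
  by (auto simp: kernel_def intro: borel_measurable_Cinf)

lemma conv_integrable:
  fixes K :: "'a::euclidean_space \<Rightarrow> real"
  assumes K: "kernel K" and u: "integrable lborel u"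
  shows "integrable lborel (\<lambda>y. K (x - y) * u y)"
proof -
  note [measurable] = kernel_measurable[OF K] borel_measurable_integrable[OF u]
  obtain M where M: "0 \<le> M" "\<And>x. \<bar>K x\<bar> \<le> M" using kernel_bounded[OF K] by blast
  show ?thesis
  proof (rule Bochner_Integration.integrable_bound)
    show "integrable lborel (\<lambda>y. M * \<bar>u y\<bar>)" using u by auto
    show "AE y in lborel. norm (K (x - y) * u y) \<le> norm (M * \<bar>u y\<bar>)"
      using M by (intro AE_I2) (auto simp: abs_mult intro!: mult_right_mono)
  qed measurable
qed

lemma conv_continuous:
  fixes K :: "'a::euclidean_space \<Rightarrow> real"
  assumes K: "kernel K" and u: "integrable lborel u"
  shows "continuous_on UNIV (conv K u)"
proof (rule continuous_at_imp_continuous_on, rule ballI)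
  fix x :: 'a
  note [measurable] = kernel_measurable[OF K] borel_measurable_integrable[OF u]
  obtain M where M: "0 \<le> M" "\<And>x. \<bar>K x\<bar> \<le> M" using kernel_bounded[OF K] by blast
  have Kc: "isCont K y" for y
    using K Cinf_on_continuous[of UNIV K] by (auto simp: kernel_def continuous_on_eq_continuous_at)
  show "isCont (conv K u) x"
    unfolding continuous_at_sequentially o_def conv_def
  proof (intro allI impI)
    fix X :: "nat \<Rightarrow> 'a" assume X: "X \<longlonglongrightarrow> x"
    show "(\<lambda>n. \<integral>y. K (X n - y) * u y \<partial>lborel) \<longlonglongrightarrow> (\<integral>y. K (x - y) * u y \<partial>lborel)"
    proof (rule integral_dominated_convergence[where w="\<lambda>y. M * \<bar>u y\<bar>"])
      show "AE y in lborel. (\<lambda>n. K (X n - y) * u y) \<longlonglongrightarrow> K (x - y) * u y"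
        by (intro AE_I2 tendsto_intros isCont_tendsto_compose[OF Kc] X)
      show "AE y in lborel. norm (K (X n - y) * u y) \<le> M * \<bar>u y\<bar>" for n
        using M by (intro AE_I2) (auto simp: abs_mult intro!: mult_right_mono)
    qed (use u in \<open>auto\<close>)
  qed
qed

text \<open>Differentiation under the integral: by the mean value theorem the difference quotients
  of \<open>K\<close> are bounded by the bound \<open>M\<close> of its partial derivative, so
  dominated convergence applies.\<close>

lemma conv_has_pd:
  fixes K :: "'a::euclidean_space \<Rightarrow> real"
  assumes K: "kernel K" and u: "integrable lborel u" and e: "e \<in> Basis"
  shows "((\<lambda>s. conv K u (x + s *\<^sub>R e)) has_real_derivative conv (pd e K) u x) (at 0)"
proof -
  note [measurable] = kernel_measurable[OF K] kernel_measurable[OF kernel_pd[OF K e]] borel_measurable_integrable[OF u]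
  have KC: "Cinf_on UNIV K" using K by (simp add: kernel_def)
  obtain M where M: "0 \<le> M" "\<And>x. \<bar>pd e K x\<bar> \<le> M" using kernel_bounded[OF kernel_pd[OF K e]] by blast
  have lip: "\<bar>K (y + h *\<^sub>R e) - K y\<bar> \<le> M * \<bar>h\<bar>" for y h
  proof -
    have der: "((\<lambda>s. K (y + s *\<^sub>R e)) has_real_derivative pd e K (y + s *\<^sub>R e)) (at s)" for s
      by (rule Cinf_on_shift_derivative[OF KC e UNIV_I])
    have "norm (K (y + h *\<^sub>R e) - K (y + 0 *\<^sub>R e)) \<le> M * norm (h - 0)"
      by (rule field_differentiable_bound[of UNIV "\<lambda>s. K (y + s *\<^sub>R e)" "\<lambda>s. pd e K (y + s *\<^sub>R e)"])
         (use der M in auto)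
    then show ?thesis by simp
  qed
  have "((\<lambda>h. (conv K u (x + (0 + h) *\<^sub>R e) - conv K u (x + 0 *\<^sub>R e)) / h) \<longlongrightarrow> conv (pd e K) u x) (at 0)"
    unfolding LIMSEQ_SEQ_conv[symmetric]
  proof (intro allI impI)
    fix S :: "nat \<Rightarrow> real" assume S: "(\<forall>n. S n \<noteq> 0) \<and> S \<longlonglongrightarrow> 0"
    have eq: "(conv K u (x + (0 + S n) *\<^sub>R e) - conv K u (x + 0 *\<^sub>R e)) / S n
        = (\<integral>y. (K ((x - y) + S n *\<^sub>R e) - K (x - y)) / S n * u y \<partial>lborel)" for n
    proof -
      have "conv K u (x + (0 + S n) *\<^sub>R e) - conv K u (x + 0 *\<^sub>R e) = (\<integral>y. K (x + S n *\<^sub>R e - y) * u y - K (x - y) * u y \<partial>lborel)"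
        unfolding conv_def by (simp add: conv_integrable[OF K u])
      also have "\<dots> / S n = (\<integral>y. (K (x + S n *\<^sub>R e - y) * u y - K (x - y) * u y) / S n \<partial>lborel)"
        by simp
      also have "\<dots> = (\<integral>y. (K ((x - y) + S n *\<^sub>R e) - K (x - y)) / S n * u y \<partial>lborel)"
        by (intro Bochner_Integration.integral_cong) (auto simp: algebra_simps diff_divide_distrib)
      finally show ?thesis .
    qed
    show "(\<lambda>n. (conv K u (x + (0 + S n) *\<^sub>R e) - conv K u (x + 0 *\<^sub>R e)) / S n) \<longlonglongrightarrow> conv (pd e K) u x"
      unfolding eq unfolding conv_def
    proof (rule integral_dominated_convergence[where w="\<lambda>y. M * \<bar>u y\<bar>"])
      show "AE y in lborel. (\<lambda>n. (K ((x - y) + S n *\<^sub>R e) - K (x - y)) / S n * u y) \<longlonglongrightarrow> pd e K (x - y) * u y"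
      proof (intro AE_I2 tendsto_mult tendsto_const)
        fix y
        have "((\<lambda>h. (K ((x - y) + (0 + h) *\<^sub>R e) - K ((x - y) + 0 *\<^sub>R e)) / h) \<longlongrightarrow> pd e K (x - y)) (at 0)"
          using Cinf_on_has_pd[OF KC e UNIV_I, of "x - y"] unfolding DERIV_def .
        then show "(\<lambda>n. (K ((x - y) + S n *\<^sub>R e) - K (x - y)) / S n) \<longlonglongrightarrow> pd e K (x - y)"
          unfolding LIMSEQ_SEQ_conv[symmetric] using S by simp
      qed
      show "AE y in lborel. norm ((K ((x - y) + S n *\<^sub>R e) - K (x - y)) / S n * u y) \<le> M * \<bar>u y\<bar>" for n
      proof (rule AE_I2)
        fix y
        have "\<bar>K ((x - y) + S n *\<^sub>R e) - K (x - y)\<bar> / \<bar>S n\<bar> \<le> M"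
          using lip[of "x - y" "S n"] S by (simp add: divide_le_eq)
        from mult_right_mono[OF this abs_ge_zero[of "u y"]]
        show "norm ((K ((x - y) + S n *\<^sub>R e) - K (x - y)) / S n * u y) \<le> M * \<bar>u y\<bar>"
          by (simp add: abs_mult)
      qed
    qed (use u in \<open>auto\<close>)
  qed
  then show ?thesis unfolding DERIV_def .
qed

text \<open>Derivatives fall on the kernel, so the convolutions of a fixed \<open>u\<close> with all
  kernels form a class closed under differentiation.\<close>

lemma Cinf_conv:
  fixes K :: "'a::euclidean_space \<Rightarrow> real"
  assumes K: "kernel K" and u: "integrable lborel u"
  shows "Cinf_on UNIV (conv K u)"
proof (rule Cinf_coinduct[of "\<lambda>F. \<exists>K. kernel K \<and> F = conv K u"])
  show "\<exists>K'. kernel K' \<and> conv K u = conv K' u" using K by blast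
next
  fix F assume "\<exists>K. kernel K \<and> F = conv K u"
  then show "continuous_on UNIV F" using conv_continuous[OF _ u] by blast
next
  fix F and e :: 'a
  assume "\<exists>K. kernel K \<and> F = conv K u" and e: "e \<in> Basis"
  then obtain K where "kernel K" "F = conv K u" by blast
  then show "\<exists>f'. (\<exists>K. kernel K \<and> f' = conv K u) \<and> (\<forall>x. ((\<lambda>s. F (x + s *\<^sub>R e)) has_real_derivative f' x) (at 0))"
    using kernel_pd[OF _ e] conv_has_pd[OF _ u e] by blast
qed

lemma pd_conv:
  assumes "kernel K" "integrable lborel u" "e \<in> Basis"
  shows "pd e (conv K u) x = conv (pd e K) u x"
  by (rule pd_eqI[OF conv_has_pd[OF assms]])

lemma lborel_reflect: "(lborel :: 'a::euclidean_space measure) = distr lborel borel (\<lambda>z. x + (-1) *\<^sub>R z)"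
  by (subst lborel_affine[of "-1" x]) (simp_all add: density_1)

lemma integral_reflect:
  fixes f :: "'a::euclidean_space \<Rightarrow> real"
  assumes "f \<in> borel_measurable borel"
  shows "(\<integral>y. f y \<partial>lborel) = (\<integral>z. f (x - z) \<partial>lborel)"
  by (subst lborel_reflect[of x], subst integral_distr) (use assms in auto)

text \<open>As \<open>K\<close> has mass one, the error is a weighted average of translation
  differences; Jensen's inequality for the square and Tonelli reduce it to the translation error for
  small shifts.\<close>

lemma conv_L2_estimate:
  fixes K :: "'a::euclidean_space \<Rightarrow> real"
  assumes K: "kernel K" and nn: "\<And>z. 0 \<le> K z" and one: "(\<integral>\<^sup>+z. ennreal (K z) \<partial>lborel) = 1"
    and supp: "\<And>z. K z \<noteq> 0 \<Longrightarrow> norm z < \<delta>" and u: "integrable lborel u"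
    and tr: "\<And>z. norm z < \<delta> \<Longrightarrow> (\<integral>\<^sup>+x. ennreal ((u (x - z) - u x)\<^sup>2) \<partial>lborel) \<le> ennreal \<epsilon>"
  shows "(\<integral>\<^sup>+x. ennreal ((conv K u x - u x)\<^sup>2) \<partial>lborel) \<le> ennreal \<epsilon>"
proof -
  note [measurable] = kernel_measurable[OF K] borel_measurable_integrable[OF u, simplified]
  have Ki: "integrable lborel K"
    unfolding integrable_iff_bounded using one nn by auto
  have K1: "(\<integral>z. K z \<partial>lborel) = 1"
    using nn_integral_eq_integral[OF Ki] nn one by (simp add: ennreal_eq_1)
  have pt: "ennreal ((conv K u x - u x)\<^sup>2) \<le> (\<integral>\<^sup>+z. ennreal (K z) * ennreal ((u (x - z) - u x)\<^sup>2) \<partial>lborel)" for x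
  proof -
    have i1: "integrable lborel (\<lambda>z. K z * u (x - z))"
    proof -
      have "integrable (distr lborel borel (\<lambda>z. x + (-1) *\<^sub>R z)) (\<lambda>y. K (x - y) * u y)"
        unfolding lborel_reflect[symmetric] by (rule conv_integrable[OF K u])
      then show ?thesis by (subst (asm) integrable_distr_eq) auto
    qed
    have "conv K u x = (\<integral>z. K z * u (x - z) \<partial>lborel)"
      unfolding conv_def by (subst integral_reflect[of _ x]) auto
    then have "conv K u x - u x = (\<integral>z. K z * u (x - z) \<partial>lborel) - (\<integral>z. K z * u x \<partial>lborel)"
      using K1 by simp
    also have "\<dots> = (\<integral>z. K z * (u (x - z) - u x) \<partial>lborel)"
      using i1 Ki by (simp add: right_diff_distrib)
    finally have "ennreal \<bar>conv K u x - u x\<bar> \<le> (\<integral>\<^sup>+z. ennreal (norm (K z * (u (x - z) - u x))) \<partial>lborel)"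
      using integral_norm_bound_ennreal[of lborel "\<lambda>z. K z * (u (x - z) - u x)"] i1 Ki
      by (simp add: right_diff_distrib)
    \<comment> \<open>Splitting the weight into two square roots turns Cauchy-Schwarz into Jensen's
      inequality: one factor integrates to the total mass 1.\<close>
    also have "\<dots> = (\<integral>\<^sup>+z. ennreal (sqrt (K z)) * ennreal (sqrt (K z) * \<bar>u (x - z) - u x\<bar>) \<partial>lborel)"
      using nn by (intro nn_integral_cong) (simp add: ennreal_mult'[symmetric] abs_mult mult.assoc[symmetric])
    finally have "(ennreal \<bar>conv K u x - u x\<bar>)\<^sup>2 \<le> (\<integral>\<^sup>+z. ennreal (sqrt (K z)) * ennreal (sqrt (K z) * \<bar>u (x - z) - u x\<bar>) \<partial>lborel)\<^sup>2"
      by (rule power_mono) simp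
    also have "\<dots> \<le> (\<integral>\<^sup>+z. (ennreal (sqrt (K z)))\<^sup>2 \<partial>lborel) * (\<integral>\<^sup>+z. (ennreal (sqrt (K z) * \<bar>u (x - z) - u x\<bar>))\<^sup>2 \<partial>lborel)"
      by (rule Cauchy_Schwarz_nn_integral) measurable
    also have "(\<integral>\<^sup>+z. (ennreal (sqrt (K z)))\<^sup>2 \<partial>lborel) = 1"
      using nn one by (simp add: ennreal_power)
    also have "(\<integral>\<^sup>+z. (ennreal (sqrt (K z) * \<bar>u (x - z) - u x\<bar>))\<^sup>2 \<partial>lborel) = (\<integral>\<^sup>+z. ennreal (K z) * ennreal ((u (x - z) - u x)\<^sup>2) \<partial>lborel)"
      using nn by (intro nn_integral_cong) (simp add: ennreal_power power_mult_distrib ennreal_mult'[symmetric])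
    finally show ?thesis by (simp add: ennreal_power)
  qed
  have "(\<integral>\<^sup>+x. ennreal ((conv K u x - u x)\<^sup>2) \<partial>lborel) \<le> (\<integral>\<^sup>+x. (\<integral>\<^sup>+z. ennreal (K z) * ennreal ((u (x - z) - u x)\<^sup>2) \<partial>lborel) \<partial>lborel)"
    by (intro nn_integral_mono pt)
  also have "\<dots> = (\<integral>\<^sup>+z. (\<integral>\<^sup>+x. ennreal (K z) * ennreal ((u (x - z) - u x)\<^sup>2) \<partial>lborel) \<partial>lborel)"
    by (rule lborel_pair.Fubini') measurable
  also have "\<dots> \<le> (\<integral>\<^sup>+z. ennreal (K z) * ennreal \<epsilon> \<partial>lborel)"
  proof (rule nn_integral_mono)
    fix z
    have "(\<integral>\<^sup>+x. ennreal (K z) * ennreal ((u (x - z) - u x)\<^sup>2) \<partial>lborel) = ennreal (K z) * (\<integral>\<^sup>+x. ennreal ((u (x - z) - u x)\<^sup>2) \<partial>lborel)"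
      by (rule nn_integral_cmult) measurable
    also have "\<dots> \<le> ennreal (K z) * ennreal \<epsilon>"
      using tr[of z] supp[of z] by (cases "K z = 0") (auto intro: mult_left_mono)
    finally show "(\<integral>\<^sup>+x. ennreal (K z) * ennreal ((u (x - z) - u x)\<^sup>2) \<partial>lborel) \<le> ennreal (K z) * ennreal \<epsilon>" .
  qed
  also have "\<dots> = ennreal \<epsilon>" using one by (subst nn_integral_multc) auto
  finally show ?thesis .
qed

text \<open>With \<open>a\<close> equal to \<open>- e / c\<close> and \<open>k\<close> equal to
  \<open>1 / (c * s)\<close> the mass sits in the ball of radius \<open>c * s\<close> around
  \<open>s *\<^sub>R e\<close>. This off-center position gives the one-sided mollifier needed at the
  boundary.\<close>

definition moll :: "'a::euclidean_space \<Rightarrow> real \<Rightarrow> 'a \<Rightarrow> real" where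
  "moll a k z = k ^ DIM('a) * mollifier (a + k *\<^sub>R z)"

lemma moll_nonneg: "0 < k \<Longrightarrow> 0 \<le> moll a k z"
  by (simp add: moll_def mollifier_nonneg)

lemma moll_support:
  fixes e :: "'a::euclidean_space"
  assumes "0 < s" "0 < c" "moll (- (1 / c) *\<^sub>R e) (1 / (c * s)) z \<noteq> 0"
  shows "norm (z - s *\<^sub>R e) < c * s"
proof -
  have "norm (- (1 / c) *\<^sub>R e + (1 / (c * s)) *\<^sub>R z) < 1"
    using assms mollifier_eq_0 by (fastforce simp: moll_def not_less[symmetric])
  moreover have "- (1 / c) *\<^sub>R e + (1 / (c * s)) *\<^sub>R z = (1 / (c * s)) *\<^sub>R (z - s *\<^sub>R e)"
    using assms by (simp add: scaleR_diff_right)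
  ultimately have "norm ((1 / (c * s)) *\<^sub>R (z - s *\<^sub>R e)) < 1" by simp
  then show ?thesis unfolding norm_scaleR using assms by (simp add: divide_less_eq)
qed

lemma kernel_moll:
  fixes a :: "'a::euclidean_space"
  assumes "0 < k"
  shows "kernel (moll a k)"
proof -
  have "Cinf_on UNIV (moll a k)"
    unfolding moll_def[abs_def] by (rule Cinf_scale[OF Cinf_affine[OF Cinf_mollifier]])
  moreover have "moll a k x = 0" if "norm x > (1 + norm a) / k" for x
  proof -
    have "k * norm x > 1 + norm a" using that assms by (simp add: field_simps)
    moreover have "norm (k *\<^sub>R x) \<le> norm (a + k *\<^sub>R x) + norm a"
      using norm_triangle_ineq4[of "a + k *\<^sub>R x" a] by simp
    ultimately have "norm (a + k *\<^sub>R x) \<ge> 1" using assms by simp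
    then show ?thesis by (simp add: moll_def mollifier_eq_0)
  qed
  ultimately show ?thesis unfolding kernel_def by blast
qed

lemma moll_nn_integral:
  fixes a :: "'a::euclidean_space"
  assumes k: "0 < k"
  shows "(\<integral>\<^sup>+z. ennreal (moll a k z) \<partial>lborel) = 1"
proof -
  note [measurable] = borel_measurable_Cinf[OF Cinf_mollifier]
  have "(\<integral>\<^sup>+z. ennreal (mollifier z) \<partial>(lborel :: 'a measure)) = ennreal (\<integral>z. mollifier z \<partial>(lborel :: 'a measure))"
    by (rule nn_integral_eq_integral[OF integrable_mollifier]) (simp add: mollifier_nonneg)
  then have "1 = (\<integral>\<^sup>+z. ennreal (mollifier z) \<partial>(lborel :: 'a measure))" by (simp add: mollifier_integral)
  also have "\<dots> = (\<integral>\<^sup>+z. ennreal (mollifier z) \<partial>density (distr lborel borel (\<lambda>x. a + k *\<^sub>R x)) (\<lambda>_. ennreal (\<bar>k\<bar> ^ DIM('a))))"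
    using lborel_affine[of k a] k by simp
  also have "\<dots> = (\<integral>\<^sup>+z. ennreal (\<bar>k\<bar> ^ DIM('a)) * ennreal (mollifier (a + k *\<^sub>R z)) \<partial>lborel)"
    by (subst nn_integral_density) (auto simp: nn_integral_distr)
  also have "\<dots> = (\<integral>\<^sup>+z. ennreal (moll a k z) \<partial>lborel)"
    using k by (intro nn_integral_cong) (simp add: moll_def ennreal_mult'[symmetric])
  finally show ?thesis by simp
qed

subsection \<open>Integration by parts\<close>

text \<open>Near the origin the convolution of \<open>f\<close> with the indicator of a large ball
  is constant, equal to the integral of \<open>f\<close>. Its derivative there, which is the same
  convolution of \<open>pd e f\<close>, must vanish.\<close>

lemma integral_pd_eq_0:
  fixes f :: "'a::euclidean_space \<Rightarrow> real"
  assumes f: "kernel f" and e: "e \<in> Basis"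
  shows "(\<integral>x. pd e f x \<partial>lborel) = 0"
proof -
  note [measurable] = kernel_measurable[OF f] kernel_measurable[OF kernel_pd[OF f e]]
  obtain R0 where R0: "\<And>x. norm x > R0 \<Longrightarrow> f x = 0" using f by (auto simp: kernel_def)
  obtain R1 where R1: "\<And>x. norm x > R1 \<Longrightarrow> pd e f x = 0" using kernel_pd[OF f e] by (auto simp: kernel_def)
  define R where "R = max (max R0 R1) 0"
  \<comment> \<open>The radius \<open>R + 1\<close> contains every \<open>x - z\<close> with
    \<open>norm x \<le> 1\<close> and \<open>z\<close> in the supports of \<open>f\<close> and
    \<open>pd e f\<close>.\<close>
  define u :: "'a \<Rightarrow> real" where "u = indicator (cball 0 (R + 1))"
  have u: "integrable lborel u" unfolding u_def using emeasure_bounded_finite[OF bounded_cball, of "0::'a" "R + 1"]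
    by (intro integrable_real_indicator) auto
  then have [measurable]: "u \<in> borel_measurable borel" by (auto dest: borel_measurable_integrable)
  have const: "conv k u x = (\<integral>z. k z \<partial>lborel)"
    if "k \<in> borel_measurable borel" "\<And>z. norm z > R \<Longrightarrow> k z = 0" "norm x \<le> 1" for k x
  proof -
    note [measurable] = that(1)
    have "conv k u x = (\<integral>z. k z * u (x - z) \<partial>lborel)"
      unfolding conv_def by (subst integral_reflect[of _ x]) auto
    also have "\<dots> = (\<integral>z. k z \<partial>lborel)"
    proof (rule Bochner_Integration.integral_cong)
      fix z
      show "k z * u (x - z) = k z"
      proof (cases "norm z > R")
        case False
        then have "norm (x - z) \<le> R + 1" using norm_triangle_ineq4[of x z] that(3) by linarith
        then show ?thesis by (simp add: u_def)
      qed (simp add: that)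
    qed simp
    finally show ?thesis .
  qed
  have "((\<lambda>s. \<integral>z. f z \<partial>lborel) has_real_derivative 0) (at (0::real))" by simp
  then have "((\<lambda>s. conv f u (0 + s *\<^sub>R e)) has_real_derivative 0) (at 0)"
  proof (rule has_field_derivative_transform_within_open[of _ _ _ "{-1<..<1}"])
    fix s :: real assume "s \<in> {-1<..<1}"
    then have "norm (0 + s *\<^sub>R e) \<le> 1" using e by auto
    then show "(\<integral>z. f z \<partial>lborel) = conv f u (0 + s *\<^sub>R e)"
      using R0 by (intro const[symmetric]) (auto simp: R_def)
  qed auto
  then have "conv (pd e f) u 0 = 0" using conv_has_pd[OF f u e, of 0] DERIV_unique by blast
  moreover have "conv (pd e f) u 0 = (\<integral>z. pd e f z \<partial>lborel)"
    using R1 by (intro const) (auto simp: R_def)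
  ultimately show ?thesis by simp
qed

lemma test_fun_kernel: "test_fun S \<theta> \<Longrightarrow> kernel \<theta>"
proof -
  assume t: "test_fun S \<theta>"
  then have "bounded (closure {x. \<theta> x \<noteq> 0})" by (auto simp: test_fun_def intro: compact_imp_bounded)
  then obtain R where R: "\<And>x. x \<in> closure {x. \<theta> x \<noteq> 0} \<Longrightarrow> norm x \<le> R" by (auto simp: bounded_iff)
  have "\<theta> x = 0" if "norm x > R" for x
  proof (rule ccontr)
    assume "\<theta> x \<noteq> 0"
    then have "x \<in> closure {x. \<theta> x \<noteq> 0}" using closure_subset[of "{x. \<theta> x \<noteq> 0}"] by blast
    then show False using R that by fastforce
  qed
  then show ?thesis using t by (auto simp: test_fun_def kernel_def)
qed

lemma test_fun_outside:
  assumes "test_fun S \<theta>" "x \<notin> S"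
  shows "\<theta> x = 0" "pd e \<theta> x = 0"
proof -
  have x: "x \<notin> closure {x. \<theta> x \<noteq> 0}" using assms by (auto simp: test_fun_def)
  then show "\<theta> x = 0" using closure_subset[of "{x. \<theta> x \<noteq> 0}"] by blast
  show "pd e \<theta> x = 0"
    by (rule pd_eq_0_open[of "- closure {x. \<theta> x \<noteq> 0}"]) (use x closure_subset[of "{x. \<theta> x \<noteq> 0}"] in auto)
qed

lemma test_funI:
  assumes "Cinf_on UNIV \<theta>" "\<And>x. \<theta> x \<noteq> 0 \<Longrightarrow> x \<in> K" "compact K" "K \<subseteq> S"
  shows "test_fun S \<theta>"
proof -
  have "closure {x. \<theta> x \<noteq> 0} \<subseteq> K" using assms by (intro closure_minimal) (auto simp: compact_imp_closed)
  moreover have "compact (closure {x. \<theta> x \<noteq> 0})"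
    using calculation assms(3) by (meson closed_closure compact_imp_bounded bounded_subset compact_eq_bounded_closed)
  ultimately show ?thesis using assms by (auto simp: test_fun_def)
qed

lemma test_fun_mult:
  assumes "Cinf_on UNIV \<eta>" "test_fun S \<theta>"
  shows "test_fun S (\<lambda>x. \<eta> x * \<theta> x)"
  by (rule test_funI[of _ "closure {x. \<theta> x \<noteq> 0}"])
     (use assms closure_subset[of "{x. \<theta> x \<noteq> 0}"] in \<open>auto simp: test_fun_def intro: Cinf_mult\<close>)

lemma weak_grad_Cinf:
  assumes \<Omega>: "open \<Omega>" "bounded \<Omega>" and \<phi>: "Cinf_on UNIV \<phi>"
  shows "weak_grad \<Omega> \<phi> (grad \<phi>)"
  unfolding weak_grad_def
proof (intro conjI allI impI ballI)
  show "L2 (lebesgue_on \<Omega>) \<phi>" by (rule L2_Cinf[OF \<phi> \<Omega>])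
  show "L2 (lebesgue_on \<Omega>) (\<lambda>x. grad \<phi> x \<bullet> e)" if "e \<in> Basis" for e
    using L2_pd[OF \<phi> that \<Omega>] that by (simp add: grad_inner)
  fix \<theta> and e :: pt assume t: "test_fun \<Omega> \<theta>" and e: "e \<in> Basis"
  have \<theta>: "Cinf_on UNIV \<theta>" using t by (simp add: test_fun_def)
  note [measurable] = borel_measurable_Cinf[OF \<phi>] borel_measurable_Cinf[OF \<theta>]
    borel_measurable_Cinf[OF Cinf_on_pd[OF \<phi> e]] borel_measurable_Cinf[OF Cinf_on_pd[OF \<theta> e]] borel_open[OF \<Omega>(1)]
  note c = Cinf_on_continuous[OF \<phi>] Cinf_on_continuous[OF \<theta>] Cinf_on_continuous[OF Cinf_on_pd[OF \<phi> e]] Cinf_on_continuous[OF Cinf_on_pd[OF \<theta> e]]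
  have i1: "integrable lborel (\<lambda>x. \<phi> x * pd e \<theta> x)" and i2: "integrable lborel (\<lambda>x. pd e \<phi> x * \<theta> x)"
    using test_fun_outside[OF t] by (auto intro!: integrable_continuous_support[OF _ _ \<Omega>(2)] continuous_intros c)
  have "0 = (\<integral>x. pd e (\<lambda>x. \<phi> x * \<theta> x) x \<partial>lborel)"
    using integral_pd_eq_0[OF test_fun_kernel[OF test_fun_mult[OF \<phi> t]] e] by simp
  also have "\<dots> = (\<integral>x. pd e \<phi> x * \<theta> x + \<phi> x * pd e \<theta> x \<partial>lborel)"
    by (simp add: pd_mult[OF \<phi> \<theta> e])
  also have "\<dots> = (\<integral>x. pd e \<phi> x * \<theta> x \<partial>lborel) + (\<integral>x. \<phi> x * pd e \<theta> x \<partial>lborel)"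
    using i1 i2 by simp
  finally have parts: "(\<integral>x. \<phi> x * pd e \<theta> x \<partial>lborel) = - (\<integral>x. pd e \<phi> x * \<theta> x \<partial>lborel)" by simp
  have "(\<integral>x. \<phi> x * pd e \<theta> x \<partial>lebesgue_on \<Omega>) = (\<integral>x. \<phi> x * pd e \<theta> x \<partial>lborel)"
    using test_fun_outside[OF t] by (subst integral_lebesgue_on) (auto intro!: Bochner_Integration.integral_cong simp: indicator_def)
  moreover have "(\<integral>x. (grad \<phi> x \<bullet> e) * \<theta> x \<partial>lebesgue_on \<Omega>) = (\<integral>x. pd e \<phi> x * \<theta> x \<partial>lborel)"
    unfolding grad_inner[OF e] using test_fun_outside[OF t]
    by (subst integral_lebesgue_on) (auto intro!: Bochner_Integration.integral_cong simp: indicator_def)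
  ultimately show "(\<integral>x. \<phi> x * pd e \<theta> x \<partial>lebesgue_on \<Omega>) = - (\<integral>x. (grad \<phi> x \<bullet> e) * \<theta> x \<partial>lebesgue_on \<Omega>)"
    using parts by simp
qed

text \<open>The constant sequence is an approximating sequence, and the trace inequality provides
  square integrability on the boundary. This makes smooth functions admissible in the first
  variational equation.\<close>

lemma trace_of_Cinf:
  assumes \<Omega>: "smooth_bounded_domain \<Omega>" and \<phi>: "Cinf_on UNIV \<phi>"
  shows "trace_of \<Omega> \<phi> \<phi>"
proof -
  have op: "open \<Omega>" "bounded \<Omega>" using \<Omega> by (auto simp: smooth_bounded_domain_def)
  obtain C where C: "(\<integral>\<^sup>+x. ennreal ((\<phi> x)\<^sup>2) \<partial>surf \<Omega>) \<le> ennreal (C * ((nL2 (lebesgue_on \<Omega>) \<phi>)\<^sup>2 + (nG \<Omega> \<phi>)\<^sup>2))"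
    using trace_inequality[OF \<Omega>] \<phi> by blast
  have m: "\<phi> \<in> borel_measurable (surf \<Omega>)" by (rule measurable_surf_borel[OF borel_measurable_Cinf[OF \<phi>]])
  have "integrable (surf \<Omega>) (\<lambda>x. (\<phi> x)\<^sup>2)"
    unfolding integrable_iff_bounded using m C by (auto intro: le_less_trans)
  then have L: "L2 (surf \<Omega>) \<phi>" using m by (simp add: L2_def)
  have "(\<lambda>n::nat. nL2 (lebesgue_on \<Omega>) (\<lambda>x. pd e \<phi> x - grad \<phi> x \<bullet> e)) \<longlonglongrightarrow> 0" if "e \<in> Basis" for e
    using that by (simp add: grad_inner)
  then show ?thesis unfolding trace_of_def
    using L weak_grad_Cinf[OF op \<phi>] \<phi> by (intro conjI exI[of _ "grad \<phi>"] exI[of _ "\<lambda>_::nat. \<phi>"]) auto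
qed

text \<open>Slices and weak gradients are only Lebesgue measurable on \<open>\<Omega>\<close>,
  whereas translations and Tonelli are applied to Borel functions on the whole space. A Borel
  version extended by zero bridges the two.\<close>

lemma L2_borel_representative:
  fixes f :: "'a::euclidean_space \<Rightarrow> real"
  assumes \<Omega>: "open \<Omega>" "bounded \<Omega>" and f: "L2 (lebesgue_on \<Omega>) f"
  obtains g where "g \<in> borel_measurable borel" "\<And>x. x \<notin> \<Omega> \<Longrightarrow> g x = 0" "AE x in lebesgue_on \<Omega>. f x = g x"
    "integrable lborel g" "(\<integral>\<^sup>+x. ennreal ((g x)\<^sup>2) \<partial>lborel) < \<infinity>"
proof -
  have \<Omega>s: "\<Omega> \<in> sets lebesgue" "\<Omega> \<in> sets borel" using \<Omega> by auto
  have fm: "f \<in> borel_measurable (lebesgue_on \<Omega>)" using f by (simp add: L2_def)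
  have "(\<lambda>x. if x \<in> \<Omega> then f x else 0) \<in> borel_measurable lebesgue"
    using fm \<Omega>s by (simp add: borel_measurable_if)
  then obtain g0 where g0: "g0 \<in> borel_measurable lborel" "AE x in lborel. (if x \<in> \<Omega> then f x else 0) = g0 x"
    using completion_ex_borel_measurable_real by blast
  define g where "g x = indicator \<Omega> x * g0 x" for x
  have gm: "g \<in> borel_measurable borel" unfolding g_def[abs_def] using g0(1) \<Omega>s by auto
  have "AE x in lebesgue. (if x \<in> \<Omega> then f x else 0) = g0 x" using g0(2) by (rule AE_completion)
  then have ae: "AE x in lebesgue_on \<Omega>. f x = g x"
    using \<Omega>s by (subst AE_restrict_space_iff) (auto elim!: eventually_mono simp: g_def)
  have glm: "g \<in> borel_measurable (lebesgue_on \<Omega>)" by (rule measurable_lebesgue_on_borel[OF gm])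
  have gL: "L2 (lebesgue_on \<Omega>) g" by (rule L2_cong_AE[OF f glm ae])
  interpret finite_measure "lebesgue_on \<Omega>" using \<Omega> by (rule lebesgue_on_finite_measure)
  have "L2 (lebesgue_on \<Omega>) (\<lambda>x. 1)" by (simp add: L2_def)
  from L2_mult_integrable[OF gL this] have gi: "integrable (lebesgue_on \<Omega>) g" by simp
  have ind: "indicator \<Omega> x *\<^sub>R g x = g x" for x by (simp add: g_def indicator_def)
  have "integrable lebesgue (\<lambda>x. indicator \<Omega> x *\<^sub>R g x)"
    using gi \<Omega>s by (subst (asm) integrable_restrict_space) auto
  then have gl: "integrable lborel g" unfolding ind using gm by (subst (asm) integrable_completion) auto
  have "(\<integral>\<^sup>+x. ennreal ((g x)\<^sup>2) \<partial>lborel) = (\<integral>\<^sup>+x\<in>\<Omega>. ennreal ((g x)\<^sup>2) \<partial>lborel)"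
    by (intro nn_integral_cong) (auto simp: g_def indicator_def)
  also have "\<dots> = (\<integral>\<^sup>+x. ennreal ((g x)\<^sup>2) \<partial>lebesgue_on \<Omega>)" using \<Omega>s by (simp add: nn_integral_lebesgue_on)
  also have "\<dots> < \<infinity>" using gL by (auto simp: L2_def integrable_iff_bounded)
  finally show ?thesis using that[of g] gm ae gl by (simp add: g_def)
qed

lemma integral_representative:
  fixes f g h :: "'a::euclidean_space \<Rightarrow> real"
  assumes \<Omega>: "open \<Omega>" and fm: "f \<in> borel_measurable (lebesgue_on \<Omega>)" and gm: "g \<in> borel_measurable borel" "\<And>x. x \<notin> \<Omega> \<Longrightarrow> g x = 0"
    and ae: "AE x in lebesgue_on \<Omega>. f x = g x" and hm: "h \<in> borel_measurable borel"
  shows "(\<integral>x. f x * h x \<partial>lebesgue_on \<Omega>) = (\<integral>x. g x * h x \<partial>lborel)"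
proof -
  note m = measurable_lebesgue_on_borel[OF gm(1), of \<Omega>] measurable_lebesgue_on_borel[OF hm, of \<Omega>]
  have "(\<integral>x. f x * h x \<partial>lebesgue_on \<Omega>) = (\<integral>x. g x * h x \<partial>lebesgue_on \<Omega>)"
    using ae fm m by (intro integral_cong_AE) auto
  also have "\<dots> = (\<integral>x. indicator \<Omega> x * (g x * h x) \<partial>lborel)"
    using \<Omega> gm(1) hm by (intro integral_lebesgue_on) auto
  also have "\<dots> = (\<integral>x. g x * h x \<partial>lborel)"
    using gm(2) by (intro Bochner_Integration.integral_cong) (auto simp: indicator_def)
  finally show ?thesis .
qed

lemma integrable_mult_continuous:
  fixes g h :: "'a::euclidean_space \<Rightarrow> real"
  assumes g: "integrable lborel g" "\<And>x. x \<notin> \<Omega> \<Longrightarrow> g x = 0" and \<Omega>: "bounded \<Omega>" and h: "continuous_on UNIV h"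
  shows "integrable lborel (\<lambda>x. g x * h x)"
proof -
  obtain B where B: "\<forall>x\<in>\<Omega>. \<bar>h x\<bar> \<le> B" using bounded_continuous_on_bounded[OF h \<Omega>] by blast
  show ?thesis
  proof (rule Bochner_Integration.integrable_bound)
    show "integrable lborel (\<lambda>x. \<bar>g x\<bar> * B)" using g(1) by auto
    show "(\<lambda>x. g x * h x) \<in> borel_measurable lborel"
      using borel_measurable_integrable[OF g(1)] borel_measurable_continuous_onI[OF h] by auto
    show "AE x in lborel. norm (g x * h x) \<le> norm (\<bar>g x\<bar> * B)"
    proof (rule AE_I2)
      fix x
      show "norm (g x * h x) \<le> norm (\<bar>g x\<bar> * B)"
      proof (cases "x \<in> \<Omega>")
        case True
        then have "\<bar>h x\<bar> \<le> \<bar>B\<bar>" using B by fastforce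
        then show ?thesis by (simp add: abs_mult mult_left_mono)
      qed (simp add: g(2))
    qed
  qed
qed

lemma nn_integral_square_mult_continuous:
  fixes g h :: "'a::euclidean_space \<Rightarrow> real"
  assumes gm: "g \<in> borel_measurable borel" and g: "(\<integral>\<^sup>+x. ennreal ((g x)\<^sup>2) \<partial>lborel) < \<infinity>" "\<And>x. x \<notin> \<Omega> \<Longrightarrow> g x = 0"
    and \<Omega>: "bounded \<Omega>" and h: "continuous_on UNIV h"
  shows "(\<integral>\<^sup>+x. ennreal ((h x * g x)\<^sup>2) \<partial>lborel) < \<infinity>"
proof -
  obtain B where B: "\<forall>x\<in>\<Omega>. \<bar>h x\<bar> \<le> B" using bounded_continuous_on_bounded[OF h \<Omega>] by blast
  have "(\<integral>\<^sup>+x. ennreal ((h x * g x)\<^sup>2) \<partial>lborel) \<le> (\<integral>\<^sup>+x. ennreal (B\<^sup>2) * ennreal ((g x)\<^sup>2) \<partial>lborel)"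
  proof (rule nn_integral_mono)
    fix x
    have "(h x * g x)\<^sup>2 \<le> B\<^sup>2 * (g x)\<^sup>2"
    proof (cases "x \<in> \<Omega>")
      case True
      then have "\<bar>h x\<bar> \<le> \<bar>B\<bar>" using B by fastforce
      then have "(h x)\<^sup>2 \<le> B\<^sup>2" by (simp only: abs_le_square_iff)
      then show ?thesis by (simp add: power_mult_distrib mult_right_mono)
    qed (simp add: g(2))
    then show "ennreal ((h x * g x)\<^sup>2) \<le> ennreal (B\<^sup>2) * ennreal ((g x)\<^sup>2)"
      by (simp add: ennreal_mult'[symmetric] ennreal_leI)
  qed
  also have "\<dots> = ennreal (B\<^sup>2) * (\<integral>\<^sup>+x. ennreal ((g x)\<^sup>2) \<partial>lborel)"
    using gm by (intro nn_integral_cmult) auto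
  also have "\<dots> < \<infinity>" using g(1) by (simp add: ennreal_mult_less_top)
  finally show ?thesis .
qed

lemma nn_integral_square_add_finite:
  fixes f g :: "'a::euclidean_space \<Rightarrow> real"
  assumes [measurable]: "f \<in> borel_measurable borel" "g \<in> borel_measurable borel"
    and f: "(\<integral>\<^sup>+x. ennreal ((f x)\<^sup>2) \<partial>lborel) < \<infinity>" and g: "(\<integral>\<^sup>+x. ennreal ((g x)\<^sup>2) \<partial>lborel) < \<infinity>"
  shows "(\<integral>\<^sup>+x. ennreal ((f x + g x)\<^sup>2) \<partial>lborel) < \<infinity>"
proof -
  have "(\<integral>\<^sup>+x. ennreal ((f x + g x)\<^sup>2) \<partial>lborel) \<le> (\<integral>\<^sup>+x. 2 * ennreal ((f x)\<^sup>2) + 2 * ennreal ((g x)\<^sup>2) \<partial>lborel)"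
  proof (rule nn_integral_mono)
    fix x
    show "ennreal ((f x + g x)\<^sup>2) \<le> 2 * ennreal ((f x)\<^sup>2) + 2 * ennreal ((g x)\<^sup>2)"
      using sq_split_ennreal[of "f x + g x" "f x"] by simp
  qed
  also have "\<dots> = 2 * (\<integral>\<^sup>+x. ennreal ((f x)\<^sup>2) \<partial>lborel) + 2 * (\<integral>\<^sup>+x. ennreal ((g x)\<^sup>2) \<partial>lborel)"
    by (subst nn_integral_add) (auto simp: nn_integral_cmult)
  also have "\<dots> < \<infinity>" using f g by (simp add: ennreal_mult_less_top)
  finally show ?thesis .
qed

subsection \<open>Density of smooth functions in the Sobolev space\<close>

text \<open>The Leibniz rule for weak gradients: the product of the cutoff with a test function is
  again a test function, and its derivative splits into two terms.\<close>

lemma weak_grad_cutoff: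
  fixes w :: "pt \<Rightarrow> real"
  assumes \<Omega>: "open \<Omega>" "bounded \<Omega>" and w: "weak_grad \<Omega> w G" and \<eta>: "Cinf_on UNIV \<eta>" and b: "b \<in> Basis"
    and wt: "wt \<in> borel_measurable borel" "\<And>x. x \<notin> \<Omega> \<Longrightarrow> wt x = 0" "AE x in lebesgue_on \<Omega>. w x = wt x" "integrable lborel wt"
    and gt: "gt \<in> borel_measurable borel" "\<And>x. x \<notin> \<Omega> \<Longrightarrow> gt x = 0" "AE x in lebesgue_on \<Omega>. G x \<bullet> b = gt x" "integrable lborel gt"
    and t: "test_fun \<Omega> \<theta>"
  shows "(\<integral>x. (\<eta> x * wt x) * pd b \<theta> x \<partial>lborel) = - (\<integral>x. (\<eta> x * gt x + pd b \<eta> x * wt x) * \<theta> x \<partial>lborel)"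
proof -
  have \<theta>: "Cinf_on UNIV \<theta>" using t by (simp add: test_fun_def)
  note C = Cinf_on_pd[OF \<eta> b] Cinf_on_pd[OF \<theta> b] Cinf_mult[OF \<eta> \<theta>]
  have mw: "w \<in> borel_measurable (lebesgue_on \<Omega>)" and mg: "(\<lambda>x. G x \<bullet> b) \<in> borel_measurable (lebesgue_on \<Omega>)"
    using w b by (auto simp: weak_grad_def L2_def)
  have c: "continuous_on UNIV (\<lambda>x. pd b \<eta> x * \<theta> x)" "continuous_on UNIV (\<lambda>x. \<eta> x * pd b \<theta> x)" "continuous_on UNIV (\<lambda>x. \<eta> x * \<theta> x)"
    by (intro continuous_intros Cinf_on_continuous \<eta> \<theta> C)+
  have i: "integrable lborel (\<lambda>x. wt x * (pd b \<eta> x * \<theta> x))" "integrable lborel (\<lambda>x. wt x * (\<eta> x * pd b \<theta> x))" "integrable lborel (\<lambda>x. gt x * (\<eta> x * \<theta> x))"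
    by (rule integrable_mult_continuous[OF wt(4,2) \<Omega>(2) c(1)] integrable_mult_continuous[OF wt(4,2) \<Omega>(2) c(2)] integrable_mult_continuous[OF gt(4,2) \<Omega>(2) c(3)]; assumption)+
  have "(\<integral>x. w x * pd b (\<lambda>x. \<eta> x * \<theta> x) x \<partial>lebesgue_on \<Omega>) = - (\<integral>x. (G x \<bullet> b) * (\<eta> x * \<theta> x) \<partial>lebesgue_on \<Omega>)"
    using w test_fun_mult[OF \<eta> t] b unfolding weak_grad_def by blast
  also have "(\<integral>x. w x * pd b (\<lambda>x. \<eta> x * \<theta> x) x \<partial>lebesgue_on \<Omega>) = (\<integral>x. wt x * pd b (\<lambda>x. \<eta> x * \<theta> x) x \<partial>lborel)"
    by (rule integral_representative[OF \<Omega>(1) mw wt(1) _ wt(3)]) (use wt(2) borel_measurable_Cinf[OF Cinf_on_pd[OF C(3) b]] in auto)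
  also have "(\<integral>x. (G x \<bullet> b) * (\<eta> x * \<theta> x) \<partial>lebesgue_on \<Omega>) = (\<integral>x. gt x * (\<eta> x * \<theta> x) \<partial>lborel)"
    by (rule integral_representative[OF \<Omega>(1) mg gt(1) _ gt(3)]) (use gt(2) borel_measurable_Cinf[OF C(3)] in auto)
  also have "(\<integral>x. wt x * pd b (\<lambda>x. \<eta> x * \<theta> x) x \<partial>lborel) = (\<integral>x. wt x * (pd b \<eta> x * \<theta> x) + wt x * (\<eta> x * pd b \<theta> x) \<partial>lborel)"
    by (simp add: pd_mult[OF \<eta> \<theta> b] distrib_left)
  also have "\<dots> = (\<integral>x. wt x * (pd b \<eta> x * \<theta> x) \<partial>lborel) + (\<integral>x. wt x * (\<eta> x * pd b \<theta> x) \<partial>lborel)"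
    using i by simp
  finally have 1: "(\<integral>x. wt x * (\<eta> x * pd b \<theta> x) \<partial>lborel) = - ((\<integral>x. gt x * (\<eta> x * \<theta> x) \<partial>lborel) + (\<integral>x. wt x * (pd b \<eta> x * \<theta> x) \<partial>lborel))"
    by linarith
  have "(\<integral>x. (\<eta> x * gt x + pd b \<eta> x * wt x) * \<theta> x \<partial>lborel) = (\<integral>x. gt x * (\<eta> x * \<theta> x) + wt x * (pd b \<eta> x * \<theta> x) \<partial>lborel)"
    by (intro Bochner_Integration.integral_cong) (auto simp: algebra_simps)
  also have "\<dots> = (\<integral>x. gt x * (\<eta> x * \<theta> x) \<partial>lborel) + (\<integral>x. wt x * (pd b \<eta> x * \<theta> x) \<partial>lborel)"
    using i by simp
  moreover have "(\<integral>x. (\<eta> x * wt x) * pd b \<theta> x \<partial>lborel) = (\<integral>x. wt x * (\<eta> x * pd b \<theta> x) \<partial>lborel)"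
    by (intro Bochner_Integration.integral_cong) (auto simp: mult_ac)
  ultimately show ?thesis using 1 by simp
qed

text \<open>Mollifying with a kernel concentrated near \<open>s e\<close> only evaluates the function at points \<open>x - s (e + z)\<close>,
  which stay in \<open>\<Omega>\<close> by the cone condition; hence the weak gradient commutes with the mollification up to the boundary.\<close>
lemma one_sided_mollification:
  fixes e :: pt
  assumes \<Omega>: "open \<Omega>" and cone: "cone_at \<Omega> p e c r" and s: "0 < s" "s < r / 4" and b: "b \<in> Basis"
    and K: "K = moll (- (1 / (c / 2)) *\<^sub>R e) (1 / ((c / 2) * s))"
    and u: "integrable lborel u" "\<And>y. dist p y > r / 2 \<Longrightarrow> u y = 0"
    and g: "\<And>y. dist p y > r / 2 \<Longrightarrow> g y = 0"
    and parts: "\<And>\<theta>. test_fun \<Omega> \<theta> \<Longrightarrow> (\<integral>x. u x * pd b \<theta> x \<partial>lborel) = - (\<integral>x. g x * \<theta> x \<partial>lborel)"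
    and x: "x \<in> \<Omega>"
  shows "pd b (conv K u) x = conv K g x"
proof -
  have c: "0 < c" "c \<le> 1" "0 < r" "norm e = 1" using cone by (auto simp: cone_at_def)
  have k: "0 < 1 / ((c / 2) * s)" using c s by simp
  have ker: "kernel K" unfolding K by (rule kernel_moll[OF k])
  have KC: "Cinf_on UNIV K" using ker by (simp add: kernel_def)
  \<comment> \<open>Half of the opening is used for the kernel, so that the closed ball carrying its
    support still lies in the open cone.\<close>
  have supp: "norm (z - s *\<^sub>R e) < c / 2 * s" if "K z \<noteq> 0" for z
    using moll_support[of s "c / 2" e z] that s c unfolding K by simp
  have supp': "norm (z - s *\<^sub>R e) \<le> c / 2 * s" if "pd b K z \<noteq> 0" for z
  proof (rule ccontr)
    assume "\<not> ?thesis"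
    then have "z \<in> {z. norm (z - s *\<^sub>R e) > c / 2 * s}" by simp
    moreover have "open {z. norm (z - s *\<^sub>R e) > c / 2 * s}" by (intro open_Collect_less continuous_intros)
    ultimately have "pd b K z = 0" using supp by (intro pd_eq_0_open[of "{z. norm (z - s *\<^sub>R e) > c / 2 * s}"]) force+
    then show False using that by simp
  qed
  have pdconv: "pd b (conv K u) x = conv (pd b K) u x" by (rule pd_conv[OF ker u(1) b])
  show ?thesis
  proof (cases "dist p x < r")
    case True
    \<comment> \<open>The reflected kernel centered at \<open>x\<close> is itself the test function:
      it is supported in \<open>\<Omega>\<close>, and its derivative in \<open>y\<close> is minus
      the derivative of \<open>K\<close> at \<open>x - y\<close>.\<close>
    define \<theta> where "\<theta> y = K (x + (-1) *\<^sub>R y)" for y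
    have \<theta>C: "Cinf_on UNIV \<theta>" unfolding \<theta>_def[abs_def] by (rule Cinf_affine[OF KC])
    have "test_fun \<Omega> \<theta>"
    proof (rule test_funI[OF \<theta>C, of "cball (x - s *\<^sub>R e) (c / 2 * s)"])
      show "y \<in> cball (x - s *\<^sub>R e) (c / 2 * s)" if "\<theta> y \<noteq> 0" for y
        using supp[of "x - y"] that by (simp add: \<theta>_def dist_norm algebra_simps)
      show "cball (x - s *\<^sub>R e) (c / 2 * s) \<subseteq> \<Omega>"
      proof
        fix y assume y: "y \<in> cball (x - s *\<^sub>R e) (c / 2 * s)"
        define z where "z = (1 / s) *\<^sub>R (x - s *\<^sub>R e - y)"
        have "norm z = (1 / s) * norm (x - s *\<^sub>R e - y)" unfolding z_def norm_scaleR using s by simp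
        also have "\<dots> \<le> (1 / s) * (c / 2 * s)" using y s by (intro mult_left_mono) (auto simp: dist_norm)
        also have "\<dots> < c" using s c by simp
        finally have "norm z < c" .
        moreover have "y = x - s *\<^sub>R (e + z)" using s by (simp add: z_def scaleR_add_right)
        ultimately show "y \<in> \<Omega>" using cone_atD[OF cone x True s(1), of z] s by simp
      qed
    qed auto
    from parts[OF this] have "(\<integral>y. u y * pd b \<theta> y \<partial>lborel) = - (\<integral>y. g y * \<theta> y \<partial>lborel)" .
    moreover have "pd b \<theta> y = - pd b K (x - y)" for y
      unfolding \<theta>_def[abs_def] using pd_affine[OF KC b, of x "-1" y] by simp
    ultimately have "(\<integral>y. pd b K (x - y) * u y \<partial>lborel) = (\<integral>y. K (x - y) * g y \<partial>lborel)"
      by (simp add: \<theta>_def mult.commute)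
    then show ?thesis unfolding pdconv by (simp add: conv_def)
  next
    case False
    \<comment> \<open>The kernel reaches less than \<open>2 * s\<close>, hence less than
      \<open>r / 2\<close>. For \<open>x\<close> outside the ball of radius \<open>r\<close> it
      meets only points where the cut-off functions vanish, and both sides are zero.\<close>
    have far: "dist p y > r / 2" if "norm ((x - y) - s *\<^sub>R e) \<le> c / 2 * s" for y
    proof -
      have "norm (x - y) \<le> norm ((x - y) - s *\<^sub>R e) + norm (s *\<^sub>R e)"
        using norm_triangle_sub[of "x - y" "s *\<^sub>R e"] by linarith
      also have "\<dots> \<le> c / 2 * s + s" using that c s by simp
      also have "\<dots> \<le> 2 * s" using c s by (simp add: mult_left_le_one_le)
      finally have "dist x y < r / 2" using s by (simp add: dist_norm)
      then show ?thesis using False dist_triangle[of p x y] by (simp add: dist_commute)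
    qed
    have z1: "pd b K (x - y) * u y = 0" for y
      using far[of y] supp'[of "x - y"] u(2)[of y] by (cases "pd b K (x - y) = 0") auto
    have z2: "K (x - y) * g y = 0" for y
      using far[of y] supp[of "x - y"] g[of y] by (cases "K (x - y) = 0") auto
    show ?thesis unfolding pdconv conv_def by (simp only: z1 z2)
  qed
qed

text \<open>One mollified function serves for the cut-off function and for all its weak derivatives,
  since by \<open>one_sided_mollification\<close> differentiation and mollification commute on
  \<open>\<Omega>\<close>. All errors are then translation errors of finitely many square-integrable
  functions.\<close>

lemma local_density:
  fixes w :: "pt \<Rightarrow> real"
  assumes \<Omega>: "open \<Omega>" "bounded \<Omega>" and w: "weak_grad \<Omega> w G" and \<eta>: "Cinf_on UNIV \<eta>"
    and cone: "cone_at \<Omega> p e c r" and supp: "\<And>y. dist p y > r / 2 \<Longrightarrow> \<eta> y = 0"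
    and wt: "wt \<in> borel_measurable borel" "\<And>x. x \<notin> \<Omega> \<Longrightarrow> wt x = 0" "AE x in lebesgue_on \<Omega>. w x = wt x" "integrable lborel wt"
      "(\<integral>\<^sup>+x. ennreal ((wt x)\<^sup>2) \<partial>lborel) < \<infinity>"
    and gt: "\<And>b. b \<in> Basis \<Longrightarrow> gt b \<in> borel_measurable borel" "\<And>b x. b \<in> Basis \<Longrightarrow> x \<notin> \<Omega> \<Longrightarrow> gt b x = 0"
      "\<And>b. b \<in> Basis \<Longrightarrow> AE x in lebesgue_on \<Omega>. G x \<bullet> b = gt b x" "\<And>b. b \<in> Basis \<Longrightarrow> integrable lborel (gt b)"
      "\<And>b. b \<in> Basis \<Longrightarrow> (\<integral>\<^sup>+x. ennreal ((gt b x)\<^sup>2) \<partial>lborel) < \<infinity>"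
    and \<epsilon>: "0 < \<epsilon>"
  shows "\<exists>\<phi>. Cinf_on UNIV \<phi> \<and> (\<integral>\<^sup>+x\<in>\<Omega>. ennreal ((\<phi> x - \<eta> x * wt x)\<^sup>2) \<partial>lborel) \<le> ennreal \<epsilon> \<and>
    (\<forall>b\<in>Basis. (\<integral>\<^sup>+x\<in>\<Omega>. ennreal ((pd b \<phi> x - (\<eta> x * gt b x + pd b \<eta> x * wt x))\<^sup>2) \<partial>lborel) \<le> ennreal \<epsilon>)"
proof -
  have c: "0 < c" "c \<le> 1" "0 < r" "norm e = 1" using cone by (auto simp: cone_at_def)
  define u where "u x = \<eta> x * wt x" for x
  define g where "g b x = \<eta> x * gt b x + pd b \<eta> x * wt x" for b x
  note m[measurable] = wt(1) borel_measurable_Cinf[OF \<eta>]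
  have um[measurable]: "u \<in> borel_measurable borel" unfolding u_def[abs_def] by measurable
  have gm[measurable]: "g b \<in> borel_measurable borel" if "b \<in> Basis" for b
    unfolding g_def[abs_def] using gt(1)[OF that] borel_measurable_Cinf[OF Cinf_on_pd[OF \<eta> that]] wt(1) borel_measurable_Cinf[OF \<eta>] by auto
  have ui: "integrable lborel u"
    using integrable_mult_continuous[OF wt(4,2) \<Omega>(2) Cinf_on_continuous[OF \<eta>]] by (simp add: u_def[abs_def] mult.commute)
  have gi: "integrable lborel (g b)" if b: "b \<in> Basis" for b
    using integrable_mult_continuous[OF wt(4,2) \<Omega>(2) Cinf_on_continuous[OF Cinf_on_pd[OF \<eta> b]]]
      integrable_mult_continuous[OF gt(4)[OF b] gt(2)[OF b] \<Omega>(2) Cinf_on_continuous[OF \<eta>]]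
    by (simp add: g_def[abs_def] mult.commute)
  have uf: "(\<integral>\<^sup>+x. ennreal ((u x)\<^sup>2) \<partial>lborel) < \<infinity>"
    unfolding u_def by (rule nn_integral_square_mult_continuous[OF wt(1,5,2) \<Omega>(2) Cinf_on_continuous[OF \<eta>]])
  have gf: "(\<integral>\<^sup>+x. ennreal ((g b x)\<^sup>2) \<partial>lborel) < \<infinity>" if b: "b \<in> Basis" for b
    unfolding g_def
    using gt(1)[OF b] borel_measurable_Cinf[OF Cinf_on_pd[OF \<eta> b]]
    by (intro nn_integral_square_add_finite
        nn_integral_square_mult_continuous[OF gt(1)[OF b] gt(5)[OF b] gt(2)[OF b] \<Omega>(2) Cinf_on_continuous[OF \<eta>]]
        nn_integral_square_mult_continuous[OF wt(1,5,2) \<Omega>(2) Cinf_on_continuous[OF Cinf_on_pd[OF \<eta> b]]]) auto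
  obtain R where R: "\<And>x. x \<in> \<Omega> \<Longrightarrow> norm x \<le> R" using \<Omega>(2) by (auto simp: bounded_iff)
  have out: "u x = 0" "b \<in> Basis \<Longrightarrow> g b x = 0" if "norm x > R" for x b
  proof -
    have "x \<notin> \<Omega>" using R[of x] that by linarith
    then show "u x = 0" "b \<in> Basis \<Longrightarrow> g b x = 0" using wt(2) gt(2) by (auto simp: u_def g_def)
  qed
  have tru: "\<exists>\<delta>>0. \<forall>z. norm z < \<delta> \<longrightarrow> (\<integral>\<^sup>+x. ennreal ((u (x - z) - u x)\<^sup>2) \<partial>lborel) \<le> ennreal \<epsilon>"
    by (rule L2_translation_continuous[OF um uf out(1) \<epsilon>])
  have trg: "\<forall>b\<in>Basis. \<exists>\<delta>>0. \<forall>z. norm z < \<delta> \<longrightarrow> (\<integral>\<^sup>+x. ennreal ((g b (x - z) - g b x)\<^sup>2) \<partial>lborel) \<le> ennreal \<epsilon>"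
    using L2_translation_continuous[OF gm gf out(2) \<epsilon>] by blast
  obtain \<delta>0 where \<delta>0: "\<delta>0 > 0" "\<And>z. norm z < \<delta>0 \<Longrightarrow> (\<integral>\<^sup>+x. ennreal ((u (x - z) - u x)\<^sup>2) \<partial>lborel) \<le> ennreal \<epsilon>"
    using tru by blast
  from trg obtain D where D: "\<forall>b\<in>Basis. D b > 0 \<and> (\<forall>z. norm z < D b \<longrightarrow> (\<integral>\<^sup>+x. ennreal ((g b (x - z) - g b x)\<^sup>2) \<partial>lborel) \<le> ennreal \<epsilon>)"
    by (rule bchoice[THEN exE])
  define \<delta> where "\<delta> = Min (insert \<delta>0 (D ` (Basis :: pt set)))"
  have \<delta>: "\<delta> > 0" unfolding \<delta>_def using D \<delta>0(1) by (subst Min_gr_iff) auto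
  have \<delta>le: "\<delta> \<le> \<delta>0" "b \<in> Basis \<Longrightarrow> \<delta> \<le> D b" for b
    unfolding \<delta>_def by (rule Min_le; simp)+
  \<comment> \<open>The support of the kernel lies within \<open>2 * s\<close> of the origin, hence
    within the common translation scale \<open>\<delta>\<close>; the other bound keeps the steps
    inside the cone.\<close>
  define s where "s = min (r / 8) (\<delta> / 4)"
  have s: "0 < s" "s < r / 4" "2 * s < \<delta>" using c \<delta> by (auto simp: s_def min_def)
  define K where "K = moll (- (1 / (c / 2)) *\<^sub>R e) (1 / ((c / 2) * s))"
  have k: "0 < 1 / ((c / 2) * s)" using c s by simp
  have ker: "kernel K" unfolding K_def by (rule kernel_moll[OF k])
  have Ksupp: "norm z < \<delta>" if "K z \<noteq> 0" for z
  proof -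
    have "norm (z - s *\<^sub>R e) < c / 2 * s"
      using moll_support[of s "c / 2" e z] that s c unfolding K_def by simp
    moreover have "norm z \<le> norm (z - s *\<^sub>R e) + norm (s *\<^sub>R e)" using norm_triangle_sub[of z "s *\<^sub>R e"] by linarith
    moreover have "c / 2 * s \<le> s" using c s by (simp add: mult_left_le_one_le)
    moreover have "norm (s *\<^sub>R e) = s" using c s by simp
    ultimately show ?thesis using s(3) by linarith
  qed
  have nnK: "0 \<le> K z" for z unfolding K_def by (rule moll_nonneg[OF k])
  have oneK: "(\<integral>\<^sup>+z. ennreal (K z) \<partial>lborel) = 1" unfolding K_def by (rule moll_nn_integral[OF k])
  have est: "(\<integral>\<^sup>+x. ennreal ((conv K v x - v x)\<^sup>2) \<partial>lborel) \<le> ennreal \<epsilon>"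
    if "integrable lborel v" "\<And>z. norm z < \<delta> \<Longrightarrow> (\<integral>\<^sup>+x. ennreal ((v (x - z) - v x)\<^sup>2) \<partial>lborel) \<le> ennreal \<epsilon>" for v
    by (rule conv_L2_estimate[OF ker nnK oneK _ that]) (rule Ksupp)
  have subI: "(\<integral>\<^sup>+x\<in>\<Omega>. f x \<partial>lborel) \<le> (\<integral>\<^sup>+x. f x \<partial>lborel)" for f :: "pt \<Rightarrow> ennreal"
    by (intro nn_integral_mono) (simp add: indicator_def)
  show ?thesis
  proof (intro exI[of _ "conv K u"] conjI ballI)
    show "Cinf_on UNIV (conv K u)" by (rule Cinf_conv[OF ker ui])
    have "(\<integral>\<^sup>+x. ennreal ((conv K u x - u x)\<^sup>2) \<partial>lborel) \<le> ennreal \<epsilon>"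
      by (rule est[OF ui], rule \<delta>0(2)) (use \<delta>le(1) in linarith)
    then show "(\<integral>\<^sup>+x\<in>\<Omega>. ennreal ((conv K u x - \<eta> x * wt x)\<^sup>2) \<partial>lborel) \<le> ennreal \<epsilon>"
      using order_trans[OF subI] unfolding u_def by blast
    fix b :: pt assume b: "b \<in> Basis"
    have pdeta: "pd b \<eta> y = 0" if "dist p y > r / 2" for y
      by (rule pd_eq_0_open[of "{y. dist p y > r / 2}"]) (use that supp in \<open>auto intro!: open_Collect_less continuous_intros\<close>)
    have eq: "pd b (conv K u) x = conv K (g b) x" if "x \<in> \<Omega>" for x
    proof (rule one_sided_mollification[OF \<Omega>(1) cone s(1,2) b K_def ui _ _ _ that])
      show "u y = 0" "g b y = 0" if "dist p y > r / 2" for y using supp[OF that] pdeta[OF that] by (auto simp: u_def g_def)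
      show "(\<integral>x. u x * pd b \<theta> x \<partial>lborel) = - (\<integral>x. g b x * \<theta> x \<partial>lborel)" if "test_fun \<Omega> \<theta>" for \<theta>
        unfolding u_def g_def
        by (rule weak_grad_cutoff[OF \<Omega> w \<eta> b wt(1,2,3,4) gt(1)[OF b] gt(2)[OF b] gt(3)[OF b] gt(4)[OF b] that])
    qed
    have "(\<integral>\<^sup>+x\<in>\<Omega>. ennreal ((pd b (conv K u) x - g b x)\<^sup>2) \<partial>lborel) = (\<integral>\<^sup>+x\<in>\<Omega>. ennreal ((conv K (g b) x - g b x)\<^sup>2) \<partial>lborel)"
      using eq by (intro nn_integral_cong) (auto simp: indicator_def)
    also have "\<dots> \<le> (\<integral>\<^sup>+x. ennreal ((conv K (g b) x - g b x)\<^sup>2) \<partial>lborel)" by (rule subI)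
    also have "\<dots> \<le> ennreal \<epsilon>"
      by (rule est[OF gi[OF b]]) (use D \<delta>le(2)[OF b] b in fastforce)
    finally show "(\<integral>\<^sup>+x\<in>\<Omega>. ennreal ((pd b (conv K u) x - (\<eta> x * gt b x + pd b \<eta> x * wt x))\<^sup>2) \<partial>lborel) \<le> ennreal \<epsilon>"
      by (simp add: g_def)
  qed
qed

text \<open>The telescoping products sum to \<open>1\<close> minus the product of all
  \<open>1 - \<beta> j\<close>, and at each point of the closure some \<open>\<beta> j\<close>
  equals 1. No quotient has to be differentiated.\<close>

lemma partition_of_unity:
  assumes \<Omega>: "bounded \<Omega>" and r: "0 < r"
  shows "\<exists>(n::nat) (p :: nat \<Rightarrow> pt) \<eta>. (\<forall>i<n. p i \<in> closure \<Omega> \<and> Cinf_on UNIV (\<eta> i) \<and> (\<forall>y. dist (p i) y > r / 2 \<longrightarrow> \<eta> i y = 0))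
    \<and> (\<forall>x\<in>closure \<Omega>. (\<Sum>i<n. \<eta> i x) = 1)"
proof -
  \<comment> \<open>In dimension three \<open>plateau\<close> vanishes from norm 6 on, that is, from
    distance \<open>6 * \<rho> = r / 2\<close> after rescaling.\<close>
  define \<rho> where "\<rho> = r / 12"
  have \<rho>: "\<rho> > 0" using r by (simp add: \<rho>_def)
  have "compact (closure \<Omega>)" using \<Omega> by (simp add: compact_closure)
  then obtain P where P: "P \<subseteq> closure \<Omega>" "finite P" "closure \<Omega> \<subseteq> (\<Union>p\<in>P. ball p \<rho>)"
    by (rule compactE_image[of _ "closure \<Omega>" "\<lambda>p. ball p \<rho>"]) (use \<rho> in force)+
  obtain p where p: "bij_betw p {..<card P} P" using ex_bij_betw_nat_finite[OF P(2)] by (auto simp: lessThan_atLeast0)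
  define \<beta> where "\<beta> i x = plateau (- (1 / \<rho>) *\<^sub>R p i + (1 / \<rho>) *\<^sub>R x)" for i and x :: pt
  define \<eta> where "\<eta> i x = \<beta> i x * (\<Prod>j<i. 1 - \<beta> j x)" for i x
  have \<beta>C: "Cinf_on UNIV (\<beta> i)" for i unfolding \<beta>_def[abs_def] by (rule Cinf_affine[OF Cinf_plateau])
  have arg: "norm (- (1 / \<rho>) *\<^sub>R p i + (1 / \<rho>) *\<^sub>R x) = dist (p i) x / \<rho>" for i x
  proof -
    have "- (1 / \<rho>) *\<^sub>R p i + (1 / \<rho>) *\<^sub>R x = (1 / \<rho>) *\<^sub>R (x - p i)" by (simp add: scaleR_diff_right)
    then show ?thesis using \<rho> by (simp add: dist_norm norm_minus_commute)
  qed
  have "Cinf_on UNIV (\<eta> i)" for i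
  proof -
    have "Cinf_on UNIV (\<lambda>x. 1 - \<beta> j x)" for j by (rule Cinf_diff[OF Cinf_const \<beta>C])
    then have "Cinf_on UNIV (\<lambda>x. \<Prod>j<i. 1 - \<beta> j x)" by (rule Cinf_prod)
    then show ?thesis unfolding \<eta>_def[abs_def] by (rule Cinf_mult[OF \<beta>C])
  qed
  moreover have "\<eta> i y = 0" if "dist (p i) y > r / 2" for i y
  proof -
    have "dist (p i) y / \<rho> \<ge> 6" using that r by (simp add: \<rho>_def field_simps)
    then have "\<beta> i y = 0" unfolding \<beta>_def by (intro plateau_eq_0, subst arg) simp
    then show ?thesis by (simp add: \<eta>_def)
  qed
  moreover have "(\<Sum>i<card P. \<eta> i x) = 1" if x: "x \<in> closure \<Omega>" for x
  proof -
    have tel: "(\<Sum>i<n. \<eta> i x) = 1 - (\<Prod>j<n. 1 - \<beta> j x)" for n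
      by (induction n) (auto simp: \<eta>_def algebra_simps)
    obtain q where q: "q \<in> P" "dist q x < \<rho>" using P(3) x by auto
    then obtain i where i: "i < card P" "p i = q" using p by (metis bij_betw_iff_bijections lessThan_iff)
    have "\<beta> i x = 1" unfolding \<beta>_def by (rule plateau_eq_1, subst arg) (use q i \<rho> in simp)
    then have "(\<Prod>j<card P. 1 - \<beta> j x) = 0" using i(1) by (intro prod_zero) auto
    then show ?thesis using tel by simp
  qed
  moreover have "p i \<in> closure \<Omega>" if "i < card P" for i
    using p P(1) that bij_betwE by blast
  ultimately show ?thesis by blast
qed

lemma nL2_le_nn_integral:
  assumes f: "L2 M f" and le: "(\<integral>\<^sup>+x. ennreal ((f x)\<^sup>2) \<partial>M) \<le> ennreal (\<epsilon>\<^sup>2)" and \<epsilon>: "0 \<le> \<epsilon>"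
  shows "nL2 M f \<le> \<epsilon>"
proof -
  have "ennreal (\<integral>x. (f x)\<^sup>2 \<partial>M) = (\<integral>\<^sup>+x. ennreal ((f x)\<^sup>2) \<partial>M)"
    using f by (intro nn_integral_eq_integral[symmetric]) (auto simp: L2_def)
  then have "ennreal ((nL2 M f)\<^sup>2) \<le> ennreal (\<epsilon>\<^sup>2)" using le by (simp only: nL2_sq)
  then have "(nL2 M f)\<^sup>2 \<le> \<epsilon>\<^sup>2" by (subst (asm) ennreal_le_iff) auto
  then show ?thesis using \<epsilon> by (rule power2_le_imp_le)
qed

lemma nn_integral_sum_square_le:
  fixes f :: "nat \<Rightarrow> 'a::euclidean_space \<Rightarrow> real"
  assumes [measurable]: "\<And>i. i < n \<Longrightarrow> f i \<in> borel_measurable borel" "\<Omega> \<in> sets borel"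
    and le: "\<And>i. i < n \<Longrightarrow> (\<integral>\<^sup>+x\<in>\<Omega>. ennreal ((f i x)\<^sup>2) \<partial>lborel) \<le> ennreal \<epsilon>" and \<epsilon>: "0 \<le> \<epsilon>"
  shows "(\<integral>\<^sup>+x\<in>\<Omega>. ennreal ((\<Sum>i<n. f i x)\<^sup>2) \<partial>lborel) \<le> ennreal ((real n)\<^sup>2 * \<epsilon>)"
proof -
  have "(\<integral>\<^sup>+x\<in>\<Omega>. ennreal ((\<Sum>i<n. f i x)\<^sup>2) \<partial>lborel) \<le> (\<integral>\<^sup>+x. ennreal (real n) * (\<Sum>i<n. ennreal ((f i x)\<^sup>2) * indicator \<Omega> x) \<partial>lborel)"
  proof (rule nn_integral_mono)
    fix x
    have "(\<Sum>i<n. f i x)\<^sup>2 \<le> real n * (\<Sum>i<n. (f i x)\<^sup>2)"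
      using sum_squared_le_sum_of_squares[of "\<lambda>i. f i x" "{..<n}"] by (simp add: mult.commute)
    then have "ennreal ((\<Sum>i<n. f i x)\<^sup>2) \<le> ennreal (real n) * (\<Sum>i<n. ennreal ((f i x)\<^sup>2))"
      by (simp add: ennreal_mult'[symmetric] sum_ennreal ennreal_leI)
    then show "ennreal ((\<Sum>i<n. f i x)\<^sup>2) * indicator \<Omega> x \<le> ennreal (real n) * (\<Sum>i<n. ennreal ((f i x)\<^sup>2) * indicator \<Omega> x)"
      by (cases "x \<in> \<Omega>") auto
  qed
  also have "\<dots> = ennreal (real n) * (\<integral>\<^sup>+x. (\<Sum>i<n. ennreal ((f i x)\<^sup>2) * indicator \<Omega> x) \<partial>lborel)"
    by (rule nn_integral_cmult) (rule borel_measurable_sum, measurable)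
  also have "(\<integral>\<^sup>+x. (\<Sum>i<n. ennreal ((f i x)\<^sup>2) * indicator \<Omega> x) \<partial>lborel) = (\<Sum>i<n. \<integral>\<^sup>+x\<in>\<Omega>. ennreal ((f i x)\<^sup>2) \<partial>lborel)"
    by (rule nn_integral_sum) measurable
  also have "ennreal (real n) * (\<Sum>i<n. \<integral>\<^sup>+x\<in>\<Omega>. ennreal ((f i x)\<^sup>2) \<partial>lborel) \<le> ennreal (real n) * (\<Sum>i<n. ennreal \<epsilon>)"
    by (intro mult_left_mono sum_mono le) auto
  also have "\<dots> = ennreal ((real n)\<^sup>2 * \<epsilon>)"
    using \<epsilon> by (simp add: power2_eq_square ennreal_mult ennreal_of_nat_eq_real_of_nat mult.assoc)
  finally show ?thesis .
qed

text \<open>The local approximations are summed over a partition of unity subordinate to balls on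
  which the uniform cone is available.\<close>

theorem Cinf_dense_H1:
  assumes \<Omega>: "smooth_bounded_domain \<Omega>" and w: "weak_grad \<Omega> w G" and \<epsilon>: "0 < \<epsilon>"
  shows "\<exists>\<phi>. Cinf_on UNIV \<phi> \<and> nL2 (lebesgue_on \<Omega>) (\<lambda>x. \<phi> x - w x) \<le> \<epsilon> \<and>
    (\<forall>b\<in>Basis. nL2 (lebesgue_on \<Omega>) (\<lambda>x. pd b \<phi> x - G x \<bullet> b) \<le> \<epsilon>)"
proof -
  have op: "open \<Omega>" "bounded \<Omega>" using \<Omega> by (auto simp: smooth_bounded_domain_def)
  have \<Omega>m[measurable]: "\<Omega> \<in> sets borel" using op by simp
  have wL: "L2 (lebesgue_on \<Omega>) w" and GL: "\<And>b. b \<in> Basis \<Longrightarrow> L2 (lebesgue_on \<Omega>) (\<lambda>x. G x \<bullet> b)"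
    using w by (auto simp: weak_grad_def)
  obtain wt where wt: "wt \<in> borel_measurable borel" "\<And>x. x \<notin> \<Omega> \<Longrightarrow> wt x = 0" "AE x in lebesgue_on \<Omega>. w x = wt x"
    "integrable lborel wt" "(\<integral>\<^sup>+x. ennreal ((wt x)\<^sup>2) \<partial>lborel) < \<infinity>"
    using L2_borel_representative[OF op wL] by blast
  have "\<forall>b\<in>Basis. \<exists>g. g \<in> borel_measurable borel \<and> (\<forall>x. x \<notin> \<Omega> \<longrightarrow> g x = 0) \<and> (AE x in lebesgue_on \<Omega>. G x \<bullet> b = g x)
    \<and> integrable lborel g \<and> (\<integral>\<^sup>+x. ennreal ((g x)\<^sup>2) \<partial>lborel) < \<infinity>"
  proof
    fix b :: pt assume "b \<in> Basis"
    then obtain g where "g \<in> borel_measurable borel" "\<And>x. x \<notin> \<Omega> \<Longrightarrow> g x = 0" "AE x in lebesgue_on \<Omega>. G x \<bullet> b = g x"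
      "integrable lborel g" "(\<integral>\<^sup>+x. ennreal ((g x)\<^sup>2) \<partial>lborel) < \<infinity>"
      using L2_borel_representative[OF op GL] by blast
    then show "\<exists>g. g \<in> borel_measurable borel \<and> (\<forall>x. x \<notin> \<Omega> \<longrightarrow> g x = 0) \<and> (AE x in lebesgue_on \<Omega>. G x \<bullet> b = g x)
      \<and> integrable lborel g \<and> (\<integral>\<^sup>+x. ennreal ((g x)\<^sup>2) \<partial>lborel) < \<infinity>"
      by (intro exI[of _ g]) auto
  qed
  then obtain gt where gt0: "\<forall>b\<in>Basis. gt b \<in> borel_measurable borel \<and> (\<forall>x. x \<notin> \<Omega> \<longrightarrow> gt b x = 0) \<and> (AE x in lebesgue_on \<Omega>. G x \<bullet> b = gt b x)
    \<and> integrable lborel (gt b) \<and> (\<integral>\<^sup>+x. ennreal ((gt b x)\<^sup>2) \<partial>lborel) < \<infinity>"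
    by (rule bchoice[THEN exE])
  then have gt: "\<And>b. b \<in> Basis \<Longrightarrow> gt b \<in> borel_measurable borel" "\<And>b x. b \<in> Basis \<Longrightarrow> x \<notin> \<Omega> \<Longrightarrow> gt b x = 0"
      "\<And>b. b \<in> Basis \<Longrightarrow> AE x in lebesgue_on \<Omega>. G x \<bullet> b = gt b x" "\<And>b. b \<in> Basis \<Longrightarrow> integrable lborel (gt b)"
      "\<And>b. b \<in> Basis \<Longrightarrow> (\<integral>\<^sup>+x. ennreal ((gt b x)\<^sup>2) \<partial>lborel) < \<infinity>"
    by auto
  obtain c r where cr: "0 < c" "0 < r" "\<And>a. a \<in> closure \<Omega> \<Longrightarrow> \<exists>e. cone_at \<Omega> a e c r"
    using uniform_cone[OF \<Omega>] by blast
  obtain n and p :: "nat \<Rightarrow> pt" and \<eta> where P: "\<And>i. i < n \<Longrightarrow> p i \<in> closure \<Omega>" "\<And>i. i < n \<Longrightarrow> Cinf_on UNIV (\<eta> i)"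
      "\<And>i y. i < n \<Longrightarrow> dist (p i) y > r / 2 \<Longrightarrow> \<eta> i y = 0" "\<And>x. x \<in> closure \<Omega> \<Longrightarrow> (\<Sum>i<n. \<eta> i x) = 1"
    using partition_of_unity[OF op(2) cr(2)] by blast
  \<comment> \<open>The squared norm of a sum of \<open>n\<close> errors is at most \<open>n\<close>
    squared times the largest of their squared norms; the summand 1 covers
    \<open>n = 0\<close>.\<close>
  define \<epsilon>' where "\<epsilon>' = \<epsilon>\<^sup>2 / ((real n)\<^sup>2 + 1)"
  have \<epsilon>': "0 < \<epsilon>'" using \<epsilon> by (simp add: \<epsilon>'_def add_nonneg_pos)
  have \<epsilon>'le: "(real n)\<^sup>2 * \<epsilon>' \<le> \<epsilon>\<^sup>2"
  proof -
    have "(real n)\<^sup>2 * \<epsilon>' = \<epsilon>\<^sup>2 * ((real n)\<^sup>2 / ((real n)\<^sup>2 + 1))" by (simp add: \<epsilon>'_def)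
    also have "\<dots> \<le> \<epsilon>\<^sup>2 * 1" by (intro mult_left_mono) (auto simp: divide_le_eq add_nonneg_pos)
    finally show ?thesis by simp
  qed
  define Q where "Q i \<phi> \<longleftrightarrow> Cinf_on UNIV \<phi> \<and> (\<integral>\<^sup>+x\<in>\<Omega>. ennreal ((\<phi> x - \<eta> i x * wt x)\<^sup>2) \<partial>lborel) \<le> ennreal \<epsilon>' \<and>
    (\<forall>b\<in>Basis. (\<integral>\<^sup>+x\<in>\<Omega>. ennreal ((pd b \<phi> x - (\<eta> i x * gt b x + pd b (\<eta> i) x * wt x))\<^sup>2) \<partial>lborel) \<le> ennreal \<epsilon>')" for i \<phi>
  have "\<forall>i\<in>{..<n}. \<exists>\<phi>. Q i \<phi>"
  proof
    fix i assume "i \<in> {..<n}"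
    then have i: "i < n" by simp
    obtain e where "cone_at \<Omega> (p i) e c r" using cr(3)[OF P(1)[OF i]] by blast
    then show "\<exists>\<phi>. Q i \<phi>" unfolding Q_def
      by (rule local_density[OF op w P(2)[OF i] _ P(3)[OF i] wt gt \<epsilon>'])
  qed
  then obtain \<phi> where Q: "\<forall>i\<in>{..<n}. Q i (\<phi> i)" by (rule bchoice[THEN exE])
  then have \<phi>C: "\<And>i. i < n \<Longrightarrow> Cinf_on UNIV (\<phi> i)" by (simp add: Q_def)
  define \<Phi> where "\<Phi> x = (\<Sum>i<n. \<phi> i x)" for x
  have \<Phi>C: "Cinf_on UNIV \<Phi>" unfolding \<Phi>_def[abs_def] using \<phi>C by (intro Cinf_sum) auto
  have fin: "nL2 (lebesgue_on \<Omega>) (\<lambda>x. f x - v x) \<le> \<epsilon>"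
    if f: "L2 (lebesgue_on \<Omega>) f" and v: "L2 (lebesgue_on \<Omega>) v" and ae: "AE x in lebesgue_on \<Omega>. v x = v' x"
      and eq: "\<And>x. x \<in> \<Omega> \<Longrightarrow> f x - v' x = (\<Sum>i<n. h i x)" and hm: "\<And>i. i < n \<Longrightarrow> h i \<in> borel_measurable borel"
      and le: "\<And>i. i < n \<Longrightarrow> (\<integral>\<^sup>+x\<in>\<Omega>. ennreal ((h i x)\<^sup>2) \<partial>lborel) \<le> ennreal \<epsilon>'" for f v v' :: "pt \<Rightarrow> real" and h
  proof (rule nL2_le_nn_integral[OF L2_diff[OF f v]])
    have "(\<integral>\<^sup>+x. ennreal ((f x - v x)\<^sup>2) \<partial>lebesgue_on \<Omega>) = (\<integral>\<^sup>+x. ennreal ((f x - v' x)\<^sup>2) \<partial>lebesgue_on \<Omega>)"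
      by (rule nn_integral_cong_AE) (use ae in auto)
    also have "\<dots> = (\<integral>\<^sup>+x\<in>\<Omega>. ennreal ((f x - v' x)\<^sup>2) \<partial>lborel)" by (rule nn_integral_lebesgue_on[OF \<Omega>m])
    also have "\<dots> = (\<integral>\<^sup>+x\<in>\<Omega>. ennreal ((\<Sum>i<n. h i x)\<^sup>2) \<partial>lborel)"
      using eq by (intro nn_integral_cong) (auto simp: indicator_def)
    also have "\<dots> \<le> ennreal ((real n)\<^sup>2 * \<epsilon>')"
      by (rule nn_integral_sum_square_le[OF hm \<Omega>m le]) (use \<epsilon>' in auto)
    also have "\<dots> \<le> ennreal (\<epsilon>\<^sup>2)" by (rule ennreal_leI[OF \<epsilon>'le])
    finally show "(\<integral>\<^sup>+x. ennreal ((f x - v x)\<^sup>2) \<partial>lebesgue_on \<Omega>) \<le> ennreal (\<epsilon>\<^sup>2)" .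
  qed (use \<epsilon> in simp)
  have sum1: "(\<Sum>i<n. \<eta> i x) = 1" if "x \<in> \<Omega>" for x using P(4)[of x] closure_subset[of \<Omega>] that by blast
  have "nL2 (lebesgue_on \<Omega>) (\<lambda>x. \<Phi> x - w x) \<le> \<epsilon>"
  proof (rule fin[OF L2_Cinf[OF \<Phi>C op] wL wt(3), of "\<lambda>i x. \<phi> i x - \<eta> i x * wt x"])
    show "\<Phi> x - wt x = (\<Sum>i<n. \<phi> i x - \<eta> i x * wt x)" if "x \<in> \<Omega>" for x
      using sum1[OF that] by (simp add: \<Phi>_def sum_subtractf sum_distrib_right[symmetric])
    show "(\<lambda>x. \<phi> i x - \<eta> i x * wt x) \<in> borel_measurable borel" if "i < n" for i
      using borel_measurable_Cinf[OF \<phi>C[OF that]] borel_measurable_Cinf[OF P(2)[OF that]] wt(1) by auto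
  qed (use Q in \<open>auto simp: Q_def\<close>)
  moreover have "nL2 (lebesgue_on \<Omega>) (\<lambda>x. pd b \<Phi> x - G x \<bullet> b) \<le> \<epsilon>" if b: "b \<in> Basis" for b
  proof (rule fin[OF L2_pd[OF \<Phi>C b op] GL[OF b] gt(3)[OF b], of "\<lambda>i x. pd b (\<phi> i) x - (\<eta> i x * gt b x + pd b (\<eta> i) x * wt x)"])
    show "pd b \<Phi> x - gt b x = (\<Sum>i<n. pd b (\<phi> i) x - (\<eta> i x * gt b x + pd b (\<eta> i) x * wt x))" if x: "x \<in> \<Omega>" for x
    proof -
      \<comment> \<open>The cutoffs sum to 1 on the open set \<open>\<Omega>\<close>, so the
        derivatives of the cutoffs cancel and no term with \<open>wt\<close> survives in the
        gradient.\<close>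
      have "pd b (\<lambda>x. (\<Sum>i<n. \<eta> i x) - 1) x = 0"
        by (rule pd_eq_0_open[OF op(1) x]) (simp add: sum1)
      moreover have "Cinf_on UNIV (\<lambda>x. \<Sum>i<n. \<eta> i x)" using P(2) by (intro Cinf_sum) auto
      ultimately have "pd b (\<lambda>x. \<Sum>i<n. \<eta> i x) x = 0"
        using pd_diff[OF _ Cinf_const b, of "\<lambda>x. \<Sum>i<n. \<eta> i x" 1 x] by (simp add: pd_const)
      then have z: "(\<Sum>i<n. pd b (\<eta> i) x) = 0" using pd_sum[of "{..<n}" \<eta> b x] P(2) b by simp
      have "pd b \<Phi> x = (\<Sum>i<n. pd b (\<phi> i) x)" unfolding \<Phi>_def[abs_def] using pd_sum[of "{..<n}" \<phi> b x] \<phi>C b by simp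
      then show ?thesis using sum1[OF x] z
        by (simp add: sum_subtractf sum.distrib sum_distrib_right[symmetric])
    qed
    show "(\<lambda>x. pd b (\<phi> i) x - (\<eta> i x * gt b x + pd b (\<eta> i) x * wt x)) \<in> borel_measurable borel" if "i < n" for i
      using borel_measurable_Cinf[OF Cinf_on_pd[OF \<phi>C[OF that] b]] borel_measurable_Cinf[OF P(2)[OF that]]
        borel_measurable_Cinf[OF Cinf_on_pd[OF P(2)[OF that] b]] wt(1) gt(1)[OF b] by auto
  qed (use Q b in \<open>auto simp: Q_def\<close>)
  ultimately show ?thesis using \<Phi>C by blast
qed

subsection \<open>The inverse Neumann Laplacian\<close>

lemma grad_add: "Cinf_on UNIV \<phi> \<Longrightarrow> Cinf_on UNIV \<psi> \<Longrightarrow> grad (\<lambda>x. \<phi> x + \<psi> x) x = grad \<phi> x + grad \<psi> x"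
  unfolding grad_def by (simp add: pd_add scaleR_left_distrib sum.distrib)

lemma grad_scale: "Cinf_on UNIV \<phi> \<Longrightarrow> grad (\<lambda>x. c * \<phi> x) x = c *\<^sub>R grad \<phi> x"
  unfolding grad_def by (simp add: pd_scale scaleR_sum_right)

lemma grad_diff: "Cinf_on UNIV \<phi> \<Longrightarrow> Cinf_on UNIV \<psi> \<Longrightarrow> grad (\<lambda>x. \<phi> x - \<psi> x) x = grad \<phi> x - grad \<psi> x"
  unfolding grad_def by (simp add: pd_diff scaleR_left_diff_distrib sum_subtractf)

definition gip :: "'a::euclidean_space set \<Rightarrow> ('a \<Rightarrow> real) \<Rightarrow> ('a \<Rightarrow> real) \<Rightarrow> real" where
  "gip \<Omega> \<phi> \<psi> = (\<integral>x. grad \<phi> x \<bullet> grad \<psi> x \<partial>lebesgue_on \<Omega>)"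

lemma gip_integrable:
  assumes "open \<Omega>" "bounded \<Omega>" "Cinf_on UNIV \<phi>" "Cinf_on UNIV \<psi>"
  shows "integrable (lebesgue_on \<Omega>) (\<lambda>x. grad \<phi> x \<bullet> grad \<psi> x)"
  using assms by (intro integrable_continuous_lebesgue_on continuous_on_inner continuous_on_grad)

lemma gip_commute: "gip \<Omega> \<phi> \<psi> = gip \<Omega> \<psi> \<phi>"
  by (simp add: gip_def inner_commute)

lemma gip_self: "gip \<Omega> \<phi> \<phi> = (nG \<Omega> \<phi>)\<^sup>2"
  by (simp add: gip_def nG_def nL2_sq power2_norm_eq_inner)

lemma gip_add_scale_right:
  assumes "open \<Omega>" "bounded \<Omega>" "Cinf_on UNIV \<phi>" "Cinf_on UNIV \<psi>" "Cinf_on UNIV \<theta>"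
  shows "gip \<Omega> \<theta> (\<lambda>x. \<phi> x + t * \<psi> x) = gip \<Omega> \<theta> \<phi> + t * gip \<Omega> \<theta> \<psi>"
  unfolding gip_def using assms gip_integrable[of \<Omega> \<theta> \<phi>] gip_integrable[of \<Omega> \<theta> \<psi>]
  by (simp add: grad_add Cinf_scale grad_scale inner_add_right)

lemma gip_diff_left:
  assumes "open \<Omega>" "bounded \<Omega>" "Cinf_on UNIV \<phi>" "Cinf_on UNIV \<psi>" "Cinf_on UNIV \<theta>"
  shows "gip \<Omega> (\<lambda>x. \<phi> x - \<psi> x) \<theta> = gip \<Omega> \<phi> \<theta> - gip \<Omega> \<psi> \<theta>"
  unfolding gip_def grad_diff[OF assms(3,4)] inner_diff_left
  by (rule Bochner_Integration.integral_diff) (rule gip_integrable[OF assms(1,2,3,5)] gip_integrable[OF assms(1,2,4,5)])+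

lemma nG_add_scale_sq:
  assumes "open \<Omega>" "bounded \<Omega>" "Cinf_on UNIV \<phi>" "Cinf_on UNIV \<psi>"
  shows "(nG \<Omega> (\<lambda>x. \<phi> x + t * \<psi> x))\<^sup>2 = (nG \<Omega> \<phi>)\<^sup>2 + 2 * t * gip \<Omega> \<phi> \<psi> + t\<^sup>2 * (nG \<Omega> \<psi>)\<^sup>2"
proof -
  have C: "Cinf_on UNIV (\<lambda>x. \<phi> x + t * \<psi> x)" using assms by (intro Cinf_add Cinf_scale)
  have "(nG \<Omega> (\<lambda>x. \<phi> x + t * \<psi> x))\<^sup>2 = gip \<Omega> (\<lambda>x. \<phi> x + t * \<psi> x) \<phi> + t * gip \<Omega> (\<lambda>x. \<phi> x + t * \<psi> x) \<psi>"
    unfolding gip_self[symmetric] by (rule gip_add_scale_right[OF assms C])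
  also have "\<dots> = gip \<Omega> \<phi> (\<lambda>x. \<phi> x + t * \<psi> x) + t * gip \<Omega> \<psi> (\<lambda>x. \<phi> x + t * \<psi> x)"
    by (simp only: gip_commute[of \<Omega> "\<lambda>x. \<phi> x + t * \<psi> x"])
  also have "\<dots> = (nG \<Omega> \<phi>)\<^sup>2 + 2 * t * gip \<Omega> \<phi> \<psi> + t\<^sup>2 * (nG \<Omega> \<psi>)\<^sup>2"
    using gip_add_scale_right[OF assms assms(3), of t] gip_add_scale_right[OF assms assms(4), of t]
    by (simp add: gip_self gip_commute[of \<Omega> \<psi> \<phi>] power2_eq_square algebra_simps)
  finally show ?thesis .
qed

definition mean_zero :: "pt set \<Rightarrow> (pt \<Rightarrow> real) \<Rightarrow> bool" where
  "mean_zero \<Omega> g \<longleftrightarrow> L2 (lebesgue_on \<Omega>) g \<and> (\<integral>x. g x \<partial>lebesgue_on \<Omega>) = 0"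

definition ip :: "'a::euclidean_space set \<Rightarrow> ('a \<Rightarrow> real) \<Rightarrow> ('a \<Rightarrow> real) \<Rightarrow> real" where
  "ip \<Omega> f g = (\<integral>x. f x * g x \<partial>lebesgue_on \<Omega>)"

lemma ip_commute: "ip \<Omega> f g = ip \<Omega> g f"
  by (simp add: ip_def mult.commute)

lemma ip_bound: "L2 (lebesgue_on \<Omega>) f \<Longrightarrow> L2 (lebesgue_on \<Omega>) g \<Longrightarrow> \<bar>ip \<Omega> f g\<bar> \<le> nL2 (lebesgue_on \<Omega>) f * nL2 (lebesgue_on \<Omega>) g"
  unfolding ip_def by (rule L2_cauchy_schwarz)

lemma ip_add_right:
  "L2 (lebesgue_on \<Omega>) f \<Longrightarrow> L2 (lebesgue_on \<Omega>) g \<Longrightarrow> L2 (lebesgue_on \<Omega>) k \<Longrightarrow> ip \<Omega> f (\<lambda>x. g x + k x) = ip \<Omega> f g + ip \<Omega> f k"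
  unfolding ip_def using L2_mult_integrable[of "lebesgue_on \<Omega>" f g] L2_mult_integrable[of "lebesgue_on \<Omega>" f k]
  by (simp add: distrib_left)

lemma ip_diff_right:
  "L2 (lebesgue_on \<Omega>) f \<Longrightarrow> L2 (lebesgue_on \<Omega>) g \<Longrightarrow> L2 (lebesgue_on \<Omega>) k \<Longrightarrow> ip \<Omega> f (\<lambda>x. g x - k x) = ip \<Omega> f g - ip \<Omega> f k"
  unfolding ip_def using L2_mult_integrable[of "lebesgue_on \<Omega>" f g] L2_mult_integrable[of "lebesgue_on \<Omega>" f k]
  by (simp add: right_diff_distrib)

lemma ip_scale_right: "ip \<Omega> f (\<lambda>x. c * g x) = c * ip \<Omega> f g"
  unfolding ip_def by (simp add: mult.left_commute[of _ c])

lemma integrable_L2_lebesgue_on: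
  assumes "open \<Omega>" "bounded \<Omega>" "L2 (lebesgue_on \<Omega>) f"
  shows "integrable (lebesgue_on \<Omega>) f"
  using L2_mult_integrable[OF assms(3) L2_continuous[OF continuous_on_const assms(1,2), of 1]] by simp

lemma measure_domain_pos:
  assumes "smooth_bounded_domain \<Omega>"
  shows "0 < measure (lebesgue_on \<Omega>) \<Omega>" "measure (lebesgue_on \<Omega>) \<Omega> = measure lebesgue \<Omega>"
proof -
  have op: "open \<Omega>" "bounded \<Omega>" "\<Omega> \<noteq> {}" using assms by (auto simp: smooth_bounded_domain_def)
  show eq: "measure (lebesgue_on \<Omega>) \<Omega> = measure lebesgue \<Omega>" using op by (simp add: measure_restrict_space)
  have "measure lebesgue \<Omega> \<noteq> 0"
    using op open_not_negligible[of \<Omega>] negligible_iff_measure[of \<Omega>] lmeasurable_open[of \<Omega>] by blast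
  then show "0 < measure (lebesgue_on \<Omega>) \<Omega>" using eq by (simp add: zero_less_measure_iff)
qed

lemma subtract_mean:
  assumes \<Omega>: "smooth_bounded_domain \<Omega>" and \<theta>: "Cinf_on UNIV \<theta>"
  obtains m where "(\<integral>x. \<theta> x - m \<partial>lebesgue_on \<Omega>) = 0"
proof -
  have op: "open \<Omega>" "bounded \<Omega>" using \<Omega> by (auto simp: smooth_bounded_domain_def)
  interpret finite_measure "lebesgue_on \<Omega>" using op by (rule lebesgue_on_finite_measure)
  let ?m = "(\<integral>x. \<theta> x \<partial>lebesgue_on \<Omega>) / measure (lebesgue_on \<Omega>) \<Omega>"
  have "integrable (lebesgue_on \<Omega>) \<theta>" by (rule integrable_continuous_lebesgue_on[OF Cinf_on_continuous[OF \<theta>] op])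
  then have "(\<integral>x. \<theta> x - ?m \<partial>lebesgue_on \<Omega>) = (\<integral>x. \<theta> x \<partial>lebesgue_on \<Omega>) - ?m * measure (lebesgue_on \<Omega>) \<Omega>"
    by (simp add: space_restrict_space)
  also have "\<dots> = 0" using measure_domain_pos(1)[OF \<Omega>] by simp
  finally show ?thesis by (rule that)
qed

text \<open>An almost minimiser of the Dirichlet energy solves the Neumann problem approximately;
  this replaces the Riesz representation theorem, so that no completion of the smooth functions is needed.\<close>
lemma neumann_approx_exists:
  assumes \<Omega>: "smooth_bounded_domain \<Omega>" and g: "mean_zero \<Omega> g" and \<epsilon>: "0 < \<epsilon>"
  shows "\<exists>\<phi>. Cinf_on UNIV \<phi> \<and> (\<integral>x. \<phi> x \<partial>lebesgue_on \<Omega>) = 0 \<and>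
    (\<forall>\<theta>. Cinf_on UNIV \<theta> \<longrightarrow> \<bar>gip \<Omega> \<phi> \<theta> - ip \<Omega> g \<theta>\<bar> \<le> \<epsilon> * nG \<Omega> \<theta>)"
proof -
  have op: "open \<Omega>" "bounded \<Omega>" using \<Omega> by (auto simp: smooth_bounded_domain_def)
  have gL: "L2 (lebesgue_on \<Omega>) g" and g0: "(\<integral>x. g x \<partial>lebesgue_on \<Omega>) = 0" using g by (auto simp: mean_zero_def)
  obtain C where C: "C > 0" "\<And>\<phi>. Cinf_on UNIV \<phi> \<Longrightarrow> (\<integral>x. \<phi> x \<partial>lebesgue_on \<Omega>) = 0 \<Longrightarrow> nL2 (lebesgue_on \<Omega>) \<phi> \<le> C * nG \<Omega> \<phi>"
    using poincare[OF \<Omega>] by blast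
  define S where "S = {\<phi>. Cinf_on UNIV \<phi> \<and> (\<integral>x. \<phi> x \<partial>lebesgue_on \<Omega>) = 0}"
  define J where "J \<phi> = (nG \<Omega> \<phi>)\<^sup>2 / 2 - ip \<Omega> g \<phi>" for \<phi>
  let ?a = "C * nL2 (lebesgue_on \<Omega>) g"
  \<comment> \<open>The Poincare inequality bounds the linear term by \<open>?a\<close> times the
    energy norm, and completing the square bounds \<open>J\<close> from below.\<close>
  have lower: "- (?a\<^sup>2 / 2) \<le> J \<phi>" if "\<phi> \<in> S" for \<phi>
  proof -
    have \<phi>: "Cinf_on UNIV \<phi>" "(\<integral>x. \<phi> x \<partial>lebesgue_on \<Omega>) = 0" using that by (auto simp: S_def)
    have "ip \<Omega> g \<phi> \<le> nL2 (lebesgue_on \<Omega>) g * nL2 (lebesgue_on \<Omega>) \<phi>"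
      using ip_bound[OF gL L2_Cinf[OF \<phi>(1) op]] by linarith
    also have "\<dots> \<le> nL2 (lebesgue_on \<Omega>) g * (C * nG \<Omega> \<phi>)" by (intro mult_left_mono C \<phi>) simp
    finally have "ip \<Omega> g \<phi> \<le> ?a * nG \<Omega> \<phi>" by (simp add: mult_ac)
    moreover have "0 \<le> (nG \<Omega> \<phi> - ?a)\<^sup>2" by simp
    then have "2 * (?a * nG \<Omega> \<phi>) \<le> (nG \<Omega> \<phi>)\<^sup>2 + ?a\<^sup>2" unfolding power2_diff by (simp add: mult_ac)
    ultimately show ?thesis unfolding J_def by linarith
  qed
  have bdd: "bdd_below (J ` S)" using lower by (intro bdd_belowI2[of _ "- (?a\<^sup>2 / 2)"]) auto
  have ne: "J ` S \<noteq> {}" by (auto simp: S_def intro!: exI[of _ "\<lambda>x. 0"] Cinf_const)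
  \<comment> \<open>An energy gap of half the square of \<open>\<epsilon>\<close> corresponds to a
    residual of size \<open>\<epsilon>\<close> relative to the energy norm, because \<open>J\<close>
    is quadratic.\<close>
  have "Inf (J ` S) < Inf (J ` S) + \<epsilon>\<^sup>2 / 2" using \<epsilon> by simp
  then have "\<exists>y\<in>J ` S. y < Inf (J ` S) + \<epsilon>\<^sup>2 / 2" by (subst (asm) cInf_less_iff[OF ne bdd])
  then obtain \<phi> where \<phi>S: "\<phi> \<in> S" and \<phi>J: "J \<phi> < Inf (J ` S) + \<epsilon>\<^sup>2 / 2" by blast
  have \<phi>: "Cinf_on UNIV \<phi>" "(\<integral>x. \<phi> x \<partial>lebesgue_on \<Omega>) = 0" using \<phi>S by (auto simp: S_def)
  have "\<bar>gip \<Omega> \<phi> \<theta> - ip \<Omega> g \<theta>\<bar> \<le> \<epsilon> * nG \<Omega> \<theta>" if \<theta>: "Cinf_on UNIV \<theta>" for \<theta>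
  proof -
    \<comment> \<open>Variations must keep the mean zero. Constants have no gradient and
      \<open>g\<close> has mean zero, so subtracting the mean of \<open>\<theta>\<close> changes
      neither of the compared quantities.\<close>
    obtain m where m: "(\<integral>x. \<theta> x - m \<partial>lebesgue_on \<Omega>) = 0" using subtract_mean[OF \<Omega> \<theta>] by blast
    define \<psi> where "\<psi> x = \<theta> x - m" for x
    have \<psi>: "Cinf_on UNIV \<psi>" unfolding \<psi>_def[abs_def] by (rule Cinf_diff[OF \<theta> Cinf_const])
    have gr: "grad \<psi> = grad \<theta>" unfolding \<psi>_def[abs_def] using grad_minus_const[OF \<theta>] by auto
    have eq1: "gip \<Omega> \<phi> \<psi> = gip \<Omega> \<phi> \<theta>" "nG \<Omega> \<psi> = nG \<Omega> \<theta>" by (auto simp: gip_def nG_def gr)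
    have eq2: "ip \<Omega> g \<psi> = ip \<Omega> g \<theta>"
    proof -
      have "ip \<Omega> g \<psi> = ip \<Omega> g \<theta> - ip \<Omega> g (\<lambda>_. m)"
        unfolding \<psi>_def by (rule ip_diff_right[OF gL L2_Cinf[OF \<theta> op] L2_Cinf[OF Cinf_const op]])
      also have "ip \<Omega> g (\<lambda>_. m) = 0" unfolding ip_def using g0 by simp
      finally show ?thesis by simp
    qed
    let ?d = "gip \<Omega> \<phi> \<theta> - ip \<Omega> g \<theta>" and ?n = "nG \<Omega> \<theta>"
    have var: "- (\<epsilon>\<^sup>2 / 2) \<le> t * ?d + t\<^sup>2 / 2 * ?n\<^sup>2" for t
    proof -
      have C': "Cinf_on UNIV (\<lambda>x. \<phi> x + t * \<psi> x)" using \<phi>(1) \<psi> by (intro Cinf_add Cinf_scale)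
      have i: "integrable (lebesgue_on \<Omega>) \<phi>" "integrable (lebesgue_on \<Omega>) \<psi>"
        using \<phi>(1) \<psi> op by (auto intro!: integrable_continuous_lebesgue_on Cinf_on_continuous)
      have "(\<integral>x. \<psi> x \<partial>lebesgue_on \<Omega>) = 0" using m by (simp add: \<psi>_def)
      then have "(\<integral>x. \<phi> x + t * \<psi> x \<partial>lebesgue_on \<Omega>) = 0" using i \<phi>(2) by simp
      then have "(\<lambda>x. \<phi> x + t * \<psi> x) \<in> S" using C' by (simp add: S_def)
      then have "Inf (J ` S) \<le> J (\<lambda>x. \<phi> x + t * \<psi> x)" using bdd by (intro cInf_lower) auto
      also have "\<dots> = J \<phi> + t * ?d + t\<^sup>2 / 2 * ?n\<^sup>2"
        unfolding J_def nG_add_scale_sq[OF op \<phi>(1) \<psi>] eq1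
          ip_add_right[OF gL L2_Cinf[OF \<phi>(1) op] L2_scale[OF L2_Cinf[OF \<psi> op]]] ip_scale_right eq2
        by (simp add: field_simps)
      finally show ?thesis using \<phi>J by linarith
    qed
    show ?thesis
    proof (cases "?n = 0")
      case True
      have "?d = 0"
      proof (rule ccontr)
        assume d: "?d \<noteq> 0"
        have "- (\<epsilon>\<^sup>2 / 2) \<le> (- \<epsilon>\<^sup>2 / ?d) * ?d + (- \<epsilon>\<^sup>2 / ?d)\<^sup>2 / 2 * ?n\<^sup>2" by (rule var)
        then show False using d True \<epsilon> by simp
      qed
      then show ?thesis using \<epsilon> by simp
    next
      case False
      then have n: "?n > 0" using nG_nonneg[of \<Omega> \<theta>] by linarith
      \<comment> \<open>Among all steps this one gives the sharpest bound on \<open>?d\<close>: the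
        quadratic term then equals the energy gap.\<close>
      define t where "t = - sgn ?d * (\<epsilon> / ?n)"
      have "t\<^sup>2 * ?n\<^sup>2 \<le> \<epsilon>\<^sup>2" using n by (auto simp: t_def power_mult_distrib power_divide sgn_real_def)
      moreover have "t * ?d = - (\<epsilon> / ?n * \<bar>?d\<bar>)" by (simp add: t_def sgn_real_def)
      ultimately have "\<epsilon> / ?n * \<bar>?d\<bar> \<le> \<epsilon>\<^sup>2" using var[of t] by simp
      then have "\<epsilon> * \<bar>?d\<bar> \<le> \<epsilon> * (\<epsilon> * ?n)" using n by (simp add: power2_eq_square divide_le_eq mult_ac)
      then show ?thesis using \<epsilon> by simp
    qed
  qed
  then show ?thesis using \<phi> by blast
qed

text \<open>A choice depending on \<open>g\<close> and \<open>n\<close> alone. When \<open>g\<close>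
  is fixed, the approximants are fixed test functions, so pairings with time-dependent functions
  stay measurable in time and increments pass to the limit.\<close>

definition neumann_approx :: "pt set \<Rightarrow> (pt \<Rightarrow> real) \<Rightarrow> nat \<Rightarrow> pt \<Rightarrow> real" where
  "neumann_approx \<Omega> g n = (SOME \<phi>. Cinf_on UNIV \<phi> \<and> (\<integral>x. \<phi> x \<partial>lebesgue_on \<Omega>) = 0 \<and>
    (\<forall>\<theta>. Cinf_on UNIV \<theta> \<longrightarrow> \<bar>gip \<Omega> \<phi> \<theta> - ip \<Omega> g \<theta>\<bar> \<le> inverse (real (Suc n)) * nG \<Omega> \<theta>))"

text \<open>The bilinear form \<open>(f, N g)\<close>, where \<open>N\<close> inverts the Neumann Laplacian on functions of mean zero.\<close>
definition neumann_form :: "pt set \<Rightarrow> (pt \<Rightarrow> real) \<Rightarrow> (pt \<Rightarrow> real) \<Rightarrow> real" where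
  "neumann_form \<Omega> f g = lim (\<lambda>n. ip \<Omega> f (neumann_approx \<Omega> g n))"

section \<open>Estimates for the approximate Neumann solutions\<close>

locale poincare_domain =
  fixes \<Omega> :: "pt set" and C :: real
  assumes dom: "smooth_bounded_domain \<Omega>" and C_pos: "0 < C"
    and pc: "Cinf_on UNIV \<phi> \<Longrightarrow> (\<integral>x. \<phi> x \<partial>lebesgue_on \<Omega>) = 0 \<Longrightarrow> nL2 (lebesgue_on \<Omega>) \<phi> \<le> C * nG \<Omega> \<phi>"
begin

abbreviation "nrm \<equiv> nL2 (lebesgue_on \<Omega>)"

lemma op: "open \<Omega>" "bounded \<Omega>"
  using dom by (auto simp: smooth_bounded_domain_def)

lemma approx:
  assumes "mean_zero \<Omega> g"
  shows "Cinf_on UNIV (neumann_approx \<Omega> g n)" "(\<integral>x. neumann_approx \<Omega> g n x \<partial>lebesgue_on \<Omega>) = 0"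
    "Cinf_on UNIV \<theta> \<Longrightarrow> \<bar>gip \<Omega> (neumann_approx \<Omega> g n) \<theta> - ip \<Omega> g \<theta>\<bar> \<le> inverse (real (Suc n)) * nG \<Omega> \<theta>"
proof -
  have "0 < inverse (real (Suc n))" by simp
  from someI_ex[OF neumann_approx_exists[OF dom assms this]]
  show "Cinf_on UNIV (neumann_approx \<Omega> g n)" "(\<integral>x. neumann_approx \<Omega> g n x \<partial>lebesgue_on \<Omega>) = 0"
    "Cinf_on UNIV \<theta> \<Longrightarrow> \<bar>gip \<Omega> (neumann_approx \<Omega> g n) \<theta> - ip \<Omega> g \<theta>\<bar> \<le> inverse (real (Suc n)) * nG \<Omega> \<theta>"
    unfolding neumann_approx_def by blast+
qed

lemma approx_L2: "mean_zero \<Omega> g \<Longrightarrow> L2 (lebesgue_on \<Omega>) (neumann_approx \<Omega> g n)"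
  by (rule L2_Cinf[OF approx(1) op])

text \<open>The approximate equation is tested with its own solution; the Poincare inequality bounds
  the right-hand side, and one factor of the energy norm is divided out.\<close>

lemma approx_nG:
  assumes g: "mean_zero \<Omega> g"
  shows "nG \<Omega> (neumann_approx \<Omega> g n) \<le> C * nrm g + inverse (real (Suc n))"
proof -
  let ?\<phi> = "neumann_approx \<Omega> g n"
  have gL: "L2 (lebesgue_on \<Omega>) g" using g by (simp add: mean_zero_def)
  have "(nG \<Omega> ?\<phi>)\<^sup>2 \<le> ip \<Omega> g ?\<phi> + inverse (real (Suc n)) * nG \<Omega> ?\<phi>"
    using approx(3)[OF g approx(1)[OF g], of n n] unfolding gip_self by linarith
  also have "ip \<Omega> g ?\<phi> \<le> nrm g * nrm ?\<phi>" using ip_bound[OF gL approx_L2[OF g]] by (rule order_trans[OF abs_ge_self])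
  also have "\<dots> \<le> nrm g * (C * nG \<Omega> ?\<phi>)" by (intro mult_left_mono pc approx[OF g]) simp
  finally have le: "nG \<Omega> ?\<phi> * nG \<Omega> ?\<phi> \<le> (C * nrm g + inverse (real (Suc n))) * nG \<Omega> ?\<phi>"
    by (simp add: power2_eq_square algebra_simps)
  show ?thesis
  proof (cases "nG \<Omega> ?\<phi> = 0")
    case False
    then have "0 < nG \<Omega> ?\<phi>" using nG_nonneg[of \<Omega> ?\<phi>] by linarith
    then show ?thesis using le by simp
  next
    case True
    then show ?thesis using C_pos by (simp add: add_nonneg_nonneg)
  qed
qed

lemma approx_nrm:
  assumes g: "mean_zero \<Omega> g"
  shows "nrm (neumann_approx \<Omega> g n) \<le> C * (C * nrm g + inverse (real (Suc n)))"
  using order_trans[OF pc[OF approx(1,2)[OF g]] mult_left_mono[OF approx_nG[OF g]]] C_pos by simp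

text \<open>Testing both approximate equations with the difference cancels \<open>g\<close> and
  leaves only the two tolerances. The sequence is thus Cauchy, although its limit is never
  named.\<close>

lemma approx_diff:
  assumes g: "mean_zero \<Omega> g"
  shows "nrm (\<lambda>x. neumann_approx \<Omega> g n x - neumann_approx \<Omega> g m x) \<le> C * (inverse (real (Suc n)) + inverse (real (Suc m)))"
proof -
  let ?f = "neumann_approx \<Omega> g n" and ?h = "neumann_approx \<Omega> g m"
  let ?d = "\<lambda>x. ?f x - ?h x"
  note F = approx(1)[OF g, of n] and H = approx(1)[OF g, of m]
  have D: "Cinf_on UNIV ?d" by (rule Cinf_diff[OF F H])
  have "gip \<Omega> ?d ?d = gip \<Omega> ?f ?d - gip \<Omega> ?h ?d"
    by (rule gip_diff_left[OF op F H D])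
  then have "(nG \<Omega> ?d)\<^sup>2 \<le> (inverse (real (Suc n)) + inverse (real (Suc m))) * nG \<Omega> ?d"
    using approx(3)[OF g D, of n] approx(3)[OF g D, of m] unfolding gip_self distrib_right by linarith
  then have le: "nG \<Omega> ?d * nG \<Omega> ?d \<le> (inverse (real (Suc n)) + inverse (real (Suc m))) * nG \<Omega> ?d"
    by (simp add: power2_eq_square)
  have nd: "nG \<Omega> ?d \<le> inverse (real (Suc n)) + inverse (real (Suc m))"
  proof (cases "nG \<Omega> ?d = 0")
    case False
    then have "0 < nG \<Omega> ?d" using nG_nonneg[of \<Omega> ?d] by linarith
    then show ?thesis using le by (simp only: mult_le_cancel_right_pos)
  qed (simp add: add_nonneg_nonneg)
  have "integrable (lebesgue_on \<Omega>) ?f" "integrable (lebesgue_on \<Omega>) ?h"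
    using F H op by (auto intro!: integrable_continuous_lebesgue_on Cinf_on_continuous)
  then have "(\<integral>x. ?d x \<partial>lebesgue_on \<Omega>) = 0" using approx(2)[OF g] by simp
  from pc[OF D this] show ?thesis using mult_left_mono[OF nd, of C] C_pos by linarith
qed

lemma neumann_form_tendsto:
  assumes f: "L2 (lebesgue_on \<Omega>) f" and g: "mean_zero \<Omega> g"
  shows "(\<lambda>n. ip \<Omega> f (neumann_approx \<Omega> g n)) \<longlonglongrightarrow> neumann_form \<Omega> f g"
proof -
  let ?X = "\<lambda>n. ip \<Omega> f (neumann_approx \<Omega> g n)"
  have b: "\<bar>?X n - ?X m\<bar> \<le> nrm f * (C * (inverse (real (Suc n)) + inverse (real (Suc m))))" for n m
  proof -
    have "?X n - ?X m = ip \<Omega> f (\<lambda>x. neumann_approx \<Omega> g n x - neumann_approx \<Omega> g m x)"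
      by (rule ip_diff_right[OF f approx_L2[OF g] approx_L2[OF g], symmetric])
    also have "\<bar>\<dots>\<bar> \<le> nrm f * nrm (\<lambda>x. neumann_approx \<Omega> g n x - neumann_approx \<Omega> g m x)"
      by (rule ip_bound[OF f L2_diff[OF approx_L2[OF g] approx_L2[OF g]]])
    also have "\<dots> \<le> nrm f * (C * (inverse (real (Suc n)) + inverse (real (Suc m))))"
      by (intro mult_left_mono approx_diff[OF g]) simp
    finally show ?thesis .
  qed
  have "Cauchy ?X"
  proof (rule metric_CauchyI)
    fix e :: real assume e: "0 < e"
    define k where "k = nrm f * C + 1"
    have k: "k > 0" using C_pos by (simp add: k_def add_nonneg_pos)
    obtain N where N: "inverse (real (Suc N)) < e / (2 * k)" using reals_Archimedean[of "e / (2 * k)"] e k by auto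
    have "dist (?X m) (?X n) < e" if mn: "N \<le> m" "N \<le> n" for m n
    proof -
      have le: "inverse (real (Suc i)) \<le> inverse (real (Suc N))" if "N \<le> i" for i using that by simp
      have "\<bar>?X m - ?X n\<bar> \<le> nrm f * (C * (inverse (real (Suc m)) + inverse (real (Suc n))))" by (rule b)
      also have "\<dots> = (nrm f * C) * (inverse (real (Suc m)) + inverse (real (Suc n)))" by simp
      also have "\<dots> \<le> k * (inverse (real (Suc m)) + inverse (real (Suc n)))"
        by (intro mult_right_mono) (auto simp: k_def)
      also have "\<dots> \<le> k * (2 * inverse (real (Suc N)))"
        using le[OF mn(1)] le[OF mn(2)] k by (intro mult_left_mono) linarith+
      also have "\<dots> < k * (e / k)" using N k by (intro mult_strict_left_mono) (auto simp: field_simps)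
      finally show ?thesis using k by (simp add: dist_real_def)
    qed
    then show "\<exists>M. \<forall>m\<ge>M. \<forall>n\<ge>M. dist (?X m) (?X n) < e" by blast
  qed
  then have "convergent ?X" by (simp add: Cauchy_convergent_iff)
  then show ?thesis unfolding neumann_form_def by (simp add: convergent_LIMSEQ_iff)
qed

lemma neumann_form_bound:
  assumes f: "L2 (lebesgue_on \<Omega>) f" and g: "mean_zero \<Omega> g"
  shows "\<bar>neumann_form \<Omega> f g\<bar> \<le> C\<^sup>2 * nrm f * nrm g"
proof (rule LIMSEQ_le[OF tendsto_rabs[OF neumann_form_tendsto[OF f g]]])
  have "(\<lambda>n. nrm f * (C * (C * nrm g + inverse (real (Suc n))))) \<longlonglongrightarrow> nrm f * (C * (C * nrm g + 0))"
    by (intro tendsto_intros LIMSEQ_inverse_real_of_nat)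
  then show "(\<lambda>n. nrm f * (C * (C * nrm g + inverse (real (Suc n))))) \<longlonglongrightarrow> C\<^sup>2 * nrm f * nrm g"
    by (simp add: power2_eq_square mult_ac)
  have "\<bar>ip \<Omega> f (neumann_approx \<Omega> g n)\<bar> \<le> nrm f * (C * (C * nrm g + inverse (real (Suc n))))" for n
    using order_trans[OF ip_bound[OF f approx_L2[OF g]] mult_left_mono[OF approx_nrm[OF g]]] by simp
  then show "\<exists>N. \<forall>n\<ge>N. \<bar>ip \<Omega> f (neumann_approx \<Omega> g n)\<bar> \<le> nrm f * (C * (C * nrm g + inverse (real (Suc n))))" by blast
qed

lemma neumann_form_add_scale_left:
  assumes f: "L2 (lebesgue_on \<Omega>) f" "L2 (lebesgue_on \<Omega>) h" and g: "mean_zero \<Omega> g"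
  shows "neumann_form \<Omega> (\<lambda>x. f x + c * h x) g = neumann_form \<Omega> f g + c * neumann_form \<Omega> h g"
proof (rule LIMSEQ_unique[OF neumann_form_tendsto[OF L2_add[OF f(1) L2_scale[OF f(2)]] g]])
  have "ip \<Omega> (\<lambda>x. f x + c * h x) (neumann_approx \<Omega> g n) = ip \<Omega> f (neumann_approx \<Omega> g n) + c * ip \<Omega> h (neumann_approx \<Omega> g n)" for n
    unfolding ip_commute[of \<Omega> _ "neumann_approx \<Omega> g n"]
    using ip_add_right[OF approx_L2[OF g] f(1) L2_scale[OF f(2)]] ip_scale_right by simp
  then show "(\<lambda>n. ip \<Omega> (\<lambda>x. f x + c * h x) (neumann_approx \<Omega> g n)) \<longlonglongrightarrow> neumann_form \<Omega> f g + c * neumann_form \<Omega> h g"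
    using tendsto_add[OF neumann_form_tendsto[OF f(1) g] tendsto_mult[OF tendsto_const[of c] neumann_form_tendsto[OF f(2) g]]] by simp
qed

lemma approx_gip_error:
  assumes f: "mean_zero \<Omega> f" and g: "mean_zero \<Omega> g"
  shows "(\<lambda>n. gip \<Omega> (neumann_approx \<Omega> f n) (neumann_approx \<Omega> g n) - ip \<Omega> f (neumann_approx \<Omega> g n)) \<longlonglongrightarrow> 0"
proof (rule Lim_null_comparison)
  show "\<forall>\<^sub>F n in sequentially. norm (gip \<Omega> (neumann_approx \<Omega> f n) (neumann_approx \<Omega> g n) - ip \<Omega> f (neumann_approx \<Omega> g n))
    \<le> inverse (real (Suc n)) * (C * nrm g + 1)"
  proof (intro always_eventually allI)
    fix n
    have "nG \<Omega> (neumann_approx \<Omega> g n) \<le> C * nrm g + 1"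
      using approx_nG[OF g, of n] inverse_le_1_iff[of "real (Suc n)"] by linarith
    then have "inverse (real (Suc n)) * nG \<Omega> (neumann_approx \<Omega> g n) \<le> inverse (real (Suc n)) * (C * nrm g + 1)"
      by (rule mult_left_mono) simp
    from order_trans[OF approx(3)[OF f approx(1)[OF g], of n n] this]
    show "norm (gip \<Omega> (neumann_approx \<Omega> f n) (neumann_approx \<Omega> g n) - ip \<Omega> f (neumann_approx \<Omega> g n))
      \<le> inverse (real (Suc n)) * (C * nrm g + 1)" by (simp only: real_norm_def)
  qed
  have "(\<lambda>n. inverse (real (Suc n)) * (C * nrm g + 1)) \<longlonglongrightarrow> 0 * (C * nrm g + 1)"
    by (intro tendsto_intros LIMSEQ_inverse_real_of_nat)
  then show "(\<lambda>n. inverse (real (Suc n)) * (C * nrm g + 1)) \<longlonglongrightarrow> 0" by simp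
qed

text \<open>As a limit of Dirichlet products the form inherits symmetry and positivity, which its
  definition by one-sided pairings does not display.\<close>

lemma neumann_form_gip_tendsto:
  assumes f: "mean_zero \<Omega> f" and g: "mean_zero \<Omega> g"
  shows "(\<lambda>n. gip \<Omega> (neumann_approx \<Omega> f n) (neumann_approx \<Omega> g n)) \<longlonglongrightarrow> neumann_form \<Omega> f g"
  using tendsto_add[OF approx_gip_error[OF f g] neumann_form_tendsto[OF _ g, of f]] f by (simp add: mean_zero_def)

lemma neumann_form_commute:
  assumes f: "mean_zero \<Omega> f" and g: "mean_zero \<Omega> g"
  shows "neumann_form \<Omega> f g = neumann_form \<Omega> g f"
  using LIMSEQ_unique[OF neumann_form_gip_tendsto[OF f g]] neumann_form_gip_tendsto[OF g f] by (simp add: gip_commute)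

lemma neumann_form_nonneg:
  assumes g: "mean_zero \<Omega> g"
  shows "0 \<le> neumann_form \<Omega> g g"
  by (rule LIMSEQ_le_const[OF neumann_form_gip_tendsto[OF g g]]) (auto simp: gip_self)

end

section \<open>Pairing with weak gradients and with boundary data\<close>

lemma integral_inner_grad:
  assumes G: "\<And>b. b \<in> Basis \<Longrightarrow> L2 (lebesgue_on \<Omega>) (\<lambda>x. G x \<bullet> b)"
    and \<phi>: "Cinf_on UNIV \<phi>" and \<Omega>: "open \<Omega>" "bounded \<Omega>"
  shows "(\<integral>x. G x \<bullet> grad \<phi> x \<partial>lebesgue_on \<Omega>) = (\<Sum>b\<in>Basis. ip \<Omega> (\<lambda>x. G x \<bullet> b) (pd b \<phi>))"
proof -
  have "(\<integral>x. G x \<bullet> grad \<phi> x \<partial>lebesgue_on \<Omega>) = (\<integral>x. (\<Sum>b\<in>Basis. (G x \<bullet> b) * pd b \<phi> x) \<partial>lebesgue_on \<Omega>)"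
  proof (rule Bochner_Integration.integral_cong)
    fix x
    show "G x \<bullet> grad \<phi> x = (\<Sum>b\<in>Basis. (G x \<bullet> b) * pd b \<phi> x)"
      by (subst euclidean_inner) (auto simp: grad_inner intro!: sum.cong)
  qed simp
  also have "\<dots> = (\<Sum>b\<in>Basis. \<integral>x. (G x \<bullet> b) * pd b \<phi> x \<partial>lebesgue_on \<Omega>)"
    by (rule Bochner_Integration.integral_sum) (rule L2_mult_integrable[OF G L2_pd[OF \<phi> _ \<Omega>]])
  finally show ?thesis by (simp add: ip_def)
qed

lemma gip_eq_sum:
  assumes \<phi>: "Cinf_on UNIV \<phi>" and \<psi>: "Cinf_on UNIV \<psi>" and \<Omega>: "open \<Omega>" "bounded \<Omega>"
  shows "gip \<Omega> \<psi> \<phi> = (\<Sum>b\<in>Basis. ip \<Omega> (pd b \<psi>) (pd b \<phi>))"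
proof -
  have "gip \<Omega> \<psi> \<phi> = (\<Sum>b\<in>Basis. ip \<Omega> (\<lambda>x. grad \<psi> x \<bullet> b) (pd b \<phi>))"
    unfolding gip_def by (rule integral_inner_grad[OF _ \<phi> \<Omega>]) (simp add: grad_inner L2_pd[OF \<psi> _ \<Omega>])
  then show ?thesis by (simp add: grad_inner ip_def)
qed

lemma nG_le_sum:
  assumes \<phi>: "Cinf_on UNIV \<phi>" and \<Omega>: "open \<Omega>" "bounded \<Omega>"
  shows "nG \<Omega> \<phi> \<le> (\<Sum>b\<in>Basis. nL2 (lebesgue_on \<Omega>) (pd b \<phi>))"
proof -
  have "(nG \<Omega> \<phi>)\<^sup>2 = (\<Sum>b\<in>Basis. (nL2 (lebesgue_on \<Omega>) (pd b \<phi>))\<^sup>2)"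
    unfolding gip_self[symmetric] gip_eq_sum[OF \<phi> \<phi> \<Omega>] by (simp add: ip_def nL2_sq power2_eq_square[symmetric])
  then have "nG \<Omega> \<phi> = L2_set (\<lambda>b. nL2 (lebesgue_on \<Omega>) (pd b \<phi>)) Basis"
    unfolding L2_set_def using nG_nonneg[of \<Omega> \<phi>] by (metis real_sqrt_unique)
  also have "\<dots> \<le> (\<Sum>b\<in>Basis. nL2 (lebesgue_on \<Omega>) (pd b \<phi>))" by (rule L2_set_le_sum) simp
  finally show ?thesis .
qed

locale trace_domain = poincare_domain +
  fixes D :: real
  assumes D_pos: "0 < D"
    and tr: "Cinf_on UNIV \<phi> \<Longrightarrow> (\<integral>\<^sup>+x. ennreal ((\<phi> x)\<^sup>2) \<partial>surf \<Omega>) \<le> ennreal (D * ((nL2 (lebesgue_on \<Omega>) \<phi>)\<^sup>2 + (nG \<Omega> \<phi>)\<^sup>2))"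
begin

text \<open>The approximate equation is known for smooth test functions. They are let tend to
  \<open>w\<close>: both pairings converge, while the error stays bounded because the energy norms
  of the approximants are bounded.\<close>

lemma neumann_weak_error:
  assumes w: "weak_grad \<Omega> w G" and g: "mean_zero \<Omega> g"
  shows "\<bar>(\<integral>x. G x \<bullet> grad (neumann_approx \<Omega> g n) x \<partial>lebesgue_on \<Omega>) - ip \<Omega> w g\<bar>
    \<le> inverse (real (Suc n)) * (\<Sum>b\<in>Basis. nrm (\<lambda>x. G x \<bullet> b) + 1)"
proof -
  \<comment> \<open>Each summand contains an extra 1, since the approximating derivatives differ
    from those of \<open>w\<close> by at most 1 in norm.\<close>
  let ?\<Phi> = "neumann_approx \<Omega> g n" and ?K = "\<Sum>b\<in>(Basis::pt set). nrm (\<lambda>x. G x \<bullet> b) + 1"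
  have wL: "L2 (lebesgue_on \<Omega>) w" and GL: "\<And>b. b \<in> Basis \<Longrightarrow> L2 (lebesgue_on \<Omega>) (\<lambda>x. G x \<bullet> b)"
    using w by (auto simp: weak_grad_def)
  have gL: "L2 (lebesgue_on \<Omega>) g" using g by (simp add: mean_zero_def)
  note \<Phi>C = approx(1)[OF g, of n]
  have "\<forall>k. \<exists>\<phi>. Cinf_on UNIV \<phi> \<and> nrm (\<lambda>x. \<phi> x - w x) \<le> inverse (real (Suc k)) \<and>
    (\<forall>b\<in>Basis. nrm (\<lambda>x. pd b \<phi> x - G x \<bullet> b) \<le> inverse (real (Suc k)))"
    by (intro allI Cinf_dense_H1[OF dom w]) simp
  then obtain \<phi> where \<phi>0: "\<forall>k. Cinf_on UNIV (\<phi> k) \<and> nrm (\<lambda>x. \<phi> k x - w x) \<le> inverse (real (Suc k)) \<and>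
    (\<forall>b\<in>Basis. nrm (\<lambda>x. pd b (\<phi> k) x - G x \<bullet> b) \<le> inverse (real (Suc k)))"
    by (rule choice[THEN exE])
  then have \<phi>: "\<And>k. Cinf_on UNIV (\<phi> k)" and \<phi>w: "\<And>k. nrm (\<lambda>x. \<phi> k x - w x) \<le> inverse (real (Suc k))"
    and \<phi>G: "\<And>k b. b \<in> Basis \<Longrightarrow> nrm (\<lambda>x. pd b (\<phi> k) x - G x \<bullet> b) \<le> inverse (real (Suc k))" by auto
  have lim0: "(\<lambda>k. a * inverse (real (Suc k))) \<longlonglongrightarrow> 0" for a :: real
    using tendsto_mult[OF tendsto_const[of a] LIMSEQ_inverse_real_of_nat] by simp
  have l1: "(\<lambda>k. ip \<Omega> g (\<phi> k)) \<longlonglongrightarrow> ip \<Omega> g w"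
  proof (rule LIM_zero_cancel, rule Lim_null_comparison[OF _ lim0[of "nrm g"]], intro always_eventually allI)
    fix k
    have "norm (ip \<Omega> g (\<phi> k) - ip \<Omega> g w) = \<bar>ip \<Omega> g (\<lambda>x. \<phi> k x - w x)\<bar>"
      using ip_diff_right[OF gL L2_Cinf[OF \<phi> op] wL] by simp
    also have "\<dots> \<le> nrm g * nrm (\<lambda>x. \<phi> k x - w x)" by (rule ip_bound[OF gL L2_diff[OF L2_Cinf[OF \<phi> op] wL]])
    also have "\<dots> \<le> nrm g * inverse (real (Suc k))" by (intro mult_left_mono \<phi>w) simp
    finally show "norm (ip \<Omega> g (\<phi> k) - ip \<Omega> g w) \<le> nrm g * inverse (real (Suc k))" .
  qed
  have l2: "(\<lambda>k. ip \<Omega> (pd b ?\<Phi>) (pd b (\<phi> k))) \<longlonglongrightarrow> ip \<Omega> (pd b ?\<Phi>) (\<lambda>x. G x \<bullet> b)" if b: "b \<in> Basis" for b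
  proof (rule LIM_zero_cancel, rule Lim_null_comparison[OF _ lim0[of "nrm (pd b ?\<Phi>)"]], intro always_eventually allI)
    fix k
    note P = L2_pd[OF \<Phi>C b op]
    have "norm (ip \<Omega> (pd b ?\<Phi>) (pd b (\<phi> k)) - ip \<Omega> (pd b ?\<Phi>) (\<lambda>x. G x \<bullet> b)) = \<bar>ip \<Omega> (pd b ?\<Phi>) (\<lambda>x. pd b (\<phi> k) x - G x \<bullet> b)\<bar>"
      using ip_diff_right[OF P L2_pd[OF \<phi> b op] GL[OF b]] by simp
    also have "\<dots> \<le> nrm (pd b ?\<Phi>) * nrm (\<lambda>x. pd b (\<phi> k) x - G x \<bullet> b)" by (rule ip_bound[OF P L2_diff[OF L2_pd[OF \<phi> b op] GL[OF b]]])
    also have "\<dots> \<le> nrm (pd b ?\<Phi>) * inverse (real (Suc k))" by (intro mult_left_mono \<phi>G b) simp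
    finally show "norm (ip \<Omega> (pd b ?\<Phi>) (pd b (\<phi> k)) - ip \<Omega> (pd b ?\<Phi>) (\<lambda>x. G x \<bullet> b)) \<le> nrm (pd b ?\<Phi>) * inverse (real (Suc k))" .
  qed
  have "(\<lambda>k. gip \<Omega> ?\<Phi> (\<phi> k)) \<longlonglongrightarrow> (\<Sum>b\<in>Basis. ip \<Omega> (pd b ?\<Phi>) (\<lambda>x. G x \<bullet> b))"
    unfolding gip_eq_sum[OF \<phi> \<Phi>C op] by (intro tendsto_sum l2)
  also have "(\<Sum>b\<in>Basis. ip \<Omega> (pd b ?\<Phi>) (\<lambda>x. G x \<bullet> b)) = (\<integral>x. G x \<bullet> grad ?\<Phi> x \<partial>lebesgue_on \<Omega>)"
  proof -
    have "(\<Sum>b\<in>Basis. ip \<Omega> (pd b ?\<Phi>) (\<lambda>x. G x \<bullet> b)) = (\<Sum>b\<in>Basis. ip \<Omega> (\<lambda>x. G x \<bullet> b) (pd b ?\<Phi>))"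
      by (intro sum.cong refl ip_commute)
    also have "\<dots> = (\<integral>x. G x \<bullet> grad ?\<Phi> x \<partial>lebesgue_on \<Omega>)"
      by (rule integral_inner_grad[OF GL \<Phi>C op, symmetric])
    finally show ?thesis .
  qed
  finally have l3: "(\<lambda>k. gip \<Omega> ?\<Phi> (\<phi> k)) \<longlonglongrightarrow> (\<integral>x. G x \<bullet> grad ?\<Phi> x \<partial>lebesgue_on \<Omega>)" .
  have b: "\<bar>gip \<Omega> ?\<Phi> (\<phi> k) - ip \<Omega> g (\<phi> k)\<bar> \<le> inverse (real (Suc n)) * ?K" for k
  proof -
    have "nrm (pd b (\<phi> k)) \<le> nrm (\<lambda>x. G x \<bullet> b) + 1" if b: "b \<in> Basis" for b
    proof -
      have "nrm (pd b (\<phi> k)) = nrm (\<lambda>x. (pd b (\<phi> k) x - G x \<bullet> b) + G x \<bullet> b)" by simp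
      also have "\<dots> \<le> nrm (\<lambda>x. pd b (\<phi> k) x - G x \<bullet> b) + nrm (\<lambda>x. G x \<bullet> b)"
        by (rule nL2_triangle[OF L2_diff[OF L2_pd[OF \<phi> b op] GL[OF b]] GL[OF b]])
      finally show ?thesis using \<phi>G[OF b, of k] inverse_le_1_iff[of "real (Suc k)"] by linarith
    qed
    then have "(\<Sum>b\<in>Basis. nrm (pd b (\<phi> k))) \<le> ?K" by (rule sum_mono)
    then have "nG \<Omega> (\<phi> k) \<le> ?K" using nG_le_sum[OF \<phi> op] by (rule order_trans[rotated])
    then have "inverse (real (Suc n)) * nG \<Omega> (\<phi> k) \<le> inverse (real (Suc n)) * ?K" by (rule mult_left_mono) simp
    then show ?thesis using approx(3)[OF g \<phi>, of n k] by linarith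
  qed
  have "(\<lambda>k. \<bar>gip \<Omega> ?\<Phi> (\<phi> k) - ip \<Omega> g (\<phi> k)\<bar>) \<longlonglongrightarrow> \<bar>(\<integral>x. G x \<bullet> grad ?\<Phi> x \<partial>lebesgue_on \<Omega>) - ip \<Omega> g w\<bar>"
    by (intro tendsto_intros l1 l3)
  then have "\<bar>(\<integral>x. G x \<bullet> grad ?\<Phi> x \<partial>lebesgue_on \<Omega>) - ip \<Omega> g w\<bar> \<le> inverse (real (Suc n)) * ?K"
    by (rule LIMSEQ_le_const2) (use b in blast)
  then show ?thesis by (simp only: ip_commute[of \<Omega> g w])
qed

lemma neumann_weak_tendsto:
  assumes w: "weak_grad \<Omega> w G" and g: "mean_zero \<Omega> g"
  shows "(\<lambda>n. \<integral>x. G x \<bullet> grad (neumann_approx \<Omega> g n) x \<partial>lebesgue_on \<Omega>) \<longlonglongrightarrow> ip \<Omega> w g"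
proof (rule LIM_zero_cancel, rule Lim_null_comparison)
  let ?K = "\<Sum>b\<in>(Basis::pt set). nrm (\<lambda>x. G x \<bullet> b) + 1"
  show "\<forall>\<^sub>F n in sequentially. norm ((\<integral>x. G x \<bullet> grad (neumann_approx \<Omega> g n) x \<partial>lebesgue_on \<Omega>) - ip \<Omega> w g)
      \<le> inverse (real (Suc n)) * ?K"
    using neumann_weak_error[OF w g] by (intro always_eventually allI) (simp only: real_norm_def)
  show "(\<lambda>n. inverse (real (Suc n)) * ?K) \<longlonglongrightarrow> 0"
    using tendsto_mult[OF LIMSEQ_inverse_real_of_nat tendsto_const[of ?K]] by simp
qed

text \<open>The trace constant relative to the gradient alone: on functions of mean zero the
  Poincare inequality bounds the full norm in the trace inequality by \<open>C\<^sup>2 + 1\<close>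
  times the squared energy norm.\<close>

definition "K0 = sqrt (D * (C\<^sup>2 + 1))"

lemma surf_approx_bound:
  assumes g: "mean_zero \<Omega> g" and h: "L2 (surf \<Omega>) h"
  shows "\<bar>\<integral>x. h x * neumann_approx \<Omega> g n x \<partial>surf \<Omega>\<bar> \<le> nL2 (surf \<Omega>) h * (K0 * (C * nrm g + inverse (real (Suc n))))"
proof -
  let ?\<Phi> = "neumann_approx \<Omega> g n"
  note \<Phi>C = approx(1)[OF g, of n]
  have \<Phi>L: "L2 (surf \<Omega>) ?\<Phi>" using trace_of_Cinf[OF dom \<Phi>C] by (simp add: trace_of_def)
  have "nL2 (surf \<Omega>) ?\<Phi> \<le> K0 * nG \<Omega> ?\<Phi>"
  proof (rule nL2_le_nn_integral[OF \<Phi>L])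
    have "(nrm ?\<Phi>)\<^sup>2 \<le> (C * nG \<Omega> ?\<Phi>)\<^sup>2" by (intro power_mono pc approx[OF g]) simp
    then have "D * ((nrm ?\<Phi>)\<^sup>2 + (nG \<Omega> ?\<Phi>)\<^sup>2) \<le> D * ((C\<^sup>2 + 1) * (nG \<Omega> ?\<Phi>)\<^sup>2)"
      using D_pos by (intro mult_left_mono) (auto simp: power_mult_distrib distrib_right)
    also have "\<dots> = (K0 * nG \<Omega> ?\<Phi>)\<^sup>2"
      using D_pos by (simp add: K0_def power_mult_distrib)
    finally show "(\<integral>\<^sup>+x. ennreal ((?\<Phi> x)\<^sup>2) \<partial>surf \<Omega>) \<le> ennreal ((K0 * nG \<Omega> ?\<Phi>)\<^sup>2)"
      using order_trans[OF tr[OF \<Phi>C] ennreal_leI] by blast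
    show "0 \<le> K0 * nG \<Omega> ?\<Phi>" using D_pos by (simp add: K0_def)
  qed
  also have "\<dots> \<le> K0 * (C * nrm g + inverse (real (Suc n)))"
    using D_pos by (intro mult_left_mono approx_nG[OF g]) (simp add: K0_def)
  finally have "nL2 (surf \<Omega>) h * nL2 (surf \<Omega>) ?\<Phi> \<le> nL2 (surf \<Omega>) h * (K0 * (C * nrm g + inverse (real (Suc n))))"
    by (rule mult_left_mono) simp
  then show ?thesis using L2_cauchy_schwarz[OF h \<Phi>L] by linarith
qed

text \<open>The first equation is tested with the approximants of \<open>N y\<close>. In the limit
  the gradient term becomes the pairing of \<open>w\<close> with \<open>y\<close>, and the boundary
  term keeps its uniform bound.\<close>

lemma static_energy:
  assumes dy: "mean_zero \<Omega> dy" and y: "mean_zero \<Omega> y" and w: "weak_grad \<Omega> w G" and h: "L2 (surf \<Omega>) h"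
    and eq: "\<And>v. Cinf_on UNIV v \<Longrightarrow> ip \<Omega> dy v + (\<integral>x. G x \<bullet> grad v x \<partial>lebesgue_on \<Omega>) = (\<integral>x. h x * v x \<partial>surf \<Omega>)"
  shows "neumann_form \<Omega> dy y + ip \<Omega> w y \<le> nL2 (surf \<Omega>) h * (K0 * C * nrm y)"
proof (rule LIMSEQ_le)
  have dL: "L2 (lebesgue_on \<Omega>) dy" using dy by (simp add: mean_zero_def)
  show "(\<lambda>n. ip \<Omega> dy (neumann_approx \<Omega> y n) + (\<integral>x. G x \<bullet> grad (neumann_approx \<Omega> y n) x \<partial>lebesgue_on \<Omega>))
    \<longlonglongrightarrow> neumann_form \<Omega> dy y + ip \<Omega> w y"
    by (intro tendsto_add neumann_form_tendsto[OF dL y] neumann_weak_tendsto[OF w y])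
  have "(\<lambda>n. nL2 (surf \<Omega>) h * (K0 * (C * nrm y + inverse (real (Suc n))))) \<longlonglongrightarrow> nL2 (surf \<Omega>) h * (K0 * (C * nrm y + 0))"
    by (intro tendsto_intros LIMSEQ_inverse_real_of_nat)
  then show "(\<lambda>n. nL2 (surf \<Omega>) h * (K0 * (C * nrm y + inverse (real (Suc n))))) \<longlonglongrightarrow> nL2 (surf \<Omega>) h * (K0 * C * nrm y)"
    by (simp add: mult.assoc)
  have "ip \<Omega> dy (neumann_approx \<Omega> y n) + (\<integral>x. G x \<bullet> grad (neumann_approx \<Omega> y n) x \<partial>lebesgue_on \<Omega>)
    \<le> nL2 (surf \<Omega>) h * (K0 * (C * nrm y + inverse (real (Suc n))))" for n
    unfolding eq[OF approx(1)[OF y]] using surf_approx_bound[OF y h, of n] by linarith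
  then show "\<exists>N. \<forall>n\<ge>N. ip \<Omega> dy (neumann_approx \<Omega> y n) + (\<integral>x. G x \<bullet> grad (neumann_approx \<Omega> y n) x \<partial>lebesgue_on \<Omega>)
    \<le> nL2 (surf \<Omega>) h * (K0 * (C * nrm y + inverse (real (Suc n))))" by blast
qed

end

lemma trace_domain_exists:
  assumes "smooth_bounded_domain \<Omega>"
  shows "\<exists>C D. trace_domain \<Omega> C D"
proof -
  obtain C where "C > 0" "\<And>\<phi>. Cinf_on UNIV \<phi> \<Longrightarrow> (\<integral>x. \<phi> x \<partial>lebesgue_on \<Omega>) = 0 \<Longrightarrow> nL2 (lebesgue_on \<Omega>) \<phi> \<le> C * nG \<Omega> \<phi>"
    using poincare[OF assms] by blast
  moreover obtain D where "D > 0" "\<And>\<phi>. Cinf_on UNIV \<phi> \<Longrightarrow> (\<integral>\<^sup>+x. ennreal ((\<phi> x)\<^sup>2) \<partial>surf \<Omega>) \<le> ennreal (D * ((nL2 (lebesgue_on \<Omega>) \<phi>)\<^sup>2 + (nG \<Omega> \<phi>)\<^sup>2))"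
    using trace_inequality[OF assms] by blast
  ultimately have "trace_domain \<Omega> C D" using assms by unfold_locales auto
  then show ?thesis by blast
qed

subsection \<open>Weak time derivatives and the Gronwall inequality\<close>

lemma DERIV_scaled_step: "((\<lambda>r. sstep (k * (r - s))) has_real_derivative k * skern (k * (r - s))) (at r)"
proof -
  have "((\<lambda>r. k * (r - s)) has_real_derivative k) (at r)" by (auto intro!: derivative_eq_intros)
  from DERIV_chain2[OF sstep_has_derivative this] show ?thesis by (simp add: mult.commute)
qed

lemma Cinf_scaled_step: "Cinf_on UNIV (\<lambda>r. sstep (k * (r - s)))"
proof -
  have "(\<lambda>r. sstep (k * (r - s))) = (\<lambda>r. sstep (- (k * s) + k *\<^sub>R r))" by (auto simp: algebra_simps)
  then show ?thesis using Cinf_affine[OF Cinf_sstep, of "- (k * s)" k] by simp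
qed

lemma continuous_skern: "continuous_on S skern"
  using Cinf_on_continuous[OF Cinf_skern] continuous_on_subset by blast

lemma finite_measure_Tm: "finite_measure (Tm T)"
  unfolding Tm_def by (intro finite_measure_lebesgue_on) auto

lemma space_Tm: "space (Tm T) = {0<..<T}"
  by (simp add: Tm_def)

lemma continuous_measurable_Tm:
  assumes "continuous_on {0..T} f"
  shows "f \<in> borel_measurable (Tm T)"
  unfolding Tm_def using assms
  by (intro continuous_imp_measurable_on_sets_lebesgue) (auto elim: continuous_on_subset)

lemma continuous_integrable_Tm:
  fixes f :: "real \<Rightarrow> real"
  assumes f: "continuous_on {0..T} f"
  shows "integrable (Tm T) f"
proof -
  interpret finite_measure "Tm T" by (rule finite_measure_Tm)
  have "bounded (f ` {0..T})" by (intro compact_imp_bounded compact_continuous_image f) simp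
  then obtain B where "\<forall>y\<in>f ` {0..T}. norm y \<le> B" unfolding bounded_iff by blast
  then show ?thesis using continuous_measurable_Tm[OF f]
    by (intro integrable_const_bound[of f B]) (auto intro!: AE_I2 simp: space_Tm)
qed

lemma scaled_kernel_integral:
  assumes k: "0 < k" and s: "0 < s - 1 / k" "s + 1 / k < T"
  shows "(\<integral>r. k * skern (k * (r - s)) \<partial>Tm T) = 1"
proof -
  let ?f = "\<lambda>r. k * skern (k * (r - s))"
  have c: "continuous_on UNIV ?f"
    by (intro continuous_intros continuous_on_compose2[OF continuous_skern[of UNIV]]) auto
  have z: "?f r = 0" if "r \<notin> {s - 1 / k..s + 1 / k}" for r
  proof -
    have "\<bar>r - s\<bar> \<ge> 1 / k" using that by auto
    then have "k * \<bar>r - s\<bar> \<ge> 1" using k by (simp add: field_simps)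
    then have "\<bar>k * (r - s)\<bar> \<ge> 1" using k by (simp only: abs_mult abs_of_pos)
    then show ?thesis by (simp add: skern_eq_0)
  qed
  have "(\<integral>r. ?f r \<partial>Tm T) = (\<integral>r. indicator {0<..<T} r * ?f r \<partial>lborel)"
    unfolding Tm_def by (rule integral_lebesgue_on) (auto intro!: borel_measurable_continuous_onI c)
  also have "\<dots> = (\<integral>r. indicator {s - 1 / k..s + 1 / k} r *\<^sub>R ?f r \<partial>lborel)"
    using z s by (intro Bochner_Integration.integral_cong) (auto simp: indicator_def)
  also have "\<dots> = sstep (k * (s + 1 / k - s)) - sstep (k * (s - 1 / k - s))"
    using k DERIV_scaled_step[of k s]
    by (intro integral_FTC_atLeastAtMost[where F="\<lambda>r. sstep (k * (r - s))"] continuous_on_subset[OF c])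
       (auto simp: has_real_derivative_iff_has_vector_derivative[symmetric] intro: has_field_derivative_at_within)
  also have "\<dots> = 1" using k by (simp add: sstep_right sstep_left)
  finally show ?thesis .
qed

lemma scaled_kernel_tendsto:
  fixes f :: "real \<Rightarrow> real"
  assumes f: "continuous_on {0..T} f" and s: "0 < s" "s < T"
  shows "(\<lambda>n. \<integral>r. f r * (real n * skern (real n * (r - s))) \<partial>Tm T) \<longlonglongrightarrow> f s"
proof (rule LIMSEQ_I)
  fix e :: real assume e: "0 < e"
  have "continuous (at s within {0..T}) f" using f s by (simp add: continuous_on_eq_continuous_within)
  then obtain d where d: "d > 0" "\<And>r. r \<in> {0..T} \<Longrightarrow> dist r s < d \<Longrightarrow> dist (f r) (f s) < e / 2"
    using e unfolding continuous_within_eps_delta by (meson half_gt_zero)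
  define \<delta> where "\<delta> = min d (min s (T - s))"
  have \<delta>: "\<delta> > 0" using d s by (simp add: \<delta>_def)
  obtain N :: nat where N: "1 / \<delta> < real N" using reals_Archimedean2 by blast
  show "\<exists>no. \<forall>n\<ge>no. norm ((\<integral>r. f r * (real n * skern (real n * (r - s))) \<partial>Tm T) - f s) < e"
  proof (intro exI[of _ N] allI impI)
    fix n assume "N \<le> n"
    then have n: "1 / \<delta> < real n" using N by linarith
    have n0: "0 < real n" using n \<delta> by (meson less_trans zero_less_divide_1_iff)
    have n1: "1 / real n < \<delta>" using n \<delta> n0 by (simp add: field_simps)
    let ?k = "\<lambda>r. real n * skern (real n * (r - s))"
    have one: "(\<integral>r. ?k r \<partial>Tm T) = 1" using n1 by (intro scaled_kernel_integral[OF n0]) (auto simp: \<delta>_def)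
    have kc: "continuous_on {0..T} ?k"
      by (intro continuous_intros continuous_on_compose2[OF continuous_skern[of UNIV]]) auto
    have ki: "integrable (Tm T) ?k" by (rule continuous_integrable_Tm[OF kc])
    have fi: "integrable (Tm T) (\<lambda>r. f r * ?k r)" by (rule continuous_integrable_Tm) (intro continuous_intros f kc)
    have "(\<integral>r. f r * ?k r \<partial>Tm T) - f s = (\<integral>r. f r * ?k r \<partial>Tm T) - (\<integral>r. f s * ?k r \<partial>Tm T)" using one by simp
    also have "\<dots> = (\<integral>r. (f r - f s) * ?k r \<partial>Tm T)" using fi ki by (simp add: left_diff_distrib)
    finally have "norm ((\<integral>r. f r * ?k r \<partial>Tm T) - f s) \<le> (\<integral>r. norm ((f r - f s) * ?k r) \<partial>Tm T)"
      by (simp add: integral_norm_bound del: real_norm_def)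
    also have "\<dots> \<le> (\<integral>r. e / 2 * ?k r \<partial>Tm T)"
    proof (rule integral_mono)
      show "integrable (Tm T) (\<lambda>r. norm ((f r - f s) * ?k r))"
        by (rule continuous_integrable_Tm) (intro continuous_intros f kc)
      show "integrable (Tm T) (\<lambda>r. e / 2 * ?k r)" using ki by simp
      fix r assume "r \<in> space (Tm T)"
      then have r: "r \<in> {0..T}" by (auto simp: space_Tm)
      show "norm ((f r - f s) * ?k r) \<le> e / 2 * ?k r"
      proof (cases "\<bar>real n * (r - s)\<bar> \<ge> 1")
        case False
        then have "real n * \<bar>r - s\<bar> < 1" by (simp add: abs_mult)
        then have "\<bar>r - s\<bar> < 1 / real n" using n0 by (simp add: field_simps)
        then have "\<bar>f r - f s\<bar> \<le> e / 2" using d(2)[OF r] n1 by (simp add: \<delta>_def dist_real_def)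
        then have "\<bar>f r - f s\<bar> * ?k r \<le> e / 2 * ?k r" by (rule mult_right_mono) (simp add: skern_nonneg)
        then show ?thesis using n0 skern_nonneg by (simp add: abs_mult)
      qed (simp add: skern_eq_0)
    qed
    also have "\<dots> = e / 2" using one by simp
    finally show "norm ((\<integral>r. f r * ?k r \<partial>Tm T) - f s) < e" using e by simp
  qed
qed

text \<open>The test functions rise from 0 to 1 around \<open>s\<close> and fall back around
  \<open>t\<close>, ever more steeply. Their derivatives are approximate identities at the two
  points, where continuity of \<open>f\<close> yields exact values, while the functions themselves
  tend to the indicator of the interval.\<close>

lemma weak_derivative_increment:
  fixes f d :: "real \<Rightarrow> real"
  assumes f: "continuous_on {0..T} f" and d: "integrable (Tm T) d" and st: "0 < s" "s < t" "t < T"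
    and weak: "\<And>\<phi>. test_fun {0<..<T} \<phi> \<Longrightarrow> (\<integral>r. f r * pd 1 \<phi> r \<partial>Tm T) = - (\<integral>r. d r * \<phi> r \<partial>Tm T)"
  shows "f t - f s = (\<integral>r. d r * indicator {s<..t} r \<partial>Tm T)"
proof -
  define \<phi> where "\<phi> n r = sstep (real n * (r - s)) - sstep (real n * (r - t))" for n r
  have \<phi>C: "Cinf_on UNIV (\<phi> n)" for n unfolding \<phi>_def[abs_def] by (intro Cinf_diff Cinf_scaled_step)
  have \<phi>pd: "pd 1 (\<phi> n) r = real n * skern (real n * (r - s)) - real n * skern (real n * (r - t))" for n r
  proof -
    have "(\<phi> n has_real_derivative real n * skern (real n * (r - s)) - real n * skern (real n * (r - t))) (at r)"
      unfolding \<phi>_def[abs_def] by (intro DERIV_diff DERIV_scaled_step)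
    then show ?thesis by (intro pd_eqI) (simp only: real_shift_derivative_iff)
  qed
  have lhs: "(\<lambda>n. \<integral>r. f r * pd 1 (\<phi> n) r \<partial>Tm T) \<longlonglongrightarrow> f s - f t"
  proof -
    have eq: "(\<integral>r. f r * pd 1 (\<phi> n) r \<partial>Tm T) = (\<integral>r. f r * (real n * skern (real n * (r - s))) \<partial>Tm T) - (\<integral>r. f r * (real n * skern (real n * (r - t))) \<partial>Tm T)" for n
    proof -
      have i: "integrable (Tm T) (\<lambda>r. f r * (real n * skern (real n * (r - a))))" for a
        by (rule continuous_integrable_Tm) (intro continuous_intros f continuous_on_compose2[OF continuous_skern[of UNIV]], auto)
      show ?thesis unfolding \<phi>pd right_diff_distrib[of "f _"] by (rule Bochner_Integration.integral_diff[OF i i])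
    qed
    show ?thesis unfolding eq using st by (intro tendsto_diff scaled_kernel_tendsto f) auto
  qed
  have rhs: "(\<lambda>n. \<integral>r. d r * \<phi> n r \<partial>Tm T) \<longlonglongrightarrow> (\<integral>r. d r * indicator {s<..t} r \<partial>Tm T)"
  proof (rule integral_dominated_convergence[where w="\<lambda>r. \<bar>d r\<bar>"])
    note [measurable] = borel_measurable_integrable[OF d]
    have [measurable]: "{s<..t} \<in> sets (Tm T)"
    proof -
      have "{s<..t} \<inter> {0<..<T} = {s<..t}" using st by auto
      moreover have "{s<..t} \<inter> {0<..<T} \<in> sets (Tm T)" unfolding Tm_def sets_restrict_space by auto
      ultimately show ?thesis by simp
    qed
    show "(\<lambda>r. d r * indicator {s<..t} r) \<in> borel_measurable (Tm T)" by measurable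
    have "\<phi> n \<in> borel_measurable (Tm T)" for n
      unfolding Tm_def by (rule measurable_lebesgue_on_borel[OF borel_measurable_Cinf[OF \<phi>C]])
    then show "(\<lambda>r. d r * \<phi> n r) \<in> borel_measurable (Tm T)" for n by measurable
    show "integrable (Tm T) (\<lambda>r. \<bar>d r\<bar>)" using d by simp
    have "\<bar>\<phi> n r\<bar> \<le> 1" for n r
      using sstep_bounds[of "real n * (r - s)"] sstep_bounds[of "real n * (r - t)"] by (auto simp: \<phi>_def)
    then show "AE r in Tm T. norm (d r * \<phi> n r) \<le> \<bar>d r\<bar>" for n
      by (intro AE_I2) (simp add: abs_mult mult_left_le)
    have st0: "(\<lambda>n. sstep (real n * (r - a))) \<longlonglongrightarrow> (if r > a then 1 else 0)" if "r \<noteq> a" for r a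
    proof -
      obtain N :: nat where N: "1 / \<bar>r - a\<bar> < real N" using reals_Archimedean2 by blast
      have "\<forall>\<^sub>F n in sequentially. (if r > a then 1 else 0) = sstep (real n * (r - a))"
        using eventually_ge_at_top[of N]
      proof eventually_elim
        case (elim n)
        then have "1 / \<bar>r - a\<bar> \<le> real n" using N by linarith
        then have "1 \<le> real n * \<bar>r - a\<bar>" using that by (simp add: divide_le_eq)
        then show ?case
        proof (cases "r > a")
          case False
          then have "real n * (r - a) \<le> -1" using \<open>1 \<le> real n * \<bar>r - a\<bar>\<close> by (simp add: algebra_simps)
          then show ?thesis using False by (simp add: sstep_left)
        qed (simp add: sstep_right)
      qed
      then show ?thesis by (rule Lim_transform_eventually[rotated]) simp
    qed
    have "AE r in Tm T. r \<notin> {s, t}"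
    proof -
      have "AE r in lborel. r \<notin> {s, t}" by (rule AE_not_in) (auto intro: finite_imp_null_set_lborel)
      then have "AE r in lebesgue. r \<notin> {s, t}" by (rule AE_completion)
      then show ?thesis unfolding Tm_def by (subst AE_restrict_space_iff) (auto elim: eventually_mono)
    qed
    then show "AE r in Tm T. (\<lambda>n. d r * \<phi> n r) \<longlonglongrightarrow> d r * indicator {s<..t} r"
    proof eventually_elim
      case (elim r)
      have "(\<lambda>n. \<phi> n r) \<longlonglongrightarrow> (if r > s then 1 else 0) - (if r > t then 1 else 0)"
        unfolding \<phi>_def using elim by (intro tendsto_diff st0) auto
      moreover have "(if r > s then 1 else 0) - (if r > t then 1 else 0) = (indicator {s<..t} r :: real)" using st by (auto simp: indicator_def)
      ultimately show ?case by (intro tendsto_intros) simp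
    qed
  qed
  \<comment> \<open>Once \<open>1 / n\<close> is below \<open>\<delta>\<close> the transition zones
    lie inside the open time interval, so that \<open>\<phi> n\<close> is an admissible test
    function.\<close>
  define \<delta> where "\<delta> = min s (T - t)"
  have \<delta>: "\<delta> > 0" using st by (simp add: \<delta>_def)
  obtain N :: nat where N: "1 / \<delta> < real N" using reals_Archimedean2 by blast
  have "\<forall>\<^sub>F n in sequentially. (\<integral>r. f r * pd 1 (\<phi> n) r \<partial>Tm T) = - (\<integral>r. d r * \<phi> n r \<partial>Tm T)"
    using eventually_ge_at_top[of N]
  proof eventually_elim
    case (elim n)
    then have n: "1 / \<delta> < real n" using N by linarith
    have n0: "0 < real n" using n \<delta> by (meson less_trans zero_less_divide_1_iff)
    have n1: "1 / real n < \<delta>" using n \<delta> n0 by (simp add: field_simps)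
    have "test_fun {0<..<T} (\<phi> n)"
    proof (rule test_funI[OF \<phi>C, of _ "{s - 1 / real n..t + 1 / real n}"])
      show "{s - 1 / real n..t + 1 / real n} \<subseteq> {0<..<T}" using n1 by (auto simp: \<delta>_def)
      fix r assume nz: "\<phi> n r \<noteq> 0"
      show "r \<in> {s - 1 / real n..t + 1 / real n}"
      proof (rule ccontr)
        assume "r \<notin> {s - 1 / real n..t + 1 / real n}"
        then consider "r < s - 1 / real n" | "r > t + 1 / real n" by fastforce
        then have "\<phi> n r = 0"
        proof cases
          case 1
          then have "r - s \<le> - (1 / real n)" "r - t \<le> - (1 / real n)" using st by auto
          then have "real n * (r - s) \<le> -1" "real n * (r - t) \<le> -1" using n0 by (auto simp: field_simps)
          then show ?thesis by (simp add: \<phi>_def sstep_left)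
        next
          case 2
          then have "r - s \<ge> 1 / real n" "r - t \<ge> 1 / real n" using st by auto
          then have "real n * (r - s) \<ge> 1" "real n * (r - t) \<ge> 1" using n0 by (auto simp: field_simps)
          then show ?thesis by (simp add: \<phi>_def sstep_right)
        qed
        then show False using nz by simp
      qed
    qed auto
    then show ?case by (rule weak)
  qed
  then have "(\<lambda>n. - (\<integral>r. d r * \<phi> n r \<partial>Tm T)) \<longlonglongrightarrow> f s - f t" by (rule Lim_transform_eventually[OF lhs])
  from LIMSEQ_unique[OF this tendsto_minus[OF rhs]] show ?thesis by simp
qed

text \<open>The right-hand side \<open>U\<close> of the integral inequality is differentiable with
  \<open>U' = k u \<le> k U\<close>, so \<open>U\<close> times \<open>exp (- (k * t))\<close> is
  nonincreasing.\<close>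

lemma gronwall:
  fixes u :: "real \<Rightarrow> real"
  assumes u: "continuous_on {0..T} u" and k: "0 \<le> k" and t: "0 < t" "t < T"
    and le: "\<And>t. 0 < t \<Longrightarrow> t < T \<Longrightarrow> u t \<le> a + k * (\<integral>r. u r * indicator {0<..t} r \<partial>Tm T)"
  shows "u t \<le> a * exp (k * t)"
proof -
  define U where "U t = a + k * integral {0..t} u" for t
  have uU: "u s \<le> U s" if s: "0 < s" "s < T" for s
  proof -
    have cs: "continuous_on {0..s} u" using u s by (auto elim: continuous_on_subset)
    have "integrable lebesgue (\<lambda>r. indicator {0..s} r *\<^sub>R u r)"
      using continuous_imp_integrable_real[OF cs] by (subst (asm) integrable_restrict_space) auto
    then have "set_integrable lebesgue {0<..s} u"
      by (intro set_integrable_subset[of lebesgue "{0..s}" u "{0<..s}"]) (auto simp: set_integrable_def)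
    then have i: "integrable (lebesgue_on {0<..s}) u" by (subst integrable_restrict_space) (auto simp: set_integrable_def)
    have "(\<integral>r. u r * indicator {0<..s} r \<partial>Tm T) = (\<integral>r. indicator {0<..<T} r *\<^sub>R (u r * indicator {0<..s} r) \<partial>lebesgue)"
      unfolding Tm_def by (rule integral_restrict_space) auto
    also have "\<dots> = (\<integral>r. indicator {0<..s} r *\<^sub>R u r \<partial>lebesgue)"
      using s by (intro Bochner_Integration.integral_cong) (auto simp: indicator_def)
    also have "\<dots> = (\<integral>r. u r \<partial>lebesgue_on {0<..s})" by (rule integral_restrict_space[symmetric]) auto
    also have "\<dots> = integral {0<..s} u" by (rule lebesgue_integral_eq_integral[OF i]) auto
    also have "\<dots> = integral {0..s} u"
      by (rule integral_spike_set) (auto intro: negligible_subset[of "{0}"])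
    finally show ?thesis using le[OF s] by (simp add: U_def)
  qed
  have dI: "((\<lambda>x. integral {0..x} u) has_real_derivative u x) (at x within {0..T})" if "x \<in> {0..T}" for x
    by (rule integral_has_real_derivative[OF u that])
  define V where "V x = U x * exp (- (k * x))" for x
  have "V t \<le> V 0"
  proof (rule DERIV_nonpos_imp_decreasing_open[where f=V and a=0 and b=t])
    have "continuous_on {0..T} (\<lambda>x. integral {0..x} u)"
      using dI by (meson DERIV_continuous_on)
    then have "continuous_on {0..T} V" unfolding V_def[abs_def] U_def[abs_def] by (intro continuous_intros)
    then show "continuous_on {0..t} V" using t by (auto elim: continuous_on_subset)
    fix x assume x: "0 < x" "x < t"
    then have xT: "0 < x" "x < T" using t by auto
    have "at x within {0..T} = at x" using xT by (intro at_within_interior) (auto simp: interior_atLeastAtMost_real)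
    then have d1: "((\<lambda>x. integral {0..x} u) has_real_derivative u x) (at x)" using dI[of x] xT by simp
    have "(V has_real_derivative (k * u x) * exp (- (k * x)) + (- k * exp (- (k * x))) * U x) (at x)"
      unfolding V_def[abs_def] U_def[abs_def]
      by (rule derivative_eq_intros d1 refl | simp)+
    moreover have "(k * u x) * exp (- (k * x)) + (- k * exp (- (k * x))) * U x = - (k * exp (- (k * x)) * (U x - u x))"
      by (simp add: algebra_simps)
    moreover have "0 \<le> k * exp (- (k * x)) * (U x - u x)" using k uU[OF xT] by simp
    ultimately show "\<exists>y. (V has_real_derivative y) (at x) \<and> y \<le> 0" by auto
  qed (use t in simp)
  then have "U t * exp (- (k * t)) \<le> a" by (simp add: V_def U_def)
  then have "U t \<le> a * exp (k * t)" by (simp add: exp_minus field_simps)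
  then show ?thesis using uU[OF t] by linarith
qed

subsection \<open>The energy inequality\<close>

lemma nL2_reverse_triangle:
  assumes "L2 M f" "L2 M g"
  shows "\<bar>nL2 M f - nL2 M g\<bar> \<le> nL2 M (\<lambda>x. f x - g x)"
proof -
  have "nL2 M f \<le> nL2 M (\<lambda>x. f x - g x) + nL2 M g" using nL2_triangle[OF L2_diff[OF assms] assms(2)] by simp
  moreover have "nL2 M g \<le> nL2 M (\<lambda>x. g x - f x) + nL2 M f" using nL2_triangle[OF L2_diff[OF assms(2,1)] assms(1)] by simp
  moreover have "nL2 M (\<lambda>x. g x - f x) = nL2 M (\<lambda>x. f x - g x)" by (rule nL2_minus_commute)
  ultimately show ?thesis by linarith
qed

lemma (in poincare_domain) mean_zero_add_scale:
  assumes "mean_zero \<Omega> f" "mean_zero \<Omega> g"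
  shows "mean_zero \<Omega> (\<lambda>x. f x + c * g x)"
proof -
  have L: "L2 (lebesgue_on \<Omega>) f" "L2 (lebesgue_on \<Omega>) g" using assms by (auto simp: mean_zero_def)
  have "integrable (lebesgue_on \<Omega>) f" "integrable (lebesgue_on \<Omega>) g" using L op by (auto intro: integrable_L2_lebesgue_on)
  then have "(\<integral>x. f x + c * g x \<partial>lebesgue_on \<Omega>) = 0" using assms by (simp add: mean_zero_def)
  then show ?thesis unfolding mean_zero_def using L2_add[OF L(1) L2_scale[OF L(2)]] by simp
qed

text \<open>Abstracts the difference of two solutions. The equations hold for slices of the given
  function, continuity in time holds for the representative \<open>yc\<close>; hence
  \<open>rate\<close> speaks of some \<open>y\<close> that agrees with \<open>yc r\<close> almost
  everywhere. The function \<open>q\<close> collects the squared data.\<close>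

locale energy = poincare_domain +
  fixes \<tau> K T :: real and yc dy :: "real \<Rightarrow> pt \<Rightarrow> real" and q :: "real \<Rightarrow> real"
  assumes T: "0 < T" and \<tau>: "0 < \<tau>" and K: "0 \<le> K"
    and ycZ: "t \<in> {0..T} \<Longrightarrow> mean_zero \<Omega> (yc t)"
    and ycc: "t \<in> {0..T} \<Longrightarrow> ((\<lambda>s. nL2 (lebesgue_on \<Omega>) (\<lambda>x. yc s x - yc t x)) \<longlongrightarrow> 0) (at t within {0..T})"
    and dyZ: "AE r in Tm T. mean_zero \<Omega> (dy r)"
    and dyi: "integrable (Tm T) (\<lambda>r. (nL2 (lebesgue_on \<Omega>) (dy r))\<^sup>2)"
    and dym: "L2 (lebesgue_on \<Omega>) v \<Longrightarrow> integrable (Tm T) (\<lambda>r. ip \<Omega> (dy r) v)"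
    and inc: "L2 (lebesgue_on \<Omega>) v \<Longrightarrow> 0 < s \<Longrightarrow> s < t \<Longrightarrow> t < T \<Longrightarrow>
        ip \<Omega> (yc t) v - ip \<Omega> (yc s) v = (\<integral>r. ip \<Omega> (dy r) v * indicator {s<..t} r \<partial>Tm T)"
    and qi: "integrable (Tm T) q" and qn: "AE r in Tm T. 0 \<le> q r"
    and rate: "AE r in Tm T. \<exists>y. mean_zero \<Omega> y \<and> nL2 (lebesgue_on \<Omega>) (\<lambda>x. yc r x - y x) = 0 \<and>
        \<tau> * ip \<Omega> (dy r) y + neumann_form \<Omega> (dy r) y \<le> K * ((nL2 (lebesgue_on \<Omega>) (yc r))\<^sup>2 + q r)"
begin

text \<open>The bilinear form whose diagonal is the energy: the viscous term plus the squared dual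
  norm given by the inverse Neumann Laplacian.\<close>

definition A :: "(pt \<Rightarrow> real) \<Rightarrow> (pt \<Rightarrow> real) \<Rightarrow> real" where
  "A f g = \<tau> * ip \<Omega> f g + neumann_form \<Omega> f g"

abbreviation "E t \<equiv> A (yc t) (yc t)"

lemma mean_zero_L2: "mean_zero \<Omega> f \<Longrightarrow> L2 (lebesgue_on \<Omega>) f"
  by (simp add: mean_zero_def)

lemma A_commute: "mean_zero \<Omega> f \<Longrightarrow> mean_zero \<Omega> g \<Longrightarrow> A f g = A g f"
  by (simp add: A_def ip_commute[of \<Omega> f g] neumann_form_commute)

lemma A_add_scale_left:
  assumes "mean_zero \<Omega> f" "mean_zero \<Omega> h" "mean_zero \<Omega> g"
  shows "A (\<lambda>x. f x + c * h x) g = A f g + c * A h g"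
proof -
  note L = assms(1,2)[THEN mean_zero_L2]
  have "ip \<Omega> (\<lambda>x. f x + c * h x) g = ip \<Omega> f g + c * ip \<Omega> h g"
    unfolding ip_commute[of \<Omega> _ g]
    using ip_add_right[OF mean_zero_L2[OF assms(3)] L(1) L2_scale[OF L(2)]] ip_scale_right by simp
  then show ?thesis unfolding A_def using neumann_form_add_scale_left[OF L assms(3), of c] by (simp add: algebra_simps)
qed

lemma A_add_scale_right:
  assumes "mean_zero \<Omega> f" "mean_zero \<Omega> h" "mean_zero \<Omega> g"
  shows "A g (\<lambda>x. f x + c * h x) = A g f + c * A g h"
  using A_add_scale_left[OF assms, of c] A_commute[OF assms(3) mean_zero_add_scale[OF assms(1,2), of c]]
    A_commute[OF assms(3,1)] A_commute[OF assms(3,2)] by simp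

lemma A_bound:
  assumes "mean_zero \<Omega> f" "mean_zero \<Omega> g"
  shows "\<bar>A f g\<bar> \<le> (\<tau> + C\<^sup>2) * (nrm f * nrm g)"
proof -
  note L = assms[THEN mean_zero_L2]
  have "\<bar>A f g\<bar> \<le> \<tau> * \<bar>ip \<Omega> f g\<bar> + \<bar>neumann_form \<Omega> f g\<bar>"
    unfolding A_def using \<tau> abs_triangle_ineq[of "\<tau> * ip \<Omega> f g" "neumann_form \<Omega> f g"] by (simp add: abs_mult)
  also have "\<dots> \<le> \<tau> * (nrm f * nrm g) + C\<^sup>2 * nrm f * nrm g"
    using \<tau> by (intro add_mono mult_left_mono ip_bound[OF L] neumann_form_bound[OF L(1) assms(2)]) auto
  finally show ?thesis by (simp add: algebra_simps)
qed

lemma E_lower: "t \<in> {0..T} \<Longrightarrow> \<tau> * (nrm (yc t))\<^sup>2 \<le> E t"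
  using neumann_form_nonneg[OF ycZ] by (simp add: A_def ip_def nL2_sq power2_eq_square[symmetric])

lemma E_upper: "t \<in> {0..T} \<Longrightarrow> E t \<le> (\<tau> + C\<^sup>2) * (nrm (yc t))\<^sup>2"
  using A_bound[OF ycZ ycZ] by (fastforce simp: power2_eq_square)

lemma u_continuous: "continuous_on {0..T} (\<lambda>t. (nrm (yc t))\<^sup>2)"
proof -
  have "continuous_on {0..T} (\<lambda>t. nrm (yc t))"
    unfolding continuous_on_def
  proof
    fix t assume t: "t \<in> {0..T}"
    show "((\<lambda>t. nrm (yc t)) \<longlongrightarrow> nrm (yc t)) (at t within {0..T})"
    proof (rule LIM_zero_cancel, rule Lim_null_comparison[OF _ ycc[OF t]])
      show "\<forall>\<^sub>F s in at t within {0..T}. norm (nrm (yc s) - nrm (yc t)) \<le> nrm (\<lambda>x. yc s x - yc t x)"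
        unfolding eventually_at_filter
        using nL2_reverse_triangle[OF mean_zero_L2[OF ycZ] mean_zero_L2[OF ycZ[OF t]]]
        by (intro always_eventually) auto
    qed
  qed
  then show ?thesis by (intro continuous_intros)
qed

lemma u_integrable: "integrable (Tm T) (\<lambda>r. (nrm (yc r))\<^sup>2)"
  by (rule continuous_integrable_Tm[OF u_continuous])

lemma dy_norm_integrable: "integrable (Tm T) (\<lambda>r. nrm (dy r))"
proof (rule Bochner_Integration.integrable_bound)
  interpret finite_measure "Tm T" by (rule finite_measure_Tm)
  show "integrable (Tm T) (\<lambda>r. (nrm (dy r))\<^sup>2 + 1)" using dyi by simp
  have "(\<lambda>r. sqrt ((nrm (dy r))\<^sup>2)) \<in> borel_measurable (Tm T)"
    by (rule measurable_compose[OF borel_measurable_integrable[OF dyi]]) simp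
  then show "(\<lambda>r. nrm (dy r)) \<in> borel_measurable (Tm T)" by simp
  show "AE r in Tm T. norm (nrm (dy r)) \<le> norm ((nrm (dy r))\<^sup>2 + 1)"
  proof (rule AE_I2)
    fix r
    have "0 \<le> (nrm (dy r) - 1)\<^sup>2" by simp
    then have "2 * nrm (dy r) \<le> (nrm (dy r))\<^sup>2 + 1" unfolding power2_diff by simp
    then have "nrm (dy r) \<le> (nrm (dy r))\<^sup>2 + 1" using nL2_nonneg[of "lebesgue_on \<Omega>" "dy r"] by linarith
    then show "norm (nrm (dy r)) \<le> norm ((nrm (dy r))\<^sup>2 + 1)" by simp
  qed
qed

lemma indicator_measurable_Tm: "0 \<le> s \<Longrightarrow> t < T \<Longrightarrow> {s<..t} \<in> sets (Tm T)"
proof -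
  assume "0 \<le> s" "t < T"
  then have "{s<..t} \<inter> {0<..<T} = {s<..t}" by auto
  moreover have "{s<..t} \<inter> {0<..<T} \<in> sets (Tm T)" unfolding Tm_def sets_restrict_space by auto
  ultimately show ?thesis by simp
qed

lemma integrable_indicator_Tm:
  fixes f :: "real \<Rightarrow> real"
  assumes "integrable (Tm T) f" "0 \<le> s" "t < T"
  shows "integrable (Tm T) (\<lambda>r. f r * indicator {s<..t} r)"
  using integrable_real_mult_indicator[OF indicator_measurable_Tm[OF assms(2,3)] assms(1)] .

text \<open>The increment formula \<open>inc\<close> holds for fixed functions, in particular for
  the approximants of \<open>N g\<close>. Dominated convergence, with the norm of \<open>dy\<close>
  as majorant, carries it to \<open>neumann_form\<close>.\<close>

lemma energy_increment:
  assumes st: "0 < s" "s < t" "t < T" and g: "mean_zero \<Omega> g"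
  shows "A (yc t) g - A (yc s) g = (\<integral>r. A (dy r) g * indicator {s<..t} r \<partial>Tm T)"
    and "integrable (Tm T) (\<lambda>r. A (dy r) g * indicator {s<..t} r)"
proof -
  note gL = mean_zero_L2[OF g]
  have ycL: "L2 (lebesgue_on \<Omega>) (yc t)" "L2 (lebesgue_on \<Omega>) (yc s)" using st by (auto intro!: mean_zero_L2[OF ycZ])
  let ?\<Phi> = "neumann_approx \<Omega> g"
  let ?f = "\<lambda>n r. ip \<Omega> (dy r) (?\<Phi> n) * indicator {s<..t} r"
  let ?l = "\<lambda>r. neumann_form \<Omega> (dy r) g * indicator {s<..t} r"
  let ?w = "\<lambda>r. nrm (dy r) * (C * (C * nrm g + 1))"
  have ipm: "(\<lambda>r. ip \<Omega> (dy r) (?\<Phi> n)) \<in> borel_measurable (Tm T)" for n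
    by (rule borel_measurable_integrable[OF dym[OF approx_L2[OF g]]])
  have fm: "?f n \<in> borel_measurable (Tm T)" for n
    by (rule borel_measurable_integrable) (use st in \<open>intro integrable_indicator_Tm dym approx_L2[OF g], auto\<close>)
  have "(\<lambda>r. neumann_form \<Omega> (dy r) g) \<in> borel_measurable (Tm T)"
    unfolding neumann_form_def by (rule borel_measurable_lim_metric[OF ipm])
  then have lm: "?l \<in> borel_measurable (Tm T)"
    using indicator_measurable_Tm[of s t] st by (intro borel_measurable_times borel_measurable_indicator) auto
  have wi: "integrable (Tm T) ?w" using dy_norm_integrable by simp
  have lim: "AE r in Tm T. (\<lambda>n. ?f n r) \<longlonglongrightarrow> ?l r"
    using dyZ by eventually_elim (intro tendsto_mult tendsto_const neumann_form_tendsto mean_zero_L2 g)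
  have bd: "AE r in Tm T. norm (?f n r) \<le> ?w r" for n
    using dyZ
  proof eventually_elim
    case (elim r)
    have "nrm (?\<Phi> n) \<le> C * (C * nrm g + 1)"
    proof -
      have "inverse (real (Suc n)) \<le> 1" using inverse_le_1_iff[of "real (Suc n)"] by simp
      then have "C * (C * nrm g + inverse (real (Suc n))) \<le> C * (C * nrm g + 1)" using C_pos by (intro mult_left_mono) auto
      then show ?thesis using approx_nrm[OF g, of n] by linarith
    qed
    then have "nrm (dy r) * nrm (?\<Phi> n) \<le> ?w r" by (rule mult_left_mono) simp
    then have "\<bar>ip \<Omega> (dy r) (?\<Phi> n)\<bar> \<le> ?w r" using ip_bound[OF mean_zero_L2[OF elim] approx_L2[OF g, of n]] by linarith
    moreover have "0 \<le> ?w r" using C_pos by simp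
    ultimately show ?case by (cases "r \<in> {s<..t}") auto
  qed
  have il: "integrable (Tm T) ?l" by (rule integrable_dominated_convergence[OF lm fm wi lim bd])
  have "(\<lambda>n. \<integral>r. ?f n r \<partial>Tm T) \<longlonglongrightarrow> (\<integral>r. ?l r \<partial>Tm T)" by (rule integral_dominated_convergence[OF lm fm wi lim bd])
  moreover have "(\<integral>r. ?f n r \<partial>Tm T) = ip \<Omega> (yc t) (?\<Phi> n) - ip \<Omega> (yc s) (?\<Phi> n)" for n
    by (rule inc[OF approx_L2[OF g] st, symmetric])
  ultimately have "(\<lambda>n. ip \<Omega> (yc t) (?\<Phi> n) - ip \<Omega> (yc s) (?\<Phi> n)) \<longlonglongrightarrow> (\<integral>r. ?l r \<partial>Tm T)" by simp
  from LIMSEQ_unique[OF this tendsto_diff[OF neumann_form_tendsto[OF ycL(1) g] neumann_form_tendsto[OF ycL(2) g]]]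
  have fo: "neumann_form \<Omega> (yc t) g - neumann_form \<Omega> (yc s) g = (\<integral>r. ?l r \<partial>Tm T)" by simp
  have ii: "integrable (Tm T) (\<lambda>r. ip \<Omega> (dy r) g * indicator {s<..t} r)"
    using st by (intro integrable_indicator_Tm dym gL) auto
  have eq: "A (dy r) g * indicator {s<..t} r = \<tau> * (ip \<Omega> (dy r) g * indicator {s<..t} r) + ?l r" for r
    by (simp add: A_def algebra_simps)
  show "integrable (Tm T) (\<lambda>r. A (dy r) g * indicator {s<..t} r)" unfolding eq using ii il by simp
  show "A (yc t) g - A (yc s) g = (\<integral>r. A (dy r) g * indicator {s<..t} r \<partial>Tm T)"
    unfolding eq using ii il fo inc[OF gL st] by (simp add: A_def algebra_simps)
qed

text \<open>The factor 2 is the one from differentiating a quadratic form.\<close>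

definition \<rho> :: "real \<Rightarrow> real" where
  "\<rho> r = 2 * K * ((nrm (yc r))\<^sup>2 + q r)"

lemma \<rho>_integrable: "integrable (Tm T) \<rho>"
  unfolding \<rho>_def[abs_def] using u_integrable qi by simp

text \<open>By symmetry the difference of the energies is the increment of \<open>A\<close> against
  the fixed function \<open>yc t + yc s\<close>. Inside the time integral this function is replaced
  by twice the value at time \<open>r\<close>, with an error of norm at most
  \<open>\<omega>\<close>.\<close>

lemma energy_step:
  assumes st: "0 < s" "s < t" "t < T"
    and \<omega>: "\<And>r. s < r \<Longrightarrow> r \<le> t \<Longrightarrow> nrm (\<lambda>x. yc t x - yc r x) + nrm (\<lambda>x. yc s x - yc r x) \<le> \<omega>"
  shows "E t - E s \<le> (\<integral>r. (\<rho> r + (\<tau> + C\<^sup>2) * \<omega> * nrm (dy r)) * indicator {s<..t} r \<partial>Tm T)"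
proof -
  have Z: "mean_zero \<Omega> (yc t)" "mean_zero \<Omega> (yc s)" using st by (auto intro!: ycZ)
  define g where "g x = yc t x + 1 * yc s x" for x
  have g: "mean_zero \<Omega> g" unfolding g_def[abs_def] by (rule mean_zero_add_scale[OF Z])
  have "E t - E s = A (yc t) g - A (yc s) g"
    using A_add_scale_right[OF Z Z(1), of 1] A_add_scale_right[OF Z Z(2), of 1] A_commute[OF Z] unfolding g_def[abs_def] by simp
  also have "\<dots> = (\<integral>r. A (dy r) g * indicator {s<..t} r \<partial>Tm T)" by (rule energy_increment(1)[OF st g])
  also have "\<dots> \<le> (\<integral>r. (\<rho> r + (\<tau> + C\<^sup>2) * \<omega> * nrm (dy r)) * indicator {s<..t} r \<partial>Tm T)"
  proof (rule integral_mono_AE)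
    show "integrable (Tm T) (\<lambda>r. A (dy r) g * indicator {s<..t} r)" by (rule energy_increment(2)[OF st g])
    show "integrable (Tm T) (\<lambda>r. (\<rho> r + (\<tau> + C\<^sup>2) * \<omega> * nrm (dy r)) * indicator {s<..t} r)"
      using \<rho>_integrable dy_norm_integrable st by (intro integrable_indicator_Tm) auto
    show "AE r in Tm T. A (dy r) g * indicator {s<..t} r \<le> (\<rho> r + (\<tau> + C\<^sup>2) * \<omega> * nrm (dy r)) * indicator {s<..t} r"
      using dyZ rate
    proof eventually_elim
      case (elim r)
      note dr = elim(1)
      from elim(2) obtain y where y: "mean_zero \<Omega> y" "nrm (\<lambda>x. yc r x - y x) = 0"
        "A (dy r) y \<le> K * ((nrm (yc r))\<^sup>2 + q r)" unfolding A_def by blast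
      show ?case
      proof (cases "r \<in> {s<..t}")
        case True
        then have r: "s < r" "r \<le> t" by auto
        have rT: "r \<in> {0..T}" using r st by auto
        \<comment> \<open>The replacement error; \<open>y\<close> is the slice for which
          \<open>rate\<close> holds.\<close>
        define k where "k x = g x + (-2) * y x" for x
        have kZ: "mean_zero \<Omega> k" unfolding k_def[abs_def] by (rule mean_zero_add_scale[OF g y(1)])
        have "g = (\<lambda>x. k x + 2 * y x)" by (auto simp: k_def)
        then have "A (dy r) g = A (dy r) k + 2 * A (dy r) y" using A_add_scale_right[OF kZ y(1) dr, of 2] by simp
        moreover have "A (dy r) k \<le> (\<tau> + C\<^sup>2) * (nrm (dy r) * nrm k)" using A_bound[OF dr kZ] by linarith
        moreover have "nrm k \<le> \<omega>"
        proof -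
          note L = mean_zero_L2[OF Z(1)] mean_zero_L2[OF Z(2)] mean_zero_L2[OF ycZ[OF rT]] mean_zero_L2[OF y(1)]
          let ?a = "\<lambda>x. yc t x - yc r x" and ?b = "\<lambda>x. yc s x - yc r x" and ?c = "\<lambda>x. yc r x - y x"
          have "k = (\<lambda>x. (?a x + ?b x) + 2 * ?c x)" by (auto simp: k_def g_def algebra_simps)
          then have "nrm k \<le> nrm (\<lambda>x. ?a x + ?b x) + nrm (\<lambda>x. 2 * ?c x)"
            using nL2_triangle[OF L2_add[OF L2_diff[OF L(1,3)] L2_diff[OF L(2,3)]] L2_scale[OF L2_diff[OF L(3,4)], of 2]] by simp
          also have "nrm (\<lambda>x. 2 * ?c x) = 0" unfolding nL2_scale using y(2) by simp
          also have "nrm (\<lambda>x. ?a x + ?b x) \<le> nrm ?a + nrm ?b" by (rule nL2_triangle[OF L2_diff[OF L(1,3)] L2_diff[OF L(2,3)]])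
          finally show ?thesis using \<omega>[OF r] by simp
        qed
        then have "(\<tau> + C\<^sup>2) * (nrm (dy r) * nrm k) \<le> (\<tau> + C\<^sup>2) * (nrm (dy r) * \<omega>)"
          using \<tau> by (intro mult_left_mono) auto
        ultimately have *: "A (dy r) g \<le> (\<tau> + C\<^sup>2) * (nrm (dy r) * \<omega>) + 2 * A (dy r) y" by linarith
        have "A (dy r) g \<le> \<rho> r + (\<tau> + C\<^sup>2) * \<omega> * nrm (dy r)"
        proof -
          have "\<rho> r = 2 * (K * ((nrm (yc r))\<^sup>2 + q r))" by (simp add: \<rho>_def)
          moreover have "(\<tau> + C\<^sup>2) * \<omega> * nrm (dy r) = (\<tau> + C\<^sup>2) * (nrm (dy r) * \<omega>)" by (simp add: mult_ac)
          ultimately show ?thesis using y(3) * by linarith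
        qed
        then show ?thesis using True by simp
      qed simp
    qed
  qed
  finally show ?thesis .
qed

text \<open>Both sides are additive over adjacent intervals, and by continuity of \<open>yc\<close>
  the oscillation assumption of \<open>energy_step\<close> holds on short intervals around each
  time. The \<open>Bolzano\<close> rule then removes the shortness.\<close>

lemma energy_step_small:
  assumes st: "0 < s" "s < t" "t < T" and \<omega>: "0 < \<omega>"
  shows "E t - E s \<le> (\<integral>r. (\<rho> r + (\<tau> + C\<^sup>2) * \<omega> * nrm (dy r)) * indicator {s<..t} r \<partial>Tm T)"
proof -
  define R where "R r = \<rho> r + (\<tau> + C\<^sup>2) * \<omega> * nrm (dy r)" for r
  have Ri: "integrable (Tm T) R" unfolding R_def[abs_def] using \<rho>_integrable dy_norm_integrable by simp
  define I where "I a = (\<integral>r. R r * indicator {0<..a} r \<partial>Tm T)" for a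
  have Id: "I b - I a = (\<integral>r. R r * indicator {a<..b} r \<partial>Tm T)" if "0 \<le> a" "a \<le> b" "b < T" for a b
  proof -
    have "I b - I a = (\<integral>r. R r * indicator {0<..b} r - R r * indicator {0<..a} r \<partial>Tm T)"
      unfolding I_def using that by (intro Bochner_Integration.integral_diff[symmetric] integrable_indicator_Tm Ri) auto
    also have "\<dots> = (\<integral>r. R r * indicator {a<..b} r \<partial>Tm T)"
      using that by (intro Bochner_Integration.integral_cong) (auto simp: indicator_def)
    finally show ?thesis .
  qed
  have "E t - E s \<le> I t - I s" using less_imp_le[OF st(2)]
  proof (induction rule: Bolzano[where P="\<lambda>a b. E b - E a \<le> I b - I a"])
    case (trans a b c)
    then show ?case by simp
  next
    case (local x)
    then have x: "0 < x" "x < T" using st by auto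
    then have xT: "x \<in> {0..T}" by auto
    have "\<forall>\<^sub>F r in at x within {0..T}. nrm (\<lambda>z. yc r z - yc x z) < \<omega> / 4"
      using order_tendstoD(2)[OF ycc[OF xT], of "\<omega> / 4"] \<omega> by simp
    then obtain d0 where d0: "d0 > 0" "\<And>r. r \<in> {0..T} \<Longrightarrow> r \<noteq> x \<Longrightarrow> dist r x < d0 \<Longrightarrow> nrm (\<lambda>z. yc r z - yc x z) < \<omega> / 4"
      unfolding eventually_at by blast
    \<comment> \<open>Besides the continuity scale, \<open>d\<close> keeps short intervals around
      \<open>x\<close> inside the open time interval.\<close>
    define d where "d = min d0 (min x (T - x))"
    have d: "d > 0" using d0 x by (simp add: d_def)
    have near: "nrm (\<lambda>z. yc r z - yc x z) \<le> \<omega> / 4" if "\<bar>r - x\<bar> < d" for r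
    proof (cases "r = x")
      case False
      have "r \<in> {0..T}" using that by (auto simp: d_def)
      then show ?thesis using d0(2)[of r] False that by (simp add: d_def dist_real_def)
    qed (use \<omega> in simp)
    show ?case
    proof (intro exI[of _ d] conjI allI impI)
      fix a b assume ab: "a \<le> x \<and> x \<le> b \<and> b - a < d"
      then have in0: "0 < a" "b < T" by (auto simp: d_def)
      show "E b - E a \<le> I b - I a"
      proof (cases "a = b")
        case False
        then have "a < b" using ab by linarith
        \<comment> \<open>Passing through time \<open>x\<close> turns the bound
          \<open>\<omega> / 4\<close> into \<open>\<omega> / 2\<close>, and the two terms required
          by \<open>energy_step\<close> add up to \<open>\<omega>\<close>.\<close>
        have two: "nrm (\<lambda>z. yc p z - yc r z) \<le> \<omega> / 2" if pr: "p \<in> {a..b}" "r \<in> {a..b}" for p r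
        proof -
          have L: "L2 (lebesgue_on \<Omega>) (yc p)" "L2 (lebesgue_on \<Omega>) (yc r)" "L2 (lebesgue_on \<Omega>) (yc x)"
            using pr in0 ab xT by (auto intro!: mean_zero_L2[OF ycZ])
          have "nrm (\<lambda>z. yc p z - yc r z) = nrm (\<lambda>z. (yc p z - yc x z) - (yc r z - yc x z))" by simp
          also have "\<dots> \<le> nrm (\<lambda>z. yc p z - yc x z) + nrm (\<lambda>z. yc r z - yc x z)"
            by (rule nL2_triangle_diff[OF L2_diff[OF L(1,3)] L2_diff[OF L(2,3)]])
          also have "\<dots> \<le> \<omega> / 4 + \<omega> / 4" using pr ab by (intro add_mono near) auto
          finally show ?thesis by simp
        qed
        have "E b - E a \<le> (\<integral>r. (\<rho> r + (\<tau> + C\<^sup>2) * \<omega> * nrm (dy r)) * indicator {a<..b} r \<partial>Tm T)"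
        proof (rule energy_step[OF in0(1) \<open>a < b\<close> in0(2)])
          fix r assume "a < r" "r \<le> b"
          then show "nrm (\<lambda>x. yc b x - yc r x) + nrm (\<lambda>x. yc a x - yc r x) \<le> \<omega>"
            using two[of b r] two[of a r] \<open>a < b\<close> by auto
        qed
        then show ?thesis using Id[of a b] in0 \<open>a < b\<close> by (simp add: R_def)
      qed simp
    qed (rule d)
  qed
  then show ?thesis using Id[of s t] st by (simp add: R_def)
qed

text \<open>The oscillation error is proportional to \<open>\<omega>\<close> times the integral of
  the norm of \<open>dy\<close>, which is finite, so \<open>\<omega>\<close> can be sent to
  zero.\<close>

lemma energy_inequality:
  assumes st: "0 < s" "s < t" "t < T"
  shows "E t - E s \<le> (\<integral>r. \<rho> r * indicator {s<..t} r \<partial>Tm T)"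
proof (rule field_le_epsilon)
  fix e :: real assume e: "0 < e"
  define N where "N = (\<integral>r. nrm (dy r) * indicator {s<..t} r \<partial>Tm T)"
  have N: "0 \<le> N" unfolding N_def by (intro integral_nonneg_AE AE_I2) simp
  have c: "0 < \<tau> + C\<^sup>2" using \<tau> by (simp add: add_pos_nonneg)
  define \<omega> where "\<omega> = e / ((\<tau> + C\<^sup>2) * (N + 1))"
  have \<omega>: "0 < \<omega>" using e c N by (simp add: \<omega>_def)
  have i: "integrable (Tm T) (\<lambda>r. \<rho> r * indicator {s<..t} r)" "integrable (Tm T) (\<lambda>r. nrm (dy r) * indicator {s<..t} r)"
    using st by (auto intro!: integrable_indicator_Tm \<rho>_integrable dy_norm_integrable)
  have "E t - E s \<le> (\<integral>r. (\<rho> r + (\<tau> + C\<^sup>2) * \<omega> * nrm (dy r)) * indicator {s<..t} r \<partial>Tm T)"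
    by (rule energy_step_small[OF st \<omega>])
  also have "\<dots> = (\<integral>r. \<rho> r * indicator {s<..t} r + ((\<tau> + C\<^sup>2) * \<omega>) * (nrm (dy r) * indicator {s<..t} r) \<partial>Tm T)"
    by (rule Bochner_Integration.integral_cong) (auto simp: algebra_simps)
  also have "\<dots> = (\<integral>r. \<rho> r * indicator {s<..t} r \<partial>Tm T) + ((\<tau> + C\<^sup>2) * \<omega>) * N"
    unfolding N_def using i by simp
  also have "((\<tau> + C\<^sup>2) * \<omega>) * N \<le> e"
  proof -
    have "(\<tau> + C\<^sup>2) * \<omega> = e / (N + 1)" using c N by (simp add: \<omega>_def)
    then have "((\<tau> + C\<^sup>2) * \<omega>) * N = e * (N / (N + 1))" by simp
    also have "\<dots> \<le> e * 1" using e N by (intro mult_left_mono) (auto simp: divide_le_eq)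
    finally show ?thesis by simp
  qed
  finally show "E t - E s \<le> (\<integral>r. \<rho> r * indicator {s<..t} r \<partial>Tm T) + e" by simp
qed

text \<open>The energy lies between \<open>\<tau>\<close> and \<open>\<tau> + C\<^sup>2\<close>
  times the squared norm; these two factors pass from the energy inequality to a Gronwall inequality
  for the norm.\<close>

lemma energy_estimate:
  assumes t: "0 < t" "t < T"
  shows "(nrm (yc t))\<^sup>2 \<le> ((\<tau> + C\<^sup>2) * (nrm (yc 0))\<^sup>2 + 2 * K * (\<integral>r. q r \<partial>Tm T)) / \<tau> * exp (2 * K / \<tau> * t)"
proof (rule gronwall[OF u_continuous _ t])
  show "0 \<le> 2 * K / \<tau>" using K \<tau> by simp
  fix t assume t: "0 < t" "t < T"
  let ?J = "\<lambda>s. \<integral>r. \<rho> r * indicator {s<..t} r \<partial>Tm T"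
  have \<rho>n: "AE r in Tm T. 0 \<le> \<rho> r" using qn by eventually_elim (use K in \<open>simp add: \<rho>_def\<close>)
  have mono: "?J s \<le> ?J 0" if "0 < s" for s
  proof (rule integral_mono_AE)
    show "integrable (Tm T) (\<lambda>r. \<rho> r * indicator {s<..t} r)" "integrable (Tm T) (\<lambda>r. \<rho> r * indicator {0<..t} r)"
      using that t by (auto intro!: integrable_indicator_Tm \<rho>_integrable)
    show "AE r in Tm T. \<rho> r * indicator {s<..t} r \<le> \<rho> r * indicator {0<..t} r"
      using \<rho>n by eventually_elim (use that in \<open>auto simp: indicator_def\<close>)
  qed
  have le: "E t \<le> (\<tau> + C\<^sup>2) * (nrm (yc s))\<^sup>2 + ?J 0" if s: "0 < s" "s < t" for s
    using energy_inequality[OF s t(2)] E_upper[of s] mono[OF s(1)] s t by simp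
  \<comment> \<open>Increments are available for positive starting times only, so the initial time
    is reached along a sequence lying strictly between 0 and \<open>t\<close>.\<close>
  define X where "X n = t / real (n + 2)" for n :: nat
  have X: "0 < X n" "X n < t" for n using t by (auto simp: X_def divide_less_eq)
  have "X \<longlonglongrightarrow> 0" unfolding X_def
    using LIMSEQ_ignore_initial_segment[OF lim_const_over_n[of t], of 2] by simp
  moreover have "continuous (at 0 within {0..T}) (\<lambda>t. (nrm (yc t))\<^sup>2)"
    using u_continuous T by (simp add: continuous_on_eq_continuous_within)
  then have cw: "\<forall>X. (\<forall>n. X n \<in> {0..T}) \<and> X \<longlonglongrightarrow> 0 \<longrightarrow> (\<lambda>n. (nrm (yc (X n)))\<^sup>2) \<longlonglongrightarrow> (nrm (yc 0))\<^sup>2"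
    unfolding continuous_within_sequentially o_def .
  moreover have "X n \<in> {0..T}" for n using X[of n] t by auto
  ultimately have "(\<lambda>n. (nrm (yc (X n)))\<^sup>2) \<longlonglongrightarrow> (nrm (yc 0))\<^sup>2" by blast
  then have "(\<lambda>n. (\<tau> + C\<^sup>2) * (nrm (yc (X n)))\<^sup>2 + ?J 0) \<longlonglongrightarrow> (\<tau> + C\<^sup>2) * (nrm (yc 0))\<^sup>2 + ?J 0"
    by (intro tendsto_add tendsto_mult tendsto_const)
  then have "E t \<le> (\<tau> + C\<^sup>2) * (nrm (yc 0))\<^sup>2 + ?J 0"
    by (rule LIMSEQ_le_const) (use le X in blast)
  moreover have "?J 0 \<le> 2 * K * (\<integral>r. q r \<partial>Tm T) + 2 * K * (\<integral>r. (nrm (yc r))\<^sup>2 * indicator {0<..t} r \<partial>Tm T)"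
  proof -
    have i: "integrable (Tm T) (\<lambda>r. (nrm (yc r))\<^sup>2 * indicator {0<..t} r)" "integrable (Tm T) (\<lambda>r. q r * indicator {0<..t} r)"
      using t by (auto intro!: integrable_indicator_Tm u_integrable qi)
    have "?J 0 = (\<integral>r. 2 * K * (q r * indicator {0<..t} r) + 2 * K * ((nrm (yc r))\<^sup>2 * indicator {0<..t} r) \<partial>Tm T)"
      by (rule Bochner_Integration.integral_cong) (auto simp: \<rho>_def algebra_simps)
    also have "\<dots> = 2 * K * (\<integral>r. q r * indicator {0<..t} r \<partial>Tm T) + 2 * K * (\<integral>r. (nrm (yc r))\<^sup>2 * indicator {0<..t} r \<partial>Tm T)"
      using i by simp
    also have "(\<integral>r. q r * indicator {0<..t} r \<partial>Tm T) \<le> (\<integral>r. q r \<partial>Tm T)"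
    proof (rule integral_mono_AE[OF i(2) qi])
      show "AE r in Tm T. q r * indicator {0<..t} r \<le> q r" using qn by eventually_elim (auto simp: indicator_def)
    qed
    finally show ?thesis using K by (simp add: mult_left_mono)
  qed
  ultimately have "\<tau> * (nrm (yc t))\<^sup>2 \<le> ((\<tau> + C\<^sup>2) * (nrm (yc 0))\<^sup>2 + 2 * K * (\<integral>r. q r \<partial>Tm T)) + 2 * K * (\<integral>r. (nrm (yc r))\<^sup>2 * indicator {0<..t} r \<partial>Tm T)"
    using E_lower[of t] t by simp
  then show "(nrm (yc t))\<^sup>2 \<le> ((\<tau> + C\<^sup>2) * (nrm (yc 0))\<^sup>2 + 2 * K * (\<integral>r. q r \<partial>Tm T)) / \<tau>
      + 2 * K / \<tau> * (\<integral>r. (nrm (yc r))\<^sup>2 * indicator {0<..t} r \<partial>Tm T)"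
    using \<tau> by (simp add: field_simps)
qed

end

subsection \<open>Time slices of solutions\<close>

lemma L2_slices:
  assumes "pair_sigma_finite M1 M2" and f: "L2 (M1 \<Otimes>\<^sub>M M2) (\<lambda>(t, x). f t x)"
  shows "AE t in M1. L2 M2 (f t)" "integrable M1 (\<lambda>t. (nL2 M2 (f t))\<^sup>2)"
    "(\<integral>t. (nL2 M2 (f t))\<^sup>2 \<partial>M1) = (nL2 (M1 \<Otimes>\<^sub>M M2) (\<lambda>(t, x). f t x))\<^sup>2"
proof -
  interpret pair_sigma_finite M1 M2 by fact
  have m[measurable]: "(\<lambda>(t, x). f t x) \<in> borel_measurable (M1 \<Otimes>\<^sub>M M2)" using f by (simp add: L2_def)
  have i: "integrable (M1 \<Otimes>\<^sub>M M2) (\<lambda>(t, x). (f t x)\<^sup>2)"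
    using f by (simp add: L2_def case_prod_beta')
  have "AE t in M1. integrable M2 (\<lambda>x. (f t x)\<^sup>2)" using AE_integrable_fst'[OF i] by simp
  moreover have "AE t in M1. f t \<in> borel_measurable M2"
    using measurable_Pair2[OF m] by (intro AE_I2) simp
  ultimately show "AE t in M1. L2 M2 (f t)" by eventually_elim (simp add: L2_def)
  show "integrable M1 (\<lambda>t. (nL2 M2 (f t))\<^sup>2)" unfolding nL2_sq using integrable_fst'[OF i] by simp
  show "(\<integral>t. (nL2 M2 (f t))\<^sup>2 \<partial>M1) = (nL2 (M1 \<Otimes>\<^sub>M M2) (\<lambda>(t, x). f t x))\<^sup>2"
    unfolding nL2_sq using integral_fst'[OF i] by (simp add: case_prod_beta')
qed

text \<open>The bounded weight \<open>a\<close> is instantiated with time test functions and their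
  derivatives, and with the constant 1 to obtain integrability of the plain pairings.\<close>

lemma L2_product_fubini:
  assumes "pair_sigma_finite M1 M2" "finite_measure M1" and f: "L2 (M1 \<Otimes>\<^sub>M M2) (\<lambda>(t, x). f t x)"
    and v: "L2 M2 v" and a[measurable]: "a \<in> borel_measurable M1" and B: "\<And>t. t \<in> space M1 \<Longrightarrow> \<bar>a t\<bar> \<le> B"
  shows "(\<integral>p. f (fst p) (snd p) * a (fst p) * v (snd p) \<partial>(M1 \<Otimes>\<^sub>M M2)) = (\<integral>t. a t * (\<integral>x. f t x * v x \<partial>M2) \<partial>M1)"
    "integrable M1 (\<lambda>t. a t * (\<integral>x. f t x * v x \<partial>M2))"
proof -
  interpret pair_sigma_finite M1 M2 by fact
  interpret F: finite_measure M1 by fact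
  have [measurable]: "v \<in> borel_measurable M2" using v by (simp add: L2_def)
  have v2: "integrable M2 (\<lambda>x. (v x)\<^sup>2)" using v by (simp add: L2_def)
  have "integrable (M1 \<Otimes>\<^sub>M M2) (\<lambda>p. (v (snd p))\<^sup>2)"
    by (rule Fubini_integrable) (use v2 in auto)
  then have i1: "integrable (M1 \<Otimes>\<^sub>M M2) (\<lambda>p. B\<^sup>2 * (v (snd p))\<^sup>2)" by simp
  have "integrable (M1 \<Otimes>\<^sub>M M2) (\<lambda>p. (a (fst p) * v (snd p))\<^sup>2)"
  proof (rule Bochner_Integration.integrable_bound[OF i1])
    show "AE p in M1 \<Otimes>\<^sub>M M2. norm ((a (fst p) * v (snd p))\<^sup>2) \<le> norm (B\<^sup>2 * (v (snd p))\<^sup>2)"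
    proof (rule AE_I2)
      fix p assume "p \<in> space (M1 \<Otimes>\<^sub>M M2)"
      then have "\<bar>a (fst p)\<bar> \<le> \<bar>B\<bar>" using B[of "fst p"] by (auto simp: space_pair_measure)
      then have "(a (fst p))\<^sup>2 \<le> B\<^sup>2" by (simp only: abs_le_square_iff)
      then show "norm ((a (fst p) * v (snd p))\<^sup>2) \<le> norm (B\<^sup>2 * (v (snd p))\<^sup>2)"
        by (simp add: power_mult_distrib mult_right_mono)
    qed
  qed measurable
  then have "L2 (M1 \<Otimes>\<^sub>M M2) (\<lambda>p. a (fst p) * v (snd p))" by (simp add: L2_def)
  from L2_mult_integrable[OF f this]
  have i: "integrable (M1 \<Otimes>\<^sub>M M2) (\<lambda>p. f (fst p) (snd p) * a (fst p) * v (snd p))"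
    by (simp add: case_prod_beta' mult.assoc)
  have eq: "(\<integral>x. f t x * a t * v x \<partial>M2) = a t * (\<integral>x. f t x * v x \<partial>M2)" for t
    by (subst integral_mult_right_zero[symmetric]) (simp add: mult_ac)
  show "(\<integral>p. f (fst p) (snd p) * a (fst p) * v (snd p) \<partial>(M1 \<Otimes>\<^sub>M M2)) = (\<integral>t. a t * (\<integral>x. f t x * v x \<partial>M2) \<partial>M1)"
    using integral_fst'[OF i] by (simp add: eq)
  show "integrable M1 (\<lambda>t. a t * (\<integral>x. f t x * v x \<partial>M2))"
    using integrable_fst'[OF i] by (simp add: eq)
qed

lemma pair_sigma_finite_Tm:
  assumes "finite_measure M"
  shows "pair_sigma_finite (Tm T) M"
proof -
  interpret A: finite_measure "Tm T" by (rule finite_measure_Tm)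
  interpret B: finite_measure M by fact
  show ?thesis ..
qed

lemma ip_eq_of_nL2_diff_0:
  assumes "L2 (lebesgue_on \<Omega>) f" "L2 (lebesgue_on \<Omega>) g" "L2 (lebesgue_on \<Omega>) v" "nL2 (lebesgue_on \<Omega>) (\<lambda>x. f x - g x) = 0"
  shows "ip \<Omega> f v = ip \<Omega> g v"
proof -
  have "ip \<Omega> v f - ip \<Omega> v g = ip \<Omega> v (\<lambda>x. f x - g x)" by (rule ip_diff_right[OF assms(3,1,2), symmetric])
  also have "\<bar>\<dots>\<bar> \<le> nL2 (lebesgue_on \<Omega>) v * nL2 (lebesgue_on \<Omega>) (\<lambda>x. f x - g x)" by (rule ip_bound[OF assms(3) L2_diff[OF assms(1,2)]])
  finally show ?thesis using assms(4) by (simp add: ip_commute[of \<Omega> v])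
qed

text \<open>Separated test functions and Fubini turn the vector-valued weak derivative into the weak
  derivative of one scalar function per \<open>v\<close>; its continuous version is the pairing of
  \<open>yc\<close> with \<open>v\<close>.\<close>

lemma solution_increment:
  assumes \<Omega>: "open \<Omega>" "bounded \<Omega>" and y: "L2 (Qm \<Omega> T) (\<lambda>(t,x). y t x)" and dy: "L2 (Qm \<Omega> T) (\<lambda>(t,x). dy t x)"
    and weak: "\<And>\<phi> v. test_fun {0<..<T} \<phi> \<Longrightarrow> L2 (lebesgue_on \<Omega>) v \<Longrightarrow>
        (\<integral>p. y (fst p) (snd p) * pd 1 \<phi> (fst p) * v (snd p) \<partial>Qm \<Omega> T)
          = - (\<integral>p. dy (fst p) (snd p) * \<phi> (fst p) * v (snd p) \<partial>Qm \<Omega> T)"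
    and ycL: "\<And>s. s \<in> {0..T} \<Longrightarrow> L2 (lebesgue_on \<Omega>) (yc s)"
    and yce: "AE t in Tm T. nL2 (lebesgue_on \<Omega>) (\<lambda>x. yc t x - y t x) = 0"
    and ycc: "\<And>t. t \<in> {0..T} \<Longrightarrow> ((\<lambda>s. nL2 (lebesgue_on \<Omega>) (\<lambda>x. yc s x - yc t x)) \<longlongrightarrow> 0) (at t within {0..T})"
    and v: "L2 (lebesgue_on \<Omega>) v"
  shows "continuous_on {0..T} (\<lambda>r. ip \<Omega> (yc r) v)" "integrable (Tm T) (\<lambda>r. ip \<Omega> (dy r) v)"
    "0 < s \<Longrightarrow> s < t \<Longrightarrow> t < T \<Longrightarrow> ip \<Omega> (yc t) v - ip \<Omega> (yc s) v = (\<integral>r. ip \<Omega> (dy r) v * indicator {s<..t} r \<partial>Tm T)"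
proof -
  note psf = pair_sigma_finite_Tm[OF lebesgue_on_finite_measure[OF \<Omega>], of T]
  note fin = finite_measure_Tm[of T]
  note y' = y[unfolded Qm_def] and dy' = dy[unfolded Qm_def]
  show cont: "continuous_on {0..T} (\<lambda>r. ip \<Omega> (yc r) v)"
    unfolding continuous_on_def
  proof
    fix t assume t: "t \<in> {0..T}"
    have "((\<lambda>s. nL2 (lebesgue_on \<Omega>) v * nL2 (lebesgue_on \<Omega>) (\<lambda>x. yc s x - yc t x)) \<longlongrightarrow> nL2 (lebesgue_on \<Omega>) v * 0) (at t within {0..T})"
      by (intro tendsto_mult tendsto_const ycc[OF t])
    then have lim: "((\<lambda>s. nL2 (lebesgue_on \<Omega>) v * nL2 (lebesgue_on \<Omega>) (\<lambda>x. yc s x - yc t x)) \<longlongrightarrow> 0) (at t within {0..T})" by simp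
    show "((\<lambda>r. ip \<Omega> (yc r) v) \<longlongrightarrow> ip \<Omega> (yc t) v) (at t within {0..T})"
    proof (rule LIM_zero_cancel, rule Lim_null_comparison[OF _ lim])
      have "norm (ip \<Omega> (yc s) v - ip \<Omega> (yc t) v) \<le> nL2 (lebesgue_on \<Omega>) v * nL2 (lebesgue_on \<Omega>) (\<lambda>x. yc s x - yc t x)" if "s \<in> {0..T}" for s
        using ip_bound[OF v L2_diff[OF ycL[OF that] ycL[OF t]]] ip_diff_right[OF v ycL[OF that] ycL[OF t]]
        by (simp add: ip_commute[of \<Omega> v])
      then show "\<forall>\<^sub>F s in at t within {0..T}. norm (ip \<Omega> (yc s) v - ip \<Omega> (yc t) v) \<le> nL2 (lebesgue_on \<Omega>) v * nL2 (lebesgue_on \<Omega>) (\<lambda>x. yc s x - yc t x)"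
        unfolding eventually_at_filter by (intro always_eventually) auto
    qed
  qed
  show di: "integrable (Tm T) (\<lambda>r. ip \<Omega> (dy r) v)"
    using L2_product_fubini(2)[OF psf fin dy' v, of "\<lambda>_. 1" 1] by (simp add: ip_def)
  have w1: "(\<integral>r. ip \<Omega> (yc r) v * pd 1 \<phi> r \<partial>Tm T) = - (\<integral>r. ip \<Omega> (dy r) v * \<phi> r \<partial>Tm T)" if t: "test_fun {0<..<T} \<phi>" for \<phi>
  proof -
    have \<phi>: "Cinf_on UNIV \<phi>" using t by (simp add: test_fun_def)
    have \<phi>': "Cinf_on UNIV (pd 1 \<phi>)" by (rule Cinf_on_pd[OF \<phi>]) simp
    have m: "\<phi> \<in> borel_measurable (Tm T)" "pd 1 \<phi> \<in> borel_measurable (Tm T)"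
      unfolding Tm_def by (intro measurable_lebesgue_on_borel borel_measurable_Cinf \<phi> \<phi>')+
    obtain B1 where B1: "\<forall>r\<in>{0<..<T}. \<bar>\<phi> r\<bar> \<le> B1"
      using bounded_continuous_on_bounded[OF Cinf_on_continuous[OF \<phi>], of "{0<..<T}"] by auto
    obtain B2 where B2: "\<forall>r\<in>{0<..<T}. \<bar>pd 1 \<phi> r\<bar> \<le> B2"
      using bounded_continuous_on_bounded[OF Cinf_on_continuous[OF \<phi>'], of "{0<..<T}"] by auto
    have e1: "(\<integral>p. y (fst p) (snd p) * pd 1 \<phi> (fst p) * v (snd p) \<partial>Qm \<Omega> T) = (\<integral>r. pd 1 \<phi> r * ip \<Omega> (y r) v \<partial>Tm T)"
      unfolding Qm_def ip_def by (rule L2_product_fubini(1)[OF psf fin y' v m(2)]) (use B2 in \<open>auto simp: space_Tm\<close>)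
    have e2: "(\<integral>p. dy (fst p) (snd p) * \<phi> (fst p) * v (snd p) \<partial>Qm \<Omega> T) = (\<integral>r. \<phi> r * ip \<Omega> (dy r) v \<partial>Tm T)"
      unfolding Qm_def ip_def by (rule L2_product_fubini(1)[OF psf fin dy' v m(1)]) (use B1 in \<open>auto simp: space_Tm\<close>)
    have my: "(\<lambda>r. ip \<Omega> (y r) v) \<in> borel_measurable (Tm T)"
      using borel_measurable_integrable[OF L2_product_fubini(2)[OF psf fin y' v, of "\<lambda>_. 1" 1]] by (simp add: ip_def)
    have "AE r in Tm T. ip \<Omega> (yc r) v * pd 1 \<phi> r = pd 1 \<phi> r * ip \<Omega> (y r) v"
      using yce L2_slices(1)[OF psf y'] AE_space[of "Tm T"]
    proof eventually_elim
      case (elim r)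
      then have "ip \<Omega> (yc r) v = ip \<Omega> (y r) v" by (intro ip_eq_of_nL2_diff_0 ycL v) (auto simp: space_Tm)
      then show ?case by simp
    qed
    then have "(\<integral>r. ip \<Omega> (yc r) v * pd 1 \<phi> r \<partial>Tm T) = (\<integral>r. pd 1 \<phi> r * ip \<Omega> (y r) v \<partial>Tm T)"
      using continuous_measurable_Tm[OF cont] my m by (intro integral_cong_AE) auto
    then show ?thesis using weak[OF t v] e1 e2 by (simp add: mult.commute)
  qed
  show "ip \<Omega> (yc t) v - ip \<Omega> (yc s) v = (\<integral>r. ip \<Omega> (dy r) v * indicator {s<..t} r \<partial>Tm T)" if "0 < s" "s < t" "t < T"
    by (rule weak_derivative_increment[OF cont di that w1])
qed

lemma weak_grad_diff:
  assumes \<Omega>: "open \<Omega>" "bounded \<Omega>" and w: "weak_grad \<Omega> w1 G1" "weak_grad \<Omega> w2 G2"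
  shows "weak_grad \<Omega> (\<lambda>x. w1 x - w2 x) (\<lambda>x. G1 x - G2 x)"
  unfolding weak_grad_def
proof (intro conjI allI impI ballI)
  have L: "L2 (lebesgue_on \<Omega>) w1" "L2 (lebesgue_on \<Omega>) w2" "\<And>e. e \<in> Basis \<Longrightarrow> L2 (lebesgue_on \<Omega>) (\<lambda>x. G1 x \<bullet> e)"
    "\<And>e. e \<in> Basis \<Longrightarrow> L2 (lebesgue_on \<Omega>) (\<lambda>x. G2 x \<bullet> e)" using w by (auto simp: weak_grad_def)
  show "L2 (lebesgue_on \<Omega>) (\<lambda>x. w1 x - w2 x)" by (rule L2_diff[OF L(1,2)])
  show "L2 (lebesgue_on \<Omega>) (\<lambda>x. (G1 x - G2 x) \<bullet> e)" if "e \<in> Basis" for e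
    using L2_diff[OF L(3,4)[OF that]] by (simp add: inner_diff_left)
  fix \<phi> and e :: pt assume t: "test_fun \<Omega> \<phi>" and e: "e \<in> Basis"
  have \<phi>: "Cinf_on UNIV \<phi>" using t by (simp add: test_fun_def)
  have i: "integrable (lebesgue_on \<Omega>) (\<lambda>x. w1 x * pd e \<phi> x)" "integrable (lebesgue_on \<Omega>) (\<lambda>x. w2 x * pd e \<phi> x)"
    "integrable (lebesgue_on \<Omega>) (\<lambda>x. (G1 x \<bullet> e) * \<phi> x)" "integrable (lebesgue_on \<Omega>) (\<lambda>x. (G2 x \<bullet> e) * \<phi> x)"
    by (intro L2_mult_integrable L e L2_pd[OF \<phi> e \<Omega>] L2_Cinf[OF \<phi> \<Omega>])+
  have "(\<integral>x. w1 x * pd e \<phi> x \<partial>lebesgue_on \<Omega>) = - (\<integral>x. (G1 x \<bullet> e) * \<phi> x \<partial>lebesgue_on \<Omega>)"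
    "(\<integral>x. w2 x * pd e \<phi> x \<partial>lebesgue_on \<Omega>) = - (\<integral>x. (G2 x \<bullet> e) * \<phi> x \<partial>lebesgue_on \<Omega>)"
    using w t e unfolding weak_grad_def by blast+
  then show "(\<integral>x. (w1 x - w2 x) * pd e \<phi> x \<partial>lebesgue_on \<Omega>) = - (\<integral>x. ((G1 x - G2 x) \<bullet> e) * \<phi> x \<partial>lebesgue_on \<Omega>)"
    using i by (simp add: left_diff_distrib inner_diff_left)
qed

lemma integrable_inner_grad:
  assumes G: "\<And>b. b \<in> Basis \<Longrightarrow> L2 (lebesgue_on \<Omega>) (\<lambda>x. G x \<bullet> b)"
    and \<phi>: "Cinf_on UNIV \<phi>" and \<Omega>: "open \<Omega>" "bounded \<Omega>"
  shows "integrable (lebesgue_on \<Omega>) (\<lambda>x. G x \<bullet> grad \<phi> x)"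
proof -
  have "integrable (lebesgue_on \<Omega>) (\<lambda>x. \<Sum>b\<in>Basis. (G x \<bullet> b) * pd b \<phi> x)"
    by (rule Bochner_Integration.integrable_sum) (rule L2_mult_integrable[OF G L2_pd[OF \<phi> _ \<Omega>]])
  moreover have "(\<lambda>x. \<Sum>b\<in>Basis. (G x \<bullet> b) * pd b \<phi> x) = (\<lambda>x. G x \<bullet> grad \<phi> x)"
  proof
    fix x
    show "(\<Sum>b\<in>Basis. (G x \<bullet> b) * pd b \<phi> x) = G x \<bullet> grad \<phi> x"
      by (subst (2) euclidean_inner) (auto simp: grad_inner intro!: sum.cong)
  qed
  ultimately show ?thesis by simp
qed

lemma subdiff_monotone:
  assumes "\<xi>1 \<in> subdiff bh r1" "\<xi>2 \<in> subdiff bh r2"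
  shows "0 \<le> (\<xi>1 - \<xi>2) * (r1 - r2)"
proof -
  have "bh r1 + \<xi>1 * (r2 - r1) \<le> bh r2" "bh r2 + \<xi>2 * (r1 - r2) \<le> bh r1"
    using assms by (auto simp: subdiff_def)
  then show ?thesis by (simp add: algebra_simps)
qed

text \<open>The system at one time. The first equation is kept for smooth \<open>v\<close> only,
  with the classical gradient and with \<open>v\<close> as its own trace; \<open>p\<close> stands
  for the perturbation term.\<close>

definition slice_solution ::
  "pt set \<Rightarrow> real \<Rightarrow> (real \<Rightarrow> real) \<Rightarrow> (pt \<Rightarrow> real) \<Rightarrow> (pt \<Rightarrow> real) \<Rightarrow> (pt \<Rightarrow> real) \<Rightarrow>
   (pt \<Rightarrow> real) \<Rightarrow> (pt \<Rightarrow> real) \<Rightarrow> (pt \<Rightarrow> real) \<Rightarrow> (pt \<Rightarrow> pt) \<Rightarrow> (pt \<Rightarrow> real) \<Rightarrow> bool" where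
  "slice_solution \<Omega> \<tau> bh p g h y dy w G \<xi> \<longleftrightarrow>
     L2 (lebesgue_on \<Omega>) p \<and> L2 (lebesgue_on \<Omega>) g \<and> L2 (surf \<Omega>) h \<and> L2 (lebesgue_on \<Omega>) y \<and>
     L2 (lebesgue_on \<Omega>) dy \<and> weak_grad \<Omega> w G \<and> L2 (lebesgue_on \<Omega>) \<xi> \<and>
     (\<forall>v. Cinf_on UNIV v \<longrightarrow> ip \<Omega> dy v + (\<integral>x. G x \<bullet> grad v x \<partial>lebesgue_on \<Omega>) = (\<integral>x. h x * v x \<partial>surf \<Omega>)) \<and>
     (\<forall>v. L2 (lebesgue_on \<Omega>) v \<longrightarrow> ip \<Omega> w v = \<tau> * ip \<Omega> dy v + ip \<Omega> \<xi> v + ip \<Omega> p v - ip \<Omega> g v) \<and>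
     (AE x in lebesgue_on \<Omega>. \<xi> x \<in> subdiff bh (y x))"

lemma ip_diff_left:
  assumes "L2 (lebesgue_on \<Omega>) v" "L2 (lebesgue_on \<Omega>) f" "L2 (lebesgue_on \<Omega>) g"
  shows "ip \<Omega> (\<lambda>x. f x - g x) v = ip \<Omega> f v - ip \<Omega> g v"
  using ip_diff_right[OF assms] by (simp add: ip_commute[of \<Omega> v])

text \<open>Adding the tested equations cancels the pairing of \<open>w\<close> with
  \<open>y\<close>, and the monotone term is dropped by its sign. In the factor, the square of
  \<open>K0 * C\<close> comes from the boundary term, \<open>k\<close> from the perturbation and 1
  from the source.\<close>

lemma (in trace_domain) rate_bound:
  assumes dy: "mean_zero \<Omega> dy" and y: "mean_zero \<Omega> y" and w: "weak_grad \<Omega> w G" and h: "L2 (surf \<Omega>) h"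
    and eq1: "\<And>v. Cinf_on UNIV v \<Longrightarrow> ip \<Omega> dy v + (\<integral>x. G x \<bullet> grad v x \<partial>lebesgue_on \<Omega>) = (\<integral>x. h x * v x \<partial>surf \<Omega>)"
    and L: "L2 (lebesgue_on \<Omega>) \<xi>" "L2 (lebesgue_on \<Omega>) p" "L2 (lebesgue_on \<Omega>) g"
    and eq2: "ip \<Omega> w y = \<tau> * ip \<Omega> dy y + ip \<Omega> \<xi> y + ip \<Omega> p y - ip \<Omega> g y"
    and mono: "AE x in lebesgue_on \<Omega>. 0 \<le> \<xi> x * y x"
    and pb: "AE x in lebesgue_on \<Omega>. \<bar>p x\<bar> \<le> k * \<bar>y x\<bar>" and k: "0 \<le> k"
  shows "\<tau> * ip \<Omega> dy y + neumann_form \<Omega> dy y \<le> ((K0 * C)\<^sup>2 + k + 1) * ((nrm y)\<^sup>2 + ((nrm g)\<^sup>2 + (nL2 (surf \<Omega>) h)\<^sup>2))"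
proof -
  let ?N = "nrm y" and ?H = "nL2 (surf \<Omega>) h" and ?g = "nrm g" and ?c = "K0 * C"
  have yL: "L2 (lebesgue_on \<Omega>) y" using y by (simp add: mean_zero_def)
  have 1: "neumann_form \<Omega> dy y + ip \<Omega> w y \<le> ?H * (K0 * C * ?N)"
    by (rule static_energy[OF dy y w h eq1])
  have 2: "0 \<le> ip \<Omega> \<xi> y" unfolding ip_def by (rule integral_nonneg_AE[OF mono])
  have "(\<integral>x. (- k) * (y x)\<^sup>2 \<partial>lebesgue_on \<Omega>) \<le> (\<integral>x. p x * y x \<partial>lebesgue_on \<Omega>)"
  proof (rule integral_mono_AE)
    show "integrable (lebesgue_on \<Omega>) (\<lambda>x. (- k) * (y x)\<^sup>2)" using yL by (simp add: L2_def)
    show "integrable (lebesgue_on \<Omega>) (\<lambda>x. p x * y x)" by (rule L2_mult_integrable[OF L(2) yL])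
    show "AE x in lebesgue_on \<Omega>. (- k) * (y x)\<^sup>2 \<le> p x * y x"
      using pb
    proof eventually_elim
      case (elim x)
      have "\<bar>p x * y x\<bar> \<le> k * \<bar>y x\<bar> * \<bar>y x\<bar>" unfolding abs_mult by (rule mult_right_mono[OF elim]) simp
      also have "\<dots> = k * (y x)\<^sup>2" by (simp add: power2_eq_square)
      finally show ?case by (simp add: abs_le_iff)
    qed
  qed
  then have 3: "- ip \<Omega> p y \<le> k * ?N\<^sup>2" by (simp add: ip_def nL2_sq)
  have 4: "ip \<Omega> g y \<le> ?g * ?N" using ip_bound[OF L(3) yL] by linarith
  have 5: "?H * (K0 * C * ?N) \<le> ?H\<^sup>2 + ?c\<^sup>2 * ?N\<^sup>2"
    using sum_squares_bound[of ?H "?c * ?N"] zero_le_power2[of ?H] zero_le_power2[of "?c * ?N"]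
    unfolding power_mult_distrib[of ?c ?N] by linarith
  have 6: "?g * ?N \<le> ?g\<^sup>2 + ?N\<^sup>2"
    using sum_squares_bound[of ?g ?N] zero_le_power2[of ?g] zero_le_power2[of ?N] by linarith
  have "\<tau> * ip \<Omega> dy y + neumann_form \<Omega> dy y \<le> (?c\<^sup>2 + k + 1) * ?N\<^sup>2 + (?g\<^sup>2 + ?H\<^sup>2)"
    using 1 2 3 4 5 6 eq2 by (simp add: distrib_right)
  \<comment> \<open>The data terms appear with coefficient 1 and are enlarged to the common factor,
    which is at least 1.\<close>
  also have "1 * (?g\<^sup>2 + ?H\<^sup>2) \<le> (?c\<^sup>2 + k + 1) * (?g\<^sup>2 + ?H\<^sup>2)"
    by (rule mult_right_mono) (use k in auto)
  then have "(?c\<^sup>2 + k + 1) * ?N\<^sup>2 + (?g\<^sup>2 + ?H\<^sup>2) \<le> (?c\<^sup>2 + k + 1) * (?N\<^sup>2 + (?g\<^sup>2 + ?H\<^sup>2))"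
    by (simp add: distrib_left)
  finally show ?thesis .
qed

context trace_domain begin

lemma slice_equation_diff:
  assumes s1: "slice_solution \<Omega> \<tau> bh p1 g1 h1 y1 dy1 w1 G1 \<xi>1" and s2: "slice_solution \<Omega> \<tau> bh p2 g2 h2 y2 dy2 w2 G2 \<xi>2"
    and v: "Cinf_on UNIV v" and hv: "L2 (surf \<Omega>) v"
  shows "ip \<Omega> (\<lambda>x. dy1 x - dy2 x) v + (\<integral>x. (G1 x - G2 x) \<bullet> grad v x \<partial>lebesgue_on \<Omega>) = (\<integral>x. (h1 x - h2 x) * v x \<partial>surf \<Omega>)"
proof -
  have "ip \<Omega> (\<lambda>x. dy1 x - dy2 x) v = ip \<Omega> dy1 v - ip \<Omega> dy2 v"
    using s1 s2 by (intro ip_diff_left L2_Cinf[OF v op]) (auto simp: slice_solution_def)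
  moreover have "(\<integral>x. (G1 x - G2 x) \<bullet> grad v x \<partial>lebesgue_on \<Omega>) = (\<integral>x. G1 x \<bullet> grad v x \<partial>lebesgue_on \<Omega>) - (\<integral>x. G2 x \<bullet> grad v x \<partial>lebesgue_on \<Omega>)"
    unfolding inner_diff_left
    by (rule Bochner_Integration.integral_diff; rule integrable_inner_grad[OF _ v op])
      (use s1 s2 in \<open>auto simp: slice_solution_def weak_grad_def\<close>)
  moreover have "(\<integral>x. (h1 x - h2 x) * v x \<partial>surf \<Omega>) = (\<integral>x. h1 x * v x \<partial>surf \<Omega>) - (\<integral>x. h2 x * v x \<partial>surf \<Omega>)"
    unfolding left_diff_distrib
    by (rule Bochner_Integration.integral_diff; rule L2_mult_integrable[OF _ hv])
      (use s1 s2 in \<open>auto simp: slice_solution_def\<close>)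
  moreover have "ip \<Omega> dy1 v + (\<integral>x. G1 x \<bullet> grad v x \<partial>lebesgue_on \<Omega>) = (\<integral>x. h1 x * v x \<partial>surf \<Omega>)"
    "ip \<Omega> dy2 v + (\<integral>x. G2 x \<bullet> grad v x \<partial>lebesgue_on \<Omega>) = (\<integral>x. h2 x * v x \<partial>surf \<Omega>)"
    using s1 s2 v unfolding slice_solution_def by blast+
  ultimately show ?thesis by linarith
qed

lemma L2_surf_Cinf: "Cinf_on UNIV v \<Longrightarrow> L2 (surf \<Omega>) v"
  using trace_of_Cinf[OF dom] by (simp add: trace_of_def)

text \<open>With the constant test function 1 the gradient term vanishes, so the integral of each
  time derivative equals the total boundary flux, and the fluxes agree.\<close>

lemma slice_mean_zero:
  assumes s1: "slice_solution \<Omega> \<tau> bh p1 g1 h1 y1 dy1 w1 G1 \<xi>1" and s2: "slice_solution \<Omega> \<tau> bh p2 g2 h2 y2 dy2 w2 G2 \<xi>2"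
    and h: "(\<integral>x. h1 x \<partial>surf \<Omega>) = (\<integral>x. h2 x \<partial>surf \<Omega>)"
  shows "mean_zero \<Omega> (\<lambda>x. dy1 x - dy2 x)"
proof -
  have c: "Cinf_on UNIV (\<lambda>x::pt. 1::real)" by (rule Cinf_const)
  have "grad (\<lambda>x::pt. 1::real) = (\<lambda>x. 0)"
    by (rule ext, rule euclidean_eqI) (simp add: grad_inner pd_const)
  then have "ip \<Omega> dy1 (\<lambda>_. 1) = (\<integral>x. h1 x \<partial>surf \<Omega>)" "ip \<Omega> dy2 (\<lambda>_. 1) = (\<integral>x. h2 x \<partial>surf \<Omega>)"
    using s1 s2 c unfolding slice_solution_def by (metis (no_types, lifting) Bochner_Integration.integral_cong add.right_neutral inner_zero_right integral_zero mult.right_neutral)+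
  moreover have L: "L2 (lebesgue_on \<Omega>) dy1" "L2 (lebesgue_on \<Omega>) dy2" using s1 s2 by (auto simp: slice_solution_def)
  moreover have "ip \<Omega> (\<lambda>x. dy1 x - dy2 x) (\<lambda>_. 1) = ip \<Omega> dy1 (\<lambda>_. 1) - ip \<Omega> dy2 (\<lambda>_. 1)"
    by (rule ip_diff_left[OF L2_Cinf[OF c op] L])
  ultimately show ?thesis using h by (simp add: mean_zero_def L2_diff ip_def)
qed

lemma slice_rate:
  assumes s1: "slice_solution \<Omega> \<tau> bh p1 g1 h1 y1 dy1 w1 G1 \<xi>1" and s2: "slice_solution \<Omega> \<tau> bh p2 g2 h2 y2 dy2 w2 G2 \<xi>2"
    and h: "(\<integral>x. h1 x \<partial>surf \<Omega>) = (\<integral>x. h2 x \<partial>surf \<Omega>)" and y: "mean_zero \<Omega> (\<lambda>x. y1 x - y2 x)"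
    and pb: "AE x in lebesgue_on \<Omega>. \<bar>p1 x - p2 x\<bar> \<le> k * \<bar>y1 x - y2 x\<bar>" and k: "0 \<le> k"
  shows "\<tau> * ip \<Omega> (\<lambda>x. dy1 x - dy2 x) (\<lambda>x. y1 x - y2 x) + neumann_form \<Omega> (\<lambda>x. dy1 x - dy2 x) (\<lambda>x. y1 x - y2 x)
    \<le> ((K0 * C)\<^sup>2 + k + 1) * ((nrm (\<lambda>x. y1 x - y2 x))\<^sup>2
      + ((nrm (\<lambda>x. g1 x - g2 x))\<^sup>2 + (nL2 (surf \<Omega>) (\<lambda>x. h1 x - h2 x))\<^sup>2))"
proof (rule rate_bound[OF slice_mean_zero[OF s1 s2 h] y _ _ _ _ _ _ _ _ pb k])
  have yL: "L2 (lebesgue_on \<Omega>) (\<lambda>x. y1 x - y2 x)" using y by (simp add: mean_zero_def)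
  show "weak_grad \<Omega> (\<lambda>x. w1 x - w2 x) (\<lambda>x. G1 x - G2 x)"
    using s1 s2 by (intro weak_grad_diff op) (auto simp: slice_solution_def)
  show "L2 (surf \<Omega>) (\<lambda>x. h1 x - h2 x)" "L2 (lebesgue_on \<Omega>) (\<lambda>x. \<xi>1 x - \<xi>2 x)"
    "L2 (lebesgue_on \<Omega>) (\<lambda>x. p1 x - p2 x)" "L2 (lebesgue_on \<Omega>) (\<lambda>x. g1 x - g2 x)"
    using s1 s2 by (auto simp: slice_solution_def intro!: L2_diff)
  show "ip \<Omega> (\<lambda>x. dy1 x - dy2 x) v + (\<integral>x. (G1 x - G2 x) \<bullet> grad v x \<partial>lebesgue_on \<Omega>) = (\<integral>x. (h1 x - h2 x) * v x \<partial>surf \<Omega>)"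
    if "Cinf_on UNIV v" for v by (rule slice_equation_diff[OF s1 s2 that L2_surf_Cinf[OF that]])
  let ?y = "\<lambda>x. y1 x - y2 x"
  have e: "ip \<Omega> w1 ?y = \<tau> * ip \<Omega> dy1 ?y + ip \<Omega> \<xi>1 ?y + ip \<Omega> p1 ?y - ip \<Omega> g1 ?y"
    "ip \<Omega> w2 ?y = \<tau> * ip \<Omega> dy2 ?y + ip \<Omega> \<xi>2 ?y + ip \<Omega> p2 ?y - ip \<Omega> g2 ?y"
    using s1 s2 yL unfolding slice_solution_def by blast+
  have d: "ip \<Omega> (\<lambda>x. w1 x - w2 x) ?y = ip \<Omega> w1 ?y - ip \<Omega> w2 ?y"
    "ip \<Omega> (\<lambda>x. dy1 x - dy2 x) ?y = ip \<Omega> dy1 ?y - ip \<Omega> dy2 ?y"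
    "ip \<Omega> (\<lambda>x. \<xi>1 x - \<xi>2 x) ?y = ip \<Omega> \<xi>1 ?y - ip \<Omega> \<xi>2 ?y"
    "ip \<Omega> (\<lambda>x. p1 x - p2 x) ?y = ip \<Omega> p1 ?y - ip \<Omega> p2 ?y"
    "ip \<Omega> (\<lambda>x. g1 x - g2 x) ?y = ip \<Omega> g1 ?y - ip \<Omega> g2 ?y"
    using s1 s2 by (auto simp: slice_solution_def weak_grad_def intro!: ip_diff_left[OF yL])
  show "ip \<Omega> (\<lambda>x. w1 x - w2 x) ?y = \<tau> * ip \<Omega> (\<lambda>x. dy1 x - dy2 x) ?y + ip \<Omega> (\<lambda>x. \<xi>1 x - \<xi>2 x) ?y
      + ip \<Omega> (\<lambda>x. p1 x - p2 x) ?y - ip \<Omega> (\<lambda>x. g1 x - g2 x) ?y"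
    unfolding d e by (simp add: algebra_simps)
  have "AE x in lebesgue_on \<Omega>. \<xi>1 x \<in> subdiff bh (y1 x)" "AE x in lebesgue_on \<Omega>. \<xi>2 x \<in> subdiff bh (y2 x)"
    using s1 s2 by (auto simp: slice_solution_def)
  then show "AE x in lebesgue_on \<Omega>. 0 \<le> (\<xi>1 x - \<xi>2 x) * (y1 x - y2 x)"
    by eventually_elim (rule subdiff_monotone)
qed

end

lemma L2_nonlinearity:
  assumes l: "l \<in> borel_measurable M" "AE x in M. \<bar>l x\<bar> \<le> m" and \<pi>: "L-lipschitz_on UNIV \<pi>" "\<pi> 0 = 0" and y: "L2 M y"
  shows "L2 M (\<lambda>x. l x * \<pi> (y x))"
proof -
  have [measurable]: "l \<in> borel_measurable M" "y \<in> borel_measurable M" using l y by (auto simp: L2_def)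
  have [measurable]: "\<pi> \<in> borel_measurable borel"
    by (rule borel_measurable_continuous_onI[OF lipschitz_on_continuous_on[OF \<pi>(1)]])
  have i: "integrable M (\<lambda>x. (m * L)\<^sup>2 * (y x)\<^sup>2)" using y by (simp add: L2_def)
  have "integrable M (\<lambda>x. (l x * \<pi> (y x))\<^sup>2)"
  proof (rule Bochner_Integration.integrable_bound[OF i])
    show "AE x in M. norm ((l x * \<pi> (y x))\<^sup>2) \<le> norm ((m * L)\<^sup>2 * (y x)\<^sup>2)"
      using l(2)
    proof eventually_elim
      case (elim x)
      have "\<bar>\<pi> (y x)\<bar> \<le> L * \<bar>y x\<bar>" using lipschitz_onD[OF \<pi>(1), of "y x" 0] \<pi>(2) by (simp add: dist_real_def)
      then have "\<bar>l x\<bar> * \<bar>\<pi> (y x)\<bar> \<le> m * (L * \<bar>y x\<bar>)" using elim by (intro mult_mono) auto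
      then have "\<bar>l x * \<pi> (y x)\<bar> \<le> \<bar>m * L * y x\<bar>" using abs_ge_self[of "m * (L * \<bar>y x\<bar>)"] by (simp add: abs_mult)
      then have "(l x * \<pi> (y x))\<^sup>2 \<le> (m * L * y x)\<^sup>2" by (simp only: abs_le_square_iff)
      then show ?case by (simp add: power_mult_distrib)
    qed
  qed measurable
  then show ?thesis by (simp add: L2_def)
qed

text \<open>Gathers one set of times of full measure on which all slices are square integrable and
  all equations hold. Slicing the boundary datum rests on the finiteness of the surface
  measure.\<close>

lemma limit_solution_slices:
  assumes dom: "smooth_bounded_domain \<Omega>" and \<pi>: "L-lipschitz_on UNIV \<pi>" "\<pi> 0 = 0"
    and lam: "(\<lambda>(t,x). lam t x) \<in> borel_measurable (Qm \<Omega> T)" "AE p in Qm \<Omega> T. \<bar>lam (fst p) (snd p)\<bar> \<le> m"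
    and data: "admissible_data \<Omega> T bh y0 g h" and sol: "limit_solution \<Omega> T \<tau> bh \<pi> lam y0 g h y w \<xi>"
  obtains dy G yc where "L2 (Qm \<Omega> T) (\<lambda>(t,x). y t x)" "L2 (Qm \<Omega> T) (\<lambda>(t,x). dy t x)"
    "\<And>s. s \<in> {0..T} \<Longrightarrow> L2 (lebesgue_on \<Omega>) (yc s)"
    "AE t in Tm T. nL2 (lebesgue_on \<Omega>) (\<lambda>x. yc t x - y t x) = 0"
    "\<And>t. t \<in> {0..T} \<Longrightarrow> ((\<lambda>s. nL2 (lebesgue_on \<Omega>) (\<lambda>x. yc s x - yc t x)) \<longlongrightarrow> 0) (at t within {0..T})"
    "nL2 (lebesgue_on \<Omega>) (\<lambda>x. yc 0 x - y0 x) = 0"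
    "\<And>v. L2 (lebesgue_on \<Omega>) v \<Longrightarrow> continuous_on {0..T} (\<lambda>r. ip \<Omega> (yc r) v)"
    "\<And>v. L2 (lebesgue_on \<Omega>) v \<Longrightarrow> integrable (Tm T) (\<lambda>r. ip \<Omega> (dy r) v)"
    "\<And>v s t. L2 (lebesgue_on \<Omega>) v \<Longrightarrow> 0 < s \<Longrightarrow> s < t \<Longrightarrow> t < T \<Longrightarrow>
       ip \<Omega> (yc t) v - ip \<Omega> (yc s) v = (\<integral>r. ip \<Omega> (dy r) v * indicator {s<..t} r \<partial>Tm T)"
    "AE t in Tm T. slice_solution \<Omega> \<tau> bh (\<lambda>x. lam t x * \<pi> (y t x)) (g t) (h t) (y t) (dy t) (w t) (G t) (\<xi> t)"
proof -
  have op: "open \<Omega>" "bounded \<Omega>" using dom by (auto simp: smooth_bounded_domain_def)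
  obtain dy Gw yc where y: "L2 (Qm \<Omega> T) (\<lambda>(t,x). y t x)" and dy: "L2 (Qm \<Omega> T) (\<lambda>(t,x). dy t x)"
    and weak: "\<forall>\<phi> v. test_fun {0<..<T} \<phi> \<and> L2 (lebesgue_on \<Omega>) v \<longrightarrow>
        (\<integral>p. y (fst p) (snd p) * pd 1 \<phi> (fst p) * v (snd p) \<partial>Qm \<Omega> T)
          = - (\<integral>p. dy (fst p) (snd p) * \<phi> (fst p) * v (snd p) \<partial>Qm \<Omega> T)"
    and wG: "AE t in Tm T. weak_grad \<Omega> (w t) (Gw t)"
    and \<xi>: "L2 (Qm \<Omega> T) (\<lambda>(t,x). \<xi> t x)"
    and eq1: "AE t in Tm T. \<forall>v Gv tv. weak_grad \<Omega> v Gv \<and> trace_of \<Omega> v tv \<longrightarrow>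
        (\<integral>x. dy t x * v x \<partial>lebesgue_on \<Omega>) + (\<integral>x. Gw t x \<bullet> Gv x \<partial>lebesgue_on \<Omega>)
          = (\<integral>x. h t x * tv x \<partial>surf \<Omega>)"
    and eq2: "AE t in Tm T. \<forall>v. L2 (lebesgue_on \<Omega>) v \<longrightarrow>
        (\<integral>x. w t x * v x \<partial>lebesgue_on \<Omega>)
          = \<tau> * (\<integral>x. dy t x * v x \<partial>lebesgue_on \<Omega>) + (\<integral>x. \<xi> t x * v x \<partial>lebesgue_on \<Omega>)
            + (\<integral>x. lam t x * \<pi> (y t x) * v x \<partial>lebesgue_on \<Omega>)
            - (\<integral>x. g t x * v x \<partial>lebesgue_on \<Omega>)"
    and sd: "AE p in Qm \<Omega> T. \<xi> (fst p) (snd p) \<in> subdiff bh (y (fst p) (snd p))"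
    and yc: "\<forall>s\<in>{0..T}. L2 (lebesgue_on \<Omega>) (yc s)"
      "AE t in Tm T. nL2 (lebesgue_on \<Omega>) (\<lambda>x. yc t x - y t x) = 0"
      "\<forall>t\<in>{0..T}. ((\<lambda>s. nL2 (lebesgue_on \<Omega>) (\<lambda>x. yc s x - yc t x)) \<longlongrightarrow> 0) (at t within {0..T})"
      "nL2 (lebesgue_on \<Omega>) (\<lambda>x. yc 0 x - y0 x) = 0"
    using sol unfolding limit_solution_def by (elim exE conjE) (rule that)
  have g: "L2 (Qm \<Omega> T) (\<lambda>(t,x). g t x)" and h: "L2 (Sm \<Omega> T) (\<lambda>(t,x). h t x)"
    using data by (auto simp: admissible_data_def)
  note psf = pair_sigma_finite_Tm[OF lebesgue_on_finite_measure[OF op], of T]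
  note psS = pair_sigma_finite_Tm[OF finite_measure_surf[OF dom], of T]
  note sl = L2_slices(1)[OF psf, folded Qm_def]
  have lamt: "AE t in Tm T. AE x in lebesgue_on \<Omega>. \<bar>lam t x\<bar> \<le> m"
    using pair_sigma_finite.AE_pair[OF psf lam(2)[unfolded Qm_def]] by simp
  have sdt: "AE t in Tm T. AE x in lebesgue_on \<Omega>. \<xi> t x \<in> subdiff bh (y t x)"
    using pair_sigma_finite.AE_pair[OF psf sd[unfolded Qm_def]] by simp
  have lamm: "lam t \<in> borel_measurable (lebesgue_on \<Omega>)" if "t \<in> space (Tm T)" for t
    using measurable_Pair2[OF lam(1)[unfolded Qm_def] that] by simp
  have slice: "AE t in Tm T. slice_solution \<Omega> \<tau> bh (\<lambda>x. lam t x * \<pi> (y t x)) (g t) (h t) (y t) (dy t) (w t) (Gw t) (\<xi> t)"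
    using sl[OF y] sl[OF dy] sl[OF \<xi>] sl[OF g] L2_slices(1)[OF psS h[unfolded Sm_def]] wG eq1 eq2 lamt sdt AE_space[of "Tm T"]
  proof eventually_elim
    case (elim t)
    \<comment> \<open>A smooth function is admissible with its classical gradient as weak gradient
      and with itself as trace.\<close>
    have eq: "ip \<Omega> (dy t) v + (\<integral>x. Gw t x \<bullet> grad v x \<partial>lebesgue_on \<Omega>) = (\<integral>x. h t x * v x \<partial>surf \<Omega>)" if "Cinf_on UNIV v" for v
      using elim(7)[rule_format, OF conjI[OF weak_grad_Cinf[OF op that] trace_of_Cinf[OF dom that]]]
      unfolding ip_def .
    have p: "L2 (lebesgue_on \<Omega>) (\<lambda>x. lam t x * \<pi> (y t x))"
      by (rule L2_nonlinearity[OF lamm[OF elim(11)] elim(9) \<pi> elim(1)])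
    show ?case unfolding slice_solution_def
      using p elim(1-6,10) eq elim(8) by (simp add: ip_def)
  qed
  have weak': "(\<integral>p. y (fst p) (snd p) * pd 1 \<phi> (fst p) * v (snd p) \<partial>Qm \<Omega> T)
          = - (\<integral>p. dy (fst p) (snd p) * \<phi> (fst p) * v (snd p) \<partial>Qm \<Omega> T)" if "test_fun {0<..<T} \<phi>" "L2 (lebesgue_on \<Omega>) v" for \<phi> v
    using weak that by blast
  note inc = solution_increment[OF op y dy weak' bspec[OF yc(1)] yc(2) bspec[OF yc(3)]]
  show thesis
    by (rule that[OF y dy bspec[OF yc(1)] yc(2) bspec[OF yc(3)] yc(4) inc(1) inc(2) inc(3) slice])
qed

subsection \<open>Stability and uniqueness\<close>

lemma nL2_eq_of_diff_0:
  assumes "L2 M f" "L2 M g" "nL2 M (\<lambda>x. f x - g x) = 0"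
  shows "nL2 M f = nL2 M g"
  using nL2_reverse_triangle[OF assms(1,2)] assms(3) by simp

lemma nL2_diff_diff_0:
  assumes L: "L2 M f1" "L2 M f2" "L2 M g1" "L2 M g2"
    and "nL2 M (\<lambda>x. f1 x - g1 x) = 0" "nL2 M (\<lambda>x. f2 x - g2 x) = 0"
  shows "nL2 M (\<lambda>x. (f1 x - f2 x) - (g1 x - g2 x)) = 0"
proof -
  have "nL2 M (\<lambda>x. (f1 x - g1 x) - (f2 x - g2 x)) \<le> 0"
    using nL2_triangle_diff[OF L2_diff[OF L(1,3)] L2_diff[OF L(2,4)]] assms(5,6) by linarith
  then have "nL2 M (\<lambda>x. (f1 x - g1 x) - (f2 x - g2 x)) = 0"
    using nL2_nonneg[of M "\<lambda>x. (f1 x - g1 x) - (f2 x - g2 x)"] by linarith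
  then show ?thesis by (simp add: algebra_simps)
qed

context trace_domain begin

lemma mean_zero_cong:
  assumes "mean_zero \<Omega> f" "L2 (lebesgue_on \<Omega>) g" "nrm (\<lambda>x. f x - g x) = 0"
  shows "mean_zero \<Omega> g"
  using ip_eq_of_nL2_diff_0[OF _ assms(2) L2_Cinf[OF Cinf_const op, of 1] assms(3)] assms(1,2)
  by (auto simp: mean_zero_def ip_def)

text \<open>On the open interval the mean does not change, since its increments are integrals of
  zero; continuity extends this to both endpoints, and the initial mean is zero.\<close>

lemma mean_zero_evolution:
  assumes T: "0 < T" and L: "\<And>t. t \<in> {0..T} \<Longrightarrow> L2 (lebesgue_on \<Omega>) (yc t)"
    and cont: "continuous_on {0..T} (\<lambda>r. ip \<Omega> (yc r) (\<lambda>_. 1))"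
    and inc: "\<And>s t. 0 < s \<Longrightarrow> s < t \<Longrightarrow> t < T \<Longrightarrow>
        ip \<Omega> (yc t) (\<lambda>_. 1) - ip \<Omega> (yc s) (\<lambda>_. 1) = (\<integral>r. ip \<Omega> (dy r) (\<lambda>_. 1) * indicator {s<..t} r \<partial>Tm T)"
    and dyZ: "AE r in Tm T. mean_zero \<Omega> (dy r)" and zero: "mean_zero \<Omega> (yc 0)" and t: "t \<in> {0..T}"
  shows "mean_zero \<Omega> (yc t)"
proof -
  let ?f = "\<lambda>r. ip \<Omega> (yc r) (\<lambda>_. 1)"
  have c: "?f t = ?f s" if "0 < s" "s < t" "t < T" for s t
  proof -
    have "AE r in Tm T. ip \<Omega> (dy r) (\<lambda>_. 1) * indicator {s<..t} r = 0"
      using dyZ by eventually_elim (simp add: mean_zero_def ip_def)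
    then have "(\<integral>r. ip \<Omega> (dy r) (\<lambda>_. 1) * indicator {s<..t} r \<partial>Tm T) = 0"
      by (rule integral_eq_zero_AE)
    then show ?thesis using inc[OF that] by simp
  qed
  have c2: "?f r = ?f (T/2)" if "r \<in> {0<..<T}" for r
    using c[of r "T/2"] c[of "T/2" r] that T by (cases r "T/2" rule: linorder_cases) auto
  have cl: "closure {0<..<T} = {0..T}" using T by (simp add: closure_greaterThanLessThan)
  have c3: "?f r = ?f (T/2)" if "r \<in> {0..T}" for r
    using continuous_constant_on_closure[of "{0<..<T}" ?f "?f (T/2)" r, unfolded cl, OF cont c2 that] .
  have "?f t = ?f 0" using c3[OF t] c3[of 0] T by simp
  then show ?thesis using L[OF t] zero by (simp add: mean_zero_def ip_def)
qed

text \<open>The constant is left explicit to display its dependence: \<open>C\<close> and, through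
  \<open>K0\<close>, the trace constant come from the domain, \<open>m\<close> bounds the
  coefficient \<open>lam\<close>, and \<open>L\<close> is the Lipschitz constant of
  \<open>\<pi>\<close>.\<close>

lemma stability:
  assumes T: "0 < T" and \<tau>: "0 < \<tau>" and \<pi>: "L-lipschitz_on UNIV \<pi>" "\<pi> 0 = 0" and m: "0 \<le> m"
    and lam: "(\<lambda>(t,x). lam t x) \<in> borel_measurable (Qm \<Omega> T)" "AE p in Qm \<Omega> T. \<bar>lam (fst p) (snd p)\<bar> \<le> m"
    and data: "admissible_data \<Omega> T bh y01 g1 h1" "admissible_data \<Omega> T bh y02 g2 h2"
    and mean: "mean \<Omega> y01 = mean \<Omega> y02"
    and hm: "AE t in Tm T. (\<integral>x. h1 t x \<partial>surf \<Omega>) = (\<integral>x. h2 t x \<partial>surf \<Omega>)"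
    and sol: "limit_solution \<Omega> T \<tau> bh \<pi> lam y01 g1 h1 y1 w1 \<xi>1" "limit_solution \<Omega> T \<tau> bh \<pi> lam y02 g2 h2 y2 w2 \<xi>2"
  defines "K \<equiv> (K0 * C)\<^sup>2 + m * L + 1"
  shows "AE t in Tm T. nrm (\<lambda>x. y1 t x - y2 t x) \<le>
      sqrt ((\<tau> + C\<^sup>2 + 2 * K) / \<tau> * exp (2 * K / \<tau> * T)) *
      (nrm (\<lambda>x. y01 x - y02 x) + nL2 (Qm \<Omega> T) (\<lambda>(t,x). g1 t x - g2 t x) + nL2 (Sm \<Omega> T) (\<lambda>(t,x). h1 t x - h2 t x))"
proof -
  obtain dy1 G1 yc1 where y1: "L2 (Qm \<Omega> T) (\<lambda>(t,x). y1 t x)" "L2 (Qm \<Omega> T) (\<lambda>(t,x). dy1 t x)"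
    and yc1: "\<And>s. s \<in> {0..T} \<Longrightarrow> L2 (lebesgue_on \<Omega>) (yc1 s)"
    "AE t in Tm T. nrm (\<lambda>x. yc1 t x - y1 t x) = 0"
    "\<And>t. t \<in> {0..T} \<Longrightarrow> ((\<lambda>s. nrm (\<lambda>x. yc1 s x - yc1 t x)) \<longlongrightarrow> 0) (at t within {0..T})"
    "nrm (\<lambda>x. yc1 0 x - y01 x) = 0"
    and inc1: "\<And>v. L2 (lebesgue_on \<Omega>) v \<Longrightarrow> continuous_on {0..T} (\<lambda>r. ip \<Omega> (yc1 r) v)"
    "\<And>v. L2 (lebesgue_on \<Omega>) v \<Longrightarrow> integrable (Tm T) (\<lambda>r. ip \<Omega> (dy1 r) v)"
    "\<And>v s t. L2 (lebesgue_on \<Omega>) v \<Longrightarrow> 0 < s \<Longrightarrow> s < t \<Longrightarrow> t < T \<Longrightarrow>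
       ip \<Omega> (yc1 t) v - ip \<Omega> (yc1 s) v = (\<integral>r. ip \<Omega> (dy1 r) v * indicator {s<..t} r \<partial>Tm T)"
    and s1: "AE t in Tm T. slice_solution \<Omega> \<tau> bh (\<lambda>x. lam t x * \<pi> (y1 t x)) (g1 t) (h1 t) (y1 t) (dy1 t) (w1 t) (G1 t) (\<xi>1 t)"
    by (rule limit_solution_slices[OF dom \<pi> lam data(1) sol(1)]) blast
  obtain dy2 G2 yc2 where y2: "L2 (Qm \<Omega> T) (\<lambda>(t,x). y2 t x)" "L2 (Qm \<Omega> T) (\<lambda>(t,x). dy2 t x)"
    and yc2: "\<And>s. s \<in> {0..T} \<Longrightarrow> L2 (lebesgue_on \<Omega>) (yc2 s)"
    "AE t in Tm T. nrm (\<lambda>x. yc2 t x - y2 t x) = 0"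
    "\<And>t. t \<in> {0..T} \<Longrightarrow> ((\<lambda>s. nrm (\<lambda>x. yc2 s x - yc2 t x)) \<longlongrightarrow> 0) (at t within {0..T})"
    "nrm (\<lambda>x. yc2 0 x - y02 x) = 0"
    and inc2: "\<And>v. L2 (lebesgue_on \<Omega>) v \<Longrightarrow> continuous_on {0..T} (\<lambda>r. ip \<Omega> (yc2 r) v)"
    "\<And>v. L2 (lebesgue_on \<Omega>) v \<Longrightarrow> integrable (Tm T) (\<lambda>r. ip \<Omega> (dy2 r) v)"
    "\<And>v s t. L2 (lebesgue_on \<Omega>) v \<Longrightarrow> 0 < s \<Longrightarrow> s < t \<Longrightarrow> t < T \<Longrightarrow>
       ip \<Omega> (yc2 t) v - ip \<Omega> (yc2 s) v = (\<integral>r. ip \<Omega> (dy2 r) v * indicator {s<..t} r \<partial>Tm T)"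
    and s2: "AE t in Tm T. slice_solution \<Omega> \<tau> bh (\<lambda>x. lam t x * \<pi> (y2 t x)) (g2 t) (h2 t) (y2 t) (dy2 t) (w2 t) (G2 t) (\<xi>2 t)"
    by (rule limit_solution_slices[OF dom \<pi> lam data(2) sol(2)]) blast
  define yc where "yc t x = yc1 t x - yc2 t x" for t x
  define dy where "dy t x = dy1 t x - dy2 t x" for t x
  define q where "q r = (nrm (\<lambda>x. g1 r x - g2 r x))\<^sup>2 + (nL2 (surf \<Omega>) (\<lambda>x. h1 r x - h2 r x))\<^sup>2" for r
  let ?g = "nL2 (Qm \<Omega> T) (\<lambda>(t,x). g1 t x - g2 t x)" and ?h = "nL2 (Sm \<Omega> T) (\<lambda>(t,x). h1 t x - h2 t x)"
  let ?a = "nrm (\<lambda>x. y01 x - y02 x)"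
  note psf = pair_sigma_finite_Tm[OF lebesgue_on_finite_measure[OF op], of T]
  note psS = pair_sigma_finite_Tm[OF finite_measure_surf[OF dom], of T]
  have L0: "0 \<le> L" using \<pi>(1) by (rule lipschitz_on_nonneg)
  have k0: "0 \<le> m * L" using m L0 by simp
  have y0: "L2 (lebesgue_on \<Omega>) y01" "L2 (lebesgue_on \<Omega>) y02" using data by (auto simp: admissible_data_def)
  have gL: "L2 (Tm T \<Otimes>\<^sub>M lebesgue_on \<Omega>) (\<lambda>(t,x). g1 t x - g2 t x)"
    and hL: "L2 (Tm T \<Otimes>\<^sub>M surf \<Omega>) (\<lambda>(t,x). h1 t x - h2 t x)"
    and dL: "L2 (Tm T \<Otimes>\<^sub>M lebesgue_on \<Omega>) (\<lambda>(t,x). dy t x)"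
    using data L2_diff[OF y1(2) y2(2)]
    by (auto simp: admissible_data_def Qm_def Sm_def dy_def case_prod_beta' intro: L2_diff)
  note gs = L2_slices[OF psf gL] and hs = L2_slices[OF psS hL] and ds = L2_slices[OF psf dL]
  have qint: "(\<integral>r. q r \<partial>Tm T) = ?g\<^sup>2 + ?h\<^sup>2"
    unfolding q_def using gs(2,3) hs(2,3) by (simp add: Qm_def Sm_def)
  have ycL: "L2 (lebesgue_on \<Omega>) (yc t)" if "t \<in> {0..T}" for t
    using L2_diff[OF yc1(1)[OF that] yc2(1)[OF that]] by (simp add: yc_def[abs_def])
  have ipyc: "ip \<Omega> (yc t) v = ip \<Omega> (yc1 t) v - ip \<Omega> (yc2 t) v" if "t \<in> {0..T}" "L2 (lebesgue_on \<Omega>) v" for t v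
    unfolding yc_def[abs_def] by (rule ip_diff_left[OF that(2) yc1(1)[OF that(1)] yc2(1)[OF that(1)]])
  have ipdy: "AE r in Tm T. \<forall>v. L2 (lebesgue_on \<Omega>) v \<longrightarrow> ip \<Omega> (dy r) v = ip \<Omega> (dy1 r) v - ip \<Omega> (dy2 r) v"
    using s1 s2
  proof eventually_elim
    case (elim r)
    then show ?case unfolding dy_def[abs_def] by (auto simp: slice_solution_def intro!: ip_diff_left)
  qed
  have dym: "integrable (Tm T) (\<lambda>r. ip \<Omega> (dy r) v)" if v: "L2 (lebesgue_on \<Omega>) v" for v
    using L2_product_fubini(2)[OF psf finite_measure_Tm dL v, of "\<lambda>_. 1" 1] by (simp add: ip_def)
  have inc: "ip \<Omega> (yc t) v - ip \<Omega> (yc s) v = (\<integral>r. ip \<Omega> (dy r) v * indicator {s<..t} r \<partial>Tm T)"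
    if v: "L2 (lebesgue_on \<Omega>) v" and st: "0 < s" "s < t" "t < T" for v s t
  proof -
    have [measurable]: "{s<..t} \<in> sets (Tm T)"
      using st by (auto simp: Tm_def sets_restrict_space intro!: image_eqI[of _ _ "{s<..t}"])
    note I = integrable_mult_indicator[OF \<open>{s<..t} \<in> sets (Tm T)\<close>]
    have i: "integrable (Tm T) (\<lambda>r. ip \<Omega> (dy1 r) v * indicator {s<..t} r)"
      "integrable (Tm T) (\<lambda>r. ip \<Omega> (dy2 r) v * indicator {s<..t} r)"
      "integrable (Tm T) (\<lambda>r. ip \<Omega> (dy r) v * indicator {s<..t} r)"
      using I[OF inc1(2)[OF v]] I[OF inc2(2)[OF v]] I[OF dym[OF v]] by (simp_all add: mult.commute)
    have "(\<integral>r. ip \<Omega> (dy r) v * indicator {s<..t} r \<partial>Tm T)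
       = (\<integral>r. ip \<Omega> (dy1 r) v * indicator {s<..t} r - ip \<Omega> (dy2 r) v * indicator {s<..t} r \<partial>Tm T)"
    proof (rule integral_cong_AE)
      show "AE r in Tm T. ip \<Omega> (dy r) v * indicator {s<..t} r
          = ip \<Omega> (dy1 r) v * indicator {s<..t} r - ip \<Omega> (dy2 r) v * indicator {s<..t} r"
        using ipdy by eventually_elim (simp add: v left_diff_distrib)
    qed (use i in \<open>auto intro!: borel_measurable_diff\<close>)
    also have "\<dots> = (ip \<Omega> (yc1 t) v - ip \<Omega> (yc1 s) v) - (ip \<Omega> (yc2 t) v - ip \<Omega> (yc2 s) v)"
      using i inc1(3)[OF v st] inc2(3)[OF v st] by simp
    finally show ?thesis using ipyc[OF _ v] st by simp
  qed
  have dyZ: "AE r in Tm T. mean_zero \<Omega> (dy r)"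
    using s1 s2 hm
  proof eventually_elim
    case (elim r)
    show ?case unfolding dy_def[abs_def] by (rule slice_mean_zero[OF elim])
  qed
  have nyc0: "nrm (\<lambda>x. yc 0 x - (y01 x - y02 x)) = 0"
    unfolding yc_def using T by (intro nL2_diff_diff_0 yc1 yc2 y0) auto
  have one: "L2 (lebesgue_on \<Omega>) (\<lambda>_. 1)" by (rule L2_Cinf[OF Cinf_const op])
  have "(\<integral>x. y01 x \<partial>lebesgue_on \<Omega>) = (\<integral>x. y02 x \<partial>lebesgue_on \<Omega>)"
    using mean measure_domain_pos[OF dom] by (simp add: mean_def)
  then have "mean_zero \<Omega> (\<lambda>x. y01 x - y02 x)"
    using y0 integrable_L2_lebesgue_on[OF op] by (simp add: mean_zero_def L2_diff)
  then have zero: "mean_zero \<Omega> (yc 0)"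
    by (rule mean_zero_cong[OF _ ycL]) (use nyc0 T nL2_minus_commute[of "lebesgue_on \<Omega>" "yc 0" "\<lambda>x. y01 x - y02 x"] in auto)
  have cont: "continuous_on {0..T} (\<lambda>r. ip \<Omega> (yc r) (\<lambda>_. 1))"
  proof (rule continuous_on_eq)
    show "continuous_on {0..T} (\<lambda>r. ip \<Omega> (yc1 r) (\<lambda>_. 1) - ip \<Omega> (yc2 r) (\<lambda>_. 1))"
      by (intro continuous_on_diff inc1(1) inc2(1) one)
  qed (simp add: ipyc[OF _ one])
  have ycZ: "mean_zero \<Omega> (yc t)" if "t \<in> {0..T}" for t
    by (rule mean_zero_evolution[OF T ycL cont inc[OF one] dyZ zero that])
  have ycc: "((\<lambda>s. nrm (\<lambda>x. yc s x - yc t x)) \<longlongrightarrow> 0) (at t within {0..T})" if t: "t \<in> {0..T}" for t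
  proof (rule Lim_null_comparison)
    show "((\<lambda>s. nrm (\<lambda>x. yc1 s x - yc1 t x) + nrm (\<lambda>x. yc2 s x - yc2 t x)) \<longlongrightarrow> 0) (at t within {0..T})"
      using tendsto_add[OF yc1(3)[OF t] yc2(3)[OF t]] by simp
    have "norm (nrm (\<lambda>x. yc s x - yc t x)) \<le> nrm (\<lambda>x. yc1 s x - yc1 t x) + nrm (\<lambda>x. yc2 s x - yc2 t x)" if "s \<in> {0..T}" for s
    proof -
      have "(\<lambda>x. yc s x - yc t x) = (\<lambda>x. (yc1 s x - yc1 t x) - (yc2 s x - yc2 t x))" by (auto simp: yc_def)
      then show ?thesis
        using nL2_triangle_diff[OF L2_diff[OF yc1(1)[OF that] yc1(1)[OF t]] L2_diff[OF yc2(1)[OF that] yc2(1)[OF t]]]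
        by simp
    qed
    then show "\<forall>\<^sub>F s in at t within {0..T}. norm (nrm (\<lambda>x. yc s x - yc t x)) \<le> nrm (\<lambda>x. yc1 s x - yc1 t x) + nrm (\<lambda>x. yc2 s x - yc2 t x)"
      unfolding eventually_at_filter by (intro always_eventually) auto
  qed
  have lamt: "AE t in Tm T. AE x in lebesgue_on \<Omega>. \<bar>lam t x\<bar> \<le> m"
    using pair_sigma_finite.AE_pair[OF psf lam(2)[unfolded Qm_def]] by simp
  have close: "AE r in Tm T. r \<in> {0..T} \<and> L2 (lebesgue_on \<Omega>) (\<lambda>x. y1 r x - y2 r x) \<and>
      nrm (\<lambda>x. yc r x - (y1 r x - y2 r x)) = 0"
    using s1 s2 yc1(2) yc2(2) AE_space[of "Tm T"]
  proof eventually_elim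
    case (elim r)
    have r: "r \<in> {0..T}" using elim(5) by (auto simp: space_Tm)
    have L: "L2 (lebesgue_on \<Omega>) (y1 r)" "L2 (lebesgue_on \<Omega>) (y2 r)" using elim(1,2) by (auto simp: slice_solution_def)
    show ?case using r L2_diff[OF L] nL2_diff_diff_0[OF yc1(1)[OF r] yc2(1)[OF r] L elim(3,4)] by (simp add: yc_def)
  qed
  have rate: "AE r in Tm T. \<exists>y. mean_zero \<Omega> y \<and> nrm (\<lambda>x. yc r x - y x) = 0 \<and>
        \<tau> * ip \<Omega> (dy r) y + neumann_form \<Omega> (dy r) y \<le> K * ((nrm (yc r))\<^sup>2 + q r)"
    using s1 s2 hm lamt close
  proof eventually_elim
    case (elim r)
    then have r: "r \<in> {0..T}" by blast
    \<comment> \<open>The witness for \<open>rate\<close> is the slice of the given difference, for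
      which the equations hold; norm and mean are transferred from \<open>yc r\<close>, with which
      it agrees almost everywhere.\<close>
    let ?y = "\<lambda>x. y1 r x - y2 r x"
    have Z: "mean_zero \<Omega> ?y" by (rule mean_zero_cong[OF ycZ[OF r]]) (use elim(5) in auto)
    have n: "nrm (yc r) = nrm ?y" by (rule nL2_eq_of_diff_0[OF ycL[OF r]]) (use elim(5) in auto)
    have pb: "AE x in lebesgue_on \<Omega>. \<bar>lam r x * \<pi> (y1 r x) - lam r x * \<pi> (y2 r x)\<bar> \<le> m * L * \<bar>?y x\<bar>"
      using elim(4)
    proof eventually_elim
      case (elim x)
      have "\<bar>\<pi> (y1 r x) - \<pi> (y2 r x)\<bar> \<le> L * \<bar>?y x\<bar>"
        using lipschitz_onD[OF \<pi>(1), of "y1 r x" "y2 r x"] by (simp add: dist_real_def)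
      then have "\<bar>lam r x\<bar> * \<bar>\<pi> (y1 r x) - \<pi> (y2 r x)\<bar> \<le> m * (L * \<bar>?y x\<bar>)"
        using elim m by (intro mult_mono) auto
      then show ?case by (simp add: right_diff_distrib[symmetric] abs_mult mult.assoc)
    qed
    show ?case
      using slice_rate[OF elim(1-3) Z pb k0] Z elim(5) n
      unfolding K_def q_def dy_def[abs_def] by (intro exI[of _ ?y]) auto
  qed
  interpret energy \<Omega> C \<tau> K T yc dy q
  proof
    show "0 \<le> K" unfolding K_def using k0 by simp
    show "integrable (Tm T) q" unfolding q_def[abs_def] using gs(2) hs(2) by simp
    show "AE r in Tm T. 0 \<le> q r" by (simp add: q_def)
  qed (use T \<tau> ycZ ycc dyZ ds(2) dym inc rate in auto)
  let ?B = "(\<tau> + C\<^sup>2 + 2 * K) / \<tau> * exp (2 * K / \<tau> * T)" and ?R = "?a + ?g + ?h"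
  have bound: "nrm (yc t) \<le> sqrt ?B * ?R" if "0 < t" "t < T" for t
  proof -
    have n0: "nrm (yc 0) = ?a"
      by (rule nL2_eq_of_diff_0[OF ycL L2_diff[OF y0] nyc0]) (use T in auto)
    have nn: "0 \<le> ?a" "0 \<le> ?g" "0 \<le> ?h" by (rule nL2_nonneg)+
    have sq: "?a\<^sup>2 \<le> ?R\<^sup>2" "?g\<^sup>2 + ?h\<^sup>2 \<le> ?R\<^sup>2"
    proof -
      show "?a\<^sup>2 \<le> ?R\<^sup>2" by (rule power_mono) (use nn in linarith)+
      have "?g\<^sup>2 + ?h\<^sup>2 \<le> (?g + ?h)\<^sup>2" using mult_nonneg_nonneg[OF nn(2,3)] by (simp add: power2_sum)
      also have "\<dots> \<le> ?R\<^sup>2" by (rule power_mono) (use nn in linarith)+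
      finally show "?g\<^sup>2 + ?h\<^sup>2 \<le> ?R\<^sup>2" .
    qed
    have "(nrm (yc t))\<^sup>2 \<le> ((\<tau> + C\<^sup>2) * ?a\<^sup>2 + 2 * K * (?g\<^sup>2 + ?h\<^sup>2)) / \<tau> * exp (2 * K / \<tau> * t)"
      using energy_estimate[OF that] by (simp add: n0 qint)
    also have "\<dots> \<le> ((\<tau> + C\<^sup>2) * ?R\<^sup>2 + 2 * K * ?R\<^sup>2) / \<tau> * exp (2 * K / \<tau> * T)"
    proof (rule mult_mono)
      show "((\<tau> + C\<^sup>2) * ?a\<^sup>2 + 2 * K * (?g\<^sup>2 + ?h\<^sup>2)) / \<tau> \<le> ((\<tau> + C\<^sup>2) * ?R\<^sup>2 + 2 * K * ?R\<^sup>2) / \<tau>"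
        by (intro divide_right_mono add_mono mult_left_mono sq) (use \<tau> K in auto)
      show "exp (2 * K / \<tau> * t) \<le> exp (2 * K / \<tau> * T)"
        unfolding exp_le_cancel_iff by (rule mult_left_mono) (use \<tau> K that in auto)
      show "0 \<le> ((\<tau> + C\<^sup>2) * ?R\<^sup>2 + 2 * K * ?R\<^sup>2) / \<tau>" using \<tau> K by simp
    qed simp
    also have "\<dots> = ?B * ?R\<^sup>2" by (simp add: algebra_simps add_divide_distrib)
    finally have "sqrt ((nrm (yc t))\<^sup>2) \<le> sqrt (?B * ?R\<^sup>2)" by (rule real_sqrt_le_mono)
    moreover have "sqrt (?R\<^sup>2) = ?R" by (rule real_sqrt_unique) (use nn in auto)
    moreover have "sqrt ((nrm (yc t))\<^sup>2) = nrm (yc t)" by (rule real_sqrt_unique) (auto simp: nL2_nonneg)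
    ultimately show ?thesis by (simp only: real_sqrt_mult)
  qed
  show ?thesis
    using close AE_space[of "Tm T"]
  proof eventually_elim
    case (elim t)
    have "nrm (yc t) = nrm (\<lambda>x. y1 t x - y2 t x)" by (rule nL2_eq_of_diff_0[OF ycL]) (use elim(1) in auto)
    then show ?case using bound[of t] elim(2) by (simp add: space_Tm)
  qed
qed

end

lemma Linf_norm_le:
  assumes "0 \<le> B" "AE x in M. \<bar>f x\<bar> \<le> B"
  shows "Linf_norm M f \<le> B"
  unfolding Linf_norm_def by (rule cInf_lower) (use assms in \<open>auto intro!: bdd_belowI[of _ 0]\<close>)

text \<open>The essential norm is an infimum, so strict inequality provides an admissible bound
  below \<open>c\<close>.\<close>

lemma Linf_bound:
  assumes "Linf M f" "Linf_norm M f < c"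
  shows "AE x in M. \<bar>f x\<bar> \<le> c"
proof -
  let ?S = "{c. 0 \<le> c \<and> (AE x in M. \<bar>f x\<bar> \<le> c)}"
  obtain b where b: "AE x in M. \<bar>f x\<bar> \<le> b" using assms(1) by (auto simp: Linf_def)
  then have "AE x in M. \<bar>f x\<bar> \<le> max 0 b" by eventually_elim auto
  then have "?S \<noteq> {}" by (auto intro!: exI[of _ "max 0 b"])
  from cInf_lessD[OF this, of c] obtain d where d: "d \<in> ?S" "d < c" using assms(2) by (auto simp: Linf_norm_def)
  then have "AE x in M. \<bar>f x\<bar> \<le> d" by simp
  then show ?thesis by eventually_elim (use d in linarith)
qed

theorem theorem2p3:
  fixes \<Omega> :: "pt set" and T \<tau> m Lp :: real
  assumes "smooth_bounded_domain \<Omega>" and "T > 0" and "\<tau> > 0"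
  shows "(\<exists>C>0. \<forall>bh \<pi> lam y01 y02 g1 g2 h1 h2 y1 w1 \<xi>1 y2 w2 \<xi>2.
      admissible_bhat bh \<and> Lp-lipschitz_on UNIV \<pi> \<and> \<pi> 0 = 0 \<and>
      Linf (Qm \<Omega> T) (\<lambda>(t,x). lam t x) \<and> Linf_norm (Qm \<Omega> T) (\<lambda>(t,x). lam t x) = m \<and>
      admissible_data \<Omega> T bh y01 g1 h1 \<and> admissible_data \<Omega> T bh y02 g2 h2 \<and>
      mean \<Omega> y01 = mean \<Omega> y02 \<and>
      (AE t in Tm T. (\<integral>x. h1 t x \<partial>surf \<Omega>) = (\<integral>x. h2 t x \<partial>surf \<Omega>)) \<and>
      limit_solution \<Omega> T \<tau> bh \<pi> lam y01 g1 h1 y1 w1 \<xi>1 \<and>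
      limit_solution \<Omega> T \<tau> bh \<pi> lam y02 g2 h2 y2 w2 \<xi>2
      \<longrightarrow> Linf_norm (Tm T) (\<lambda>t. nL2 (lebesgue_on \<Omega>) (\<lambda>x. y1 t x - y2 t x))
          \<le> C * (nL2 (lebesgue_on \<Omega>) (\<lambda>x. y01 x - y02 x)
                 + nL2 (Qm \<Omega> T) (\<lambda>(t,x). g1 t x - g2 t x)
                 + nL2 (Sm \<Omega> T) (\<lambda>(t,x). h1 t x - h2 t x)))
    \<and> (\<forall>bh \<pi> L lam y0 g h y1 w1 \<xi>1 y2 w2 \<xi>2.
      admissible_bhat bh \<and> L-lipschitz_on UNIV \<pi> \<and> \<pi> 0 = 0 \<and>
      Linf (Qm \<Omega> T) (\<lambda>(t,x). lam t x) \<and> admissible_data \<Omega> T bh y0 g h \<and>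
      limit_solution \<Omega> T \<tau> bh \<pi> lam y0 g h y1 w1 \<xi>1 \<and>
      limit_solution \<Omega> T \<tau> bh \<pi> lam y0 g h y2 w2 \<xi>2
      \<longrightarrow> (AE p in Qm \<Omega> T. y1 (fst p) (snd p) = y2 (fst p) (snd p)))"
proof -
  obtain C D where "trace_domain \<Omega> C D" using trace_domain_exists[OF assms(1)] by blast
  then interpret trace_domain \<Omega> C D .
  note T = assms(2) and \<tau> = assms(3)
  let ?B = "\<lambda>m L. sqrt ((\<tau> + C\<^sup>2 + 2 * ((K0 * C)\<^sup>2 + m * L + 1)) / \<tau> * exp (2 * ((K0 * C)\<^sup>2 + m * L + 1) / \<tau> * T))"
  note psf = pair_sigma_finite_Tm[OF lebesgue_on_finite_measure[OF op], of T]
  have B0: "0 \<le> ?B m L" if "0 \<le> m" "0 \<le> L" for m L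
    using that \<tau> by auto
  \<comment> \<open>The summand 1 supplies the strict inequality required by
    \<open>Linf_bound\<close>.\<close>
  have lamb: "AE p in Qm \<Omega> T. \<bar>lam (fst p) (snd p)\<bar> \<le> \<bar>Linf_norm (Qm \<Omega> T) (\<lambda>(t,x). lam t x)\<bar> + 1"
    if "Linf (Qm \<Omega> T) (\<lambda>(t,x). lam t x)" for lam
    using Linf_bound[OF that, of "\<bar>Linf_norm (Qm \<Omega> T) (\<lambda>(t,x). lam t x)\<bar> + 1"] by (simp add: case_prod_beta')
  have lamm: "(\<lambda>(t,x). lam t x) \<in> borel_measurable (Qm \<Omega> T)"
    if "Linf (Qm \<Omega> T) (\<lambda>(t,x). lam t x)" for lam
    using that by (simp add: Linf_def)
  show ?thesis
  \<comment> \<open>The witness is fixed before the hypotheses on \<open>lam\<close> and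
    \<open>\<pi>\<close> are available; absolute values keep the radicand nonnegative and the
    summand 1 makes the constant positive.\<close>
  proof (intro conjI exI[of _ "?B (\<bar>m\<bar> + 1) \<bar>Lp\<bar> + 1"] allI impI; (elim conjE)?)
    show "0 < ?B (\<bar>m\<bar> + 1) \<bar>Lp\<bar> + 1" using B0[of "\<bar>m\<bar> + 1" "\<bar>Lp\<bar>"] by linarith
  next
    fix bh \<pi> lam y01 y02 g1 g2 h1 h2 y1 w1 \<xi>1 y2 w2 \<xi>2
    assume \<pi>: "Lp-lipschitz_on UNIV \<pi>" "\<pi> 0 = 0" and lam: "Linf (Qm \<Omega> T) (\<lambda>(t,x). lam t x)"
      "Linf_norm (Qm \<Omega> T) (\<lambda>(t,x). lam t x) = m"
      and d: "admissible_data \<Omega> T bh y01 g1 h1" "admissible_data \<Omega> T bh y02 g2 h2"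
        "mean \<Omega> y01 = mean \<Omega> y02" "AE t in Tm T. (\<integral>x. h1 t x \<partial>surf \<Omega>) = (\<integral>x. h2 t x \<partial>surf \<Omega>)"
        "limit_solution \<Omega> T \<tau> bh \<pi> lam y01 g1 h1 y1 w1 \<xi>1" "limit_solution \<Omega> T \<tau> bh \<pi> lam y02 g2 h2 y2 w2 \<xi>2"
    let ?R = "nL2 (lebesgue_on \<Omega>) (\<lambda>x. y01 x - y02 x) + nL2 (Qm \<Omega> T) (\<lambda>(t,x). g1 t x - g2 t x)
                 + nL2 (Sm \<Omega> T) (\<lambda>(t,x). h1 t x - h2 t x)"
    have R: "0 \<le> ?R" by (intro add_nonneg_nonneg nL2_nonneg)
    have Lp: "0 \<le> Lp" using \<pi>(1) by (rule lipschitz_on_nonneg)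
    have "AE t in Tm T. nrm (\<lambda>x. y1 t x - y2 t x) \<le> ?B (\<bar>m\<bar> + 1) Lp * ?R"
      by (rule stability[OF T \<tau> \<pi> _ lamm[OF lam(1)] lamb[OF lam(1), unfolded lam(2)] d]) simp
    then have "Linf_norm (Tm T) (\<lambda>t. nrm (\<lambda>x. y1 t x - y2 t x)) \<le> ?B (\<bar>m\<bar> + 1) Lp * ?R"
      by (intro Linf_norm_le mult_nonneg_nonneg B0 R Lp) (auto simp: nL2_nonneg)
    also have "\<dots> \<le> (?B (\<bar>m\<bar> + 1) \<bar>Lp\<bar> + 1) * ?R" using R Lp by (intro mult_right_mono) auto
    finally show "Linf_norm (Tm T) (\<lambda>t. nrm (\<lambda>x. y1 t x - y2 t x)) \<le> (?B (\<bar>m\<bar> + 1) \<bar>Lp\<bar> + 1) * ?R" .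
  next
    fix bh \<pi> L lam y0 g h y1 w1 \<xi>1 y2 w2 \<xi>2
    assume \<pi>: "L-lipschitz_on UNIV \<pi>" "\<pi> 0 = 0" and lam: "Linf (Qm \<Omega> T) (\<lambda>(t,x). lam t x)"
      and d: "admissible_data \<Omega> T bh y0 g h"
      and s: "limit_solution \<Omega> T \<tau> bh \<pi> lam y0 g h y1 w1 \<xi>1" "limit_solution \<Omega> T \<tau> bh \<pi> lam y0 g h y2 w2 \<xi>2"
    have y: "L2 (Qm \<Omega> T) (\<lambda>(t,x). y1 t x)" "L2 (Qm \<Omega> T) (\<lambda>(t,x). y2 t x)"
      using s by (auto simp: limit_solution_def)
    let ?d = "\<lambda>(t,x). y1 t x - y2 t x"
    have dL: "L2 (Tm T \<Otimes>\<^sub>M lebesgue_on \<Omega>) ?d"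
      using L2_diff[OF y] by (simp add: Qm_def case_prod_beta')
    have "nL2 (Qm \<Omega> T) (\<lambda>(t,x). g t x - g t x) = 0" "nL2 (Sm \<Omega> T) (\<lambda>(t,x). h t x - h t x) = 0"
      "nrm (\<lambda>x. y0 x - y0 x) = 0" by (simp_all add: nL2_def case_prod_beta')
    \<comment> \<open>Equal data make the bracket on the right of the stability estimate vanish;
      Fubini then turns zero slices into equality almost everywhere in space and time.\<close>
    then have "AE t in Tm T. nrm (\<lambda>x. y1 t x - y2 t x) \<le> 0"
      using stability[OF T \<tau> \<pi> _ lamm[OF lam] lamb[OF lam] d d refl _ s] by simp
    then have "AE t in Tm T. (nrm (\<lambda>x. y1 t x - y2 t x))\<^sup>2 = 0"
    proof eventually_elim
      case (elim t)
      then have "nrm (\<lambda>x. y1 t x - y2 t x) = 0"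
        using nL2_nonneg[of "lebesgue_on \<Omega>" "\<lambda>x. y1 t x - y2 t x"] by linarith
      then show ?case by simp
    qed
    then have "(nL2 (Tm T \<Otimes>\<^sub>M lebesgue_on \<Omega>) ?d)\<^sup>2 = 0"
      unfolding L2_slices(3)[OF psf dL, symmetric] by (rule integral_eq_zero_AE)
    then have "AE p in Qm \<Omega> T. ?d p = 0"
      using nL2_eq_0_iff[OF dL] unfolding Qm_def by simp
    then show "AE p in Qm \<Omega> T. y1 (fst p) (snd p) = y2 (fst p) (snd p)"
      by eventually_elim (simp add: case_prod_beta')
  qed
qed

end
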